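(* Let $M\in W^{1,\infty}(Y^\delta(x))$ be symmetric and uniformly positive definite, let $R\in W^{1,\infty}(Y^\delta(x))$ be positive semi-definite, and assume that the initial value $w_0\in V^{mic}$ is $H^2$-regular, i.e. $w_0\in H^2(Y^\delta(x);\mathbb R^N)$. Then there is a constant $C>0$, independent of $w_0$ and of $t\in[0,T]$, such that every solution $w$ with $w(t,\cdot)\in H^2(Y^\delta(x);\mathbb R^N)$, $t\in[0,T]$, of the Sobolev equation $$\int_{Y^\delta(x)}M\big(\tfrac y\delta\big)\nabla_y\partial_tw(t,y)\cdot\nabla_yv(y)\,dy+\int_{Y^\delta(x)}R\big(\tfrac y\delta\big)\nabla_yw(t,y)\cdot\nabla_yv(y)\,dy=0\quad\text{for all }v\in V^{mic},\ t\in[0,T],$$ $$w(0)=w_0\quad\text{in }Y^\delta(x),$$ satisfies, for all $t\in[0,T]$, $$\|w(t)\|_{H^2(Y^\delta(x))}\le C\,\|w_0\|_{H^2(Y^\delta(x))}.$$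
   Context: $T>0$, $\delta>0$, $Y=(0,1)^3$, and $x\in\Omega$ is a fixed point of an open bounded simply connected set $\Omega\subseteq\mathbb R^3$, entering only as a parameter; $Y^\delta(x)=x+\delta Y$. $N_E\ge0$ is an integer, $n=3(2+N_E)$ and $N=n/3$. $M=M(x,\cdot)$ and $R=R(x,\cdot)$ are $Y$-periodic functions $\mathbb R^3\to\mathbb R^{n\times n}$ (the dependence on $x$ is suppressed); the regularity hypotheses refer to the coefficients $y\mapsto M(y/\delta)$, $y\mapsto R(y/\delta)$ on $Y^\delta(x)$. Uniform positive definiteness: $\alpha|\Phi|^2\le M\Phi\cdot\Phi\le C_M|\Phi|^2$ for all $\Phi\in\mathbb R^n$ with constants $\alpha,C_M>0$. Positive semi-definiteness: $R\Phi\cdot\Phi\ge0$ for all $\Phi\in\mathbb R^n$. $V^{mic}=H^1_\#(Y^\delta(x);\mathbb R^N)$ is the space of periodic $H^1$ functions with zero mean. For $w=(w_1,\dots,w_N)$, $\nabla_yw\in\mathbb R^n$ denotes the vector stacking the gradients $\nabla w_1,\dots,\nabla w_N$.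
   Formalization: M and R are required to be W^{1,∞} as periodic functions on ℝ³ (no jumps across opposite faces of Y^δ(x)), not merely W^{1,∞} in the open cell; coefficients that jump across faces can produce edge singularities for which the H² bound fails. *)

theory Defs
  imports "HOL-Analysis.Analysis"
begin

section \<open>The cell and periodicity\<close>

definition cell :: "real \<Rightarrow> real^3 \<Rightarrow> (real^3) set" where
  "cell \<delta> x = (\<lambda>y. x + \<delta> *\<^sub>R y) ` {y. \<forall>i. 0 < y $ i \<and> y $ i < 1}"

definition periodic :: "real \<Rightarrow> (real^3 \<Rightarrow> 'b) \<Rightarrow> bool" where
  "periodic L f \<longleftrightarrow> (\<forall>y i. f (y + L *\<^sub>R axis i 1) = f y)"

section \<open>Weak derivatives\<close>

definition pd :: "3 \<Rightarrow> (real^3 \<Rightarrow> real) \<Rightarrow> real^3 \<Rightarrow> real" where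
  "pd i \<phi> y = frechet_derivative \<phi> (at y) (axis i 1)"

primrec Ck :: "nat \<Rightarrow> (real^3 \<Rightarrow> real) \<Rightarrow> bool" where
  "Ck 0 \<phi> \<longleftrightarrow> continuous_on UNIV \<phi>"
| "Ck (Suc k) \<phi> \<longleftrightarrow> \<phi> differentiable_on UNIV \<and> (\<forall>i. Ck k (pd i \<phi>))"

definition test_fun :: "(real^3) set \<Rightarrow> (real^3 \<Rightarrow> real) \<Rightarrow> bool" where
  "test_fun U \<phi> \<longleftrightarrow> (\<forall>k. Ck k \<phi>) \<and>
     compact (closure {y. \<phi> y \<noteq> 0}) \<and> closure {y. \<phi> y \<noteq> 0} \<subseteq> U"

definition loc_integrable :: "(real^3) set \<Rightarrow> (real^3 \<Rightarrow> 'b::euclidean_space) \<Rightarrow> bool" where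
  "loc_integrable U f \<longleftrightarrow> (\<forall>K. compact K \<and> K \<subseteq> U \<longrightarrow> f absolutely_integrable_on K)"

definition has_weak_deriv ::
    "(real^3) set \<Rightarrow> 3 \<Rightarrow> (real^3 \<Rightarrow> 'b::euclidean_space) \<Rightarrow> (real^3 \<Rightarrow> 'b) \<Rightarrow> bool" where
  "has_weak_deriv U i f g \<longleftrightarrow> loc_integrable U f \<and> loc_integrable U g \<and>
     (\<forall>\<phi>. test_fun U \<phi> \<longrightarrow>
        (LINT y|lebesgue_on U. pd i \<phi> y *\<^sub>R f y) = - (LINT y|lebesgue_on U. \<phi> y *\<^sub>R g y))"

text \<open>The weak derivative is unique up to null sets; \<open>weak_deriv\<close> picks a representative.\<close>

definition weak_deriv ::
    "(real^3) set \<Rightarrow> 3 \<Rightarrow> (real^3 \<Rightarrow> 'b::euclidean_space) \<Rightarrow> real^3 \<Rightarrow> 'b" where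
  "weak_deriv U i f = (SOME g. has_weak_deriv U i f g)"

text \<open>The vector in \<open>\<real>\<^sup>n\<close>, \<open>n = 3N\<close>, that stacks the gradients of the \<open>N\<close> components; its
  entry \<open>(a, i)\<close> is the \<open>i\<close>-th weak derivative of component \<open>a\<close>.\<close>

definition grad :: "(real^3) set \<Rightarrow> (real^3 \<Rightarrow> real^'m) \<Rightarrow> real^3 \<Rightarrow> real^('m \<times> 3)" where
  "grad U f y = (\<chi> p. weak_deriv U (snd p) f y $ fst p)"

section \<open>Function spaces\<close>

definition L2 :: "(real^3) set \<Rightarrow> (real^3 \<Rightarrow> 'b::euclidean_space) \<Rightarrow> bool" where
  "L2 U f \<longleftrightarrow> f \<in> borel_measurable (lebesgue_on U) \<and>
     integrable (lebesgue_on U) (\<lambda>y. (norm (f y))\<^sup>2)"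

definition Linf :: "(real^3) set \<Rightarrow> (real^3 \<Rightarrow> 'b::euclidean_space) \<Rightarrow> bool" where
  "Linf U f \<longleftrightarrow> f \<in> borel_measurable (lebesgue_on U) \<and>
     (\<exists>B. AE y in lebesgue_on U. norm (f y) \<le> B)"

definition H1 :: "(real^3) set \<Rightarrow> (real^3 \<Rightarrow> 'b::euclidean_space) \<Rightarrow> bool" where
  "H1 U f \<longleftrightarrow> L2 U f \<and> (\<forall>i. \<exists>g. has_weak_deriv U i f g \<and> L2 U g)"

definition H2 :: "(real^3) set \<Rightarrow> (real^3 \<Rightarrow> 'b::euclidean_space) \<Rightarrow> bool" where
  "H2 U f \<longleftrightarrow> H1 U f \<and> (\<forall>i. H1 U (weak_deriv U i f))"

definition L2_norm :: "(real^3) set \<Rightarrow> (real^3 \<Rightarrow> 'b::euclidean_space) \<Rightarrow> real" where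
  "L2_norm U f = sqrt (LINT y|lebesgue_on U. (norm (f y))\<^sup>2)"

definition H1_norm :: "(real^3) set \<Rightarrow> (real^3 \<Rightarrow> 'b::euclidean_space) \<Rightarrow> real" where
  "H1_norm U f = sqrt ((L2_norm U f)\<^sup>2 + (\<Sum>i\<in>UNIV. (L2_norm U (weak_deriv U i f))\<^sup>2))"

definition H2_norm :: "(real^3) set \<Rightarrow> (real^3 \<Rightarrow> 'b::euclidean_space) \<Rightarrow> real" where
  "H2_norm U f = sqrt ((L2_norm U f)\<^sup>2 + (\<Sum>i\<in>UNIV. (L2_norm U (weak_deriv U i f))\<^sup>2)
     + (\<Sum>i\<in>UNIV. \<Sum>j\<in>UNIV. (L2_norm U (weak_deriv U j (weak_deriv U i f)))\<^sup>2))"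

text \<open>Periodic functions on the cell are represented by their periodic extensions to the whole
  space. Taking the weak derivatives on the whole space, and not only inside the cell, says that
  opposite faces match: the extension has no jump across the faces. This is how \<open>H\<^sup>1\<^sub>#\<close>
  differs from \<open>H\<^sup>1\<close> of the open cell.\<close>

definition H1_per :: "real \<Rightarrow> real^3 \<Rightarrow> (real^3 \<Rightarrow> 'b::euclidean_space) \<Rightarrow> bool" where
  "H1_per \<delta> x f \<longleftrightarrow> periodic \<delta> f \<and> L2 (cell \<delta> x) f \<and>
     (\<forall>i. \<exists>g. has_weak_deriv UNIV i f g \<and> L2 (cell \<delta> x) g)"

text \<open>\<open>W\<^bsup>1,\<infinity>\<^esup>\<close> for periodic coefficients, in the same sense. It cannot be relaxed to
  \<open>W\<^bsup>1,\<infinity>\<^esup>\<close> of the open cell: coefficients that jump across the faces meeting in an edge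
  produce \<open>r log r\<close> singularities there, and the \<open>H\<^sup>2\<close> bound fails.\<close>

definition W1inf_per :: "real \<Rightarrow> real^3 \<Rightarrow> (real^3 \<Rightarrow> 'b::euclidean_space) \<Rightarrow> bool" where
  "W1inf_per \<delta> x f \<longleftrightarrow> periodic \<delta> f \<and> Linf (cell \<delta> x) f \<and>
     (\<forall>i. \<exists>g. has_weak_deriv UNIV i f g \<and> Linf (cell \<delta> x) g)"

definition V_mic :: "real \<Rightarrow> real^3 \<Rightarrow> (real^3 \<Rightarrow> real^'m) set" where
  "V_mic \<delta> x = {f. H1_per \<delta> x f \<and> (LINT y|lebesgue_on (cell \<delta> x). f y) = 0}"

section \<open>The Sobolev equation\<close>

text \<open>\<open>dw\<close> is the time derivative of \<open>w\<close> as a curve in \<open>V_mic\<close>: the difference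
  quotients converge in \<open>H\<^sup>1\<close> at every time, one-sidedly at \<open>0\<close> and \<open>T\<close>.\<close>

definition has_time_deriv ::
    "real \<Rightarrow> real \<Rightarrow> real^3 \<Rightarrow> (real \<Rightarrow> real^3 \<Rightarrow> real^'m) \<Rightarrow> (real \<Rightarrow> real^3 \<Rightarrow> real^'m) \<Rightarrow> bool" where
  "has_time_deriv T \<delta> x w dw \<longleftrightarrow>
     (\<forall>t\<in>{0..T}. w t \<in> V_mic \<delta> x \<and> dw t \<in> V_mic \<delta> x \<and>
        ((\<lambda>s. H1_norm (cell \<delta> x) (\<lambda>y. (1 / (s - t)) *\<^sub>R (w s y - w t y) - dw t y)) \<longlongrightarrow> 0)
          (at t within {0..T}))"

definition sobolev_solution ::
    "real \<Rightarrow> real \<Rightarrow> real^3 \<Rightarrow> (real^3 \<Rightarrow> real^('m \<times> 3)^('m \<times> 3)) \<Rightarrow>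
     (real^3 \<Rightarrow> real^('m \<times> 3)^('m \<times> 3)) \<Rightarrow> (real^3 \<Rightarrow> real^'m) \<Rightarrow>
     (real \<Rightarrow> real^3 \<Rightarrow> real^'m) \<Rightarrow> bool" where
  "sobolev_solution T \<delta> x M R w0 w \<longleftrightarrow>
     (\<exists>dw. has_time_deriv T \<delta> x w dw \<and>
       (\<forall>v\<in>V_mic \<delta> x. \<forall>t\<in>{0..T}.
          (LINT y|lebesgue_on (cell \<delta> x).
             (M ((1 / \<delta>) *\<^sub>R y) *v grad (cell \<delta> x) (dw t) y) \<bullet> grad (cell \<delta> x) v y)
        + (LINT y|lebesgue_on (cell \<delta> x).
             (R ((1 / \<delta>) *\<^sub>R y) *v grad (cell \<delta> x) (w t) y) \<bullet> grad (cell \<delta> x) v y) = 0)) \<and>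
     (AE y in lebesgue_on (cell \<delta> x). w 0 y = w0 y)"

end

theory Submission
  imports Defs
begin

text \<open>
  After rescaling to the unit cube, periodic functions live on the torus, on which translations are
  isometries of \<open>L\<^sup>2\<close>. The gradients of \<open>V_mic\<close> are, up to closure, a closed subspace \<open>GG\<close> that is
  invariant under translations, and the gradient \<open>G\<close> of a solution satisfies \<open>G' = - B G\<close>, where \<open>B\<close>
  is the bounded operator on \<open>GG\<close> that solves the elliptic problem with matrix \<open>M\<close> and right-hand side
  \<open>R G\<close>. Hence \<open>G(t)\<close> is the sum of the series \<open>(- t)\<^sup>n B\<^sup>n G(0) / n!\<close>, and it suffices that \<open>B\<close> multiplies a
  bound on second derivatives by at most a constant. As \<open>M\<close> and \<open>R\<close> are Lipschitz continuous, this is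
  elliptic regularity by difference quotients.

  The initial value is \<open>H\<^sup>2\<close> only inside the cell, so its normal derivative may jump across faces.
  Therefore \<open>G(0)\<close> is split into its components in the three directions. The component in direction \<open>i\<close>
  jumps only across the faces orthogonal to \<open>i\<close>; for such a right-hand side the tangential differences
  are controlled by testing, and the normal ones, away from the faces, by the equation itself, because
  the normal flux of a solenoidal field does not jump.
\<close>

section \<open>Abstract Hilbert space tools\<close>

text \<open>The series is used because the solution is differentiable in time only as a curve in
  \<open>H1\<close>. Nothing is known about how its second derivatives depend on time, so no
  differential inequality for them can be written down. A bound on the differences of an
  \<open>L2\<close> class, in contrast, survives sums and \<open>L2\<close> limits. Regularity is
  therefore expressed by bounds of the form \<open>norm (dif j h u) \<le> K * h\<close>, and
  derivatives appear in integrated form, \<open>dif l h w = av l h g\<close>. One family of faces is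
  treated at a time because the elliptic argument needs directions to test in. If jumps occur only
  across the faces orthogonal to \<open>i\<close>, the other two directions are free of them and
  give estimates across every face; the equation then yields the remaining one. With all three
  families at once no such direction would be left. The classes \<open>Reg i\<close> are stable
  under multiplication by the coefficients, since Lipschitz factors create no new jumps. Test
  gradients are produced, and second derivatives recovered, by averaging over short segments, which
  takes the place of mollification.\<close>

lemma minimizing_sequence_Cauchy:
  fixes v :: "nat \<Rightarrow> 'a::real_normed_vector" and r :: "nat \<Rightarrow> real"
  assumes "\<And>m n. (norm (v m - v n))\<^sup>2 \<le> r m + r n" and r: "r \<longlonglongrightarrow> 0"
  shows "Cauchy v"
proof (rule metric_CauchyI)
  fix e :: real assume e: "e > 0"
  then have "eventually (\<lambda>n. r n < e\<^sup>2 / 2) sequentially"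
    using order_tendstoD(2)[OF r, of "e\<^sup>2/2"] by simp
  then obtain N where N: "\<And>n. n \<ge> N \<Longrightarrow> r n < e\<^sup>2 / 2"
    unfolding eventually_sequentially by auto
  have "dist (v m) (v n) < e" if "m \<ge> N" "n \<ge> N" for m n
  proof -
    have "(norm (v m - v n))\<^sup>2 < e\<^sup>2"
      using assms(1)[of m n] N[OF that(1)] N[OF that(2)] by linarith
    then show ?thesis
      using e by (simp add: dist_norm power_less_imp_less_base)
  qed
  then show "\<exists>M. \<forall>m\<ge>M. \<forall>n\<ge>M. dist (v m) (v n) < e" by blast
qed

lemma quadratic_nonneg_imp_linear_zero:
  fixes a b :: real
  assumes "\<And>t. 0 \<le> 2 * t * a + t\<^sup>2 * b"
  shows "a = 0"
proof (rule ccontr)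
  assume a: "a \<noteq> 0"
  define c where "c = \<bar>b\<bar> + 1"
  have c: "c > 0" "b < c" by (auto simp: c_def)
  have "0 \<le> 2 * (- a / c) * a + (- a / c)\<^sup>2 * b" by (rule assms)
  also have "\<dots> = (a\<^sup>2 / c) * (b / c - 2)"
    using c by (simp add: power2_eq_square field_simps)
  also have "\<dots> < 0"
    using a c by (intro mult_pos_neg) (auto simp: divide_less_eq)
  finally show False by simp
qed

text \<open>Symmetry makes the equation the Euler equation of the functional \<open>J\<close>, which
  is bounded below by coercivity. The parallelogram identity \<open>par\<close> turns a minimising
  sequence into a Cauchy sequence. For \<open>M\<close> the identity this is the orthogonal
  projection onto \<open>S\<close>, which is also how density is proved later.\<close>

lemma riesz_coercive:
  fixes M :: "'a::{real_inner, complete_space} \<Rightarrow> 'a"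
  assumes S: "subspace S" "closed S" and M: "bounded_linear M"
    and sym: "\<And>u v. inner (M u) v = inner u (M v)"
    and coer: "\<And>u. \<alpha> * (norm u)\<^sup>2 \<le> inner (M u) u" and \<alpha>: "\<alpha> > 0"
  shows "\<exists>u\<in>S. \<forall>v\<in>S. inner (M u) v = inner f v"
proof -
  interpret M: bounded_linear M by fact
  define J where "J u = inner (M u) u - 2 * inner f u" for u
  have low: "- (norm f)\<^sup>2 / \<alpha> \<le> J u" for u
  proof -
    have 1: "inner f u \<le> norm f * norm u" by (rule norm_cauchy_schwarz)
    have 2: "0 \<le> (\<alpha> * norm u - norm f)\<^sup>2 / \<alpha>" using \<alpha> by simp
    have "(\<alpha> * norm u - norm f)\<^sup>2 / \<alpha> = \<alpha> * (norm u)\<^sup>2 - 2 * (norm f * norm u) + (norm f)\<^sup>2 / \<alpha>"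
      using \<alpha> by (simp add: power2_eq_square field_simps)
    then show ?thesis unfolding J_def using 1 2 coer[of u] by linarith
  qed
  define d where "d = (INF u\<in>S. J u)"
  have bdd: "bdd_below (J ` S)" by (rule bdd_belowI2) (rule low)
  have ne: "J ` S \<noteq> {}" using subspace_0[OF S(1)] by auto
  have d_le: "d \<le> J u" if "u \<in> S" for u
    unfolding d_def by (rule cINF_lower[OF bdd that])
  have "\<exists>u\<in>S. J u < d + 1 / real (Suc n)" for n
  proof -
    have "d < d + 1 / real (Suc n)" by simp
    then show ?thesis unfolding d_def using cINF_less_iff[of S J, OF _ bdd] ne by blast
  qed
  then obtain v where v: "\<And>n. v n \<in> S" "\<And>n. J (v n) < d + 1 / real (Suc n)"
    by metis
  have par: "inner (M (a - b)) (a - b) / 2 = J a + J b - 2 * J ((1/2) *\<^sub>R (a + b))" for a b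
    by (simp add: J_def M.add M.diff M.scaleR inner_simps sym[of a b] inner_commute field_simps)
  have est: "(norm (v m - v n))\<^sup>2 \<le> 2 / \<alpha> * (1 / real (Suc m)) + 2 / \<alpha> * (1 / real (Suc n))" for m n
  proof -
    have "(1/2) *\<^sub>R (v m + v n) \<in> S"
      using S(1) v(1) by (intro subspace_scale subspace_add) auto
    then have "inner (M (v m - v n)) (v m - v n) / 2 \<le> 1 / real (Suc m) + 1 / real (Suc n)"
      unfolding par using d_le v(2)[of m] v(2)[of n] by (smt (verit))
    then have "\<alpha> * (norm (v m - v n))\<^sup>2 / 2 \<le> 1 / real (Suc m) + 1 / real (Suc n)"
      by (rule order_trans[rotated]) (intro divide_right_mono coer, simp)
    then have "(norm (v m - v n))\<^sup>2 \<le> (1 / real (Suc m) + 1 / real (Suc n)) * (2 / \<alpha>)"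
      using \<alpha> by (simp add: pos_le_divide_eq mult.commute del: of_nat_Suc)
    also have "\<dots> = 2 / \<alpha> * (1 / real (Suc m)) + 2 / \<alpha> * (1 / real (Suc n))"
      by (rule trans[OF distrib_right]) (simp only: mult.commute)
    finally show ?thesis .
  qed
  have "Cauchy v"
    by (rule minimizing_sequence_Cauchy[OF est])
       (rule tendsto_eq_intros LIMSEQ_Suc[OF lim_const_over_n] | simp)+
  then obtain u where u: "v \<longlonglongrightarrow> u"
    using Cauchy_convergent convergent_def by blast
  have uS: "u \<in> S" using closed_sequentially[OF S(2)] v(1) u by blast
  have "(\<lambda>n. J (v n)) \<longlonglongrightarrow> J u"
    unfolding J_def by (intro tendsto_intros M.tendsto u)
  moreover have "(\<lambda>n. d + 1 / real (Suc n)) \<longlonglongrightarrow> d"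
    by (rule tendsto_eq_intros LIMSEQ_Suc[OF lim_const_over_n] | simp)+
  ultimately have Ju: "J u \<le> d"
    by (rule LIMSEQ_le) (use v(2) less_imp_le in blast)
  have "inner (M u) w = inner f w" if w: "w \<in> S" for w
  proof -
    have "0 \<le> 2 * t * (inner (M u) w - inner f w) + t\<^sup>2 * inner (M w) w" for t
    proof -
      have "u + t *\<^sub>R w \<in> S" using S(1) uS w by (intro subspace_scale subspace_add) auto
      then have "J u \<le> J (u + t *\<^sub>R w)" using Ju d_le by fastforce
      also have "\<dots> = J u + 2 * t * (inner (M u) w - inner f w) + t\<^sup>2 * inner (M w) w"
        using sym[of w u]
        by (simp add: J_def M.add M.scaleR inner_simps power2_eq_square algebra_simps inner_commute)
      finally show ?thesis by simp
    qed
    then show ?thesis using quadratic_nonneg_imp_linear_zero by force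
  qed
  then show ?thesis using uS by auto
qed

text \<open>The Taylor sums satisfy \<open>S (Suc n)' = - B (S n)\<close> and
  \<open>S n 0 = G 0\<close>, so the error for \<open>Suc n\<close> is an antiderivative of
  \<open>- B\<close> applied to the error for \<open>n\<close>. Iterating gives a bound of order
  \<open>(b * t) ^ n / fact n\<close>. The result is stated as convergence of finite sums of the
  iterates \<open>(B ^^ k) (G 0)\<close>, because bounds preserved by \<open>B\<close> are to be
  summed over them.\<close>

lemma exp_taylor_unique:
  fixes G :: "real \<Rightarrow> 'a::real_normed_vector" and B :: "'a \<Rightarrow> 'a"
  assumes B: "bounded_linear B" and b: "\<And>u. norm (B u) \<le> b * norm u" "b \<ge> 0"
    and G: "\<And>t. t \<in> {0..T} \<Longrightarrow> (G has_vector_derivative - B (G t)) (at t within {0..T})"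
    and t: "t \<in> {0..T}"
  shows "(\<lambda>n. \<Sum>k\<le>n. ((- t) ^ k / fact k) *\<^sub>R (B ^^ k) (G 0)) \<longlonglongrightarrow> G t"
proof -
  interpret B: bounded_linear B by fact
  define S where "S n t = (\<Sum>k\<le>n. ((- t) ^ k / fact k) *\<^sub>R (B ^^ k) (G 0))" for n t
  have S0: "S n 0 = G 0" for n
  proof -
    have "S n 0 = (\<Sum>k\<in>{0}. ((- 0) ^ k / fact k) *\<^sub>R (B ^^ k) (G 0))"
      unfolding S_def by (rule sum.mono_neutral_right) auto
    then show ?thesis by simp
  qed
  have dS: "(S (Suc n) has_vector_derivative - B (S n t)) (at t within A)" for n t A
  proof -
    have eq: "S (Suc n) = (\<lambda>t. G 0 + (\<Sum>k\<le>n. ((- t) ^ Suc k / fact (Suc k)) *\<^sub>R (B ^^ Suc k) (G 0)))"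
      unfolding S_def by (rule ext, subst sum.atMost_Suc_shift) simp
    have *: "((\<lambda>t. (- t) ^ Suc k / fact (Suc k)) has_real_derivative - ((- t) ^ k / fact k)) (at t within A)" for k t
      by (rule derivative_eq_intros refl | simp add: field_simps del: of_nat_Suc)+
    have "(S (Suc n) has_vector_derivative (0 + (\<Sum>k\<le>n. (- ((- t) ^ k / fact k)) *\<^sub>R (B ^^ Suc k) (G 0)))) (at t within A)"
      unfolding eq
      by (intro has_vector_derivative_add has_vector_derivative_const has_vector_derivative_sum
           bounded_linear.has_vector_derivative[OF bounded_linear_scaleR_left]
           *[unfolded has_real_derivative_iff_has_vector_derivative])
    also have "0 + (\<Sum>k\<le>n. (- ((- t) ^ k / fact k)) *\<^sub>R (B ^^ Suc k) (G 0)) = - B (S n t)"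
      unfolding S_def by (simp add: B.sum B.scaleR sum_negf)
    finally show ?thesis .
  qed
  have contG: "continuous_on {0..T} G"
    unfolding continuous_on_eq_continuous_within
    using G has_vector_derivative_continuous by blast
  then have "bounded (G ` {0..T})" by (intro compact_imp_bounded compact_continuous_image) auto
  then obtain K where "K > 0" "\<forall>u\<in>G ` {0..T}. norm u \<le> K"
    unfolding bounded_pos by meson
  then have K: "\<And>s. s \<in> {0..T} \<Longrightarrow> norm (G s) \<le> K" "K > 0"
    by (simp_all only: ball_simps)
  have contS: "continuous_on X (S n)" for n X
    unfolding S_def by (intro continuous_intros) auto
  have bound: "norm (G s - S n s) \<le> 2 * K * (b * s) ^ n / fact n * exp (b*T)" if s: "s \<in> {0..T}" for n s
    using s
  proof (induction n arbitrary: s)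
    case 0
    have T0: "0 \<le> T" using 0 by auto
    have "norm (G s - S 0 s) \<le> norm (G s) + norm (G 0)"
      unfolding S_def by (simp add: norm_triangle_ineq4)
    also have "\<dots> \<le> 2 * K" using K(1)[OF 0] K(1)[of 0] T0 by simp
    also have "\<dots> \<le> 2 * K * exp (b*T)" using K(2) b(2) T0 by (simp add: mult_le_cancel_left1)
    finally show ?case by simp
  next
    case (Suc n)
    \<comment> \<open>The derivative of \<open>?\<phi>\<close> is \<open>b\<close> times the bound
      for \<open>n\<close>, so the induction hypothesis bounds the derivative of the error by that
      of \<open>?\<phi>\<close>, and both the error and \<open>?\<phi>\<close> vanish at 0.\<close>
    let ?\<phi> = "\<lambda>s. 2 * K * (b * s) ^ Suc n / fact (Suc n) * exp (b*T)"
    show ?case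
    proof (cases "s = 0")
      case True then show ?thesis by (simp add: S0)
    next
      case False
      then have s: "0 < s" "s \<le> T" using Suc.prems by auto
      have "norm ((G s - S (Suc n) s) - (G 0 - S (Suc n) 0)) \<le> ?\<phi> s - ?\<phi> 0"
      proof (rule differentiable_bound_general[OF s(1), where f="\<lambda>s. G s - S (Suc n) s" and
            f'="\<lambda>r. - B (G r) - (- B (S n r))" and \<phi>' = "\<lambda>r. b * (2 * K * (b * r) ^ n / fact n * exp (b*T))"])
        show "continuous_on {0..s} (\<lambda>s. G s - S (Suc n) s)"
          using s by (intro continuous_intros contS continuous_on_subset[OF contG]) auto
        show "continuous_on {0..s} ?\<phi>" by (intro continuous_intros) auto
      next
        fix r assume r: "0 < r" "r < s"
        then have "at r within {0..T} = at r"
          using s by (intro at_within_interior) auto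
        then have "(G has_vector_derivative - B (G r)) (at r)"
          using G[of r] r s by auto
        then show "((\<lambda>s. G s - S (Suc n) s) has_vector_derivative - B (G r) - - B (S n r)) (at r)"
          by (intro has_vector_derivative_diff dS)
        show "(?\<phi> has_vector_derivative b * (2 * K * (b * r) ^ n / fact n * exp (b * T))) (at r)"
          unfolding has_real_derivative_iff_has_vector_derivative[symmetric]
          by (rule derivative_eq_intros refl | simp add: field_simps del: of_nat_Suc power_Suc)+
        have "norm (- B (G r) - - B (S n r)) = norm (B (G r - S n r))"
          by (simp add: B.diff norm_minus_commute)
        also have "\<dots> \<le> b * norm (G r - S n r)" by (rule b)
        also have "\<dots> \<le> b * (2 * K * (b * r) ^ n / fact n * exp (b*T))"
          using Suc.IH[of r] r s b(2) by (intro mult_left_mono) auto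
        finally show "norm (- B (G r) - - B (S n r)) \<le> b * (2 * K * (b * r) ^ n / fact n * exp (b * T))" .
      qed
      then show ?thesis by (simp add: S0)
    qed
  qed
  have "(\<lambda>n. S n t) \<longlonglongrightarrow> G t"
  proof (rule LIM_zero_cancel, rule Lim_null_comparison)
    show "\<forall>\<^sub>F n in sequentially. norm (S n t - G t) \<le> 2 * K * ((b * t) ^ n / fact n) * exp (b*T)"
      using bound[OF t] by (simp add: norm_minus_commute)
    have "(\<lambda>n. (b * t) ^ n / fact n) \<longlonglongrightarrow> 0"
      using summable_LIMSEQ_zero[OF summable_exp[of "b*t"]] by (simp add: divide_inverse mult.commute)
    then show "(\<lambda>n. 2 * K * ((b * t) ^ n / fact n) * exp (b*T)) \<longlonglongrightarrow> 0"
      by (intro tendsto_mult_left_zero tendsto_mult_right_zero)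
  qed
  then show ?thesis unfolding S_def .
qed

section \<open>Square integrable functions on the unit torus\<close>

text \<open>Half open, so that it is a fundamental domain of the integer lattice: \<open>fr\<close>
  maps the whole space onto it and fixes its points. Addition on the torus is
  \<open>fr (y + z)\<close>.\<close>

definition unit_cube :: "(real^3) set" where
  "unit_cube = {y. \<forall>i. 0 \<le> y $ i \<and> y $ i < 1}"

text \<open>Built on \<open>lborel\<close> and not on \<open>lebesgue\<close>, so that compositions
  with translations and Fubini arguments on products stay measurable. Lebesgue measurable functions
  enter only through Borel representatives.\<close>

definition cubeM :: "(real^3) measure" where
  "cubeM = restrict_space lborel unit_cube"

definition fr :: "real^3 \<Rightarrow> real^3" where
  "fr y = (\<chi> i. frac (y $ i))"

abbreviation ax :: "3 \<Rightarrow> real^3" where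
  "ax l \<equiv> axis l 1"

lemma borel_measurable_vecI:
  fixes f :: "'a \<Rightarrow> real^'n"
  assumes "\<And>i. (\<lambda>x. f x $ i) \<in> borel_measurable M"
  shows "f \<in> borel_measurable M"
proof (subst borel_measurable_euclidean_space, intro ballI)
  fix b :: "real^'n" assume "b \<in> Basis"
  then obtain i where "b = axis i 1" by (auto simp: Basis_vec_def)
  then show "(\<lambda>x. f x \<bullet> b) \<in> borel_measurable M"
    using assms by (simp add: inner_axis)
qed

lemma borel_measurable_vec_nth [measurable]: "(\<lambda>x::real^'n. x $ i) \<in> borel_measurable borel"
  by (intro borel_measurable_continuous_onI continuous_intros)

lemma fr_measurable [measurable]: "fr \<in> borel_measurable borel"
  unfolding fr_def by (rule borel_measurable_vecI) (simp add: frac_def, measurable)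

lemma unit_cube_sets [measurable]: "unit_cube \<in> sets borel"
proof -
  have "unit_cube = {y\<in>space borel. \<forall>i. 0 \<le> y $ i \<and> y $ i < 1}" by (auto simp: unit_cube_def)
  also have "\<dots> \<in> sets borel" by measurable
  finally show ?thesis .
qed

lemma frac_add_of_int: "frac (a + of_int n) = frac (a :: real)"
  by (simp add: frac_def)

lemma fr_in_cube [simp]: "fr y \<in> unit_cube"
  by (simp add: fr_def unit_cube_def frac_lt_1)

lemma fr_cube: "y \<in> unit_cube \<Longrightarrow> fr y = y"
  by (simp add: fr_def unit_cube_def vec_eq_iff frac_eq)

lemma fr_fr_add [simp]: "fr (fr y + z) = fr (y + z)"
proof -
  have "frac (frac (y $ i) + z $ i) = frac (y $ i + z $ i)" for i
    using frac_add_of_int[of "frac (y $ i) + z $ i" "\<lfloor>y $ i\<rfloor>"] by (simp add: frac_def)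
  then show ?thesis by (simp add: fr_def vec_eq_iff)
qed

lemma space_cubeM [simp]: "space cubeM = unit_cube"
  by (simp add: cubeM_def space_restrict_space)

lemma measurable_cubeM_I [measurable (raw)]: "f \<in> borel_measurable borel \<Longrightarrow> f \<in> borel_measurable cubeM"
  unfolding cubeM_def by (rule measurable_restrict_space1) simp

lemma AE_cubeM: "(AE y in cubeM. P y) \<longleftrightarrow> (AE y in lborel. y \<in> unit_cube \<longrightarrow> P y)"
  unfolding cubeM_def by (subst AE_restrict_space_iff) auto

lemma nn_integral_cubeM: "(\<integral>\<^sup>+y. f y \<partial>cubeM) = (\<integral>\<^sup>+y. f y * indicator unit_cube y \<partial>lborel)"
  unfolding cubeM_def by (subst nn_integral_restrict_space) auto

lemma emeasure_cubeM: "emeasure cubeM unit_cube = 1"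
proof -
  have "emeasure cubeM unit_cube = emeasure lborel unit_cube"
    unfolding cubeM_def by (subst emeasure_restrict_space) auto
  moreover have "emeasure lborel (box 0 (\<chi> i. 1) :: (real^3) set) \<le> emeasure lborel unit_cube"
    by (rule emeasure_mono) (auto simp: unit_cube_def mem_box_cart less_imp_le)
  moreover have "emeasure lborel unit_cube \<le> emeasure lborel (cbox 0 (\<chi> i. 1) :: (real^3) set)"
    by (rule emeasure_mono) (auto simp: unit_cube_def mem_box_cart less_imp_le)
  moreover have "emeasure lborel (box 0 (\<chi> i. 1) :: (real^3) set) = 1"
    "emeasure lborel (cbox 0 (\<chi> i. 1) :: (real^3) set) = 1"
    by (auto simp: emeasure_lborel_box_eq emeasure_lborel_cbox_eq Basis_vec_def inner_axis intro!: prod.neutral)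
  ultimately show ?thesis by auto
qed

interpretation cubeM: finite_measure cubeM
  by standard (simp add: emeasure_cubeM)

section \<open>Invariance of the torus measure under translations\<close>

lemma nn_integral_lborel_shift:
  fixes c :: "real^3"
  assumes [measurable]: "f \<in> borel_measurable borel"
  shows "(\<integral>\<^sup>+y. f (y + c) \<partial>lborel) = (\<integral>\<^sup>+y. f y \<partial>lborel)"
proof -
  have "(\<integral>\<^sup>+y. f y \<partial>lborel) = (\<integral>\<^sup>+y. f y \<partial>distr lborel borel ((+) c))"
    by (simp add: lborel_distr_plus)
  also have "\<dots> = (\<integral>\<^sup>+y. f (c + y) \<partial>lborel)"
    by (subst nn_integral_distr) auto
  finally show ?thesis by (simp add: add.commute)
qed

text \<open>Modulo integers only \<open>k = frac h\<close> matters. Points of \<open>A\<close> stay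
  in the cube when moved by \<open>k\<close>; points of \<open>B\<close> leave it and come back
  moved by \<open>k - 1\<close>. The two translated pieces partition the cube again, so invariance
  of Lebesgue measure on each piece is enough.\<close>

lemma nn_integral_shift_axis:
  assumes f [measurable]: "f \<in> borel_measurable borel"
  shows "(\<integral>\<^sup>+y. f (fr (y + h *\<^sub>R ax l)) \<partial>cubeM) = (\<integral>\<^sup>+y. f y \<partial>cubeM)"
proof -
  define k where "k = frac h"
  have k: "0 \<le> k" "k < 1" by (auto simp: k_def frac_lt_1)
  have fk: "fr (y + h *\<^sub>R ax l) = fr (y + k *\<^sub>R ax l)" for y
  proof -
    have "frac (y $ i + h * ax l $ i) = frac (y $ i + frac h * ax l $ i)" for i
      using frac_add_of_int[of "y $ i + frac h * ax l $ i" "\<lfloor>h\<rfloor>"]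
      by (cases "i = l") (auto simp: axis_def frac_def algebra_simps)
    then show ?thesis by (simp add: fr_def k_def)
  qed
  define A where "A = {y \<in> unit_cube. y $ l < 1 - k}"
  define B where "B = {y \<in> unit_cube. \<not> y $ l < 1 - k}"
  have [measurable]: "A \<in> sets borel" "B \<in> sets borel"
    unfolding A_def B_def by measurable
  have frA: "fr (y + k *\<^sub>R ax l) = y + k *\<^sub>R ax l" if "y \<in> A" for y
    using that k by (intro fr_cube) (auto simp: A_def unit_cube_def axis_def)
  have frB: "fr (y + k *\<^sub>R ax l) = y + (k - 1) *\<^sub>R ax l" if "y \<in> B" for y
  proof -
    have "fr (y + k *\<^sub>R ax l) = fr (y + (k - 1) *\<^sub>R ax l)"
      by (auto simp: fr_def vec_eq_iff axis_def frac_def add_diff_eq)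
    also have "\<dots> = y + (k - 1) *\<^sub>R ax l"
    proof (rule fr_cube)
      have "y $ l < 1" using that by (simp add: B_def unit_cube_def)
      then have "y $ l + k < 2" using k by linarith
      then show "y + (k - 1) *\<^sub>R ax l \<in> unit_cube"
        using that k by (auto simp: B_def unit_cube_def axis_def)
    qed
    finally show ?thesis .
  qed
  have "(\<integral>\<^sup>+y. f (fr (y + h *\<^sub>R ax l)) \<partial>cubeM)
      = (\<integral>\<^sup>+y. f (y + k *\<^sub>R ax l) * indicator A y + f (y + (k - 1) *\<^sub>R ax l) * indicator B y \<partial>lborel)"
    unfolding nn_integral_cubeM fk
  proof (rule nn_integral_cong)
    fix y show "f (fr (y + k *\<^sub>R ax l)) * indicator unit_cube y
      = f (y + k *\<^sub>R ax l) * indicator A y + f (y + (k - 1) *\<^sub>R ax l) * indicator B y"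
      by (cases "y \<in> A"; cases "y \<in> B") (auto simp: frA frB, auto simp: A_def B_def)
  qed
  also have "\<dots> = (\<integral>\<^sup>+y. f (y + k *\<^sub>R ax l) * indicator A ((y + k *\<^sub>R ax l) - k *\<^sub>R ax l) \<partial>lborel)
     + (\<integral>\<^sup>+y. f (y + (k-1) *\<^sub>R ax l) * indicator B ((y + (k-1) *\<^sub>R ax l) - (k-1) *\<^sub>R ax l) \<partial>lborel)"
    by (subst nn_integral_add) auto
  also have "(\<integral>\<^sup>+y. f (y + k *\<^sub>R ax l) * indicator A ((y + k *\<^sub>R ax l) - k *\<^sub>R ax l) \<partial>lborel)
      = (\<integral>\<^sup>+y. f y * indicator A (y - k *\<^sub>R ax l) \<partial>lborel)"
    by (rule nn_integral_lborel_shift[where f = "\<lambda>y. f y * indicator A (y - k *\<^sub>R ax l)"]) measurable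
  also have "(\<integral>\<^sup>+y. f (y + (k-1) *\<^sub>R ax l) * indicator B ((y + (k-1) *\<^sub>R ax l) - (k-1) *\<^sub>R ax l) \<partial>lborel)
      = (\<integral>\<^sup>+y. f y * indicator B (y - (k-1) *\<^sub>R ax l) \<partial>lborel)"
    by (rule nn_integral_lborel_shift[where f = "\<lambda>y. f y * indicator B (y - (k-1) *\<^sub>R ax l)"]) measurable
  also have "(\<integral>\<^sup>+y. f y * indicator A (y - k *\<^sub>R ax l) \<partial>lborel) + (\<integral>\<^sup>+y. f y * indicator B (y - (k-1) *\<^sub>R ax l) \<partial>lborel)
     = (\<integral>\<^sup>+y. f y * indicator A (y - k *\<^sub>R ax l) + f y * indicator B (y - (k-1) *\<^sub>R ax l) \<partial>lborel)"
    by (rule nn_integral_add[symmetric]) measurable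
  also have "\<dots> = (\<integral>\<^sup>+y. f y \<partial>cubeM)"
    unfolding nn_integral_cubeM
  proof (rule nn_integral_cong)
    fix y :: "real^3"
    define P where "P = (\<forall>i. i \<noteq> l \<longrightarrow> 0 \<le> y $ i \<and> y $ i < 1)"
    have c: "y - a *\<^sub>R ax l \<in> unit_cube \<longleftrightarrow> P \<and> 0 \<le> y $ l - a \<and> y $ l - a < 1" for a
    proof -
      have "(y - a *\<^sub>R ax l) $ i = (if i = l then y $ l - a else y $ i)" for i
        by (simp add: axis_def)
      then show ?thesis unfolding unit_cube_def P_def by auto
    qed
    have cl: "(y - a *\<^sub>R ax l) $ l = y $ l - a" for a
      by (simp add: axis_def)
    have 0: "y \<in> unit_cube \<longleftrightarrow> P \<and> 0 \<le> y $ l \<and> y $ l < 1"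
      using c[of 0] by simp
    have 1: "y - k *\<^sub>R ax l \<in> A \<longleftrightarrow> y \<in> unit_cube \<and> k \<le> y $ l"
      unfolding A_def mem_Collect_eq c cl 0 using k by auto
    have 2: "y - (k-1) *\<^sub>R ax l \<in> B \<longleftrightarrow> y \<in> unit_cube \<and> \<not> k \<le> y $ l"
      unfolding B_def mem_Collect_eq c cl 0 using k by auto
    show "f y * indicator A (y - k *\<^sub>R ax l) + f y * indicator B (y - (k - 1) *\<^sub>R ax l) = f y * indicator unit_cube y"
      using 1 2 by (auto simp: indicator_def)
  qed
  finally show ?thesis .
qed

lemma nn_integral_shift:
  assumes [measurable]: "f \<in> borel_measurable borel"
  shows "(\<integral>\<^sup>+y. f (fr (y + z)) \<partial>cubeM) = (\<integral>\<^sup>+y. f y \<partial>cubeM)"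
proof -
  have z: "z = (\<Sum>l\<in>UNIV. (z $ l) *\<^sub>R ax l)"
    by (simp add: vec_eq_iff axis_def if_distrib[where f="\<lambda>c. _ * c"] cong: if_cong)
  have z3: "y + z = ((y + (z $ 1) *\<^sub>R ax 1) + (z $ 2) *\<^sub>R ax 2) + (z $ 3) *\<^sub>R ax 3" for y
    by (subst z) (simp add: sum_3 add.assoc)
  have "(\<integral>\<^sup>+y. f (fr (y + z)) \<partial>cubeM) =
    (\<integral>\<^sup>+y. (\<lambda>y. f (fr (fr (y + (z $ 2) *\<^sub>R ax 2) + (z $ 3) *\<^sub>R ax 3))) (fr (y + (z $ 1) *\<^sub>R ax 1)) \<partial>cubeM)"
    unfolding z3 by (simp add: add.assoc)
  also have "\<dots> = (\<integral>\<^sup>+y. f (fr (fr (y + (z $ 2) *\<^sub>R ax 2) + (z $ 3) *\<^sub>R ax 3)) \<partial>cubeM)"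
    by (rule nn_integral_shift_axis[where f = "\<lambda>y. f (fr (fr (y + (z $ 2) *\<^sub>R ax 2) + (z $ 3) *\<^sub>R ax 3))"]) measurable
  also have "\<dots> = (\<integral>\<^sup>+y. f (fr (y + (z $ 3) *\<^sub>R ax 3)) \<partial>cubeM)"
    by (rule nn_integral_shift_axis[where f = "\<lambda>y. f (fr (y + (z $ 3) *\<^sub>R ax 3))"]) measurable
  also have "\<dots> = (\<integral>\<^sup>+y. f y \<partial>cubeM)"
    by (rule nn_integral_shift_axis) measurable
  finally show ?thesis .
qed

lemma distr_shift: "distr cubeM borel (\<lambda>y. fr (y + z)) = distr cubeM borel (\<lambda>y. y)"
proof (rule measure_eqI)
  fix A assume "A \<in> sets (distr cubeM borel (\<lambda>y. fr (y + z)))"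
  then have [measurable]: "A \<in> sets borel" by simp
  have "(\<integral>\<^sup>+y. indicator A (fr (y + z)) \<partial>cubeM) = (\<integral>\<^sup>+y. indicator A y \<partial>cubeM)"
    by (rule nn_integral_shift) measurable
  then have "(\<integral>\<^sup>+y. indicator A y \<partial>distr cubeM borel (\<lambda>y. fr (y + z))) = (\<integral>\<^sup>+y. indicator A y \<partial>distr cubeM borel (\<lambda>y. y))"
    by (subst (1 2) nn_integral_distr) auto
  then show "emeasure (distr cubeM borel (\<lambda>y. fr (y + z))) A = emeasure (distr cubeM borel (\<lambda>y. y)) A"
    by simp
qed simp

lemma AE_shift:
  assumes "AE y in cubeM. P y"
  shows "AE y in cubeM. P (fr (y + z))"
proof -
  obtain N where N: "N \<in> null_sets cubeM" "{y\<in>space cubeM. \<not> P y} \<subseteq> N"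
    using assms unfolding eventually_ae_filter by auto
  then have Nb [measurable]: "N \<in> sets borel" and Nc: "N \<subseteq> unit_cube"
    by (auto simp: null_sets_def cubeM_def sets_restrict_space)
  have "(\<integral>\<^sup>+y. indicator N (fr (y + z)) \<partial>cubeM) = (\<integral>\<^sup>+y. indicator N y \<partial>cubeM)"
    by (rule nn_integral_shift) measurable
  also have "\<dots> = 0" using N by (simp add: null_sets_def)
  finally have "AE y in cubeM. indicator N (fr (y + z)) = (0::ennreal)"
    by (subst (asm) nn_integral_0_iff_AE) measurable
  then show ?thesis
    by eventually_elim (use N(2) fr_in_cube[of "_ + z"] in \<open>force simp: indicator_def split: if_splits\<close>)
qed

lemma integrable_shift:
  fixes f :: "real^3 \<Rightarrow> 'b::{banach, second_countable_topology}"
  assumes f: "f \<in> borel_measurable borel"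
  shows "integrable cubeM (\<lambda>y. f (fr (y + z))) \<longleftrightarrow> integrable cubeM f"
proof -
  have "integrable (distr cubeM borel (\<lambda>y. fr (y + z))) f \<longleftrightarrow> integrable (distr cubeM borel (\<lambda>y. y)) f"
    by (simp only: distr_shift)
  then show ?thesis using f by (subst (asm) (1 2) integrable_distr_eq) auto
qed

lemma integral_cube_shift:
  fixes f :: "real^3 \<Rightarrow> 'b::{banach, second_countable_topology}"
  assumes f: "f \<in> borel_measurable borel"
  shows "(\<integral>y. f (fr (y + z)) \<partial>cubeM) = (\<integral>y. f y \<partial>cubeM)"
proof -
  have "(\<integral>y. f y \<partial>distr cubeM borel (\<lambda>y. fr (y + z))) = (\<integral>y. f y \<partial>distr cubeM borel (\<lambda>y. y))"
    by (simp only: distr_shift)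
  then show ?thesis using f by (subst (asm) (1 2) integral_distr) auto
qed

section \<open>Square integrable Borel functions on the cube\<close>

definition Sq :: "(real^3 \<Rightarrow> 'b::euclidean_space) set" where
  "Sq = {f. f \<in> borel_measurable borel \<and> integrable cubeM (\<lambda>y. (norm (f y))\<^sup>2)}"

lemma Sq_measurable: "f \<in> Sq \<Longrightarrow> f \<in> borel_measurable borel"
  by (simp add: Sq_def)

lemma Sq_dominated:
  assumes f: "f \<in> borel_measurable borel" and g: "integrable cubeM g"
    and le: "AE y in cubeM. (norm (f y))\<^sup>2 \<le> g y"
  shows "f \<in> Sq"
  unfolding Sq_def
proof (intro CollectI conjI f Bochner_Integration.integrable_bound[OF g])
  show "(\<lambda>y. (norm (f y))\<^sup>2) \<in> borel_measurable cubeM" using f by measurable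
  show "AE y in cubeM. norm ((norm (f y))\<^sup>2) \<le> norm (g y)" using le by eventually_elim auto
qed

lemma Sq_norm_dominated:
  assumes f: "f \<in> borel_measurable borel" and g: "g \<in> Sq"
    and le: "AE y in cubeM. norm (f y) \<le> c * norm (g y)"
  shows "f \<in> Sq"
proof (rule Sq_dominated[OF f])
  show "integrable cubeM (\<lambda>y. c\<^sup>2 * (norm (g y))\<^sup>2)" using g by (simp add: Sq_def)
  show "AE y in cubeM. (norm (f y))\<^sup>2 \<le> c\<^sup>2 * (norm (g y))\<^sup>2"
    using le
  proof eventually_elim
    case (elim y)
    then have "(norm (f y))\<^sup>2 \<le> (c * norm (g y))\<^sup>2" by (intro power_mono) auto
    then show ?case by (simp add: power_mult_distrib)
  qed
qed

lemma norm_add_sq_le: "(norm (a + b :: 'b::real_inner))\<^sup>2 \<le> 2 * (norm a)\<^sup>2 + 2 * (norm b)\<^sup>2"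
proof -
  have "0 \<le> (norm (a - b))\<^sup>2" by simp
  then show ?thesis by (simp add: power2_norm_eq_inner inner_simps inner_commute)
qed

lemma abs_inner_le_sq: "\<bar>inner a b\<bar> \<le> (norm (a :: 'b::real_inner))\<^sup>2 + (norm b)\<^sup>2"
proof -
  have "\<bar>inner a b\<bar> \<le> norm a * norm b" by (rule Cauchy_Schwarz_ineq2)
  moreover have "2 * (norm a * norm b) \<le> (norm a)\<^sup>2 + (norm b)\<^sup>2"
    using sum_squares_bound[of "norm a" "norm b"] by (simp add: mult.assoc)
  moreover have "0 \<le> norm a * norm b" by simp
  ultimately show ?thesis by linarith
qed

lemma Sq_add: assumes "f \<in> Sq" "g \<in> Sq" shows "(\<lambda>y. f y + g y) \<in> Sq"
proof (rule Sq_dominated)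
  show "integrable cubeM (\<lambda>y. 2 * (norm (f y))\<^sup>2 + 2 * (norm (g y))\<^sup>2)"
    using assms by (auto simp: Sq_def)
qed (use assms in \<open>auto simp: Sq_def norm_add_sq_le\<close>)

lemma Sq_scaleR: assumes "f \<in> Sq" shows "(\<lambda>y. c *\<^sub>R f y) \<in> Sq"
  by (rule Sq_norm_dominated[OF _ assms, where c = "\<bar>c\<bar>"]) (use assms in \<open>auto simp: Sq_def\<close>)

lemma Sq_uminus: assumes "f \<in> Sq" shows "(\<lambda>y. - f y) \<in> Sq"
  using Sq_scaleR[OF assms, of "-1"] by simp

lemma Sq_diff: assumes "f \<in> Sq" "g \<in> Sq" shows "(\<lambda>y. f y - g y) \<in> Sq"
  using Sq_add[OF assms(1) Sq_uminus[OF assms(2)]] by simp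

lemma Sq_bounded:
  assumes "f \<in> borel_measurable borel" "AE y in cubeM. norm (f y) \<le> c"
  shows "f \<in> Sq"
proof (rule Sq_dominated[OF assms(1)])
  show "integrable cubeM (\<lambda>y. c\<^sup>2)" by (rule cubeM.integrable_const)
  show "AE y in cubeM. (norm (f y))\<^sup>2 \<le> c\<^sup>2"
    using assms(2) by eventually_elim (simp add: power_mono)
qed

lemma Sq_const: "(\<lambda>y. c) \<in> Sq"
  by (rule Sq_bounded[where c = "norm c"]) auto

lemma Sq_integrable_inner:
  assumes "f \<in> Sq" "g \<in> Sq"
  shows "integrable cubeM (\<lambda>y. inner (f y) (g y))"
proof (rule Bochner_Integration.integrable_bound)
  show "integrable cubeM (\<lambda>y. (norm (f y))\<^sup>2 + (norm (g y))\<^sup>2)"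
    using assms by (simp add: Sq_def)
  show "(\<lambda>y. inner (f y) (g y)) \<in> borel_measurable cubeM"
    using assms by (auto simp: Sq_def)
  show "AE y in cubeM. norm (inner (f y) (g y)) \<le> norm ((norm (f y))\<^sup>2 + (norm (g y))\<^sup>2)"
    using abs_inner_le_sq by auto
qed

lemma Sq_integrable:
  assumes "f \<in> Sq" shows "integrable cubeM f"
proof (rule Bochner_Integration.integrable_bound)
  show "integrable cubeM (\<lambda>y. 1 + (norm (f y))\<^sup>2)" using assms by (simp add: Sq_def)
  show "f \<in> borel_measurable cubeM" using assms by (auto simp: Sq_def)
  show "AE y in cubeM. norm (f y) \<le> norm (1 + (norm (f y))\<^sup>2)"
  proof (rule AE_I2)
    fix y
    have "2 * norm (f y) \<le> 1 + (norm (f y))\<^sup>2"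
      using sum_squares_bound[of 1 "norm (f y)"] by simp
    then have "norm (f y) \<le> 1 + (norm (f y))\<^sup>2" using norm_ge_zero[of "f y"] by linarith
    then show "norm (f y) \<le> norm (1 + (norm (f y))\<^sup>2)" by simp
  qed
qed

lemma Sq_shift: assumes "f \<in> Sq" shows "(\<lambda>y. f (fr (y + z))) \<in> Sq"
proof -
  have [measurable]: "f \<in> borel_measurable borel" using assms by (simp add: Sq_def)
  have "integrable cubeM (\<lambda>y. (\<lambda>y. (norm (f y))\<^sup>2) (fr (y + z)))"
    using assms by (subst integrable_shift) (auto simp: Sq_def)
  then show ?thesis by (simp add: Sq_def)
qed

\<comment> \<open>A partial quotient, because the relation lives on members of \<open>Sq\<close>
  only. Making the classes a type gives instances of \<open>real_inner\<close> and
  \<open>complete_space\<close>, so that the Riesz argument, integrals of curves and vector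
  derivatives can be used for them.\<close>
quotient_type (overloaded) 'b l2 = "real^3 \<Rightarrow> 'b::euclidean_space"
  / partial: "\<lambda>f g. f \<in> Sq \<and> g \<in> Sq \<and> (AE y in cubeM. f y = g y)"
  morphisms rep_l2 cls
proof (rule part_equivpI)
  show "\<exists>f. f \<in> Sq \<and> f \<in> Sq \<and> (AE y in cubeM. f y = (f y :: 'b))"
    using Sq_const[of 0] by auto
  show "symp (\<lambda>f g. f \<in> Sq \<and> g \<in> Sq \<and> (AE y in cubeM. f y = (g y :: 'b)))"
    by (rule sympI, elim conjE, intro conjI, assumption+, erule eventually_mono, simp)
  show "transp (\<lambda>f g. f \<in> Sq \<and> g \<in> Sq \<and> (AE y in cubeM. f y = (g y :: 'b)))"
  proof (rule transpI)
    fix f g h :: "real^3 \<Rightarrow> 'b"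
    assume 1: "f \<in> Sq \<and> g \<in> Sq \<and> (AE y in cubeM. f y = g y)"
      and 2: "g \<in> Sq \<and> h \<in> Sq \<and> (AE y in cubeM. g y = h y)"
    have "AE y in cubeM. f y = h y"
      using 1[THEN conjunct2, THEN conjunct2] 2[THEN conjunct2, THEN conjunct2] by eventually_elim simp
    then show "f \<in> Sq \<and> h \<in> Sq \<and> (AE y in cubeM. f y = h y)" using 1 2 by simp
  qed
qed

section \<open>Hilbert space structure on classes of functions\<close>

definition rep :: "'b::euclidean_space l2 \<Rightarrow> real^3 \<Rightarrow> 'b" where
  "rep F = (SOME f. f \<in> Sq \<and> cls f = F)"

lemma rep_props: "rep F \<in> Sq \<and> cls (rep F) = F"
proof -
  have "\<exists>f. f \<in> Sq \<and> cls f = F"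
    using Quotient_abs_rep[OF Quotient_l2, of F] Quotient_rep_reflp[OF Quotient_l2, of F]
    by (intro exI[of _ "rep_l2 F"]) simp
  then show ?thesis unfolding rep_def by (rule someI_ex)
qed

lemma rep_Sq [simp]: "rep F \<in> Sq" and cls_rep [simp]: "cls (rep F) = F"
  using rep_props by auto

lemma rep_measurable [measurable]: "rep F \<in> borel_measurable borel"
  using rep_Sq by (rule Sq_measurable)

lemma cls_eq_iff:
  assumes "f \<in> Sq" "g \<in> Sq"
  shows "cls f = cls g \<longleftrightarrow> (AE y in cubeM. f y = g y)"
  using Quotient_rel[OF Quotient_l2, of f g] assms by auto

lemma rep_cls: "f \<in> Sq \<Longrightarrow> AE y in cubeM. rep (cls f) y = f y"
  by (metis cls_eq_iff cls_rep rep_Sq)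

lemma AE_cong2:
  assumes "AE y in M. f1 y = f2 y" "AE y in M. g1 y = g2 y"
  shows "AE y in M. h (f1 y) (g1 y) = h (f2 y) (g2 y)"
  using assms by eventually_elim simp

instantiation l2 :: (euclidean_space) real_vector
begin

lift_definition zero_l2 :: "'a l2" is "\<lambda>_. 0" by (simp add: Sq_const)

lift_definition plus_l2 :: "'a l2 \<Rightarrow> 'a l2 \<Rightarrow> 'a l2" is "\<lambda>f g y. f y + g y"
  by (elim conjE, intro conjI Sq_add AE_cong2[where h = "(+)"])

lift_definition uminus_l2 :: "'a l2 \<Rightarrow> 'a l2" is "\<lambda>f y. - f y"
  by (elim conjE, intro conjI Sq_uminus AE_cong2[where h = "\<lambda>a b. - a"])

lift_definition minus_l2 :: "'a l2 \<Rightarrow> 'a l2 \<Rightarrow> 'a l2" is "\<lambda>f g y. f y - g y"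
  by (elim conjE, intro conjI Sq_diff AE_cong2[where h = "(-)"])

lift_definition scaleR_l2 :: "real \<Rightarrow> 'a l2 \<Rightarrow> 'a l2" is "\<lambda>c f y. c *\<^sub>R f y"
  by (elim conjE, intro conjI Sq_scaleR AE_cong2[where h = "\<lambda>a b. _ *\<^sub>R a"])

instance
proof
  fix F G H :: "'a l2" and a b :: real
  obtain f g h where *: "F = cls f" "G = cls g" "H = cls h" "f \<in> Sq" "g \<in> Sq" "h \<in> Sq"
    using cls_rep rep_Sq by metis
  have add: "cls u + cls v = cls (\<lambda>y. u y + v y)" if "u \<in> Sq" "v \<in> Sq" for u v :: "real^3 \<Rightarrow> 'a"
    using that by (intro plus_l2.abs_eq) auto
  have diff: "cls u - cls v = cls (\<lambda>y. u y - v y)" if "u \<in> Sq" "v \<in> Sq" for u v :: "real^3 \<Rightarrow> 'a"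
    using that by (intro minus_l2.abs_eq) auto
  have uminus: "- cls u = cls (\<lambda>y. - u y)" if "u \<in> Sq" for u :: "real^3 \<Rightarrow> 'a"
    using that by (intro uminus_l2.abs_eq) auto
  have scaleR: "c *\<^sub>R cls u = cls (\<lambda>y. c *\<^sub>R u y)" if "u \<in> Sq" for u :: "real^3 \<Rightarrow> 'a" and c
    using that by (intro scaleR_l2.abs_eq) auto
  note defs = * add diff uminus scaleR zero_l2_def Sq_const Sq_add Sq_diff Sq_uminus Sq_scaleR
  show "F + G + H = F + (G + H)" by (simp add: defs add.assoc)
  show "F + G = G + F" by (simp add: defs add.commute)
  show "0 + F = F" by (simp add: defs)
  show "- F + F = 0" by (simp add: defs)
  show "F - G = F + - G" by (simp add: defs)
  show "a *\<^sub>R (F + G) = a *\<^sub>R F + a *\<^sub>R G" by (simp add: defs scaleR_right_distrib)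
  show "(a + b) *\<^sub>R F = a *\<^sub>R F + b *\<^sub>R F" by (simp add: defs scaleR_left_distrib)
  show "a *\<^sub>R b *\<^sub>R F = (a * b) *\<^sub>R F" by (simp add: defs)
  show "1 *\<^sub>R F = F" by (simp add: defs)
qed

end

lemma cls_zero: "cls (\<lambda>_. 0) = 0" by (simp add: zero_l2_def)

lemma cls_add: "f \<in> Sq \<Longrightarrow> g \<in> Sq \<Longrightarrow> cls f + cls g = cls (\<lambda>y. f y + g y)"
  by (rule plus_l2.abs_eq) auto

lemma cls_diff: "f \<in> Sq \<Longrightarrow> g \<in> Sq \<Longrightarrow> cls f - cls g = cls (\<lambda>y. f y - g y)"
  by (rule minus_l2.abs_eq) auto

lemma cls_scaleR: "f \<in> Sq \<Longrightarrow> c *\<^sub>R cls f = cls (\<lambda>y. c *\<^sub>R f y)"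
  by (rule scaleR_l2.abs_eq) auto

instantiation l2 :: (euclidean_space) real_inner
begin

lift_definition inner_l2 :: "'a l2 \<Rightarrow> 'a l2 \<Rightarrow> real" is "\<lambda>f g. \<integral>y. inner (f y) (g y) \<partial>cubeM"
  by (intro integral_cong_AE)
     (auto simp: Sq_def intro!: AE_cong2[where h = inner])

definition norm_l2 :: "'a l2 \<Rightarrow> real" where "norm_l2 F = sqrt (inner F F)"
definition sgn_l2 :: "'a l2 \<Rightarrow> 'a l2" where "sgn_l2 F = F /\<^sub>R norm F"
definition dist_l2 :: "'a l2 \<Rightarrow> 'a l2 \<Rightarrow> real" where "dist_l2 F G = norm (F - G)"
definition uniformity_l2 :: "('a l2 \<times> 'a l2) filter" where
  "uniformity_l2 = (INF e\<in>{0 <..}. principal {(F, G). dist F G < e})"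
definition open_l2 :: "'a l2 set \<Rightarrow> bool" where
  "open_l2 U \<longleftrightarrow> (\<forall>x\<in>U. eventually (\<lambda>(x', y). x' = x \<longrightarrow> y \<in> U) uniformity)"

instance
proof
  fix F G H :: "'a l2" and r :: real
  show "dist F G = norm (F - G)" by (rule dist_l2_def)
  show "sgn F = F /\<^sub>R norm F" by (rule sgn_l2_def)
  show "(uniformity :: ('a l2 \<times> 'a l2) filter) = (INF e\<in>{0 <..}. principal {(F, G). dist F G < e})"
    by (rule uniformity_l2_def)
  show "open U \<longleftrightarrow> (\<forall>x\<in>U. eventually (\<lambda>(x', y). x' = x \<longrightarrow> y \<in> U) uniformity)" for U :: "'a l2 set"
    by (rule open_l2_def)
  obtain f g h where *: "F = cls f" "G = cls g" "H = cls h" "f \<in> Sq" "g \<in> Sq" "h \<in> Sq"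
    using cls_rep rep_Sq by metis
  have inner: "inner (cls u) (cls v) = (\<integral>y. inner (u y) (v y) \<partial>cubeM)" if "u \<in> Sq" "v \<in> Sq"
    for u v :: "real^3 \<Rightarrow> 'a"
    using that by (intro inner_l2.abs_eq) auto
  show "inner F G = inner G F" by (simp add: * inner inner_commute)
  show "inner (F + G) H = inner F H + inner G H"
    by (simp add: * cls_add inner Sq_add inner_add_left Bochner_Integration.integral_add Sq_integrable_inner)
  show "inner (r *\<^sub>R F) G = r * inner F G" by (simp add: * cls_scaleR inner Sq_scaleR)
  show "0 \<le> inner F F" by (simp add: * inner)
  have "(\<integral>y. inner (f y) (f y) \<partial>cubeM) = 0 \<longleftrightarrow> (AE y in cubeM. inner (f y) (f y) = 0)"
    by (rule integral_nonneg_eq_0_iff_AE) (auto simp: Sq_integrable_inner *)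
  then show "inner F F = 0 \<longleftrightarrow> F = 0"
    by (simp add: * inner zero_l2_def cls_eq_iff Sq_const)
  show "norm F = sqrt (inner F F)" by (rule norm_l2_def)
qed

end

lemma inner_cls: "f \<in> Sq \<Longrightarrow> g \<in> Sq \<Longrightarrow> inner (cls f) (cls g) = (\<integral>y. inner (f y) (g y) \<partial>cubeM)"
  by (rule inner_l2.abs_eq) auto

lemma norm_cls: "f \<in> Sq \<Longrightarrow> (norm (cls f))\<^sup>2 = (\<integral>y. (norm (f y))\<^sup>2 \<partial>cubeM)"
  by (simp add: power2_norm_eq_inner inner_cls)

lemma norm_rep: "(norm F)\<^sup>2 = (\<integral>y. (norm (rep F y))\<^sup>2 \<partial>cubeM)"
  using norm_cls[of "rep F"] by simp

text \<open>The Riesz-Fischer argument. The increments are summable in \<open>L2\<close>, hence in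
  \<open>L1\<close> as the cube has measure one, so the representatives converge almost everywhere.
  Fatou's lemma then bounds the distance from the pointwise limit \<open>g\<close> to each
  \<open>X n\<close>, which shows both that \<open>g\<close> is square integrable and that it is the
  limit.\<close>

lemma l2_Cauchy_subseq_limit:
  fixes X :: "nat \<Rightarrow> 'b::euclidean_space l2"
  assumes r: "\<And>n. norm (X (Suc n) - X n) \<le> (1/2) ^ n" and C: "Cauchy X"
  shows "\<exists>L. X \<longlonglongrightarrow> L"
proof -
  define f where "f n = rep (X n)" for n
  have fS [simp]: "f n \<in> Sq" and Xf: "X n = cls (f n)" for n by (auto simp: f_def)
  have [measurable]: "f n \<in> borel_measurable borel" for n by (simp add: f_def)
  have dS: "(\<lambda>y. f m y - f n y) \<in> Sq" for m n by (rule Sq_diff) auto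
  have nd: "norm (X m - X n) ^ 2 = (\<integral>y. (norm (f m y - f n y))\<^sup>2 \<partial>cubeM)" for m n
    unfolding Xf by (subst cls_diff) (auto simp: norm_cls dS)
  have nnd: "(\<integral>\<^sup>+y. ennreal ((norm (f m y - f n y))\<^sup>2) \<partial>cubeM) = ennreal ((norm (X m - X n))\<^sup>2)" for m n
    unfolding nd using dS[of m n] by (intro nn_integral_eq_integral) (auto simp: Sq_def)
  have L1: "(\<integral>\<^sup>+y. ennreal (norm (f (Suc n) y - f n y)) \<partial>cubeM) \<le> ennreal ((1/2)^n)" for n
  proof -
    \<comment> \<open>Young's inequality \<open>a \<le> e / 2 + a\<^sup>2 / (2 * e)\<close> stands
      in for Cauchy-Schwarz. The weight \<open>e\<close> is the bound on the \<open>L2\<close> norm,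
      so each of the two terms integrates to at most \<open>e / 2\<close>.\<close>
    define e :: real where "e = (1/2)^n"
    have e: "e > 0" by (simp add: e_def)
    have "(\<integral>\<^sup>+y. ennreal (norm (f (Suc n) y - f n y)) \<partial>cubeM)
       \<le> (\<integral>\<^sup>+y. ennreal (e / 2) + ennreal (1 / (2 * e)) * ennreal ((norm (f (Suc n) y - f n y))\<^sup>2) \<partial>cubeM)"
    proof (rule nn_integral_mono)
      fix y
      define a where "a = norm (f (Suc n) y - f n y)"
      have "0 \<le> (a - e)\<^sup>2" by simp
      then have "a * (2 * e) \<le> e\<^sup>2 + a\<^sup>2" by (simp add: power2_diff)
      then have "a \<le> (e\<^sup>2 + a\<^sup>2) / (2 * e)" using e by (simp add: pos_le_divide_eq)
      also have "\<dots> = e / 2 + 1 / (2 * e) * a\<^sup>2" using e by (simp add: field_simps power2_eq_square)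
      finally have "ennreal a \<le> ennreal (e / 2 + 1 / (2 * e) * a\<^sup>2)" by (rule ennreal_leI)
      then show "ennreal (norm (f (Suc n) y - f n y)) \<le>
          ennreal (e / 2) + ennreal (1 / (2 * e)) * ennreal ((norm (f (Suc n) y - f n y))\<^sup>2)"
        using e by (simp add: a_def ennreal_plus ennreal_mult'[symmetric])
    qed
    also have "\<dots> = ennreal (e / 2) + ennreal (1 / (2 * e)) * ennreal ((norm (X (Suc n) - X n))\<^sup>2)"
      by (subst nn_integral_add) (auto simp: nn_integral_cmult nnd emeasure_cubeM)
    also have "\<dots> \<le> ennreal (e / 2) + ennreal (1 / (2 * e)) * ennreal (e\<^sup>2)"
      using r[of n] by (intro add_mono mult_left_mono ennreal_leI power_mono) (auto simp: e_def)
    also have "\<dots> = ennreal (e / 2 + 1 / (2 * e) * e\<^sup>2)"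
      using e by (simp add: ennreal_plus ennreal_mult'[symmetric])
    also have "e / 2 + 1 / (2 * e) * e\<^sup>2 = e" using e by (simp add: power2_eq_square)
    finally show ?thesis by (simp add: e_def)
  qed
  have "(\<integral>\<^sup>+y. (\<Sum>n. ennreal (norm (f (Suc n) y - f n y))) \<partial>cubeM)
      = (\<Sum>n. \<integral>\<^sup>+y. ennreal (norm (f (Suc n) y - f n y)) \<partial>cubeM)"
    by (rule nn_integral_suminf) measurable
  also have "\<dots> \<le> (\<Sum>n. ennreal ((1/2)^n))" by (intro suminf_le L1) auto
  also have "\<dots> = ennreal (\<Sum>n. (1/2)^n)" by (rule suminf_ennreal2) auto
  also have "\<dots> < \<infinity>" by simp
  finally have "AE y in cubeM. (\<Sum>n. ennreal (norm (f (Suc n) y - f n y))) \<noteq> \<infinity>"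
    by (intro nn_integral_PInf_AE) auto
  then have conv: "AE y in cubeM. (\<lambda>n. f n y) \<longlonglongrightarrow> lim (\<lambda>n. f n y)"
  proof eventually_elim
    case (elim y)
    then have "summable (\<lambda>n. norm (f (Suc n) y - f n y))"
      by (intro summable_suminf_not_top) auto
    then have "summable (\<lambda>n. f (Suc n) y - f n y)" by (rule summable_norm_cancel)
    then have "convergent (\<lambda>n. \<Sum>i<n. f (Suc i) y - f i y)"
      by (simp only: summable_iff_convergent)
    then have "convergent (\<lambda>n. f n y - f 0 y)" by (simp only: sum_lessThan_telescope[of "\<lambda>n. f n y"])
    then have "convergent (\<lambda>n. f n y)" by (simp only: convergent_diff_const_right_iff)
    then show ?case by (simp add: convergent_LIMSEQ_iff)
  qed
  define g where "g y = lim (\<lambda>n. f n y)" for y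
  have [measurable]: "g \<in> borel_measurable borel"
    unfolding g_def by measurable
  have fatou: "(\<integral>\<^sup>+y. ennreal ((norm (g y - f n y))\<^sup>2) \<partial>cubeM) \<le> ennreal (e\<^sup>2)"
    if e: "\<And>m. m \<ge> n \<Longrightarrow> norm (X m - X n) \<le> e" for n e
  proof -
    have "(\<integral>\<^sup>+y. ennreal ((norm (g y - f n y))\<^sup>2) \<partial>cubeM)
      = (\<integral>\<^sup>+y. liminf (\<lambda>m. ennreal ((norm (f m y - f n y))\<^sup>2)) \<partial>cubeM)"
    proof (rule nn_integral_cong_AE)
      show "AE y in cubeM. ennreal ((norm (g y - f n y))\<^sup>2) = liminf (\<lambda>m. ennreal ((norm (f m y - f n y))\<^sup>2))"
        using conv
      proof eventually_elim
        case (elim y)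
        then have "(\<lambda>m. ennreal ((norm (f m y - f n y))\<^sup>2)) \<longlonglongrightarrow> ennreal ((norm (g y - f n y))\<^sup>2)"
          unfolding g_def by (intro tendsto_ennrealI tendsto_intros)
        then show ?case by (intro lim_imp_Liminf[symmetric]) auto
      qed
    qed
    also have "\<dots> \<le> liminf (\<lambda>m. \<integral>\<^sup>+y. ennreal ((norm (f m y - f n y))\<^sup>2) \<partial>cubeM)"
      by (rule nn_integral_liminf) measurable
    also have "\<dots> \<le> ennreal (e\<^sup>2)"
    proof (rule Liminf_le)
      show "\<forall>\<^sub>F m in sequentially. (\<integral>\<^sup>+y. ennreal ((norm (f m y - f n y))\<^sup>2) \<partial>cubeM) \<le> ennreal (e\<^sup>2)"
        unfolding nnd eventually_sequentially
        by (intro exI[of _ n] allI impI ennreal_leI power_mono e) auto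
    qed simp
    finally show ?thesis .
  qed
  have gf: "(\<lambda>y. g y - f n y) \<in> Sq" "norm (cls (\<lambda>y. g y - f n y)) \<le> e"
    if e: "\<And>m. m \<ge> n \<Longrightarrow> norm (X m - X n) \<le> e" and "e \<ge> 0" for n e
  proof -
    have "(\<integral>\<^sup>+y. ennreal ((norm (g y - f n y))\<^sup>2) \<partial>cubeM) < \<infinity>"
      using fatou[OF e] by (auto intro: le_less_trans)
    then show S: "(\<lambda>y. g y - f n y) \<in> Sq"
      unfolding Sq_def by (auto intro!: integrableI_nonneg)
    have "ennreal ((norm (cls (\<lambda>y. g y - f n y)))\<^sup>2) = (\<integral>\<^sup>+y. ennreal ((norm (g y - f n y))\<^sup>2) \<partial>cubeM)"
      unfolding norm_cls[OF S] using S
      by (intro nn_integral_eq_integral[symmetric]) (auto simp: Sq_def)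
    also have "\<dots> \<le> ennreal (e\<^sup>2)" by (rule fatou[OF e])
    finally have "(norm (cls (\<lambda>y. g y - f n y)))\<^sup>2 \<le> e\<^sup>2" by simp
    then show "norm (cls (\<lambda>y. g y - f n y)) \<le> e"
      using \<open>e \<ge> 0\<close> by (rule power2_le_imp_le)
  qed
  have tail: "\<exists>N. \<forall>n\<ge>N. \<forall>m\<ge>n. norm (X m - X n) \<le> e" if "e > 0" for e
  proof -
    obtain N where "\<forall>m\<ge>N. \<forall>n\<ge>N. norm (X m - X n) < e" using CauchyD[OF C \<open>e > 0\<close>] by blast
    then show ?thesis by (intro exI[of _ N]) (simp add: less_imp_le)
  qed
  have gS: "g \<in> Sq"
  proof -
    obtain N where "\<And>n m. n \<ge> N \<Longrightarrow> m \<ge> n \<Longrightarrow> norm (X m - X n) \<le> 1"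
      using tail[of 1] by auto
    then have "(\<lambda>y. (g y - f N y) + f N y) \<in> Sq" by (intro Sq_add gf) auto
    then show ?thesis by simp
  qed
  have "X \<longlonglongrightarrow> cls g"
  proof (rule metric_LIMSEQ_I)
    fix e :: real assume "e > 0"
    then obtain N where N: "\<And>n m. n \<ge> N \<Longrightarrow> m \<ge> n \<Longrightarrow> norm (X m - X n) \<le> e/2"
      using tail[of "e/2"] by auto
    have "dist (X n) (cls g) < e" if "n \<ge> N" for n
    proof -
      have "norm (cls (\<lambda>y. g y - f n y)) \<le> e/2" using N that \<open>e > 0\<close> by (intro gf) auto
      then have "norm (cls g - X n) \<le> e/2" unfolding Xf by (subst cls_diff) (auto simp: gS)
      then show ?thesis using \<open>e > 0\<close> by (simp add: dist_norm norm_minus_commute)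
    qed
    then show "\<exists>N. \<forall>n\<ge>N. dist (X n) (cls g) < e" by blast
  qed
  then show ?thesis by blast
qed

instance l2 :: (euclidean_space) complete_space
proof
  fix X :: "nat \<Rightarrow> 'a l2" assume X: "Cauchy X"
  have "\<exists>N. \<forall>m\<ge>N. \<forall>n\<ge>N. norm (X m - X n) < (1/2)^k" for k :: nat
    using X unfolding Cauchy_def dist_norm by auto
  then obtain N where N: "\<And>k m n. m \<ge> N k \<Longrightarrow> n \<ge> N k \<Longrightarrow> norm (X m - X n) < (1/2)^k"
    by metis
  define r where "r = rec_nat (N 0) (\<lambda>k a. max (Suc a) (N (Suc k)))"
  have r: "r 0 = N 0" "r (Suc k) = max (Suc (r k)) (N (Suc k))" for k by (auto simp: r_def)
  have rN: "r k \<ge> N k" for k by (cases k) (auto simp: r)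
  have mono: "strict_mono r" by (rule strict_monoI_Suc) (simp add: r)
  have "norm (X (r (Suc k)) - X (r k)) \<le> (1/2)^k" for k
    using rN[of k] by (intro less_imp_le[OF N]) (auto simp: r(2))
  then have "\<exists>L. (X \<circ> r) \<longlonglongrightarrow> L"
    by (intro l2_Cauchy_subseq_limit Cauchy_subseq_Cauchy[OF X mono]) auto
  then obtain L where "(X \<circ> r) \<longlonglongrightarrow> L" by blast
  then have "X \<longlonglongrightarrow> L" using X mono Cauchy_converges_subseq by blast
  then show "convergent X" by (auto simp: convergent_def)
qed

instance l2 :: (euclidean_space) banach ..

section \<open>Translations and pointwise linear operators\<close>

definition shift :: "real^3 \<Rightarrow> 'b::euclidean_space l2 \<Rightarrow> 'b l2" where
  "shift z F = cls (\<lambda>y. rep F (fr (y + z)))"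

lemma shift_cls: assumes "f \<in> Sq" shows "shift z (cls f) = cls (\<lambda>y. f (fr (y + z)))"
  unfolding shift_def using assms AE_shift[OF rep_cls[OF assms], of z]
  by (subst cls_eq_iff) (auto intro: Sq_shift)

lemma l2_obtain: obtains f where "F = cls f" "f \<in> Sq"
  by (metis cls_rep rep_Sq)

lemma shift_add: "shift z (F + G) = shift z F + shift z G"
proof -
  obtain f g where "F = cls f" "f \<in> Sq" "G = cls g" "g \<in> Sq" by (metis l2_obtain)
  then show ?thesis by (simp add: shift_cls cls_add Sq_add Sq_shift)
qed

lemma shift_scaleR: "shift z (c *\<^sub>R F) = c *\<^sub>R shift z F"
proof -
  obtain f where "F = cls f" "f \<in> Sq" by (metis l2_obtain)
  then show ?thesis by (simp add: shift_cls cls_scaleR Sq_scaleR Sq_shift)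
qed

lemma shift_inner: "inner (shift z F) (shift z G) = inner F G"
proof -
  obtain f g where *: "F = cls f" "f \<in> Sq" "G = cls g" "g \<in> Sq" by (metis l2_obtain)
  then have [measurable]: "f \<in> borel_measurable borel" "g \<in> borel_measurable borel"
    by (auto simp: Sq_def)
  have "inner (shift z F) (shift z G) = (\<integral>y. (\<lambda>y. inner (f y) (g y)) (fr (y + z)) \<partial>cubeM)"
    using * by (simp add: shift_cls inner_cls Sq_shift)
  also have "\<dots> = (\<integral>y. inner (f y) (g y) \<partial>cubeM)"
    by (rule integral_cube_shift) measurable
  finally show ?thesis using * by (simp add: inner_cls)
qed

lemma norm_shift [simp]: "norm (shift z F) = norm F"
  by (simp add: norm_eq_sqrt_inner shift_inner)

lemma bounded_linear_shift: "bounded_linear (shift z)"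
  by (rule bounded_linear_intro[where K = 1]) (auto simp: shift_add shift_scaleR)

lemmas shift_diff = linear_diff[OF bounded_linear.linear[OF bounded_linear_shift]]
lemma shift_shift: "shift z (shift w F) = shift (z + w) F"
proof -
  obtain f where "F = cls f" "f \<in> Sq" by (metis l2_obtain)
  then show ?thesis by (simp add: shift_cls Sq_shift add.assoc)
qed

lemma shift_0 [simp]: "shift 0 F = F"
proof -
  obtain f where *: "F = cls f" "f \<in> Sq" by (metis l2_obtain)
  have "AE y in cubeM. f (fr (y + 0)) = f y" by (rule AE_I2) (simp add: fr_cube)
  then show ?thesis using * by (simp add: shift_cls cls_eq_iff Sq_shift[where z = 0, simplified])
qed

lemma shift_commute: "shift z (shift w F) = shift w (shift z F)"
  by (simp add: shift_shift add.commute)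

lemma inner_shift_left: "inner (shift z F) G = inner F (shift (- z) G)"
  using shift_inner[of "- z" "shift z F" G] by (simp add: shift_shift)

text \<open>Covers the three kinds of multiplication that occur: by coefficient matrices, by the
  constant maps that extract or insert a gradient component, and by indicators of cut-off sets.
  Linearity holds at every point but the bound only almost everywhere, so that differences of
  translated coefficients qualify as well.\<close>

definition lin_field :: "(real^3 \<Rightarrow> 'b::euclidean_space \<Rightarrow> 'c::euclidean_space) \<Rightarrow> real \<Rightarrow> bool" where
  "lin_field A c \<longleftrightarrow> (\<forall>y. linear (A y)) \<and> (\<forall>v. (\<lambda>y. A y v) \<in> borel_measurable borel) \<and>
     (AE y in cubeM. \<forall>v. norm (A y v) \<le> c * norm v)"

definition pw :: "(real^3 \<Rightarrow> 'b::euclidean_space \<Rightarrow> 'c::euclidean_space) \<Rightarrow> 'b l2 \<Rightarrow> 'c l2" where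
  "pw A F = cls (\<lambda>y. A y (rep F y))"

lemma lin_field_measurable:
  assumes A: "lin_field A c" and [measurable]: "f \<in> borel_measurable borel"
  shows "(\<lambda>y. A y (f y)) \<in> borel_measurable borel"
proof -
  have lin: "linear (A y)" for y using A by (simp add: lin_field_def)
  have eq: "(\<lambda>y. A y (f y)) = (\<lambda>y. \<Sum>b\<in>Basis. inner (f y) b *\<^sub>R A y b)"
  proof
    fix y
    have "A y (f y) = A y (\<Sum>b\<in>Basis. inner (f y) b *\<^sub>R b)" by (simp add: euclidean_representation)
    then show "A y (f y) = (\<Sum>b\<in>Basis. inner (f y) b *\<^sub>R A y b)"
      by (simp add: linear_sum[OF lin] linear_cmul[OF lin])
  qed
  have "(\<lambda>y. A y b) \<in> borel_measurable borel" for b using A by (simp add: lin_field_def)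
  then show ?thesis unfolding eq by measurable
qed

lemma lin_field_Sq: assumes "lin_field A c" "f \<in> Sq" shows "(\<lambda>y. A y (f y)) \<in> Sq"
proof (rule Sq_norm_dominated[OF _ assms(2)])
  show "(\<lambda>y. A y (f y)) \<in> borel_measurable borel"
    by (rule lin_field_measurable[OF assms(1) Sq_measurable[OF assms(2)]])
  show "AE y in cubeM. norm (A y (f y)) \<le> c * norm (f y)"
  proof -
    have "AE y in cubeM. \<forall>v. norm (A y v) \<le> c * norm v" using assms(1) by (simp add: lin_field_def)
    then show ?thesis by eventually_elim simp
  qed
qed

lemma pw_cls: assumes "lin_field A c" "f \<in> Sq" shows "pw A (cls f) = cls (\<lambda>y. A y (f y))"
proof -
  have "AE y in cubeM. A y (rep (cls f) y) = A y (f y)"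
    using rep_cls[OF assms(2)] by eventually_elim simp
  then show ?thesis
    unfolding pw_def
    using cls_eq_iff[OF lin_field_Sq[OF assms(1) rep_Sq[of "cls f"]] lin_field_Sq[OF assms]] by simp
qed

lemma bounded_linear_pw:
  assumes A: "lin_field A c" shows "bounded_linear (pw A)"
    and norm_pw: "\<And>F. c \<ge> 0 \<Longrightarrow> norm (pw A F) \<le> c * norm F"
proof -
  have lin: "linear (A y)" for y using A by (simp add: lin_field_def)
  have bd: "norm (pw A F) \<le> d * norm F" if d: "lin_field A d" "d \<ge> 0" for F d
  proof -
    obtain f where *: "F = cls f" "f \<in> Sq" by (metis l2_obtain)
    have "(norm (pw A F))\<^sup>2 = (\<integral>y. (norm (A y (f y)))\<^sup>2 \<partial>cubeM)"
      using * d by (simp add: pw_cls norm_cls lin_field_Sq)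
    also have "\<dots> \<le> (\<integral>y. d\<^sup>2 * (norm (f y))\<^sup>2 \<partial>cubeM)"
    proof (rule integral_mono_AE)
      show "integrable cubeM (\<lambda>y. (norm (A y (f y)))\<^sup>2)"
        using lin_field_Sq[OF A *(2)] by (simp add: Sq_def)
      show "integrable cubeM (\<lambda>y. d\<^sup>2 * (norm (f y))\<^sup>2)" using *(2) by (simp add: Sq_def)
      have "AE y in cubeM. \<forall>v. norm (A y v) \<le> d * norm v" using d by (simp add: lin_field_def)
      then show "AE y in cubeM. (norm (A y (f y)))\<^sup>2 \<le> d\<^sup>2 * (norm (f y))\<^sup>2"
      proof eventually_elim
        case (elim y)
        then have "(norm (A y (f y)))\<^sup>2 \<le> (d * norm (f y))\<^sup>2" by (intro power_mono) auto
        then show ?case by (simp add: power_mult_distrib)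
      qed
    qed
    also have "\<dots> = (d * norm F)\<^sup>2" using * by (simp add: norm_cls power_mult_distrib)
    finally show ?thesis by (rule power2_le_imp_le) (simp add: d(2))
  qed
  show "\<And>F. c \<ge> 0 \<Longrightarrow> norm (pw A F) \<le> c * norm F" using bd A by auto
  have A': "lin_field A \<bar>c\<bar>"
  proof -
    have "AE y in cubeM. \<forall>v. norm (A y v) \<le> c * norm v" using A by (simp add: lin_field_def)
    then have "AE y in cubeM. \<forall>v. norm (A y v) \<le> \<bar>c\<bar> * norm v"
      by eventually_elim (meson abs_ge_self mult_right_mono norm_ge_zero order_trans)
    then show ?thesis using A by (simp add: lin_field_def)
  qed
  show "bounded_linear (pw A)"
  proof (rule bounded_linear_intro[where K = "\<bar>c\<bar>"])
    fix F G :: "'a l2" and r :: real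
    obtain f g where *: "F = cls f" "f \<in> Sq" "G = cls g" "g \<in> Sq" by (metis l2_obtain)
    show "pw A (F + G) = pw A F + pw A G"
      using * A by (simp add: cls_add pw_cls Sq_add lin_field_Sq linear_add[OF lin])
    show "pw A (r *\<^sub>R F) = r *\<^sub>R pw A F"
      using * A by (simp add: cls_scaleR pw_cls Sq_scaleR lin_field_Sq linear_cmul[OF lin])
    show "norm (pw A F) \<le> norm F * \<bar>c\<bar>" using bd[OF A'] by (simp add: mult.commute)
  qed
qed

lemma inner_pw:
  assumes "lin_field A c"
  shows "inner (pw A F) G = (\<integral>y. inner (A y (rep F y)) (rep G y) \<partial>cubeM)"
proof -
  have "pw A F = cls (\<lambda>y. A y (rep F y))" by (simp add: pw_def)
  then show ?thesis
    using inner_cls[OF lin_field_Sq[OF assms rep_Sq[of F]] rep_Sq[of G]] by simp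
qed

lemma lin_field_shift: assumes "lin_field A c" shows "lin_field (\<lambda>y. A (fr (y + z))) c"
proof -
  have [measurable]: "(\<lambda>y. A y v) \<in> borel_measurable borel" for v using assms by (simp add: lin_field_def)
  have "(\<lambda>y. A (fr (y + z)) v) \<in> borel_measurable borel" for v by measurable
  moreover have "AE y in cubeM. \<forall>v. norm (A y v) \<le> c * norm v" using assms by (simp add: lin_field_def)
  then have "AE y in cubeM. \<forall>v. norm (A (fr (y + z)) v) \<le> c * norm v" by (rule AE_shift)
  ultimately show ?thesis using assms by (simp add: lin_field_def)
qed

lemma shift_pw: assumes A: "lin_field A c" shows "shift z (pw A F) = pw (\<lambda>y. A (fr (y + z))) (shift z F)"
proof -
  obtain f where "F = cls f" "f \<in> Sq" by (metis l2_obtain)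
  then show ?thesis
    using pw_cls[OF lin_field_shift[OF A] Sq_shift[of f z], of z] A
    by (simp add: pw_cls shift_cls lin_field_Sq Sq_shift)
qed

lemma pw_cong:
  assumes "lin_field A c" "lin_field A' c'" "AE y in cubeM. \<forall>v. A y v = A' y v"
  shows "pw A F = pw A' F"
proof -
  have "AE y in cubeM. A y (rep F y) = A' y (rep F y)"
    using assms(3) by eventually_elim simp
  then show ?thesis
    unfolding pw_def
    using cls_eq_iff[OF lin_field_Sq[OF assms(1) rep_Sq[of F]] lin_field_Sq[OF assms(2) rep_Sq[of F]]] by simp
qed

lemma shift_pw_commute:
  assumes A: "lin_field A c" and inv: "AE y in cubeM. \<forall>v. A (fr (y + z)) v = A y v"
  shows "shift z (pw A F) = pw A (shift z F)"
  unfolding shift_pw[OF A] by (rule pw_cong[OF lin_field_shift[OF A] A inv])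

text \<open>Substitute for the product rule: the commutator of a multiplication and a translation is
  multiplication by the increment of the coefficient. For a Lipschitz coefficient \<open>L\<close>
  is proportional to the length of \<open>z\<close>, and this is how derivatives of the coefficients
  enter the estimates.\<close>

lemma shift_pw_diff:
  assumes A: "lin_field A c" and L: "AE y in cubeM. \<forall>v. norm (A (fr (y + z)) v - A y v) \<le> L * norm v"
    and "L \<ge> 0"
  shows "norm (shift z (pw A F) - pw A (shift z F)) \<le> L * norm F"
proof -
  define D where "D y v = A (fr (y + z)) v - A y v" for y v
  have A': "lin_field (\<lambda>y. A (fr (y + z))) c" by (rule lin_field_shift[OF A])
  have D: "lin_field D L"
    using A A' L unfolding lin_field_def D_def by (auto intro: linear_compose_sub borel_measurable_diff)
  obtain f where f: "F = cls f" "f \<in> Sq" by (metis l2_obtain)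
  have "shift z (pw A F) - pw A (shift z F) = pw D (shift z F)"
    unfolding shift_pw[OF A] f(1) shift_cls[OF f(2)] pw_cls[OF A Sq_shift[OF f(2)]]
      pw_cls[OF A' Sq_shift[OF f(2)]] pw_cls[OF D Sq_shift[OF f(2)]]
    by (subst cls_diff[OF lin_field_Sq[OF A' Sq_shift[OF f(2)]] lin_field_Sq[OF A Sq_shift[OF f(2)]]])
       (simp add: D_def)
  then show ?thesis using norm_pw[OF D \<open>L \<ge> 0\<close>, of "shift z F"] by simp
qed

section \<open>Smooth bump functions\<close>

fun smooth_upto :: "nat \<Rightarrow> (real \<Rightarrow> real) \<Rightarrow> bool" where
  "smooth_upto 0 f \<longleftrightarrow> (\<forall>x. isCont f x)"
| "smooth_upto (Suc k) f \<longleftrightarrow> (\<exists>f'. (\<forall>x. (f has_real_derivative f' x) (at x)) \<and> smooth_upto k f')"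

lemma smooth_upto_Suc_D: "smooth_upto (Suc k) f \<Longrightarrow> smooth_upto k f"
proof (induction k arbitrary: f)
  case 0 then show ?case by (auto intro: DERIV_isCont)
next
  case (Suc k)
  then obtain f' where "\<forall>x. (f has_real_derivative f' x) (at x)" "smooth_upto (Suc k) f'"
    by (metis smooth_upto.simps(2))
  then show ?case using Suc.IH by (metis smooth_upto.simps(2))
qed

lemma smooth_upto_add: "smooth_upto k f \<Longrightarrow> smooth_upto k g \<Longrightarrow> smooth_upto k (\<lambda>x. f x + g x)"
proof (induction k arbitrary: f g)
  case 0 then show ?case by simp
next
  case (Suc k)
  then obtain f' g' where "\<forall>x. (f has_real_derivative f' x) (at x)" "smooth_upto k f'"
     "\<forall>x. (g has_real_derivative g' x) (at x)" "smooth_upto k g'"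
    by (metis smooth_upto.simps(2))
  then show ?case unfolding smooth_upto.simps(2)
    by (intro exI[of _ "\<lambda>x. f' x + g' x"]) (auto intro: DERIV_add Suc.IH)
qed

lemma smooth_upto_mult: "smooth_upto k f \<Longrightarrow> smooth_upto k g \<Longrightarrow> smooth_upto k (\<lambda>x. f x * g x)"
proof (induction k arbitrary: f g)
  case 0 then show ?case by simp
next
  case (Suc k)
  then obtain f' g' where *: "\<forall>x. (f has_real_derivative f' x) (at x)" "smooth_upto k f'"
     "\<forall>x. (g has_real_derivative g' x) (at x)" "smooth_upto k g'"
    by (metis smooth_upto.simps(2))
  have "smooth_upto k (\<lambda>x. f' x * g x + g' x * f x)"
    using Suc.IH * Suc.prems smooth_upto_Suc_D by (intro smooth_upto_add Suc.IH) auto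
  then show ?case unfolding smooth_upto.simps(2)
    using * by (intro exI[of _ "\<lambda>x. f' x * g x + g' x * f x"]) (auto intro: DERIV_mult)
qed

lemma smooth_upto_const: "smooth_upto k (\<lambda>x. c)"
proof (induction k arbitrary: c)
  case (Suc k)
  then show ?case unfolding smooth_upto.simps(2)
    by (intro exI[of _ "\<lambda>x. 0"]) auto
qed simp

lemma smooth_upto_affine: "smooth_upto k f \<Longrightarrow> smooth_upto k (\<lambda>x. f (a * x + b))"
proof (induction k arbitrary: f)
  case 0
  then show ?case by (auto intro!: isCont_o2[where f = "\<lambda>x. a * x + b"] continuous_intros)
next
  case (Suc k)
  then obtain f' where *: "\<forall>x. (f has_real_derivative f' x) (at x)" "smooth_upto k f'"
    by (metis smooth_upto.simps(2))
  have "((\<lambda>x. f (a * x + b)) has_real_derivative f' (a * x + b) * a) (at x)" for x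
    by (rule DERIV_chain2[where f = f and g = "\<lambda>x. a * x + b"])
       (use * in \<open>auto intro!: derivative_eq_intros\<close>)
  moreover have "smooth_upto k (\<lambda>x. f' (a * x + b) * a)"
    using Suc.IH[OF *(2)] by (intro smooth_upto_mult smooth_upto_const)
  ultimately show ?case unfolding smooth_upto.simps(2)
    by (intro exI[of _ "\<lambda>x. f' (a * x + b) * a"]) auto
qed

text \<open>The exponent \<open>m\<close> is carried along because derivatives of
  \<open>exp (- (1/x))\<close> are combinations of these functions. With it the family is closed
  under differentiation, and smoothness is an induction on the order.\<close>

definition flat :: "nat \<Rightarrow> real \<Rightarrow> real" where
  "flat m x = (if x > 0 then (1/x) ^ m * exp (- (1/x)) else 0)"

lemma isCont_flat_0: "isCont (flat m) 0"
proof -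
  have "((\<lambda>u::real. u ^ m / exp u) \<longlongrightarrow> 0) at_top" by (rule tendsto_power_div_exp_0)
  then have "((\<lambda>x. (inverse x) ^ m / exp (inverse x)) \<longlongrightarrow> 0) (at_right (0::real))"
    by (rule filterlim_compose) (rule filterlim_inverse_at_top_right)
  moreover have "\<forall>\<^sub>F x in at_right (0::real). (inverse x) ^ m / exp (inverse x) = flat m x"
    by (auto simp: eventually_at_filter flat_def exp_minus divide_inverse)
  ultimately have r: "(flat m \<longlongrightarrow> 0) (at_right 0)" by (rule Lim_transform_eventually)
  have l: "(flat m \<longlongrightarrow> 0) (at_left 0)"
    by (rule Lim_transform_eventually[OF tendsto_const]) (auto simp: eventually_at_filter flat_def)
  have "flat m 0 = 0" by (simp add: flat_def)
  then show ?thesis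
    unfolding isCont_def using filterlim_split_at_real[OF l r] by simp
qed

lemma DERIV_flat: "(flat m has_real_derivative flat (m + 2) x - real m * flat (m + 1) x) (at x)"
proof -
  consider "x > 0" | "x < 0" | "x = 0" by linarith
  then show ?thesis
  proof cases
    case 1
    have "((\<lambda>x. (1/x) ^ m * exp (- (1/x))) has_real_derivative flat (m + 2) x - real m * flat (m + 1) x) (at x)"
      using 1
      by (auto intro!: derivative_eq_intros simp: flat_def divide_simps power2_eq_square)
         (cases m; simp add: field_simps)
    moreover have ev: "\<forall>\<^sub>F y in nhds x. (1/y) ^ m * exp (- (1/y)) = flat m y"
      using eventually_nhds_in_open[of "{0<..}" x] 1 by (auto elim!: eventually_mono simp: flat_def)
    ultimately show ?thesis using DERIV_cong_ev[OF refl ev refl] by blast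
  next
    case 2
    have ev: "\<forall>\<^sub>F y in nhds x. flat m y = 0"
      using eventually_nhds_in_open[of "{..<0}" x] 2 by (auto elim!: eventually_mono simp: flat_def)
    have "(flat m has_real_derivative 0) (at x)"
      using DERIV_cong_ev[OF refl ev refl, of 0] by simp
    then show ?thesis using 2 by (simp add: flat_def)
  next
    case 3
    \<comment> \<open>At the origin the difference quotient of \<open>flat m\<close> is
      \<open>flat (m + 1)\<close>, which is continuous there.\<close>
    have "flat m z - flat m x = flat (m + 1) z * (z - x)" for z
      using 3 by (simp add: flat_def)
    moreover have "flat (m + 1) 0 = 0" "flat (m + 2) 0 = 0" by (auto simp: flat_def)
    ultimately show ?thesis
      unfolding CARAT_DERIV using 3 isCont_flat_0 by (intro exI[of _ "flat (m + 1)"]) auto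
  qed
qed

lemma smooth_upto_flat: "smooth_upto k (flat m)"
proof (induction k arbitrary: m)
  case 0 then show ?case using DERIV_isCont[OF DERIV_flat] by auto
next
  case (Suc k)
  have "smooth_upto k (\<lambda>x. flat (m + 2) x + (- real m) * flat (m + 1) x)"
    by (intro smooth_upto_add smooth_upto_mult smooth_upto_const Suc)
  then show ?case unfolding smooth_upto.simps(2)
    using DERIV_flat by (intro exI[of _ "\<lambda>x. flat (m + 2) x + (- real m) * flat (m + 1) x"]) auto
qed

text \<open>\<open>n\<close> is a steepness: for a fixed interval the bumps tend to its indicator as
  \<open>n\<close> grows, so this family can replace all test functions. It is closed under
  translations and, with \<open>n\<close> divided by the factor, under dilations, which makes it
  easy to transport between the cell and the cube.\<close>

definition bump1 :: "real \<Rightarrow> real \<Rightarrow> real \<Rightarrow> real \<Rightarrow> real" where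
  "bump1 n a b x = flat 0 (n * (x - a)) * flat 0 (n * (b - x))"

lemma smooth_upto_bump1: "smooth_upto k (bump1 n a b)"
proof -
  have "smooth_upto k (\<lambda>x. flat 0 (n * x + (- n * a)) * flat 0 ((- n) * x + n * b))"
    by (intro smooth_upto_mult smooth_upto_affine smooth_upto_flat)
  then show ?thesis by (simp add: bump1_def[abs_def] algebra_simps)
qed

lemma flat0_bounds: "0 \<le> flat 0 x" "flat 0 x \<le> 1"
  by (auto simp: flat_def)

lemma bump1_bounds: "0 \<le> bump1 n a b x" "bump1 n a b x \<le> 1"
  using flat0_bounds by (auto simp: bump1_def intro: mult_le_one)

lemma bump1_eq_0: "n > 0 \<Longrightarrow> x \<notin> {a<..<b} \<Longrightarrow> bump1 n a b x = 0"
  by (auto simp: bump1_def flat_def zero_less_mult_iff)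

lemma flat0_tendsto: "x > 0 \<Longrightarrow> (\<lambda>n. flat 0 (real (Suc n) * x)) \<longlonglongrightarrow> 1"
proof -
  assume x: "x > 0"
  have "(\<lambda>n. exp (- (1 / x * inverse (real (Suc n))))) \<longlonglongrightarrow> exp (- (1 / x * 0))"
    by (intro tendsto_intros LIMSEQ_inverse_real_of_nat)
  moreover have "flat 0 (real (Suc n) * x) = exp (- (1 / x * inverse (real (Suc n))))" for n
    using x by (simp add: flat_def divide_inverse mult.commute)
  ultimately show ?thesis by simp
qed

lemma bump1_tendsto: "(\<lambda>n. bump1 (real (Suc n)) a b x) \<longlonglongrightarrow> indicator {a<..<b} x"
proof (cases "x \<in> {a<..<b}")
  case True
  then have "(\<lambda>n. bump1 (real (Suc n)) a b x) \<longlonglongrightarrow> 1 * 1"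
    unfolding bump1_def by (intro tendsto_mult flat0_tendsto) auto
  then show ?thesis using True by simp
next
  case False
  then show ?thesis by (simp add: bump1_eq_0)
qed

definition bump :: "real \<Rightarrow> real^3 \<Rightarrow> real^3 \<Rightarrow> real^3 \<Rightarrow> real" where
  "bump n c d y = (\<Prod>i\<in>UNIV. bump1 n (c $ i) (d $ i) (y $ i))"

text \<open>Products of functions of one coordinate are closed under partial derivatives, which
  replace one factor. Smoothness in three variables thus reduces to \<open>smooth_upto\<close> for
  each factor.\<close>

definition prodfun :: "(3 \<Rightarrow> real \<Rightarrow> real) \<Rightarrow> real^3 \<Rightarrow> real" where
  "prodfun F y = (\<Prod>i\<in>UNIV. F i (y $ i))"

lemma prodfun_has_derivative:
  assumes "\<And>i x. (F i has_real_derivative F' i x) (at x)"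
  shows "(prodfun F has_derivative (\<lambda>v. \<Sum>j\<in>UNIV. v $ j * prodfun (F(j := F' j)) y)) (at y)"
proof -
  have d: "((\<lambda>y. F i (y $ i)) has_derivative (\<lambda>v. F' i (y $ i) * v $ i)) (at y)" for i
    by (rule has_derivative_compose[where g = "F i" and f = "\<lambda>y. y $ i"])
       (use assms in \<open>auto intro!: bounded_linear_imp_has_derivative bounded_linear_vec_nth
          simp: has_field_derivative_def\<close>)
  have "((\<lambda>y. \<Prod>i\<in>UNIV. F i (y $ i)) has_derivative
      (\<lambda>v. \<Sum>i\<in>UNIV. F' i (y $ i) * v $ i * (\<Prod>j\<in>UNIV - {i}. F j (y $ j)))) (at y)"
    by (rule has_derivative_prod) (rule d)
  moreover have "F' i (y $ i) * v $ i * (\<Prod>j\<in>UNIV - {i}. F j (y $ j)) = v $ i * prodfun (F(i := F' i)) y" for i v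
  proof -
    have "prodfun (F(i := F' i)) y = (\<Prod>j\<in>insert i (UNIV - {i}). (F(i := F' i)) j (y $ j))"
      by (simp add: prodfun_def insert_absorb)
    also have "\<dots> = F' i (y $ i) * (\<Prod>j\<in>UNIV - {i}. F j (y $ j))"
      by (subst prod.insert) (auto intro: prod.cong)
    finally show ?thesis by simp
  qed
  ultimately show ?thesis by (simp add: prodfun_def[abs_def])
qed

lemma pd_prodfun:
  assumes "\<And>i x. (F i has_real_derivative F' i x) (at x)"
  shows "pd j (prodfun F) = prodfun (F(j := F' j))"
proof
  fix y
  have "frechet_derivative (prodfun F) (at y) = (\<lambda>v. \<Sum>j\<in>UNIV. v $ j * prodfun (F(j := F' j)) y)"
    using frechet_derivative_at[OF prodfun_has_derivative[of F F' y, OF assms]] by simp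
  then have "pd j (prodfun F) y = (\<Sum>i\<in>UNIV. axis j 1 $ i * prodfun (F(i := F' i)) y)"
    by (simp add: pd_def)
  also have "\<dots> = (\<Sum>i\<in>UNIV. if i = j then prodfun (F(j := F' j)) y else 0)"
    by (rule sum.cong) (auto simp: axis_def)
  finally show "pd j (prodfun F) y = prodfun (F(j := F' j)) y" by simp
qed

lemma Ck_prodfun: "(\<And>i. smooth_upto k (F i)) \<Longrightarrow> Ck k (prodfun F)"
proof (induction k arbitrary: F)
  case 0
  have "isCont (\<lambda>y. F i (y $ i)) y" for i and y :: "real^3"
    by (rule isCont_o2[where f = "\<lambda>y. y $ i"]) (use 0 in \<open>auto intro!: continuous_intros\<close>)
  then show ?case
    by (auto simp: prodfun_def intro!: continuous_at_imp_continuous_on continuous_prod)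
next
  case (Suc k)
  then have "\<forall>i. \<exists>f'. (\<forall>x. (F i has_real_derivative f' x) (at x)) \<and> smooth_upto k f'"
    by simp
  then obtain F' where F': "\<And>i x. (F i has_real_derivative F' i x) (at x)" "\<And>i. smooth_upto k (F' i)"
    by metis
  have "prodfun F differentiable_on UNIV"
    by (auto simp: differentiable_on_def intro!: differentiableI prodfun_has_derivative[OF F'(1)])
  moreover have "Ck k (pd j (prodfun F))" for j
    unfolding pd_prodfun[OF F'(1)]
    using Suc.prems smooth_upto_Suc_D F'(2) by (intro Suc.IH) auto
  ultimately show ?case by simp
qed

lemma bump_prodfun: "bump n c d = prodfun (\<lambda>i. bump1 n (c $ i) (d $ i))"
  by (simp add: bump_def[abs_def] prodfun_def[abs_def])

lemma Ck_bump: "Ck k (bump n c d)"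
  unfolding bump_prodfun by (intro Ck_prodfun smooth_upto_bump1)

lemma bump_bounds: "0 \<le> bump n c d y" "bump n c d y \<le> 1"
  unfolding bump_def using bump1_bounds by (auto intro!: prod_nonneg prod_le_1)

lemma bump_eq_0: "n > 0 \<Longrightarrow> y \<notin> box c d \<Longrightarrow> bump n c d y = 0"
  unfolding bump_def mem_box_cart by (force intro: bump1_eq_0)

lemma bump_tendsto: "(\<lambda>n. bump (real (Suc n)) c d y) \<longlonglongrightarrow> indicator (box c d) y"
proof -
  have "(\<lambda>n. bump (real (Suc n)) c d y) \<longlonglongrightarrow> (\<Prod>i\<in>UNIV. indicator {c $ i<..<d $ i} (y $ i))"
    unfolding bump_def by (intro tendsto_prod bump1_tendsto)
  moreover have "(\<Prod>i\<in>UNIV. indicator {c $ i<..<d $ i} (y $ i)) = (indicator (box c d) y :: real)"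
  proof (cases "y \<in> box c d")
    case True then show ?thesis by (auto simp: mem_box_cart intro!: prod.neutral)
  next
    case False
    then obtain i where "\<not> (c $ i < y $ i \<and> y $ i < d $ i)" by (auto simp: mem_box_cart)
    then have "(\<Prod>i\<in>UNIV. indicator {c $ i<..<d $ i} (y $ i)) = (0::real)"
      by (intro prod_zero bexI[of _ i]) auto
    then show ?thesis using False by simp
  qed
  ultimately show ?thesis by simp
qed

lemma bump_continuous: "continuous_on UNIV (bump n c d)"
  using Ck_bump[of 0] by simp

lemma bump_measurable [measurable]: "bump n c d \<in> borel_measurable borel"
  by (rule borel_measurable_continuous_onI[OF bump_continuous])

lemma test_fun_bump:
  assumes "n > 0" "cbox c d \<subseteq> U"
  shows "test_fun U (bump n c d)"
proof -
  have "{y. bump n c d y \<noteq> 0} \<subseteq> cbox c d"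
    using bump_eq_0[OF assms(1)] box_subset_cbox by blast
  then have *: "closure {y. bump n c d y \<noteq> 0} \<subseteq> cbox c d"
    by (intro closure_minimal closed_cbox)
  then have "compact (closure {y. bump n c d y \<noteq> 0})"
    by (metis bounded_cbox bounded_subset closed_closure compact_eq_bounded_closed)
  then show ?thesis unfolding test_fun_def using Ck_bump * assms(2) by auto
qed

lemma bump_shift: "bump n c d (y - z) = bump n (c + z) (d + z) y"
  by (simp add: bump_def bump1_def algebra_simps)

text \<open>Collects what later arguments use of the partial derivative of a bump: a continuous
  bounded function \<open>D\<close> that is the derivative along coordinate lines, moves with the
  bump and vanishes off the closed box. It is an elimination rule so that \<open>D\<close> can be
  used in place of Frechet derivatives.\<close>

lemma pd_bump:
  assumes "n > 0"
  obtains D B where "pd l (bump n c d) = D" "continuous_on UNIV D" "\<And>y. \<bar>D y\<bar> \<le> B"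
    "\<And>y t. ((\<lambda>t. bump n c d (y + t *\<^sub>R ax l)) has_real_derivative D (y + t *\<^sub>R ax l)) (at t)"
    "\<And>z. pd l (bump n (c + z) (d + z)) = (\<lambda>y. D (y - z))"
    "\<And>y. y \<notin> cbox c d \<Longrightarrow> D y = 0"
proof -
  define G where "G c d i = bump1 n (c $ i) (d $ i)" for c d :: "real^3" and i
  have "\<exists>g'. (\<forall>x. (bump1 n a b has_real_derivative g' x) (at x))" for a b
    using smooth_upto_bump1[of "Suc 0" n a b] by auto
  then obtain g' where g': "\<And>a b x. (bump1 n a b has_real_derivative g' a b x) (at x)"
    by metis
  define G' where "G' c d i = g' (c $ i) (d $ i)" for c d :: "real^3" and i
  have G': "(G c d i has_real_derivative G' c d i x) (at x)" for c d i x
    unfolding G_def G'_def by (rule g')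
  have bG: "bump n c d = prodfun (G c d)" for c d by (simp add: bump_prodfun G_def[abs_def])
  define D where "D c d = prodfun ((G c d)(l := G' c d l))" for c d
  have pdD: "pd l (bump n c d) = D c d" for c d
    unfolding bG D_def by (rule pd_prodfun[OF G'])
  have contD: "continuous_on UNIV (D c d)" for c d
    using Ck_bump[of "Suc 0" n c d] unfolding Ck.simps pdD[symmetric] by blast
  have line: "((\<lambda>t. bump n c d (y + t *\<^sub>R ax l)) has_real_derivative D c d (y + t *\<^sub>R ax l)) (at t)" for c d y t
  proof -
    have 1: "(bump n c d has_derivative (\<lambda>v. \<Sum>j\<in>UNIV. v $ j * prodfun ((G c d)(j := G' c d j)) (y + t *\<^sub>R ax l))) (at (y + t *\<^sub>R ax l))"
      unfolding bG by (rule prodfun_has_derivative[OF G'])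
    have 2: "((\<lambda>t. y + t *\<^sub>R ax l) has_derivative (\<lambda>h. h *\<^sub>R ax l)) (at t)"
      by (auto intro!: derivative_eq_intros)
    have "(\<Sum>j\<in>UNIV. (h *\<^sub>R ax l) $ j * prodfun ((G c d)(j := G' c d j)) (y + t *\<^sub>R ax l))
       = D c d (y + t *\<^sub>R ax l) * h" for h
    proof -
      have "(\<Sum>j\<in>UNIV. (h *\<^sub>R ax l) $ j * prodfun ((G c d)(j := G' c d j)) (y + t *\<^sub>R ax l))
       = (\<Sum>j\<in>UNIV. if j = l then h * prodfun ((G c d)(l := G' c d l)) (y + t *\<^sub>R ax l) else 0)"
        by (rule sum.cong) (auto simp: axis_def)
      then show ?thesis by (simp add: D_def)
    qed
    then show ?thesis
      using has_derivative_compose[OF 2 1] by (simp add: has_field_derivative_def)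
  qed
  have D0: "D c d y = 0" if y: "y \<notin> cbox c d" for y
  proof -
    have "open (- cbox c d)" by (intro open_Compl closed_cbox)
    moreover have "bump n c d z = 0" if "z \<in> - cbox c d" for z
      using that box_subset_cbox[of c d] bump_eq_0[OF assms, of z c d] by blast
    ultimately have ev: "\<forall>\<^sub>F z in nhds y. bump n c d z = 0"
      using y by (auto simp: eventually_nhds intro!: exI[of _ "- cbox c d"])
    have "isCont (\<lambda>t. y + t *\<^sub>R ax l) 0" by (intro continuous_intros)
    then have "filterlim (\<lambda>t. y + t *\<^sub>R ax l) (nhds y) (nhds 0)"
      using tendsto_at_iff_tendsto_nhds[of "\<lambda>t. y + t *\<^sub>R ax l" 0] by (simp add: isCont_def)
    then have "\<forall>\<^sub>F t in nhds 0. bump n c d (y + t *\<^sub>R ax l) = 0"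
      using ev by (auto simp: filterlim_iff)
    then have "((\<lambda>t. bump n c d (y + t *\<^sub>R ax l)) has_real_derivative 0) (at 0) \<longleftrightarrow>
       ((\<lambda>t. 0) has_real_derivative 0) (at (0::real))"
      by (intro DERIV_cong_ev) auto
    then have "((\<lambda>t. bump n c d (y + t *\<^sub>R ax l)) has_real_derivative 0) (at 0)" by simp
    then show ?thesis using line[of c d y 0] DERIV_unique by fastforce
  qed
  have "bounded (D c d ` cbox c d)"
    by (intro compact_imp_bounded compact_continuous_image continuous_on_subset[OF contD]) auto
  then obtain B where B: "B > 0" "\<forall>r\<in>D c d ` cbox c d. norm r \<le> B" unfolding bounded_pos by meson
  have "\<bar>D c d y\<bar> \<le> B" for y
    using B D0[of y] by (cases "y \<in> cbox c d") auto
  moreover have "pd l (bump n (c + z) (d + z)) = (\<lambda>y. D c d (y - z))" for z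
  proof
    fix y
    have "((\<lambda>t. bump n (c + z) (d + z) (y + t *\<^sub>R ax l)) has_real_derivative D (c + z) (d + z) y) (at 0)"
      using line[of "c+z" "d+z" y 0] by simp
    moreover have "((\<lambda>t. bump n c d ((y - z) + t *\<^sub>R ax l)) has_real_derivative D c d (y - z)) (at 0)"
      using line[of c d "y - z" 0] by simp
    then have "((\<lambda>t. bump n (c + z) (d + z) (y + t *\<^sub>R ax l)) has_real_derivative D c d (y - z)) (at 0)"
      by (simp add: bump_shift[symmetric] diff_add_eq)
    ultimately show "pd l (bump n (c + z) (d + z)) y = D c d (y - z)"
      unfolding pdD by (rule DERIV_unique)
  qed
  ultimately show ?thesis
    by (intro that[of "D c d" B] pdD contD line D0)
qed

section \<open>Functions determined by their integrals against bumps\<close>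

lemma box_Int_box_vec:
  fixes a b c d :: "real^3"
  shows "box a b \<inter> box c d = box (\<chi> i. max (a $ i) (c $ i)) (\<chi> i. min (b $ i) (d $ i))"
  by (auto simp: mem_box_cart)

text \<open>Steep bumps give zero integrals over all boxes inside \<open>box p q\<close>. Boxes are
  stable under intersection and generate the Borel sets, so the integral of the truncated function
  over every Borel set vanishes, and with it the function.\<close>

lemma fundamental_lemma:
  fixes u :: "real^3 \<Rightarrow> 'b::euclidean_space"
  assumes u: "integrable lborel u"
    and H: "\<And>n c d. n > 0 \<Longrightarrow> cbox c d \<subseteq> cbox p q \<Longrightarrow> (LINT y|lborel. bump n c d y *\<^sub>R u y) = 0"
  shows "AE y in lborel. y \<in> box p q \<longrightarrow> u y = 0"
proof -
  have [measurable]: "u \<in> borel_measurable borel" using u by auto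
  define u1 where "u1 y = indicator (box p q) y *\<^sub>R u y" for y
  have u1: "integrable lborel u1"
    unfolding u1_def using u by (intro integrable_mult_indicator) auto
  have box0: "(LINT y|lborel. indicator (box c d) y *\<^sub>R u1 y) = 0" for c d
  proof -
    \<comment> \<open>Clipping a box to \<open>box p q\<close> does not change the integral of
      \<open>u1\<close>, and brings its closed box within the range of \<open>H\<close>.\<close>
    define c' d' where cd': "c' = (\<chi> i. max (c $ i) (p $ i))" "d' = (\<chi> i. min (d $ i) (q $ i))"
    have ind: "indicator (box c d) y *\<^sub>R u1 y = indicator (box c' d') y *\<^sub>R u y" for y
      unfolding u1_def cd' box_Int_box_vec[symmetric] by (auto simp: indicator_def)
    have "cbox c' d' \<subseteq> cbox p q" by (auto simp: mem_box_cart cd')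
    then have z: "(LINT y|lborel. bump (real (Suc n)) c' d' y *\<^sub>R u y) = 0" for n
      by (intro H) auto
    have "(\<lambda>n. LINT y|lborel. bump (real (Suc n)) c' d' y *\<^sub>R u y) \<longlonglongrightarrow> (LINT y|lborel. indicator (box c' d') y *\<^sub>R u y)"
    proof (rule integral_dominated_convergence)
      show "integrable lborel (\<lambda>y. norm (u y))" using u by auto
      show "AE y in lborel. (\<lambda>n. bump (real (Suc n)) c' d' y *\<^sub>R u y) \<longlonglongrightarrow> indicator (box c' d') y *\<^sub>R u y"
        by (intro AE_I2 tendsto_scaleR bump_tendsto tendsto_const)
      show "AE y in lborel. norm (bump (real (Suc n)) c' d' y *\<^sub>R u y) \<le> norm (u y)" for n
        using bump_bounds[of "real (Suc n)" c' d'] by (intro AE_I2) (simp add: mult_left_le_one_le)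
    qed measurable
    then show ?thesis unfolding z ind using LIMSEQ_unique[OF _ tendsto_const] by blast
  qed
  have tot: "(LINT y|lborel. u1 y) = 0"
  proof -
    have "indicator (box p q) y *\<^sub>R u1 y = u1 y" for y by (simp add: u1_def indicator_def)
    then show ?thesis using box0[of p q] by simp
  qed
  have intI: "integrable lborel (\<lambda>y. indicator A y *\<^sub>R u1 y)" if "A \<in> sets borel" for A
    using u1 that by (intro integrable_mult_indicator) auto
  have all: "set_lebesgue_integral lborel A u1 = 0" if A: "A \<in> sets lborel" for A
  proof -
    let ?G = "range (\<lambda>(a, b). box a b :: (real^3) set)"
    have sig: "sigma_sets UNIV ?G = sets borel"
      by (simp add: borel_eq_box sets_measure_of)
    have "Int_stable ?G"
    proof (rule Int_stableI)
      fix a b assume "a \<in> ?G" "b \<in> ?G"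
      then obtain p1 q1 p2 q2 :: "real^3" where "a = box p1 q1" "b = box p2 q2" by auto
      then have "a \<inter> b = (\<lambda>(a, b). box a b) ((\<chi> i. max (p1 $ i) (p2 $ i)), (\<chi> i. min (q1 $ i) (q2 $ i)))"
        by (simp add: box_Int_box_vec)
      then show "a \<inter> b \<in> ?G" by (rule range_eqI)
    qed
    moreover have "?G \<subseteq> Pow UNIV" by simp
    moreover have "A \<in> sigma_sets UNIV ?G" using A by (simp add: sig)
    ultimately show ?thesis
    proof (induction rule: sigma_sets_induct_disjoint)
      case (basic A)
      then show ?case using box0 by (auto simp: set_lebesgue_integral_def)
    next
      case empty then show ?case by (simp add: set_lebesgue_integral_def)
    next
      case (compl A)
      then have A: "A \<in> sets borel" by (simp add: sig)
      have "set_lebesgue_integral lborel (UNIV - A) u1 = (LINT y|lborel. u1 y - indicator A y *\<^sub>R u1 y)"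
        unfolding set_lebesgue_integral_def
        by (rule Bochner_Integration.integral_cong) (auto simp: indicator_def)
      also have "\<dots> = 0"
        using compl u1 tot intI[OF A] by (simp add: set_lebesgue_integral_def)
      finally show ?case .
    next
      case (union A)
      then have "\<And>i. A i \<in> sets lborel" using sig by auto
      moreover have "set_integrable lborel (\<Union>i. A i) u1"
        unfolding set_integrable_def using calculation by (intro intI) auto
      moreover have "\<And>i j. i \<noteq> j \<Longrightarrow> A i \<inter> A j = {}" using union(1) by (auto simp: disjoint_family_on_def)
      ultimately have "set_lebesgue_integral lborel (\<Union>i. A i) u1 = (\<Sum>i. set_lebesgue_integral lborel (A i) u1)"
        by (intro lebesgue_integral_countable_add) auto
      then show ?case using union by simp
    qed
  qed
  have "AE y in lborel. u1 y = 0" by (rule sigma_finite_measure.density_zero[OF sigma_finite_lborel u1 all])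
  then show ?thesis by eventually_elim (auto simp: u1_def)
qed

section \<open>Weak derivatives as integrals along segments\<close>

lemma integrable_lborel_shift:
  fixes f :: "real^3 \<Rightarrow> 'b::{banach, second_countable_topology}"
  assumes "integrable lborel f" shows "integrable lborel (\<lambda>y. f (y + z))"
proof -
  have "integrable (distr lborel borel ((+) z)) f" using assms by (simp add: lborel_distr_plus)
  then show ?thesis using assms by (subst (asm) integrable_distr_eq) (auto simp: add.commute)
qed

lemma integral_lborel_shift:
  fixes f :: "real^3 \<Rightarrow> 'b::{banach, second_countable_topology}"
  assumes [measurable]: "f \<in> borel_measurable borel"
  shows "(LINT y|lborel. f (y + z)) = (LINT y|lborel. f y)"
proof -
  have "(LINT y|distr lborel borel ((+) z). f y) = (LINT y|lborel. f (z + y))"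
    by (subst integral_distr) auto
  then show ?thesis by (simp add: lborel_distr_plus add.commute)
qed

text \<open>Two speeds \<open>c\<close> and \<open>d\<close> occur because the exchange of integrals
  is used twice: once with the test function moving (\<open>c = - 1\<close>, \<open>d = 0\<close>)
  and once with the derivative moving (\<open>c = 0\<close>, \<open>d = 1\<close>).\<close>

lemma shift_product_integrable:
  fixes g :: "real^3 \<Rightarrow> 'b::euclidean_space" and D :: "real^3 \<Rightarrow> real"
  assumes g: "integrable lborel g" and [measurable]: "D \<in> borel_measurable borel"
    and B: "\<And>y. \<bar>D y\<bar> \<le> B"
  shows "integrable (lborel \<Otimes>\<^sub>M lborel)
    (\<lambda>(y, s). (indicator {0..h::real} s * D (y + (c * s) *\<^sub>R ax l)) *\<^sub>R g (y + (d * s) *\<^sub>R ax l))"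
proof -
  have [measurable]: "g \<in> borel_measurable borel" using g by auto
  have B0: "B \<ge> 0" using B[of 0] by (smt (verit))
  have m: "(\<lambda>(s, y). (indicator {0..h} s * D (y + (c * s) *\<^sub>R ax l)) *\<^sub>R g (y + (d * s) *\<^sub>R ax l))
     \<in> borel_measurable (lborel \<Otimes>\<^sub>M lborel)" by measurable
  have nn: "(\<integral>\<^sup>+y. ennreal (norm (g (y + z))) \<partial>lborel) = (\<integral>\<^sup>+y. ennreal (norm (g y)) \<partial>lborel)" for z
    by (rule nn_integral_lborel_shift) measurable
  have "integrable (lborel \<Otimes>\<^sub>M lborel)
    (\<lambda>(s, y). (indicator {0..h} s * D (y + (c * s) *\<^sub>R ax l)) *\<^sub>R g (y + (d * s) *\<^sub>R ax l))"
  proof (rule integrableI_bounded[OF m])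
    have "(\<integral>\<^sup>+x. ennreal (norm ((\<lambda>(s, y). (indicator {0..h} s * D (y + (c * s) *\<^sub>R ax l)) *\<^sub>R g (y + (d * s) *\<^sub>R ax l)) x)) \<partial>(lborel \<Otimes>\<^sub>M lborel))
      = (\<integral>\<^sup>+s. \<integral>\<^sup>+y. ennreal (norm ((indicator {0..h} s * D (y + (c * s) *\<^sub>R ax l)) *\<^sub>R g (y + (d * s) *\<^sub>R ax l))) \<partial>lborel \<partial>lborel)"
      by (subst lborel.nn_integral_fst[symmetric]) auto
    also have "\<dots> \<le> (\<integral>\<^sup>+s. \<integral>\<^sup>+y. (ennreal B * indicator {0..h} s) * ennreal (norm (g (y + (d * s) *\<^sub>R ax l))) \<partial>lborel \<partial>lborel)"
    proof (intro nn_integral_mono)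
      fix s :: real and y :: "real^3"
      have "norm ((indicator {0..h} s * D (y + (c * s) *\<^sub>R ax l)) *\<^sub>R g (y + (d * s) *\<^sub>R ax l))
        \<le> (B * indicator {0..h} s) * norm (g (y + (d * s) *\<^sub>R ax l))"
        using B by (auto simp: indicator_def abs_mult intro!: mult_right_mono)
      then show "ennreal (norm ((indicator {0..h} s * D (y + (c * s) *\<^sub>R ax l)) *\<^sub>R g (y + (d * s) *\<^sub>R ax l)))
        \<le> (ennreal B * indicator {0..h} s) * ennreal (norm (g (y + (d * s) *\<^sub>R ax l)))"
        using B0 by (auto simp: ennreal_mult'[symmetric] indicator_def ennreal_leI)
    qed
    also have "\<dots> = (\<integral>\<^sup>+s. (ennreal B * indicator {0..h} s) * (\<integral>\<^sup>+y. ennreal (norm (g y)) \<partial>lborel) \<partial>lborel)"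
      by (intro nn_integral_cong) (simp add: nn_integral_cmult nn)
    also have "\<dots> = ennreal B * emeasure lborel {0..h} * (\<integral>\<^sup>+y. ennreal (norm (g y)) \<partial>lborel)"
      by (simp add: nn_integral_multc nn_integral_cmult)
    also have "\<dots> < \<infinity>"
      using g by (auto simp: ennreal_mult_less_top integrable_iff_bounded emeasure_lborel_Icc_eq)
    finally show "(\<integral>\<^sup>+x. ennreal (norm ((\<lambda>(s, y). (indicator {0..h} s * D (y + (c * s) *\<^sub>R ax l)) *\<^sub>R g (y + (d * s) *\<^sub>R ax l)) x)) \<partial>(lborel \<Otimes>\<^sub>M lborel)) < \<infinity>" .
  qed
  then show ?thesis
    using lborel_pair.integrable_product_swap_iff by (fastforce simp: case_prod_unfold)
qed

lemma shift_product_Fubini: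
  fixes g :: "real^3 \<Rightarrow> 'b::euclidean_space" and D :: "real^3 \<Rightarrow> real"
  assumes g: "integrable lborel g" and D: "D \<in> borel_measurable borel"
    and B: "\<And>y. \<bar>D y\<bar> \<le> B"
  shows "(LINT y|lborel. LINT s|lborel. (indicator {0..h::real} s * D (y + (c * s) *\<^sub>R ax l)) *\<^sub>R g (y + (d * s) *\<^sub>R ax l))
    = (LINT s|lborel. LINT y|lborel. (indicator {0..h} s * D (y + (c * s) *\<^sub>R ax l)) *\<^sub>R g (y + (d * s) *\<^sub>R ax l))"
    and "integrable lborel (\<lambda>y. LINT s|lborel. (indicator {0..h::real} s * D (y + (c * s) *\<^sub>R ax l)) *\<^sub>R g (y + (d * s) *\<^sub>R ax l))"
proof -
  note int = shift_product_integrable[OF assms, of h c l d]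
  show "(LINT y|lborel. LINT s|lborel. (indicator {0..h::real} s * D (y + (c * s) *\<^sub>R ax l)) *\<^sub>R g (y + (d * s) *\<^sub>R ax l))
    = (LINT s|lborel. LINT y|lborel. (indicator {0..h} s * D (y + (c * s) *\<^sub>R ax l)) *\<^sub>R g (y + (d * s) *\<^sub>R ax l))"
    using lborel_pair.Fubini_integral[OF int] by simp
  show "integrable lborel (\<lambda>y. LINT s|lborel. (indicator {0..h::real} s * D (y + (c * s) *\<^sub>R ax l)) *\<^sub>R g (y + (d * s) *\<^sub>R ax l))"
    using lborel_pair.integrable_fst'[OF int] by simp
qed

lemma integral_scaleR_right':
  fixes f :: "'a \<Rightarrow> 'b::{banach, second_countable_topology}"
  shows "(LINT x|M. c *\<^sub>R f x) = c *\<^sub>R (LINT x|M. f x)"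
  by (cases "c = 0"; cases "integrable M f") (auto simp: not_integrable_integral_eq)

text \<open>The fundamental theorem of calculus for weak derivatives. The translation is moved onto
  the test function, whose increment is the integral of its line derivative, and Fubini lets the
  weak derivative be applied for each \<open>s\<close> separately. There the shifted bump must still
  be supported in \<open>U\<close>, which explains the last assumption. Bumps suffice because
  translations map bumps to bumps.\<close>

lemma weak_deriv_translation:
  fixes f g :: "real^3 \<Rightarrow> 'b::euclidean_space"
  assumes f: "integrable lborel f" and g: "integrable lborel g"
    and weak: "\<And>n c d. n > 0 \<Longrightarrow> cbox c d \<subseteq> U \<Longrightarrow>
      (LINT y|lborel. pd l (bump n c d) y *\<^sub>R f y) = - (LINT y|lborel. bump n c d y *\<^sub>R g y)"
    and h: "h \<ge> 0" and U: "\<And>s. s \<in> {0..h} \<Longrightarrow> (\<lambda>y. y + s *\<^sub>R ax l) ` cbox p q \<subseteq> U"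
  shows "AE y in lborel. y \<in> box p q \<longrightarrow>
     f (y + h *\<^sub>R ax l) - f y = (LINT s|lborel. indicator {0..h} s *\<^sub>R g (y + s *\<^sub>R ax l))"
proof -
  have [measurable]: "f \<in> borel_measurable borel" "g \<in> borel_measurable borel" using f g by auto
  define I where "I y = (LINT s|lborel. indicator {0..h} s *\<^sub>R g (y + s *\<^sub>R ax l))" for y
  define u where "u y = f (y + h *\<^sub>R ax l) - f y - I y" for y
  have I: "integrable lborel I"
    using shift_product_Fubini(2)[OF g, of "\<lambda>_. 1" 1 h 0 l 1] by (simp add: I_def[abs_def])
  have u: "integrable lborel u"
    unfolding u_def by (intro Bochner_Integration.integrable_diff integrable_lborel_shift f I)
  have "(LINT y|lborel. bump n c d y *\<^sub>R u y) = 0" if n: "n > 0" and cd: "cbox c d \<subseteq> cbox p q" for n c d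
  proof -
    let ?\<phi> = "bump n c d"
    obtain D B where D: "pd l ?\<phi> = D" "continuous_on UNIV D" "\<And>y. \<bar>D y\<bar> \<le> B"
      "\<And>y t. ((\<lambda>t. ?\<phi> (y + t *\<^sub>R ax l)) has_real_derivative D (y + t *\<^sub>R ax l)) (at t)"
      "\<And>z. pd l (bump n (c + z) (d + z)) = (\<lambda>y. D (y - z))"
      using pd_bump[OF n] by metis
    have Dm: "D \<in> borel_measurable borel" by (rule borel_measurable_continuous_onI[OF D(2)])
    have bd: "\<bar>?\<phi> y\<bar> \<le> 1" for y using bump_bounds[of n c d y] by simp
    have bint: "integrable lborel (\<lambda>y. ?\<phi> (y + z) *\<^sub>R F y)" if F: "integrable lborel F"
      for F :: "real^3 \<Rightarrow> 'b" and z
    proof (rule Bochner_Integration.integrable_bound[OF F])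
      show "AE y in lborel. norm (?\<phi> (y + z) *\<^sub>R F y) \<le> norm (F y)"
        using bd by (auto intro!: mult_left_le_one_le)
      show "(\<lambda>y. ?\<phi> (y + z) *\<^sub>R F y) \<in> borel_measurable lborel" using F by measurable
    qed
    have slice: "(LINT y|lborel. D (y - s *\<^sub>R ax l) *\<^sub>R f y) = - (LINT y|lborel. ?\<phi> y *\<^sub>R g (y + s *\<^sub>R ax l))"
      if s: "s \<in> {0..h}" for s
    proof -
      let ?z = "s *\<^sub>R ax l"
      have "cbox (c + ?z) (d + ?z) \<subseteq> U"
      proof
        fix y assume "y \<in> cbox (c + ?z) (d + ?z)"
        then have "y - ?z \<in> cbox c d" by (auto simp: mem_box_cart algebra_simps)
        then have "(y - ?z) + ?z \<in> U" using cd U[OF s] by blast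
        then show "y \<in> U" by simp
      qed
      from weak[OF n this]
      have "(LINT y|lborel. D (y - ?z) *\<^sub>R f y) = - (LINT y|lborel. bump n (c + ?z) (d + ?z) y *\<^sub>R g y)"
        by (simp add: D(5))
      also have "(LINT y|lborel. bump n (c + ?z) (d + ?z) y *\<^sub>R g y) = (LINT y|lborel. ?\<phi> (y - ?z) *\<^sub>R g y)"
        by (simp add: bump_shift)
      also have "\<dots> = (LINT y|lborel. ?\<phi> (y + ?z - ?z) *\<^sub>R g (y + ?z))"
        by (rule integral_lborel_shift[symmetric, where f = "\<lambda>y. ?\<phi> (y - ?z) *\<^sub>R g y"]) measurable
      finally show ?thesis by simp
    qed
    have FTC: "(LINT s|lborel. indicator {0..h} s * D (y + (- 1 * s) *\<^sub>R ax l)) = ?\<phi> y - ?\<phi> (y - h *\<^sub>R ax l)"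
      and FTCi: "integrable lborel (\<lambda>s. indicator {0..h} s * D (y + (- 1 * s) *\<^sub>R ax l))" for y
    proof -
      have d: "((\<lambda>s. - ?\<phi> (y + (- 1 * s) *\<^sub>R ax l)) has_real_derivative D (y + (- 1 * s) *\<^sub>R ax l)) (at s)" for s
        using DERIV_minus[OF DERIV_chain2[OF D(4)[of y "- 1 * s"] DERIV_cmult_Id[of "- 1" s]]] by simp
      have c: "isCont (\<lambda>s. D (y + (- 1 * s) *\<^sub>R ax l)) s" for s
        using D(2) by (intro continuous_on_interior[OF continuous_on_compose2[OF D(2)], of UNIV])
           (auto intro!: continuous_intros)
      have "has_bochner_integral lborel (\<lambda>s. D (y + (- 1 * s) *\<^sub>R ax l) * indicator {0..h} s)
          (- ?\<phi> (y + (- 1 * h) *\<^sub>R ax l) - - ?\<phi> (y + (- 1 * 0) *\<^sub>R ax l))"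
        by (rule has_bochner_integral_FTC_Icc_real[OF h d c])
      then show "(LINT s|lborel. indicator {0..h} s * D (y + (- 1 * s) *\<^sub>R ax l)) = ?\<phi> y - ?\<phi> (y - h *\<^sub>R ax l)"
        and "integrable lborel (\<lambda>s. indicator {0..h} s * D (y + (- 1 * s) *\<^sub>R ax l))"
        by (simp_all add: has_bochner_integral_iff mult.commute)
    qed
    have "(LINT y|lborel. (?\<phi> y - ?\<phi> (y - h *\<^sub>R ax l)) *\<^sub>R f y)
        = (LINT y|lborel. LINT s|lborel. (indicator {0..h} s * D (y + (- 1 * s) *\<^sub>R ax l)) *\<^sub>R f (y + (0 * s) *\<^sub>R ax l))"
    proof (rule Bochner_Integration.integral_cong[OF refl])
      fix y
      have "(LINT s|lborel. (indicator {0..h} s * D (y + (- 1 * s) *\<^sub>R ax l)) *\<^sub>R f y)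
          = (?\<phi> y - ?\<phi> (y - h *\<^sub>R ax l)) *\<^sub>R f y"
        unfolding FTC[symmetric] by (rule integral_scaleR_left[OF FTCi])
      then show "(?\<phi> y - ?\<phi> (y - h *\<^sub>R ax l)) *\<^sub>R f y
          = (LINT s|lborel. (indicator {0..h} s * D (y + (- 1 * s) *\<^sub>R ax l)) *\<^sub>R f (y + (0 * s) *\<^sub>R ax l))"
        by simp
    qed
    also have "\<dots> = (LINT s|lborel. LINT y|lborel. (indicator {0..h} s * D (y + (- 1 * s) *\<^sub>R ax l)) *\<^sub>R f (y + (0 * s) *\<^sub>R ax l))"
      by (rule shift_product_Fubini(1)[OF f Dm D(3)])
    also have "\<dots> = (LINT s|lborel. indicator {0..h} s *\<^sub>R (LINT y|lborel. D (y - s *\<^sub>R ax l) *\<^sub>R f y))"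
      by (rule Bochner_Integration.integral_cong) (auto simp: scaleR_scaleR[symmetric] simp del: scaleR_scaleR)
    also have "\<dots> = (LINT s|lborel. - (indicator {0..h} s *\<^sub>R (LINT y|lborel. ?\<phi> y *\<^sub>R g (y + s *\<^sub>R ax l))))"
      by (rule Bochner_Integration.integral_cong) (auto simp: indicator_def slice)
    also have "\<dots> = - (LINT s|lborel. LINT y|lborel. (indicator {0..h} s * ?\<phi> (y + (0 * s) *\<^sub>R ax l)) *\<^sub>R g (y + (1 * s) *\<^sub>R ax l))"
      by (simp add: scaleR_scaleR[symmetric] del: scaleR_scaleR)
    also have "\<dots> = - (LINT y|lborel. LINT s|lborel. (indicator {0..h} s * ?\<phi> (y + (0 * s) *\<^sub>R ax l)) *\<^sub>R g (y + (1 * s) *\<^sub>R ax l))"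
      by (subst shift_product_Fubini(1)[OF g bump_measurable bd]) simp
    also have "\<dots> = - (LINT y|lborel. ?\<phi> y *\<^sub>R I y)"
    proof -
      have "(LINT s|lborel. (indicator {0..h} s * ?\<phi> (y + (0 * s) *\<^sub>R ax l)) *\<^sub>R g (y + (1 * s) *\<^sub>R ax l)) = ?\<phi> y *\<^sub>R I y" for y
        unfolding I_def integral_scaleR_right'[symmetric]
        by (rule Bochner_Integration.integral_cong) (auto simp: mult.commute)
      then show ?thesis by simp
    qed
    finally have eq: "(LINT y|lborel. ?\<phi> y *\<^sub>R f y - ?\<phi> (y - h *\<^sub>R ax l) *\<^sub>R f y) = - (LINT y|lborel. ?\<phi> y *\<^sub>R I y)"
      by (simp add: scaleR_diff_left)
    have "(LINT y|lborel. ?\<phi> (y - h *\<^sub>R ax l) *\<^sub>R f y) = (LINT y|lborel. ?\<phi> (y + h *\<^sub>R ax l - h *\<^sub>R ax l) *\<^sub>R f (y + h *\<^sub>R ax l))"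
      by (rule integral_lborel_shift[symmetric, where f = "\<lambda>y. ?\<phi> (y - h *\<^sub>R ax l) *\<^sub>R f y"]) measurable
    then have sh: "(LINT y|lborel. ?\<phi> (y - h *\<^sub>R ax l) *\<^sub>R f y) = (LINT y|lborel. ?\<phi> y *\<^sub>R f (y + h *\<^sub>R ax l))"
      by simp
    have i: "integrable lborel (\<lambda>y. ?\<phi> y *\<^sub>R F y)" if "integrable lborel F" for F :: "real^3 \<Rightarrow> 'b"
      using bint[OF that, of 0] by simp
    have i2: "integrable lborel (\<lambda>y. ?\<phi> (y - h *\<^sub>R ax l) *\<^sub>R f y)"
      using bint[OF f, of "- (h *\<^sub>R ax l)"] by simp
    have "(LINT y|lborel. ?\<phi> y *\<^sub>R u y) = (LINT y|lborel. ?\<phi> y *\<^sub>R f (y + h *\<^sub>R ax l) - ?\<phi> y *\<^sub>R f y - ?\<phi> y *\<^sub>R I y)"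
      by (simp add: u_def scaleR_diff_right)
    also have "\<dots> = (LINT y|lborel. ?\<phi> y *\<^sub>R f (y + h *\<^sub>R ax l)) - (LINT y|lborel. ?\<phi> y *\<^sub>R f y) - (LINT y|lborel. ?\<phi> y *\<^sub>R I y)"
      using i[OF f] i[OF I] i[OF integrable_lborel_shift[OF f]] by simp
    also have "\<dots> = 0"
    proof -
      have "(LINT y|lborel. ?\<phi> y *\<^sub>R f y) - (LINT y|lborel. ?\<phi> y *\<^sub>R f (y + h *\<^sub>R ax l)) = - (LINT y|lborel. ?\<phi> y *\<^sub>R I y)"
        using eq i[OF f] i2 by (simp add: sh)
      from arg_cong[OF this, of uminus] show ?thesis by simp
    qed
    finally show ?thesis .
  qed
  then have "AE y in lborel. y \<in> box p q \<longrightarrow> u y = 0" by (intro fundamental_lemma[OF u])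
  then show ?thesis by eventually_elim (auto simp: u_def I_def)
qed

section \<open>Strong continuity of translations and averages\<close>

lemma AE_cube_interior: "AE y in cubeM. y \<in> box 0 (\<chi> i. 1)"
proof -
  let ?B = "box 0 (\<chi> i. 1) :: (real^3) set"
  have sub: "?B \<subseteq> unit_cube" by (auto simp: unit_cube_def mem_box_cart less_imp_le)
  have B1: "emeasure lborel ?B = 1"
    by (auto simp: emeasure_lborel_box_eq Basis_vec_def inner_axis intro!: prod.neutral)
  have C1: "emeasure lborel unit_cube = 1"
    using emeasure_cubeM unfolding cubeM_def by (subst (asm) emeasure_restrict_space) auto
  have "emeasure lborel (unit_cube - ?B) = 0"
    using B1 C1 sub by (subst emeasure_Diff) auto
  then have "unit_cube - ?B \<in> null_sets lborel" by (auto simp: null_sets_def)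
  then have "AE y in lborel. y \<notin> unit_cube - ?B" by (rule AE_not_in)
  then show ?thesis unfolding AE_cubeM by eventually_elim auto
qed

lemma integrable_cubeM_iff:
  fixes f :: "real^3 \<Rightarrow> 'b::{banach, second_countable_topology}"
  shows "integrable cubeM f \<longleftrightarrow> integrable lborel (\<lambda>y. indicator unit_cube y *\<^sub>R f y)"
  unfolding cubeM_def by (rule integrable_restrict_space) auto

lemma integral_cubeM:
  fixes f :: "real^3 \<Rightarrow> 'b::{banach, second_countable_topology}"
  shows "(\<integral>y. f y \<partial>cubeM) = (LINT y|lborel. indicator unit_cube y *\<^sub>R f y)"
  unfolding cubeM_def by (rule integral_restrict_space) auto

lemma bump_Sq: "(\<lambda>y. bump n c d y *\<^sub>R b) \<in> Sq"
proof (rule Sq_bounded[where c = "norm b"])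
  show "AE y in cubeM. norm (bump n c d y *\<^sub>R b) \<le> norm b"
    using bump_bounds[of n c d] by (auto intro!: mult_left_le_one_le)
qed measurable

text \<open>The bumps are merely restricted to the cube and need not be periodic, since the faces
  are a null set.\<close>

lemma l2_zeroI:
  fixes F :: "'b::euclidean_space l2"
  assumes H: "\<And>n c d b. n > 0 \<Longrightarrow> inner F (cls (\<lambda>y. bump n c d y *\<^sub>R b)) = 0"
  shows "F = 0"
proof -
  define u where "u y = indicator unit_cube y *\<^sub>R rep F y" for y
  have u: "integrable lborel u"
    using Sq_integrable[OF rep_Sq[of F]] unfolding integrable_cubeM_iff u_def .
  have "(LINT y|lborel. bump n c d y *\<^sub>R u y) = 0" if n: "n > 0" for n c d
  proof (rule euclidean_eqI)
    fix b :: 'b assume "b \<in> Basis"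
    have i: "integrable lborel (\<lambda>y. bump n c d y *\<^sub>R u y)"
    proof (rule Bochner_Integration.integrable_bound[OF u])
      show "AE y in lborel. norm (bump n c d y *\<^sub>R u y) \<le> norm (u y)"
        using bump_bounds[of n c d] by (auto intro!: mult_left_le_one_le)
      show "(\<lambda>y. bump n c d y *\<^sub>R u y) \<in> borel_measurable lborel" using u by measurable
    qed
    have "inner (LINT y|lborel. bump n c d y *\<^sub>R u y) b = (LINT y|lborel. inner (bump n c d y *\<^sub>R u y) b)"
      by (rule integral_inner_left[symmetric]) (rule i)
    also have "\<dots> = (LINT y|lborel. indicator unit_cube y *\<^sub>R inner (rep F y) (bump n c d y *\<^sub>R b))"
      by (rule Bochner_Integration.integral_cong) (auto simp: u_def)
    also have "\<dots> = inner F (cls (\<lambda>y. bump n c d y *\<^sub>R b))"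
      using inner_cls[OF rep_Sq[of F] bump_Sq[of n c d b]] by (simp add: integral_cubeM)
    finally show "inner (LINT y|lborel. bump n c d y *\<^sub>R u y) b = inner 0 b" using H[OF n] by simp
  qed
  then have "AE y in lborel. y \<in> box 0 (\<chi> i. 1) \<longrightarrow> u y = 0" by (intro fundamental_lemma[OF u])
  then have "AE y in cubeM. y \<in> box 0 (\<chi> i. 1) \<longrightarrow> u y = 0"
    unfolding AE_cubeM by eventually_elim auto
  moreover have "AE y in cubeM. y \<in> unit_cube" by (rule AE_I2) simp
  ultimately have "AE y in cubeM. rep F y = 0"
    using AE_cube_interior by eventually_elim (auto simp: u_def)
  then have "cls (rep F) = cls (\<lambda>_. 0)" by (subst cls_eq_iff) (auto simp: Sq_const)
  then show ?thesis by (simp add: cls_zero)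
qed

text \<open>No periodicity of \<open>f\<close> is asked for: at an interior point of the cube the
  reduction \<open>fr\<close> is the identity for all small shifts, and the faces are a null set.
  Dominated convergence does the rest.\<close>

lemma shift_seq_tendsto_continuous:
  fixes f :: "real^3 \<Rightarrow> 'b::euclidean_space"
  assumes c: "continuous_on UNIV f" and B: "\<And>y. norm (f y) \<le> B" and z: "z \<longlonglongrightarrow> 0"
  shows "(\<lambda>n. shift (z n) (cls f)) \<longlonglongrightarrow> cls f"
proof -
  have [measurable]: "f \<in> borel_measurable borel" by (rule borel_measurable_continuous_onI[OF c])
  have fS: "f \<in> Sq" by (rule Sq_bounded[where c = B]) (auto simp: B)
  have n: "(norm (shift (z n) (cls f) - cls f))\<^sup>2 = (\<integral>y. (norm (f (fr (y + z n)) - f y))\<^sup>2 \<partial>cubeM)" for n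
    by (simp add: shift_cls fS cls_diff Sq_shift norm_cls Sq_diff)
  have "(\<lambda>n. \<integral>y. (norm (f (fr (y + z n)) - f y))\<^sup>2 \<partial>cubeM) \<longlonglongrightarrow> (\<integral>y. 0 \<partial>cubeM)"
  proof (rule integral_dominated_convergence[where w = "\<lambda>_. (2 * B)\<^sup>2"])
    show "AE y in cubeM. (\<lambda>n. (norm (f (fr (y + z n)) - f y))\<^sup>2) \<longlonglongrightarrow> 0"
      using AE_cube_interior
    proof eventually_elim
      case (elim y)
      have yz: "(\<lambda>n. y + z n) \<longlonglongrightarrow> y" using z by (auto intro!: tendsto_eq_intros)
      have "isCont f y" using c by (simp add: continuous_on_eq_continuous_at)
      then have "(\<lambda>n. f (y + z n)) \<longlonglongrightarrow> f y" using yz isCont_tendsto_compose by blast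
      then have "(\<lambda>n. (norm (f (y + z n) - f y))\<^sup>2) \<longlonglongrightarrow> (norm (f y - f y))\<^sup>2"
        by (intro tendsto_intros)
      moreover have "\<forall>\<^sub>F n in sequentially. y + z n \<in> box 0 (\<chi> i. 1)"
        using topological_tendstoD[OF yz open_box elim] .
      then have "\<forall>\<^sub>F n in sequentially. (norm (f (y + z n) - f y))\<^sup>2 = (norm (f (fr (y + z n)) - f y))\<^sup>2"
        by eventually_elim (subst fr_cube, auto simp: unit_cube_def mem_box_cart less_imp_le)
      ultimately show ?case using Lim_transform_eventually by fastforce
    qed
    show "AE y in cubeM. norm ((norm (f (fr (y + z n)) - f y))\<^sup>2) \<le> (2 * B)\<^sup>2" for n
    proof (rule AE_I2)
      fix y
      have "norm (f (fr (y + z n)) - f y) \<le> 2 * B"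
        using norm_triangle_ineq4[of "f (fr (y + z n))" "f y"] B[of "fr (y + z n)"] B[of y] by linarith
      then have "(norm (f (fr (y + z n)) - f y))\<^sup>2 \<le> (2 * B)\<^sup>2" by (intro power_mono) auto
      then show "norm ((norm (f (fr (y + z n)) - f y))\<^sup>2) \<le> (2 * B)\<^sup>2" by simp
    qed
  qed (simp_all, measurable)
  then have "(\<lambda>n. (norm (shift (z n) (cls f) - cls f))\<^sup>2) \<longlonglongrightarrow> 0" by (simp add: n)
  then have "(\<lambda>n. sqrt ((norm (shift (z n) (cls f) - cls f))\<^sup>2)) \<longlonglongrightarrow> sqrt 0"
    by (rule tendsto_real_sqrt)
  then have "(\<lambda>n. norm (shift (z n) (cls f) - cls f)) \<longlonglongrightarrow> 0" by simp
  then show ?thesis using LIM_zero_cancel tendsto_norm_zero_iff by blast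
qed

lemma shift_zero: "shift z 0 = 0"
  by (rule linear_0[OF bounded_linear.linear[OF bounded_linear_shift]])

text \<open>The classes for which the claim holds form a closed subspace that contains all bumps.
  The difference between \<open>F\<close> and its projection onto that subspace is orthogonal to
  every bump, hence zero; so density comes from orthogonality and not from an approximation
  theorem.\<close>

lemma shift_seq_tendsto:
  fixes F :: "'b::euclidean_space l2"
  assumes "z \<longlonglongrightarrow> 0"
  shows "(\<lambda>n. shift (z n) F) \<longlonglongrightarrow> F"
proof -
  define C where "C = {F :: 'b l2. (\<lambda>n. shift (z n) F) \<longlonglongrightarrow> F}"
  have C: "subspace C"
    unfolding subspace_def C_def
    by (auto simp: shift_zero shift_add shift_scaleR intro!: tendsto_intros)
  have "closed C"
    unfolding closed_sequential_limits
  proof safe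
    fix X F assume X: "\<forall>n. X n \<in> C" "X \<longlonglongrightarrow> F"
    have "(\<lambda>n. shift (z n) F) \<longlonglongrightarrow> F"
    proof (rule metric_LIMSEQ_I)
      fix e :: real assume e: "e > 0"
      obtain k where k: "norm (X k - F) < e / 3"
        using X(2) e unfolding lim_sequentially dist_norm by (meson divide_pos_pos order_refl zero_less_numeral)
      have "(\<lambda>n. shift (z n) (X k)) \<longlonglongrightarrow> X k" using X(1) by (simp add: C_def)
      then obtain N where N: "\<And>n. n \<ge> N \<Longrightarrow> norm (shift (z n) (X k) - X k) < e / 3"
        using e unfolding lim_sequentially dist_norm by (meson divide_pos_pos zero_less_numeral)
      have "dist (shift (z n) F) F < e" if "n \<ge> N" for n
      proof -
        have "shift (z n) F - F = shift (z n) (F - X k) + (shift (z n) (X k) - X k) + (X k - F)"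
          by (simp add: shift_diff)
        then have "norm (shift (z n) F - F) \<le> norm (shift (z n) (F - X k)) + norm (shift (z n) (X k) - X k) + norm (X k - F)"
          by (simp only:) (intro order_trans[OF norm_triangle_ineq] add_right_mono norm_triangle_ineq)
        also have "\<dots> < e" using k N[OF that] by (simp add: norm_minus_commute)
        finally show ?thesis by (simp add: dist_norm)
      qed
      then show "\<exists>N. \<forall>n\<ge>N. dist (shift (z n) F) F < e" by blast
    qed
    then show "F \<in> C" by (simp add: C_def)
  qed
  with C obtain u where u: "u \<in> C" "\<And>v. v \<in> C \<Longrightarrow> inner u v = inner F v"
    using riesz_coercive[of C "\<lambda>x. x" 1 F] bounded_linear_ident
    by (metis dual_order.refl mult_1 power2_norm_eq_inner zero_less_one)
  have "cls (\<lambda>y. bump n c d y *\<^sub>R b) \<in> C" for n c d b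
    unfolding C_def mem_Collect_eq
  proof (rule shift_seq_tendsto_continuous[OF _ _ assms, where B = "norm b"])
    show "continuous_on UNIV (\<lambda>y. bump n c d y *\<^sub>R b)" by (intro continuous_intros bump_continuous)
    show "norm (bump n c d y *\<^sub>R b) \<le> norm b" for y
      using bump_bounds[of n c d y] by (auto intro!: mult_left_le_one_le)
  qed
  then have "F - u = 0" using u by (intro l2_zeroI) (simp add: inner_diff_left)
  then show ?thesis using u by (simp add: C_def)
qed

lemma shift_line_continuous: "continuous_on S (\<lambda>s::real. shift (s *\<^sub>R v) F)"
proof (rule continuous_on_subset[of UNIV])
  show "continuous_on UNIV (\<lambda>s::real. shift (s *\<^sub>R v) F)"
    unfolding continuous_on_sequentially comp_def
  proof safe
    fix x :: "nat \<Rightarrow> real" and a assume x: "x \<longlonglongrightarrow> a"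
    have "(\<lambda>n. (x n - a) *\<^sub>R v) \<longlonglongrightarrow> (a - a) *\<^sub>R v" by (intro tendsto_intros x)
    then have "(\<lambda>n. shift ((x n - a) *\<^sub>R v) F) \<longlonglongrightarrow> F" by (intro shift_seq_tendsto) simp
    then have "(\<lambda>n. shift (a *\<^sub>R v) (shift ((x n - a) *\<^sub>R v) F)) \<longlonglongrightarrow> shift (a *\<^sub>R v) F"
      by (rule bounded_linear.tendsto[OF bounded_linear_shift])
    then show "(\<lambda>n. shift (x n *\<^sub>R v) F) \<longlonglongrightarrow> shift (a *\<^sub>R v) F"
      by (simp add: shift_shift scaleR_add_left[symmetric] del: scaleR_add_left)
  qed
qed simp

text \<open>Formally the value at \<open>y\<close> is the integral of
  \<open>F (y + s *\<^sub>R ax l)\<close> over \<open>s\<close> from 0 to \<open>h\<close>, not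
  divided by \<open>h\<close>. Thus \<open>dif l h w = av l h g\<close> for all
  \<open>h \<ge> 0\<close> is the integrated form of the statement that \<open>g\<close> is the
  derivative of \<open>w\<close> in direction \<open>l\<close>, and it makes sense for
  classes.\<close>

definition av :: "3 \<Rightarrow> real \<Rightarrow> 'b::euclidean_space l2 \<Rightarrow> 'b l2" where
  "av l h F = integral {0..h} (\<lambda>s. shift (s *\<^sub>R ax l) F)"

lemma shift_integrable: "(\<lambda>s. shift (s *\<^sub>R ax l) F) integrable_on {a..b}"
  by (intro integrable_continuous_real shift_line_continuous)

lemma norm_av: "h \<ge> 0 \<Longrightarrow> norm (av l h F) \<le> h * norm F"
  unfolding av_def using integral_bound[of 0 h "\<lambda>s. shift (s *\<^sub>R ax l) F" "norm F"]
  by (simp add: shift_line_continuous mult.commute)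

lemma av_bounded_linear_commute:
  fixes L :: "'b::euclidean_space l2 \<Rightarrow> 'c::euclidean_space l2"
  assumes "bounded_linear L" "\<And>s. L (shift (s *\<^sub>R ax l) F) = shift (s *\<^sub>R ax l) (L F)"
  shows "L (av l h F) = av l h (L F)"
  unfolding av_def using integral_linear[OF shift_integrable[where a=0 and b=h and l=l and F=F] assms(1)] assms(2)
  by (simp add: comp_def)

lemma bounded_linear_av: assumes "h \<ge> 0" shows "bounded_linear (av l h :: 'b::euclidean_space l2 \<Rightarrow> _)"
proof (rule bounded_linear_intro[where K = h])
  show "av l h (F + G) = av l h F + av l h G" for F G :: "'b l2"
    unfolding av_def by (simp add: shift_add Henstock_Kurzweil_Integration.integral_add[OF shift_integrable shift_integrable])
  show "av l h (r *\<^sub>R F) = r *\<^sub>R av l h F" for F :: "'b l2" and r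
    unfolding av_def by (simp add: shift_scaleR)
  show "norm (av l h F) \<le> norm F * h" for F :: "'b l2"
    using norm_av[OF assms] by (simp add: mult.commute)
qed

lemma shift_av: "shift z (av l h F) = av l h (shift z F)"
  by (rule av_bounded_linear_commute[OF bounded_linear_shift]) (rule shift_commute)

lemma av_av: assumes "k \<ge> 0" shows "av m k (av l h F) = av l h (av m k F)"
  by (rule av_bounded_linear_commute[OF bounded_linear_av[OF assms]]) (simp add: shift_av)

lemma inner_av: "inner (av l h F) G = integral {0..h} (\<lambda>s. inner (shift (s *\<^sub>R ax l) F) G)"
  unfolding av_def using integral_linear[OF shift_integrable[where a=0 and b=h and l=l and F=F] bounded_linear_inner_left[of G]]
  by (simp add: comp_def)

text \<open>The left-hand side is the integral over \<open>{h..h + k}\<close> minus that over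
  \<open>{0..k}\<close>; splitting \<open>{0..h + k}\<close> at the other point exchanges
  \<open>h\<close> and \<open>k\<close>. Consequently the differences of an average are averages of
  a difference: averaging over a segment creates a derivative.\<close>

lemma shift_diff_av:
  assumes "h \<ge> 0" "k \<ge> 0"
  shows "shift (h *\<^sub>R ax l) (av l k F) - av l k F = shift (k *\<^sub>R ax l) (av l h F) - av l h F"
proof -
  let ?f = "\<lambda>s. shift (s *\<^sub>R ax l) F"
  have sh: "shift (a *\<^sub>R ax l) (av l b F) = integral {a..a + b} ?f" if "b \<ge> 0" for a b
  proof -
    have "shift (a *\<^sub>R ax l) (av l b F) = integral {0..b} (\<lambda>s. ?f (s + a))"
      unfolding av_def using integral_linear[OF shift_integrable[where a=0 and b=b and l=l and F=F] bounded_linear_shift[of "a *\<^sub>R ax l"]]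
      by (simp add: comp_def shift_shift scaleR_add_left add.commute)
    also have "(?f has_integral integral {a..a + b} ?f) {a..a + b}"
      using shift_integrable by (rule integrable_integral)
    then have "((\<lambda>s. ?f (s + a)) has_integral integral {a..a + b} ?f) {a - a..a + b - a}"
      by (intro has_integral_shift_real_ivl) auto
    then have "integral {0..b} (\<lambda>s. ?f (s + a)) = integral {a..a + b} ?f"
      by (intro integral_unique) simp
    finally show ?thesis .
  qed
  have "integral {0..h} ?f + integral {h..h + k} ?f = integral {0..h + k} ?f"
    using assms by (intro Henstock_Kurzweil_Integration.integral_combine shift_integrable) auto
  moreover have "integral {0..k} ?f + integral {k..k + h} ?f = integral {0..k + h} ?f"
    using assms by (intro Henstock_Kurzweil_Integration.integral_combine shift_integrable) auto
  ultimately have "av l h F + shift (h *\<^sub>R ax l) (av l k F) = av l k F + shift (k *\<^sub>R ax l) (av l h F)"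
    unfolding sh[OF assms(2)] sh[OF assms(1)] by (simp add: av_def add.commute)
  then show ?thesis by (simp add: algebra_simps)
qed

lemma av_limit: "((\<lambda>h. (1 / h) *\<^sub>R av l h F) \<longlongrightarrow> F) (at_right 0)"
proof (rule tendstoI)
  fix e :: real assume e: "e > 0"
  have "continuous_on UNIV (\<lambda>s::real. shift (s *\<^sub>R ax l) F)" by (rule shift_line_continuous)
  from this[unfolded continuous_on_iff, rule_format, of 0 "e / 2"] e
  have "\<exists>d>0. \<forall>s. \<bar>s\<bar> < d \<longrightarrow> norm (shift (s *\<^sub>R ax l) F - F) < e / 2"
    by (simp add: dist_norm)
  then obtain d where d: "d > 0" "\<And>s. \<bar>s\<bar> < d \<Longrightarrow> norm (shift (s *\<^sub>R ax l) F - F) < e / 2"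
    by blast
  have "dist ((1 / h) *\<^sub>R av l h F) F < e" if h: "0 < h" "h < d" for h
  proof -
    have "av l h F - h *\<^sub>R F = integral {0..h} (\<lambda>s. shift (s *\<^sub>R ax l) F - F)"
      unfolding av_def using h
      by (subst Henstock_Kurzweil_Integration.integral_diff[OF shift_integrable]) auto
    moreover have "norm (integral {0..h} (\<lambda>s. shift (s *\<^sub>R ax l) F - F)) \<le> (e / 2) * (h - 0)"
      using h d(2) by (intro integral_bound continuous_intros shift_line_continuous) (auto intro: less_imp_le)
    ultimately have "norm (av l h F - h *\<^sub>R F) \<le> (e / 2) * h" by simp
    moreover have "(1 / h) *\<^sub>R av l h F - F = (1 / h) *\<^sub>R (av l h F - h *\<^sub>R F)"
      using h by (simp add: scaleR_diff_right)
    ultimately have "norm ((1 / h) *\<^sub>R av l h F - F) \<le> e / 2"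
      using h by (simp add: divide_le_eq)
    then show ?thesis using e by (simp add: dist_norm)
  qed
  then show "\<forall>\<^sub>F h in at_right 0. dist ((1 / h) *\<^sub>R av l h F) F < e"
    using d(1) eventually_at_right_real by (auto simp: eventually_at_right)
qed

lemma norm_shift_diff_uminus: "norm (shift (- z) F - F) = norm (shift z F - F)"
proof -
  have "shift z (shift (- z) F - F) = F - shift z F" by (simp add: shift_diff shift_shift)
  then show ?thesis by (metis norm_shift norm_minus_commute)
qed

section \<open>Averages as pointwise line integrals\<close>

lemma pair_cube: "pair_sigma_finite cubeM (lborel :: real measure)"
  by (intro pair_sigma_finite.intro sigma_finite_lborel cubeM.sigma_finite_measure_axioms)

lemma line_integrable:
  fixes \<psi> :: "real^3 \<Rightarrow> 'b::euclidean_space"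
  assumes \<psi>: "\<psi> \<in> Sq"
  shows "AE y in cubeM. integrable lborel (\<lambda>s. indicator {0..h} s *\<^sub>R \<psi> (fr (y + s *\<^sub>R ax l)))"
    and "(\<lambda>y. LINT s|lborel. indicator {0..h} s *\<^sub>R \<psi> (fr (y + s *\<^sub>R ax l))) \<in> borel_measurable borel"
proof -
  interpret pair_sigma_finite cubeM "lborel :: real measure" by (rule pair_cube)
  have [measurable]: "\<psi> \<in> borel_measurable borel" using \<psi> by (rule Sq_measurable)
  have [measurable]: "(\<lambda>y. y) \<in> borel_measurable cubeM" by measurable
  have m: "(\<lambda>(y, s). indicator {0..h} s *\<^sub>R \<psi> (fr (y + s *\<^sub>R ax l))) \<in> borel_measurable (cubeM \<Otimes>\<^sub>M lborel)"
    by measurable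
  have i: "integrable cubeM (\<lambda>y. norm (\<psi> y))" using Sq_integrable[OF \<psi>] by simp
  have "integrable (cubeM \<Otimes>\<^sub>M lborel) (\<lambda>(y, s). indicator {0..h} s *\<^sub>R \<psi> (fr (y + s *\<^sub>R ax l)))"
  proof (rule integrableI_bounded[OF m])
    have "(\<integral>\<^sup>+x. ennreal (norm ((\<lambda>(y, s). indicator {0..h} s *\<^sub>R \<psi> (fr (y + s *\<^sub>R ax l))) x)) \<partial>(cubeM \<Otimes>\<^sub>M lborel))
      = (\<integral>\<^sup>+s. \<integral>\<^sup>+y. ennreal (norm (indicator {0..h} s *\<^sub>R \<psi> (fr (y + s *\<^sub>R ax l)))) \<partial>cubeM \<partial>lborel)"
      by (subst nn_integral_snd[symmetric]) (auto simp: case_prod_unfold)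
    also have "\<dots> = (\<integral>\<^sup>+s. indicator {0..h} s * (\<integral>\<^sup>+y. ennreal (norm (\<psi> (fr (y + s *\<^sub>R ax l)))) \<partial>cubeM) \<partial>lborel)"
      by (intro nn_integral_cong, subst nn_integral_cmult[symmetric])
         (auto intro!: nn_integral_cong simp: indicator_def)
    also have "\<dots> = (\<integral>\<^sup>+s. indicator {0..h} s * (\<integral>\<^sup>+y. ennreal (norm (\<psi> y)) \<partial>cubeM) \<partial>lborel)"
      by (subst nn_integral_shift) auto
    also have "\<dots> = emeasure lborel {0..h} * (\<integral>\<^sup>+y. ennreal (norm (\<psi> y)) \<partial>cubeM)"
      by (simp add: nn_integral_multc)
    also have "\<dots> < \<infinity>"
      using i by (auto simp: ennreal_mult_less_top integrable_iff_bounded emeasure_lborel_Icc_eq)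
    finally show "(\<integral>\<^sup>+x. ennreal (norm ((\<lambda>(y, s). indicator {0..h} s *\<^sub>R \<psi> (fr (y + s *\<^sub>R ax l))) x)) \<partial>(cubeM \<Otimes>\<^sub>M lborel)) < \<infinity>" .
  qed
  from AE_integrable_fst'[OF this]
  show "AE y in cubeM. integrable lborel (\<lambda>s. indicator {0..h} s *\<^sub>R \<psi> (fr (y + s *\<^sub>R ax l)))" by simp
  show "(\<lambda>y. LINT s|lborel. indicator {0..h} s *\<^sub>R \<psi> (fr (y + s *\<^sub>R ax l))) \<in> borel_measurable borel"
    by measurable
qed

lemma lin_field_indicator:
  assumes [measurable]: "A \<in> sets borel"
  shows "lin_field (\<lambda>y (v::'b::euclidean_space). indicator A y *\<^sub>R v) 1"
  unfolding lin_field_def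
proof (intro conjI allI AE_I2)
  show "linear (\<lambda>v::'b. indicator A y *\<^sub>R v)" for y by (auto intro: linear_scaleR)
  show "(\<lambda>y. indicator A y *\<^sub>R v) \<in> borel_measurable borel" for v :: 'b
    using assms by (intro borel_measurable_scaleR borel_measurable_indicator borel_measurable_const)
  show "norm (indicator A y *\<^sub>R v) \<le> 1 * norm v" for v :: 'b and y by (simp add: indicator_def)
qed

lemma inner_pw_indicator:
  assumes "A \<in> sets borel"
  shows "inner (pw (\<lambda>y v. indicator A y *\<^sub>R v) F) G = inner F (pw (\<lambda>y v. indicator A y *\<^sub>R v) G)"
proof -
  have "inner F (pw (\<lambda>y v. indicator A y *\<^sub>R v) G) = inner (pw (\<lambda>y v. indicator A y *\<^sub>R v) G) F"
    by (rule inner_commute)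
  then show ?thesis
    unfolding inner_pw[OF lin_field_indicator[OF assms]] by (simp add: inner_commute)
qed

text \<open>The integral of a curve in \<open>L2\<close> is compared with pointwise line integrals
  by pairing with an arbitrary class and exchanging the integrals. The set \<open>A\<close> admits
  identities that are only known away from the faces.\<close>

lemma cls_eq_av:
  fixes \<psi> f :: "real^3 \<Rightarrow> 'b::euclidean_space"
  assumes f: "f \<in> Sq" and \<psi>: "\<psi> \<in> Sq" and A [measurable]: "A \<in> sets borel"
    and eq: "AE y in cubeM. y \<in> A \<longrightarrow> f y = (LINT s|lborel. indicator {0..h} s *\<^sub>R \<psi> (fr (y + s *\<^sub>R ax l)))"
  shows "pw (\<lambda>y v. indicator A y *\<^sub>R v) (cls f) = pw (\<lambda>y v. indicator A y *\<^sub>R v) (av l h (cls \<psi>))"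
proof (rule vector_eq_ldot[THEN iffD1], rule allI)
  fix G0 :: "'b l2"
  interpret pair_sigma_finite cubeM "lborel :: real measure" by (rule pair_cube)
  let ?P = "pw (\<lambda>y v. indicator A y *\<^sub>R (v :: 'b))"
  obtain g where g: "?P G0 = cls g" "g \<in> Sq" by (metis l2_obtain)
  have gA: "AE y in cubeM. y \<notin> A \<longrightarrow> g y = 0"
  proof -
    have "cls g = cls (\<lambda>y. indicator A y *\<^sub>R rep G0 y)" using g by (simp add: pw_def)
    then have "AE y in cubeM. g y = indicator A y *\<^sub>R rep G0 y"
      using cls_eq_iff[OF g(2) lin_field_Sq[OF lin_field_indicator[OF A] rep_Sq[of G0]]] by simp
    then show ?thesis by eventually_elim auto
  qed
  have [measurable]: "\<psi> \<in> borel_measurable borel" "g \<in> borel_measurable borel" "f \<in> borel_measurable borel"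
    using f g \<psi> by (auto intro: Sq_measurable)
  have [measurable]: "(\<lambda>y. y) \<in> borel_measurable cubeM" by measurable
  have m: "(\<lambda>(y, s). indicator {0..h} s * inner (\<psi> (fr (y + s *\<^sub>R ax l))) (g y)) \<in> borel_measurable (cubeM \<Otimes>\<^sub>M lborel)"
    by measurable
  have Tin: "inner (shift (s *\<^sub>R ax l) (cls \<psi>)) (cls g) = (\<integral>y. inner (\<psi> (fr (y + s *\<^sub>R ax l))) (g y) \<partial>cubeM)" for s
    using \<psi> g by (simp add: shift_cls inner_cls Sq_shift)
  have int: "integrable (cubeM \<Otimes>\<^sub>M lborel) (\<lambda>(y, s). indicator {0..h} s * inner (\<psi> (fr (y + s *\<^sub>R ax l))) (g y))"
  proof (rule integrableI_bounded[OF m])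
    have "(\<integral>\<^sup>+x. ennreal (norm ((\<lambda>(y, s). indicator {0..h} s * inner (\<psi> (fr (y + s *\<^sub>R ax l))) (g y)) x)) \<partial>(cubeM \<Otimes>\<^sub>M lborel))
      = (\<integral>\<^sup>+s. \<integral>\<^sup>+y. ennreal (norm (indicator {0..h} s * inner (\<psi> (fr (y + s *\<^sub>R ax l))) (g y))) \<partial>cubeM \<partial>lborel)"
      by (subst nn_integral_snd[symmetric]) (auto simp: case_prod_unfold)
    also have "\<dots> \<le> (\<integral>\<^sup>+s. indicator {0..h} s * (\<integral>\<^sup>+y. ennreal ((norm (\<psi> (fr (y + s *\<^sub>R ax l))))\<^sup>2) + ennreal ((norm (g y))\<^sup>2) \<partial>cubeM) \<partial>lborel)"
    proof (rule nn_integral_mono, subst nn_integral_cmult[symmetric], measurable, rule nn_integral_mono)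
      fix s y
      show "ennreal (norm (indicator {0..h} s * inner (\<psi> (fr (y + s *\<^sub>R ax l))) (g y)))
        \<le> indicator {0..h} s * (ennreal ((norm (\<psi> (fr (y + s *\<^sub>R ax l))))\<^sup>2) + ennreal ((norm (g y))\<^sup>2))"
        using abs_inner_le_sq[of "\<psi> (fr (y + s *\<^sub>R ax l))" "g y"]
        by (auto simp: indicator_def abs_mult ennreal_plus[symmetric] intro!: ennreal_leI simp del: ennreal_plus)
    qed
    also have "\<dots> = (\<integral>\<^sup>+s. indicator {0..h} s * ((\<integral>\<^sup>+y. ennreal ((norm (\<psi> y))\<^sup>2) \<partial>cubeM) + (\<integral>\<^sup>+y. ennreal ((norm (g y))\<^sup>2) \<partial>cubeM)) \<partial>lborel)"
    proof (intro nn_integral_cong arg_cong2[where f = "(*)"] refl)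
      fix s
      have "(\<integral>\<^sup>+y. ennreal ((norm (\<psi> (fr (y + s *\<^sub>R ax l))))\<^sup>2) \<partial>cubeM) = (\<integral>\<^sup>+y. ennreal ((norm (\<psi> y))\<^sup>2) \<partial>cubeM)"
        by (rule nn_integral_shift) measurable
      then show "(\<integral>\<^sup>+y. ennreal ((norm (\<psi> (fr (y + s *\<^sub>R ax l))))\<^sup>2) + ennreal ((norm (g y))\<^sup>2) \<partial>cubeM)
         = (\<integral>\<^sup>+y. ennreal ((norm (\<psi> y))\<^sup>2) \<partial>cubeM) + (\<integral>\<^sup>+y. ennreal ((norm (g y))\<^sup>2) \<partial>cubeM)"
        by (subst nn_integral_add) auto
    qed
    also have "\<dots> = emeasure lborel {0..h} * ((\<integral>\<^sup>+y. ennreal ((norm (\<psi> y))\<^sup>2) \<partial>cubeM) + (\<integral>\<^sup>+y. ennreal ((norm (g y))\<^sup>2) \<partial>cubeM))"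
      by (simp add: nn_integral_multc)
    also have "\<dots> < \<infinity>"
      using \<psi> g by (auto simp: ennreal_mult_less_top Sq_def integrable_iff_bounded emeasure_lborel_Icc_eq)
    finally show "(\<integral>\<^sup>+x. ennreal (norm ((\<lambda>(y, s). indicator {0..h} s * inner (\<psi> (fr (y + s *\<^sub>R ax l))) (g y)) x)) \<partial>(cubeM \<Otimes>\<^sub>M lborel)) < \<infinity>" .
  qed
  have sym: "inner G0 (?P F) = inner F (cls g)" for F
    unfolding inner_commute[of G0] inner_pw_indicator[OF A] g(1) ..
  have "inner G0 (?P (cls f)) = inner (cls f) (cls g)" by (rule sym)
  also have "\<dots> = (\<integral>y. inner (f y) (g y) \<partial>cubeM)" using f g by (simp add: inner_cls)
  also have "\<dots> = (\<integral>y. (LINT s|lborel. indicator {0..h} s * inner (\<psi> (fr (y + s *\<^sub>R ax l))) (g y)) \<partial>cubeM)"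
  proof (rule integral_cong_AE)
    show "AE y in cubeM. inner (f y) (g y) = (LINT s|lborel. indicator {0..h} s * inner (\<psi> (fr (y + s *\<^sub>R ax l))) (g y))"
      using eq gA line_integrable(1)[OF \<psi>, of h l]
    proof eventually_elim
      case (elim y)
      have "(LINT s|lborel. indicator {0..h} s * inner (\<psi> (fr (y + s *\<^sub>R ax l))) (g y))
         = (LINT s|lborel. inner (indicator {0..h} s *\<^sub>R \<psi> (fr (y + s *\<^sub>R ax l))) (g y))"
        by simp
      also have "\<dots> = inner (LINT s|lborel. indicator {0..h} s *\<^sub>R \<psi> (fr (y + s *\<^sub>R ax l))) (g y)"
        by (rule integral_inner_left) (rule elim)
      also have "\<dots> = inner (f y) (g y)" using elim by (cases "y \<in> A") auto
      finally show ?case by simp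
    qed
  qed measurable
  also have "\<dots> = (LINT s|lborel. \<integral>y. indicator {0..h} s * inner (\<psi> (fr (y + s *\<^sub>R ax l))) (g y) \<partial>cubeM)"
    using Fubini_integral[OF int] by simp
  also have "\<dots> = (LINT s|lborel. indicator {0..h} s *\<^sub>R inner (shift (s *\<^sub>R ax l) (cls \<psi>)) (cls g))"
    by (simp add: Tin)
  also have "\<dots> = integral {0..h} (\<lambda>s. inner (shift (s *\<^sub>R ax l) (cls \<psi>)) (cls g))"
  proof -
    have "set_integrable lborel {0..h} (\<lambda>s. inner (shift (s *\<^sub>R ax l) (cls \<psi>)) (cls g))"
      unfolding set_integrable_def
      by (rule borel_integrable_compact) (auto intro!: continuous_intros shift_line_continuous)
    from set_borel_integral_eq_integral(2)[OF this] show ?thesis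
      by (simp add: set_lebesgue_integral_def)
  qed
  also have "\<dots> = inner (av l h (cls \<psi>)) (cls g)" by (rule inner_av[symmetric])
  also have "\<dots> = inner G0 (?P (av l h (cls \<psi>)))"
    by (rule sym[symmetric])
  finally show "inner G0 (?P (cls f)) = inner G0 (?P (av l h (cls \<psi>)))" .
qed

lemma rep_av:
  fixes \<psi> :: "real^3 \<Rightarrow> 'b::euclidean_space"
  assumes \<psi>: "\<psi> \<in> Sq"
  shows "AE y in cubeM. rep (av l h (cls \<psi>)) y = (LINT s|lborel. indicator {0..h} s *\<^sub>R \<psi> (fr (y + s *\<^sub>R ax l)))"
proof -
  define f where "f y = (LINT s|lborel. indicator {0..h} s *\<^sub>R \<psi> (fr (y + s *\<^sub>R ax l)))" for y
  have [measurable]: "f \<in> borel_measurable borel" unfolding f_def by (rule line_integrable(2)[OF \<psi>])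
  define A where "A n = {y. norm (f y) \<le> real n}" for n
  have A [measurable]: "A n \<in> sets borel" for n
  proof -
    have "{y \<in> space borel. norm (f y) \<le> real n} \<in> sets borel" by measurable
    then show ?thesis by (simp add: A_def)
  qed
  have "AE y in cubeM. y \<in> A n \<longrightarrow> rep (av l h (cls \<psi>)) y = f y" for n
  proof -
    define F where "F y = indicator (A n) y *\<^sub>R f y" for y
    have F: "F \<in> Sq"
      by (rule Sq_bounded[where c = "real n"]) (auto simp: F_def[abs_def] A_def indicator_def)
    note L = lin_field_indicator[OF A, of n]
    have "pw (\<lambda>y v. indicator (A n) y *\<^sub>R v) (cls F) = pw (\<lambda>y v. indicator (A n) y *\<^sub>R v) (av l h (cls \<psi>))"
      by (rule cls_eq_av[OF F \<psi> A]) (auto simp: F_def f_def)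
    then have "cls (\<lambda>y. indicator (A n) y *\<^sub>R F y) = cls (\<lambda>y. indicator (A n) y *\<^sub>R rep (av l h (cls \<psi>)) y)"
      using pw_cls[OF L F] by (simp add: pw_def)
    then have "AE y in cubeM. indicator (A n) y *\<^sub>R F y = indicator (A n) y *\<^sub>R rep (av l h (cls \<psi>)) y"
      using cls_eq_iff[OF lin_field_Sq[OF L F] lin_field_Sq[OF L rep_Sq[of "av l h (cls \<psi>)"]]] by simp
    then show ?thesis by eventually_elim (auto simp: F_def)
  qed
  then have "AE y in cubeM. \<forall>n. y \<in> A n \<longrightarrow> rep (av l h (cls \<psi>)) y = f y"
    by (subst AE_all_countable) blast
  then show ?thesis
  proof eventually_elim
    case (elim y)
    obtain n where "norm (f y) \<le> real n" using real_arch_simple by blast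
    then show ?case using elim by (auto simp: A_def f_def)
  qed
qed

section \<open>Poincare inequality\<close>

lemma shift_vector_bound:
  assumes D: "\<And>l h. h \<ge> 0 \<Longrightarrow> norm (shift (h *\<^sub>R ax l) w - w) \<le> h * g l" and z: "z \<in> unit_cube"
  shows "norm (shift z w - w) \<le> (\<Sum>l\<in>UNIV. g l)"
proof -
  have z3: "z = (z $ 1) *\<^sub>R ax 1 + ((z $ 2) *\<^sub>R ax 2 + (z $ 3) *\<^sub>R ax 3)"
    by (simp add: vec_eq_iff axis_def forall_3)
  have b: "norm (shift ((z $ l) *\<^sub>R ax l) w - w) \<le> g l" for l
  proof -
    have "0 \<le> z $ l" "z $ l \<le> 1" using z by (auto simp: unit_cube_def less_imp_le)
    moreover have "0 \<le> g l" using order_trans[OF norm_ge_zero D[of 1 l]] by simp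
    ultimately show ?thesis using D[of "z $ l" l] mult_left_le_one_le[of "g l" "z $ l"] by linarith
  qed
  have "shift z w - w = shift ((z $ 1) *\<^sub>R ax 1) (shift ((z $ 2) *\<^sub>R ax 2) (shift ((z $ 3) *\<^sub>R ax 3) w - w))
      + (shift ((z $ 1) *\<^sub>R ax 1) (shift ((z $ 2) *\<^sub>R ax 2) w - w) + (shift ((z $ 1) *\<^sub>R ax 1) w - w))"
    by (subst z3) (simp add: shift_diff shift_shift add.assoc)
  then have "norm (shift z w - w) \<le> norm (shift ((z $ 3) *\<^sub>R ax 3) w - w)
      + (norm (shift ((z $ 2) *\<^sub>R ax 2) w - w) + norm (shift ((z $ 1) *\<^sub>R ax 1) w - w))"
    by (simp only:) (intro order_trans[OF norm_triangle_ineq] add_mono; simp)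
  also have "\<dots> \<le> g 3 + (g 2 + g 1)" by (intro add_mono b)
  finally show ?thesis by (simp add: sum_3)
qed

text \<open>The squared norm of \<open>f (fr (y + z)) - f y\<close>, averaged over both variables,
  is twice the squared norm of \<open>w\<close>, because the mean is zero. For fixed
  \<open>z\<close> its average over \<open>y\<close> is at most the square of the sum of the
  directional bounds. This gives an explicit constant without a compactness argument.\<close>

lemma poincare:
  fixes w :: "'b::euclidean_space l2"
  assumes D: "\<And>l h. h \<ge> 0 \<Longrightarrow> norm (shift (h *\<^sub>R ax l) w - w) \<le> h * g l"
    and mean: "(\<integral>y. rep w y \<partial>cubeM) = 0"
  shows "norm w \<le> (\<Sum>l\<in>UNIV. g l)"
proof -
  define K where "K = (\<Sum>l\<in>UNIV. g l)"
  have "0 \<le> g l" for l using order_trans[OF norm_ge_zero D[of 1 l]] by simp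
  then have K: "K \<ge> 0" unfolding K_def by (intro sum_nonneg)
  define f where "f = rep w"
  have fS: "f \<in> Sq" and wf: "w = cls f" by (auto simp: f_def)
  have [measurable]: "f \<in> borel_measurable borel" by (simp add: f_def)
  have [measurable]: "(\<lambda>y. y) \<in> borel_measurable cubeM" by measurable
  have dS: "(\<lambda>y. f (fr (y + z)) - f y) \<in> Sq" for z by (intro Sq_diff Sq_shift fS)
  have "norm (shift z w - w) \<le> K" if "z \<in> unit_cube" for z
    unfolding K_def by (rule shift_vector_bound[OF D that])
  then have 1: "(\<integral>\<^sup>+y. ennreal ((norm (f (fr (y + z)) - f y))\<^sup>2) \<partial>cubeM) \<le> ennreal (K\<^sup>2)" if "z \<in> unit_cube" for z
  proof -
    have "(\<integral>\<^sup>+y. ennreal ((norm (f (fr (y + z)) - f y))\<^sup>2) \<partial>cubeM) = ennreal ((norm (shift z w - w))\<^sup>2)"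
    proof -
      have "shift z w - w = cls (\<lambda>y. f (fr (y + z)) - f y)"
        unfolding wf shift_cls[OF fS] by (rule cls_diff[OF Sq_shift[OF fS] fS])
      then show ?thesis
        using dS[of z] by (simp add: norm_cls[OF dS]) (auto simp: Sq_def intro!: nn_integral_eq_integral)
    qed
    then show ?thesis using \<open>\<And>z. z \<in> unit_cube \<Longrightarrow> norm (shift z w - w) \<le> K\<close>[OF that]
      by (auto intro!: ennreal_leI power_mono)
  qed
  have 2: "(\<integral>\<^sup>+z. ennreal ((norm (f (fr (y + z)) - f y))\<^sup>2) \<partial>cubeM) = ennreal ((norm w)\<^sup>2 + (norm (f y))\<^sup>2)" for y
  proof -
    have "(\<integral>\<^sup>+z. ennreal ((norm (f (fr (y + z)) - f y))\<^sup>2) \<partial>cubeM) = (\<integral>\<^sup>+z. (\<lambda>z. ennreal ((norm (f z - f y))\<^sup>2)) (fr (z + y)) \<partial>cubeM)"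
      by (simp add: add.commute)
    also have "\<dots> = (\<integral>\<^sup>+z. ennreal ((norm (f z - f y))\<^sup>2) \<partial>cubeM)"
      by (rule nn_integral_shift) measurable
    also have "\<dots> = ennreal (\<integral>z. (norm (f z - f y))\<^sup>2 \<partial>cubeM)"
      using Sq_diff[OF fS Sq_const[of "f y"]] by (intro nn_integral_eq_integral) (auto simp: Sq_def)
    also have "(\<integral>z. (norm (f z - f y))\<^sup>2 \<partial>cubeM) = (\<integral>z. (norm (f z))\<^sup>2 - 2 * inner (f z) (f y) + (norm (f y))\<^sup>2 \<partial>cubeM)"
      by (rule Bochner_Integration.integral_cong[OF refl])
         (simp add: power2_norm_eq_inner inner_diff_left inner_diff_right inner_commute)
    also have "\<dots> = (\<integral>z. (norm (f z))\<^sup>2 \<partial>cubeM) - 2 * (\<integral>z. inner (f z) (f y) \<partial>cubeM) + (\<integral>z. (norm (f y))\<^sup>2 \<partial>cubeM)"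
      using fS Sq_integrable_inner[OF fS Sq_const[of "f y"]] by (simp add: Sq_def)
    also have "(\<integral>z. inner (f z) (f y) \<partial>cubeM) = inner (\<integral>z. f z \<partial>cubeM) (f y)"
      using Sq_integrable[OF fS] by (intro integral_inner_left)
    also have "(\<integral>z. f z \<partial>cubeM) = 0" using mean by (simp add: f_def)
    also have "(\<integral>z. (norm (f y))\<^sup>2 \<partial>cubeM) = (norm (f y))\<^sup>2"
      by (simp add: measure_def emeasure_cubeM)
    also have "(\<integral>z. (norm (f z))\<^sup>2 \<partial>cubeM) = (norm w)\<^sup>2" using fS by (simp add: wf norm_cls)
    finally show ?thesis by simp
  qed
  interpret pair_sigma_finite cubeM cubeM
    by (intro pair_sigma_finite.intro cubeM.sigma_finite_measure_axioms)
  have "(\<integral>\<^sup>+z. \<integral>\<^sup>+y. ennreal ((norm (f (fr (y + z)) - f y))\<^sup>2) \<partial>cubeM \<partial>cubeM)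
     = (\<integral>\<^sup>+y. \<integral>\<^sup>+z. ennreal ((norm (f (fr (y + z)) - f y))\<^sup>2) \<partial>cubeM \<partial>cubeM)"
    by (rule Fubini') measurable
  also have "\<dots> = (\<integral>\<^sup>+y. ennreal ((norm w)\<^sup>2) + ennreal ((norm (f y))\<^sup>2) \<partial>cubeM)" by (simp add: 2)
  also have "\<dots> = ennreal ((norm w)\<^sup>2) + ennreal ((norm w)\<^sup>2)"
  proof -
    have "(\<integral>\<^sup>+y. ennreal ((norm (f y))\<^sup>2) \<partial>cubeM) = ennreal ((norm w)\<^sup>2)"
      using fS unfolding wf norm_cls[OF fS] by (intro nn_integral_eq_integral) (auto simp: Sq_def)
    then show ?thesis by (subst nn_integral_add) (auto simp: emeasure_cubeM)
  qed
  finally have "ennreal ((norm w)\<^sup>2) + ennreal ((norm w)\<^sup>2) = (\<integral>\<^sup>+z. \<integral>\<^sup>+y. ennreal ((norm (f (fr (y + z)) - f y))\<^sup>2) \<partial>cubeM \<partial>cubeM)"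
    by simp
  also have "\<dots> \<le> (\<integral>\<^sup>+z. ennreal (K\<^sup>2) \<partial>cubeM)"
    using 1 by (intro nn_integral_mono) simp
  also have "\<dots> = ennreal (K\<^sup>2)" by (simp add: emeasure_cubeM)
  finally have "ennreal ((norm w)\<^sup>2) + ennreal ((norm w)\<^sup>2) \<le> ennreal (K\<^sup>2)" .
  then have "ennreal ((norm w)\<^sup>2 + (norm w)\<^sup>2) \<le> ennreal (K\<^sup>2)"
    by (subst ennreal_plus) simp_all
  then have "(norm w)\<^sup>2 + (norm w)\<^sup>2 \<le> K\<^sup>2" by simp
  then have "(norm w)\<^sup>2 \<le> K\<^sup>2" using zero_le_power2[of "norm w"] by linarith
  then show ?thesis using K unfolding K_def by (rule power2_le_imp_le)
qed

section \<open>Gradient fields on the torus\<close>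

lemma lin_field_const:
  assumes "linear L" "\<And>v. norm (L v) \<le> c * norm v"
  shows "lin_field (\<lambda>y. L) c"
  using assms by (auto simp: lin_field_def)

definition cmp0 :: "3 \<Rightarrow> real^('m \<times> 3) \<Rightarrow> real^'m" where
  "cmp0 l v = (\<chi> a. v $ (a, l))"

definition emb0 :: "3 \<Rightarrow> real^'m \<Rightarrow> real^('m \<times> 3)" where
  "emb0 l u = (\<chi> p. if snd p = l then u $ fst p else 0)"

lemma norm_vec_prod: "(norm (v :: real^('m::finite \<times> 3)))\<^sup>2 = (\<Sum>l\<in>UNIV. (norm (cmp0 l v))\<^sup>2)"
proof -
  have "(\<Sum>l\<in>UNIV. (norm (cmp0 l v))\<^sup>2) = (\<Sum>l\<in>UNIV. \<Sum>a\<in>UNIV. (v $ (a, l))\<^sup>2)"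
    unfolding cmp0_def power2_norm_eq_inner inner_vec_def by (simp add: power2_eq_square)
  also have "\<dots> = (\<Sum>a\<in>UNIV. \<Sum>l\<in>UNIV. (v $ (a, l))\<^sup>2)" by (rule sum.swap)
  also have "\<dots> = (\<Sum>p\<in>UNIV \<times> UNIV. (v $ p)\<^sup>2)" by (simp add: sum.cartesian_product)
  also have "\<dots> = (norm v)\<^sup>2"
    unfolding power2_norm_eq_inner inner_vec_def by (simp add: power2_eq_square)
  finally show ?thesis ..
qed

lemma lin_field_cmp0: "lin_field (\<lambda>y. cmp0 l :: real^('m::finite \<times> 3) \<Rightarrow> _) 1"
proof (rule lin_field_const)
  show "linear (cmp0 l :: real^('m \<times> 3) \<Rightarrow> _)"
    by (rule linearI) (simp_all add: cmp0_def vec_eq_iff)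
  show "norm (cmp0 l v) \<le> 1 * norm v" for v :: "real^('m \<times> 3)"
  proof -
    have "(norm (cmp0 l v))\<^sup>2 \<le> (norm v)\<^sup>2"
      unfolding norm_vec_prod[of v] by (rule member_le_sum) auto
    from power2_le_imp_le[OF this norm_ge_zero] show ?thesis by simp
  qed
qed

lemma cmp0_emb0: "cmp0 l (emb0 l' u) = (if l = l' then u else 0)"
  by (simp add: cmp0_def emb0_def vec_eq_iff)

lemma lin_field_emb0: "lin_field (\<lambda>y. emb0 l :: real^'m::finite \<Rightarrow> _) 1"
proof (rule lin_field_const)
  show "linear (emb0 l :: real^'m \<Rightarrow> _)"
    by (rule linearI) (simp_all add: emb0_def vec_eq_iff)
  show "norm (emb0 l v) \<le> 1 * norm v" for v :: "real^'m"
  proof -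
    have "(norm (emb0 l v))\<^sup>2 = (\<Sum>l'\<in>UNIV. if l' = l then (norm v)\<^sup>2 else 0)"
      unfolding norm_vec_prod cmp0_emb0 by (rule sum.cong) auto
    then have "(norm (emb0 l v))\<^sup>2 = (norm v)\<^sup>2" by simp
    then show ?thesis by (simp add: power2_eq_iff_nonneg)
  qed
qed

definition cmp :: "3 \<Rightarrow> (real^('m::finite \<times> 3)) l2 \<Rightarrow> (real^'m) l2" where
  "cmp l = pw (\<lambda>y. cmp0 l)"

definition emb :: "3 \<Rightarrow> (real^'m::finite) l2 \<Rightarrow> (real^('m \<times> 3)) l2" where
  "emb l = pw (\<lambda>y. emb0 l)"

lemma cmp_cls: "f \<in> Sq \<Longrightarrow> cmp l (cls f) = cls (\<lambda>y. cmp0 l (f y))"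
  unfolding cmp_def by (rule pw_cls[OF lin_field_cmp0])

lemma emb_cls: "f \<in> Sq \<Longrightarrow> emb l (cls f) = cls (\<lambda>y. emb0 l (f y))"
  unfolding emb_def by (rule pw_cls[OF lin_field_emb0])

lemma bounded_linear_cmp: "bounded_linear (cmp l)"
  unfolding cmp_def by (rule bounded_linear_pw[OF lin_field_cmp0])

lemma bounded_linear_emb: "bounded_linear (emb l)"
  unfolding emb_def by (rule bounded_linear_pw[OF lin_field_emb0])

lemma norm_cmp: "norm (cmp l F) \<le> norm F"
  unfolding cmp_def using norm_pw[OF lin_field_cmp0, of l F] by simp

lemma norm_emb: "norm (emb l F) \<le> norm F"
  unfolding emb_def using norm_pw[OF lin_field_emb0, of l F] by simp

lemma shift_cmp: "shift z (cmp l F) = cmp l (shift z F)"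
  unfolding cmp_def by (rule shift_pw_commute[OF lin_field_cmp0]) simp

lemma shift_emb: "shift z (emb l F) = emb l (shift z F)"
  unfolding emb_def by (rule shift_pw_commute[OF lin_field_emb0]) simp

lemma cmp_emb: "cmp l (emb l' F) = (if l = l' then F else 0)"
proof -
  obtain f where f: "F = cls f" "f \<in> Sq" by (metis l2_obtain)
  have "cmp l (emb l' F) = cls (\<lambda>y. cmp0 l (emb0 l' (f y)))"
    unfolding f(1) emb_cls[OF f(2)] by (rule cmp_cls[OF lin_field_Sq[OF lin_field_emb0 f(2)]])
  then show ?thesis by (simp add: cmp0_emb0 f(1) cls_zero)
qed

lemma inner_emb: "inner (emb l F) G = inner F (cmp l G)"
proof -
  have eq: "inner (emb0 l u) v = inner (cmp0 l v) u" for u :: "real^'m::finite" and v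
  proof -
    have "inner (emb0 l u) v = (\<Sum>p\<in>UNIV \<times> UNIV. (if snd p = l then u $ fst p else 0) * v $ p)"
      by (simp add: inner_vec_def emb0_def)
    also have "\<dots> = (\<Sum>a\<in>UNIV. \<Sum>m\<in>UNIV. (if m = l then u $ a * v $ (a, l) else 0))"
      unfolding sum.cartesian_product by (rule sum.cong) auto
    finally show ?thesis by (simp add: inner_vec_def cmp0_def mult.commute)
  qed
  then have "inner (emb l F) G = (\<integral>y. inner (cmp0 l (rep G y)) (rep F y) \<partial>cubeM)"
    unfolding emb_def inner_pw[OF lin_field_emb0] by (simp only: eq)
  also have "\<dots> = inner (cmp l G) F" unfolding cmp_def inner_pw[OF lin_field_cmp0] ..
  finally show ?thesis by (simp add: inner_commute)
qed

lemma l2_eq_cmpI: "(\<And>l. cmp l F = cmp l G) \<Longrightarrow> F = G"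
proof -
  assume *: "\<And>l. cmp l F = cmp l G"
  define f where "f = rep (F - G)"
  have f: "F - G = cls f" "f \<in> Sq" by (auto simp: f_def)
  have "cls (\<lambda>y. cmp0 l (f y)) = cls (\<lambda>_. 0)" for l
    using * linear_diff[OF bounded_linear.linear[OF bounded_linear_cmp], of l F G]
    by (simp add: f(1) cmp_cls[OF f(2)] cls_zero)
  then have "AE y in cubeM. cmp0 l (f y) = 0" for l
    using cls_eq_iff[OF lin_field_Sq[OF lin_field_cmp0 f(2)] Sq_const[of 0]] by blast
  then have "AE y in cubeM. \<forall>l. cmp0 l (f y) = 0" by (simp add: AE_all_countable)
  then have "AE y in cubeM. f y = 0"
    by eventually_elim (auto simp: cmp0_def vec_eq_iff)
  then have "F - G = 0" unfolding f(1) cls_zero[symmetric] by (subst cls_eq_iff) (auto simp: f Sq_const)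
  then show "F = G" by simp
qed

lemma sum_emb_cmp: "(\<Sum>l\<in>UNIV. emb l (cmp l F)) = F"
proof (rule l2_eq_cmpI)
  fix m
  have "cmp m (\<Sum>l\<in>UNIV. emb l (cmp l F)) = (\<Sum>l\<in>UNIV. if l = m then cmp m F else 0)"
    unfolding linear_sum[OF bounded_linear.linear[OF bounded_linear_cmp]] cmp_emb
    by (rule sum.cong) auto
  then show "cmp m (\<Sum>l\<in>UNIV. emb l (cmp l F)) = cmp m F" by simp
qed

lemma norm_le_sum_cmp: "norm F \<le> (\<Sum>l\<in>UNIV. norm (cmp l F))"
proof -
  have "norm F = norm (\<Sum>l\<in>UNIV. emb l (cmp l F))" by (simp add: sum_emb_cmp)
  also have "\<dots> \<le> (\<Sum>l\<in>UNIV. norm (emb l (cmp l F)))" by (rule norm_sum)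
  also have "\<dots> \<le> (\<Sum>l\<in>UNIV. norm (cmp l F))" by (intro sum_mono norm_emb)
  finally show ?thesis .
qed

section \<open>Differences, normalised averages and cut-offs\<close>

definition dif :: "3 \<Rightarrow> real \<Rightarrow> 'b::euclidean_space l2 \<Rightarrow> 'b l2" where
  "dif l h F = shift (h *\<^sub>R ax l) F - F"

lemma bounded_linear_dif: "bounded_linear (dif l h)"
  unfolding dif_def[abs_def] by (intro bounded_linear_sub bounded_linear_shift bounded_linear_ident)

lemmas dif_linear = bounded_linear.linear[OF bounded_linear_dif]

lemma dif_commute: "dif l h (dif m k F) = dif m k (dif l h F)"
  by (simp add: dif_def shift_diff shift_shift add.commute)

lemma dif_cmp: "dif l h (cmp m F) = cmp m (dif l h F)"
  by (simp add: dif_def shift_cmp linear_diff[OF bounded_linear.linear[OF bounded_linear_cmp]])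

lemma dif_emb: "dif l h (emb m F) = emb m (dif l h F)"
  by (simp add: dif_def shift_emb linear_diff[OF bounded_linear.linear[OF bounded_linear_emb]])

lemma shift_dif: "shift z (dif l h F) = dif l h (shift z F)"
  by (simp add: dif_def shift_diff shift_commute)

lemma dif_av: "k \<ge> 0 \<Longrightarrow> dif l h (av m k F) = av m k (dif l h F)"
  by (simp add: dif_def shift_av linear_diff[OF bounded_linear.linear[OF bounded_linear_av]])

lemma norm_dif_uminus: "norm (dif l (- h) F) = norm (dif l h F)"
  using norm_shift_diff_uminus[of "h *\<^sub>R ax l" F] by (simp add: dif_def)

lemma inner_dif_left: "inner (dif l h F) G = inner F (dif l (- h) G)"
  by (simp add: dif_def inner_diff_left inner_diff_right inner_shift_left)

definition avg :: "3 \<Rightarrow> real \<Rightarrow> 'b::euclidean_space l2 \<Rightarrow> 'b l2" where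
  "avg l k F = (1 / k) *\<^sub>R av l k F"

lemma bounded_linear_avg: "k > 0 \<Longrightarrow> bounded_linear (avg l k)"
  unfolding avg_def[abs_def]
  by (intro bounded_linear_compose[OF bounded_linear_scaleR_right] bounded_linear_av) simp

lemma norm_avg: "k > 0 \<Longrightarrow> norm (avg l k F) \<le> norm F"
  using norm_av[of k l F] by (simp add: avg_def divide_le_eq mult.commute)

lemma avg_avg: "k > 0 \<Longrightarrow> avg l k (avg m k F) = avg m k (avg l k F)"
  unfolding avg_def
  by (simp add: linear_cmul[OF bounded_linear.linear[OF bounded_linear_av]] av_av[of k l])

text \<open>Smoothing without mollifiers: by \<open>shift_diff_av\<close> the average over length
  \<open>k\<close> has an \<open>L2\<close> derivative in its own direction, namely the difference
  quotient with step \<open>k\<close>.\<close>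

lemma dif_avg:
  assumes "k > 0" "h \<ge> 0"
  shows "dif l h (avg l k F) = av l h ((1 / k) *\<^sub>R dif l k F)"
proof -
  have "dif l h (av l k F) = av l h (dif l k F)"
    using shift_diff_av[of h k l F] assms dif_av[of h l k l F] by (simp add: dif_def)
  then show ?thesis
    using assms by (simp add: avg_def linear_cmul[OF dif_linear]
        linear_cmul[OF bounded_linear.linear[OF bounded_linear_av]])
qed

text \<open>A null sequence strictly between 0 and 1. The summand 2 excludes the value 1, since
  bounds with the cut-off \<open>Q\<close> are available for \<open>h < 1\<close> only.\<close>

definition hs :: "nat \<Rightarrow> real" where "hs n = 1 / (real n + 2)"

lemma hs: "0 < hs n" "hs n < 1"
  by (auto simp: hs_def)

lemma hs_tendsto: "hs \<longlonglongrightarrow> 0"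
proof -
  have "(\<lambda>n. 1 / real (n + 2)) \<longlonglongrightarrow> 0" by (rule LIMSEQ_ignore_initial_segment[OF lim_const_over_n])
  then show ?thesis by (simp add: hs_def[abs_def] add.commute)
qed

lemma avg_tendsto: "(\<lambda>n. avg l (hs n) F) \<longlonglongrightarrow> F"
proof -
  have "filterlim hs (at_right 0) sequentially"
    using hs_tendsto hs by (auto simp: filterlim_at less_imp_neq[OF hs(1), symmetric])
  from filterlim_compose[OF av_limit this] show ?thesis by (simp add: avg_def)
qed

lemma avg_seq_tendsto:
  assumes "X \<longlonglongrightarrow> F" shows "(\<lambda>n. avg l (hs n) (X n)) \<longlonglongrightarrow> F"
proof -
  have "(\<lambda>n. avg l (hs n) (X n - F)) \<longlonglongrightarrow> 0"
  proof (rule Lim_null_comparison)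
    show "\<forall>\<^sub>F n in sequentially. norm (avg l (hs n) (X n - F)) \<le> norm (X n - F)"
      by (intro always_eventually allI norm_avg hs)
    show "(\<lambda>n. norm (X n - F)) \<longlonglongrightarrow> 0" using assms by (simp add: LIM_zero tendsto_norm_zero)
  qed
  then have "(\<lambda>n. avg l (hs n) (X n - F) + avg l (hs n) F) \<longlonglongrightarrow> 0 + F"
    by (intro tendsto_add avg_tendsto)
  moreover have "avg l (hs n) (X n - F) + avg l (hs n) F = avg l (hs n) (X n)" for n
    by (simp add: linear_diff[OF bounded_linear.linear[OF bounded_linear_avg[OF hs(1)]]])
  ultimately show ?thesis by simp
qed

definition slab :: "3 \<Rightarrow> real \<Rightarrow> (real^3) set" where
  "slab l h = {y. y $ l < 1 - h}"

lemma slab_sets [measurable]: "slab l h \<in> sets borel"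
proof -
  have "{y \<in> space borel. y $ l < 1 - h} \<in> sets borel" by measurable
  then show ?thesis by (simp add: slab_def)
qed

text \<open>Cuts off the points whose translate by \<open>h\<close> in direction \<open>l\<close> crosses a face of the cube.\<close>

definition Q :: "3 \<Rightarrow> real \<Rightarrow> 'b::euclidean_space l2 \<Rightarrow> 'b l2" where
  "Q l h = pw (\<lambda>y v. indicator (slab l h) y *\<^sub>R v)"

lemma bounded_linear_Q: "bounded_linear (Q l h)"
  unfolding Q_def by (rule bounded_linear_pw[OF lin_field_indicator]) measurable

lemmas Q_linear = bounded_linear.linear[OF bounded_linear_Q]

lemma norm_Q: "norm (Q l h F) \<le> norm F"
  unfolding Q_def using norm_pw[OF lin_field_indicator[OF slab_sets[of l h]], of F] by simp

lemma shift_Q: assumes "m \<noteq> l" shows "shift (s *\<^sub>R ax m) (Q l h F) = Q l h (shift (s *\<^sub>R ax m) F)"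
  unfolding Q_def
proof (rule shift_pw_commute[OF lin_field_indicator[OF slab_sets]], rule AE_I2)
  fix y assume "y \<in> space cubeM"
  then have "fr (y + s *\<^sub>R ax m) $ l = y $ l"
    using assms by (simp add: fr_def axis_def unit_cube_def frac_eq)
  then show "\<forall>v. indicator (slab l h) (fr (y + s *\<^sub>R ax m)) *\<^sub>R v = indicator (slab l h) y *\<^sub>R v"
    by (simp add: slab_def indicator_def)
qed

lemma Q_pw:
  assumes A: "lin_field A c"
  shows "Q l h (pw A F) = pw A (Q l h F)"
proof -
  obtain f where f: "F = cls f" "f \<in> Sq" by (metis l2_obtain)
  note L = lin_field_indicator[OF slab_sets, of l h]
  have "linear (A y)" for y using A by (simp add: lin_field_def)
  then show ?thesis
    unfolding Q_def f(1) pw_cls[OF A f(2)] pw_cls[OF L f(2)]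
      pw_cls[OF L lin_field_Sq[OF A f(2)]] pw_cls[OF A lin_field_Sq[OF L f(2)]]
    by (simp add: linear_cmul)
qed

lemma Q_cmp: "Q l h (cmp m F) = cmp m (Q l h F)"
  unfolding cmp_def by (rule Q_pw[OF lin_field_cmp0])

lemma Q_tendsto: "(\<lambda>n. Q l (hs n) F) \<longlonglongrightarrow> F"
proof -
  obtain f where f: "F = cls f" "f \<in> Sq" by (metis l2_obtain)
  note L = lin_field_indicator[OF slab_sets]
  have [measurable]: "f \<in> borel_measurable borel" using f by (auto intro: Sq_measurable)
  have fi: "integrable cubeM (\<lambda>y. (norm (f y))\<^sup>2)" using f by (simp add: Sq_def)
  have n: "(norm (Q l (hs n) F - F))\<^sup>2 = (\<integral>y. (norm (indicator (slab l (hs n)) y *\<^sub>R f y - f y))\<^sup>2 \<partial>cubeM)" for n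
    unfolding Q_def f(1) pw_cls[OF L f(2)] cls_diff[OF lin_field_Sq[OF L f(2)] f(2)]
    by (rule norm_cls[OF Sq_diff[OF lin_field_Sq[OF L f(2)] f(2)]])
  have "(\<lambda>n. \<integral>y. (norm (indicator (slab l (hs n)) y *\<^sub>R f y - f y))\<^sup>2 \<partial>cubeM) \<longlonglongrightarrow> (\<integral>y. 0 \<partial>cubeM)"
  proof (rule integral_dominated_convergence[OF _ _ fi])
    show "AE y in cubeM. (\<lambda>n. (norm (indicator (slab l (hs n)) y *\<^sub>R f y - f y))\<^sup>2) \<longlonglongrightarrow> 0"
    proof (rule AE_I2)
      fix y assume "y \<in> space cubeM"
      then have "0 < 1 - y $ l" by (simp add: unit_cube_def)
      from order_tendstoD(2)[OF hs_tendsto this]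
      have "\<forall>\<^sub>F n in sequentially. (norm (indicator (slab l (hs n)) y *\<^sub>R f y - f y))\<^sup>2 = 0"
        by eventually_elim (auto simp: slab_def)
      then show "(\<lambda>n. (norm (indicator (slab l (hs n)) y *\<^sub>R f y - f y))\<^sup>2) \<longlonglongrightarrow> 0"
        by (rule tendsto_eventually)
    qed
    show "AE y in cubeM. norm ((norm (indicator (slab l (hs n)) y *\<^sub>R f y - f y))\<^sup>2) \<le> (norm (f y))\<^sup>2" for n
      by (rule AE_I2) (simp add: indicator_def)
  qed measurable
  then have "(\<lambda>n. (norm (Q l (hs n) F - F))\<^sup>2) \<longlonglongrightarrow> 0" by (simp add: n)
  then have "(\<lambda>n. sqrt ((norm (Q l (hs n) F - F))\<^sup>2)) \<longlonglongrightarrow> sqrt 0"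
    by (rule tendsto_real_sqrt)
  then have "(\<lambda>n. norm (Q l (hs n) F - F)) \<longlonglongrightarrow> 0" by simp
  then show ?thesis using LIM_zero_cancel tendsto_norm_zero_iff by blast
qed

lemma Q_avg_tendsto: "(\<lambda>n. Q l (hs n) (avg l (hs n) F)) \<longlonglongrightarrow> F"
proof -
  have "(\<lambda>n. Q l (hs n) (avg l (hs n) F - F)) \<longlonglongrightarrow> 0"
  proof (rule Lim_null_comparison)
    show "\<forall>\<^sub>F n in sequentially. norm (Q l (hs n) (avg l (hs n) F - F)) \<le> norm (avg l (hs n) F - F)"
      using norm_Q by (intro always_eventually) auto
    show "(\<lambda>n. norm (avg l (hs n) F - F)) \<longlonglongrightarrow> 0"
      using avg_tendsto[of l F] by (simp add: LIM_zero tendsto_norm_zero)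
  qed
  then have "(\<lambda>n. Q l (hs n) (avg l (hs n) F - F) + Q l (hs n) F) \<longlonglongrightarrow> 0 + F"
    by (intro tendsto_add Q_tendsto)
  then show ?thesis by (simp add: linear_diff[OF Q_linear])
qed

text \<open>Cut-offs and normalised averages both tend to the identity, so a bound of order
  \<open>h\<close> for the cut-off averages bounds the density itself. In this way difference bounds
  away from the faces become bounds on second derivatives.\<close>

lemma norm_le_of_Q_av:
  assumes "\<And>h. 0 < h \<Longrightarrow> h < 1 \<Longrightarrow> norm (Q l h (av l h F)) \<le> K * h"
  shows "norm F \<le> K"
proof (rule LIMSEQ_le_const2[OF tendsto_norm[OF Q_avg_tendsto[of l F]]])
  have "norm (Q l (hs n) (avg l (hs n) F)) \<le> K" for n
    using assms[OF hs(1)[of n] hs(2)[of n]] hs(1)[of n]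
    by (simp add: avg_def linear_cmul[OF Q_linear] divide_le_eq)
  then show "\<exists>N. \<forall>n\<ge>N. norm (Q l (hs n) (avg l (hs n) F)) \<le> K" by blast
qed

text \<open>The integrated form of \<open>\<gamma> = \<nabla>w\<close> on the torus.\<close>

definition GG0 :: "(real^('m::finite \<times> 3)) l2 set" where
  "GG0 = {\<gamma>. \<exists>w. \<forall>l. \<forall>h\<ge>0. dif l h w = av l h (cmp l \<gamma>)}"

text \<open>The closure provides the closed subspace that the Riesz argument requires. Equations
  between bounded operators pass to it from \<open>GG0\<close>, so potentials are only ever used for
  elements of \<open>GG0\<close>.\<close>

definition GG :: "(real^('m::finite \<times> 3)) l2 set" where
  "GG = closure GG0"

lemma subspace_GG0: "subspace (GG0 :: (real^('m::finite \<times> 3)) l2 set)"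
proof (rule subspaceI)
  have cl: "linear (\<lambda>\<gamma> :: (real^('m \<times> 3)) l2. av l h (cmp l \<gamma>))" if "h \<ge> 0" for l h
    using linear_compose[OF bounded_linear.linear[OF bounded_linear_cmp] bounded_linear.linear[OF bounded_linear_av[OF that]]]
    by (simp add: comp_def)
  have "dif l h (0 :: (real^'m) l2) = av l h (cmp l 0)" if "h \<ge> 0" for l h
    using linear_0[OF dif_linear] linear_0[OF cl[OF that]] by simp
  then show "0 \<in> (GG0 :: (real^('m \<times> 3)) l2 set)" unfolding GG0_def by blast
  show "x + y \<in> GG0" if xy: "x \<in> GG0" "y \<in> GG0" for x y :: "(real^('m \<times> 3)) l2"
  proof -
    obtain v w where "\<forall>l. \<forall>h\<ge>0. dif l h v = av l h (cmp l x)" "\<forall>l. \<forall>h\<ge>0. dif l h w = av l h (cmp l y)"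
      using xy unfolding GG0_def by blast
    then have "\<forall>l. \<forall>h\<ge>0. dif l h (v + w) = av l h (cmp l (x + y))"
      by (simp add: linear_add[OF dif_linear] linear_add[OF cl])
    then show ?thesis unfolding GG0_def by blast
  qed
  show "c *\<^sub>R x \<in> GG0" if x: "x \<in> GG0" for c and x :: "(real^('m \<times> 3)) l2"
  proof -
    obtain v where "\<forall>l. \<forall>h\<ge>0. dif l h v = av l h (cmp l x)"
      using x unfolding GG0_def by blast
    then have "\<forall>l. \<forall>h\<ge>0. dif l h (c *\<^sub>R v) = av l h (cmp l (c *\<^sub>R x))"
      by (simp add: linear_cmul[OF dif_linear] linear_cmul[OF cl])
    then show ?thesis unfolding GG0_def by blast
  qed
qed

lemma subspace_closure':
  fixes S :: "'a::real_normed_vector set"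
  assumes S: "subspace S" shows "subspace (closure S)"
proof (rule subspaceI)
  show "0 \<in> closure S" using subspace_0[OF S] closure_subset by blast
  show "x + y \<in> closure S" if "x \<in> closure S" "y \<in> closure S" for x y
  proof -
    obtain a b where "\<forall>n. a n \<in> S" "a \<longlonglongrightarrow> x" "\<forall>n. b n \<in> S" "b \<longlonglongrightarrow> y"
      using \<open>x \<in> closure S\<close> \<open>y \<in> closure S\<close> unfolding closure_sequential by blast
    then show ?thesis unfolding closure_sequential
      by (intro exI[of _ "\<lambda>n. a n + b n"]) (auto intro: tendsto_add subspace_add[OF S])
  qed
  show "c *\<^sub>R x \<in> closure S" if "x \<in> closure S" for c x
  proof -
    obtain a where "\<forall>n. a n \<in> S" "a \<longlonglongrightarrow> x"
      using \<open>x \<in> closure S\<close> unfolding closure_sequential by blast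
    then show ?thesis unfolding closure_sequential
      by (intro exI[of _ "\<lambda>n. c *\<^sub>R a n"]) (auto intro: tendsto_scaleR subspace_scale[OF S])
  qed
qed

lemma subspace_GG: "subspace GG"
  unfolding GG_def by (rule subspace_closure'[OF subspace_GG0])

lemma closed_GG: "closed GG" by (simp add: GG_def)

lemma shift_GG:
  fixes \<gamma> :: "(real^('m::finite \<times> 3)) l2"
  assumes "\<gamma> \<in> GG" shows "shift z \<gamma> \<in> GG"
proof -
  have 0: "shift z g \<in> GG0" if g: "g \<in> GG0" for g :: "(real^('m \<times> 3)) l2"
  proof -
    obtain w where "\<forall>l. \<forall>h\<ge>0. dif l h w = av l h (cmp l g)"
      using g unfolding GG0_def by blast
    then have "\<forall>l. \<forall>h\<ge>0. dif l h (shift z w) = av l h (cmp l (shift z g))"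
      by (simp add: shift_av[symmetric] shift_cmp[symmetric] flip: shift_dif)
    then show ?thesis unfolding GG0_def by blast
  qed
  obtain a where a: "\<forall>n. a n \<in> GG0" "a \<longlonglongrightarrow> \<gamma>"
    using assms unfolding GG_def closure_sequential by blast
  then have "(\<lambda>n. shift z (a n)) \<longlonglongrightarrow> shift z \<gamma>" by (intro bounded_linear.tendsto[OF bounded_linear_shift])
  then show ?thesis unfolding GG_def closure_sequential
    using a(1) 0 by (intro exI[of _ "\<lambda>n. shift z (a n)"]) simp
qed

lemma dif_GG: "\<gamma> \<in> GG \<Longrightarrow> dif l h \<gamma> \<in> GG"
  unfolding dif_def by (intro subspace_diff[OF subspace_GG] shift_GG)

text \<open>Integrated over a rectangle, the equality of mixed derivatives passes to the closure \<open>GG\<close>.\<close>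

lemma curl_identity:
  fixes \<gamma> :: "(real^('m::finite \<times> 3)) l2"
  assumes "\<gamma> \<in> GG" "h \<ge> 0" "k \<ge> 0"
  shows "dif i h (av j k (cmp j \<gamma>)) = dif j k (av i h (cmp i \<gamma>))"
proof -
  have bl: "bounded_linear (\<lambda>\<gamma> :: (real^('m \<times> 3)) l2. dif i h (av j k (cmp j \<gamma>)))" if "k \<ge> 0" for i j h k
    by (intro bounded_linear_compose[OF bounded_linear_dif] bounded_linear_compose[OF bounded_linear_av[OF that]] bounded_linear_cmp)
  have "GG \<subseteq> {\<gamma> :: (real^('m \<times> 3)) l2. dif i h (av j k (cmp j \<gamma>)) = dif j k (av i h (cmp i \<gamma>))}"
    unfolding GG_def
  proof (rule closure_minimal)
    show "GG0 \<subseteq> {\<gamma> :: (real^('m \<times> 3)) l2. dif i h (av j k (cmp j \<gamma>)) = dif j k (av i h (cmp i \<gamma>))}"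
    proof
      fix g :: "(real^('m \<times> 3)) l2" assume "g \<in> GG0"
      then obtain w where w: "\<forall>l. \<forall>h\<ge>0. dif l h w = av l h (cmp l g)"
        unfolding GG0_def by blast
      show "g \<in> {\<gamma> :: (real^('m \<times> 3)) l2. dif i h (av j k (cmp j \<gamma>)) = dif j k (av i h (cmp i \<gamma>))}"
        using w assms dif_commute[of i h j k w] by simp
    qed
    show "closed {\<gamma> :: (real^('m \<times> 3)) l2. dif i h (av j k (cmp j \<gamma>)) = dif j k (av i h (cmp i \<gamma>))}"
      using assms by (intro closed_Collect_eq linear_continuous_on bl) auto
  qed
  then show ?thesis using assms(1) by auto
qed

text \<open>By \<open>curl_identity\<close> the difference of component \<open>j\<close> in
  direction \<open>i\<close>, averaged over a short segment in direction \<open>j\<close>, is the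
  average in direction \<open>i\<close> of a difference of component \<open>i\<close> in direction
  \<open>j\<close>. Dividing by the length of the segment and letting it tend to zero exchanges the
  two indices in the bound.\<close>

lemma curl_bound:
  assumes \<gamma>: "\<gamma> \<in> GG" and K: "\<And>k. k \<ge> 0 \<Longrightarrow> norm (dif j k (cmp i \<gamma>)) \<le> K * k" and h: "h \<ge> 0"
  shows "norm (dif i h (cmp j \<gamma>)) \<le> K * h"
proof (rule LIMSEQ_le_const2[OF tendsto_norm[OF avg_tendsto[of j "dif i h (cmp j \<gamma>)"]]])
  have "norm (avg j (hs n) (dif i h (cmp j \<gamma>))) \<le> K * h" for n
  proof -
    let ?k = "hs n"
    have k: "?k > 0" "?k \<ge> 0" using hs(1)[of n] by auto
    have "av j ?k (dif i h (cmp j \<gamma>)) = av i h (dif j ?k (cmp i \<gamma>))"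
      using curl_identity[OF \<gamma> h k(2), of i j] h k by (simp add: dif_av)
    then have "norm (av j ?k (dif i h (cmp j \<gamma>))) \<le> h * (K * ?k)"
      using norm_av[OF h, of i "dif j ?k (cmp i \<gamma>)"] mult_left_mono[OF K[OF k(2)] h] by simp
    then show ?thesis using k by (simp add: avg_def divide_le_eq mult.commute mult.left_commute)
  qed
  then show "\<exists>N. \<forall>n\<ge>N. norm (avg j (hs n) (dif i h (cmp j \<gamma>))) \<le> K * h" by blast
qed

section \<open>Elliptic regularity away from one family of faces\<close>

lemma Q_av: assumes "m \<noteq> l" "h \<ge> 0" shows "Q l k (av m h F) = av m h (Q l k F)"
  by (rule av_bounded_linear_commute[OF bounded_linear_Q]) (rule shift_Q[symmetric, OF assms(1)])

text \<open>The second derivatives of a periodic \<open>H\<^sup>1\<close> function that is \<open>H\<^sup>2\<close> inside the cell may jump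
  across the faces, but only the pure ones: a jump of \<open>\<partial>\<^sub>i w\<close> across a face orthogonal to \<open>j \<noteq> i\<close> would be
  seen by the tangential derivative \<open>\<partial>\<^sub>i\<close> of the continuous trace of \<open>w\<close>.\<close>

lemma mixed_difference:
  assumes w: "\<And>l h. h \<ge> 0 \<Longrightarrow> dif l h w = av l h (g l)"
    and loc: "\<And>h. 0 < h \<Longrightarrow> h < 1 \<Longrightarrow> Q i h (dif i h (g j)) = Q i h (av i h G)"
    and ij: "i \<noteq> j" and h: "h \<ge> 0"
  shows "dif j h (g i) = av j h G"
proof -
  define u where "u = dif j h (g i) - av j h G"
  \<comment> \<open>Averaging in direction \<open>i\<close> turns \<open>g i\<close> into a
    difference of \<open>w\<close>, for which the directions \<open>i\<close> and \<open>j\<close>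
    can be exchanged. What is left is a difference of \<open>g j\<close> in direction
    \<open>i\<close>, to which \<open>loc\<close> applies.\<close>
  have "Q i k (av i k u) = 0" if k: "0 < k" "k < 1" for k
  proof -
    have k0: "k \<ge> 0" using k by simp
    have "av i k u = dif j h (av i k (g i)) - av j h (av i k G)"
      using k0 by (simp add: u_def linear_diff[OF bounded_linear.linear[OF bounded_linear_av]] dif_av av_av[OF k0])
    also have "dif j h (av i k (g i)) = dif i k (av j h (g j))"
      unfolding w[OF k0, of i, symmetric] w[OF h, of j, symmetric] by (rule dif_commute)
    also have "\<dots> = av j h (dif i k (g j))" by (rule dif_av[OF h])
    finally have "Q i k (av i k u) = av j h (Q i k (dif i k (g j))) - av j h (Q i k (av i k G))"
      using ij h by (simp add: linear_diff[OF Q_linear] Q_av)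
    then show ?thesis using loc[OF k] by simp
  qed
  then have "Q i (hs n) (avg i (hs n) u) = 0" for n
    using hs by (simp add: avg_def linear_cmul[OF Q_linear])
  then have "u = 0" using LIMSEQ_unique[OF Q_avg_tendsto[of i u]] by simp
  then show ?thesis by (simp add: u_def)
qed

lemma other_axes:
  obtains j m :: 3 where "i \<noteq> j" "i \<noteq> m" "j \<noteq> m" "\<And>l. l = i \<or> l = j \<or> l = m"
proof -
  consider "i = 1" | "i = 2" | "i = 3" using exhaust_3 by blast
  then show ?thesis
  proof cases
    case 1 show ?thesis by (rule that[of 2 3]) (use 1 exhaust_3 in auto)
  next
    case 2 show ?thesis by (rule that[of 1 3]) (use 2 exhaust_3 in auto)
  next
    case 3 show ?thesis by (rule that[of 1 2]) (use 3 exhaust_3 in auto)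
  qed
qed

text \<open>The potential is \<open>\<phi>\<close> averaged in all three directions; by
  \<open>dif_avg\<close> each partial derivative replaces one of the averages by a difference
  quotient. An arbitrary class \<open>\<phi>\<close> thus yields genuine elements of
  \<open>GG0\<close> to test with.\<close>

lemma avg_gradient:
  fixes \<phi> :: "(real^'m::finite) l2"
  assumes d: "i \<noteq> j" "i \<noteq> m" "j \<noteq> m" and all: "\<And>l. l = i \<or> l = j \<or> l = m" and k: "k > 0"
  shows "emb i ((1/k) *\<^sub>R dif i k (avg j k (avg m k \<phi>))) + emb j ((1/k) *\<^sub>R dif j k (avg i k (avg m k \<phi>)))
     + emb m ((1/k) *\<^sub>R dif m k (avg i k (avg j k \<phi>))) \<in> GG0"
    (is "?\<gamma> \<in> GG0")
proof -
  define w where "w = avg i k (avg j k (avg m k \<phi>))"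
  have w: "w = avg j k (avg i k (avg m k \<phi>))" "w = avg m k (avg i k (avg j k \<phi>))"
    unfolding w_def using k by (simp_all add: avg_avg)
  note cadd = linear_add[OF bounded_linear.linear[OF bounded_linear_cmp]]
  have c: "cmp i ?\<gamma> = (1/k) *\<^sub>R dif i k (avg j k (avg m k \<phi>))"
    "cmp j ?\<gamma> = (1/k) *\<^sub>R dif j k (avg i k (avg m k \<phi>))"
    "cmp m ?\<gamma> = (1/k) *\<^sub>R dif m k (avg i k (avg j k \<phi>))"
    using d by (simp_all add: cadd cmp_emb)
  have "dif l h w = av l h (cmp l ?\<gamma>)" if h: "h \<ge> 0" for l h
  proof -
    consider "l = i" | "l = j" | "l = m" using all by blast
    then show ?thesis
    proof cases
      case 1 show ?thesis unfolding 1 c(1) w_def by (rule dif_avg[OF k h])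
    next
      case 2 show ?thesis unfolding 2 c(2) w(1) by (rule dif_avg[OF k h])
    next
      case 3 show ?thesis unfolding 3 c(3) w(2) by (rule dif_avg[OF k h])
    qed
  qed
  then show ?thesis unfolding GG0_def by blast
qed

text \<open>A solenoidal field has a normal component that is as regular across a face as the tangential
  derivatives allow, so it does not jump there.\<close>

lemma flux_bound:
  fixes p :: "(real^('m::finite \<times> 3)) l2"
  assumes orth: "\<And>\<gamma>. \<gamma> \<in> GG \<Longrightarrow> inner p \<gamma> = 0" and K: "K \<ge> 0"
    and tang: "\<And>j h. j \<noteq> i \<Longrightarrow> h \<ge> 0 \<Longrightarrow> norm (dif j h p) \<le> K * h" and h: "h \<ge> 0"
  shows "norm (dif i h (cmp i p)) \<le> 2 * K * h"
proof -
  obtain j m where d: "i \<noteq> j" "i \<noteq> m" "j \<noteq> m" and all: "\<And>l. l = i \<or> l = j \<or> l = m"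
    using other_axes by blast
  have U: "UNIV = {i, j, m}" using all by auto
  define \<phi>0 where "\<phi>0 = dif i h (cmp i p)"
  \<comment> \<open>Formally \<open>\<phi>\<close> integrates \<open>\<phi>0\<close> over the
    segment of length \<open>h\<close> behind the point, so its derivative in direction
    \<open>i\<close> is \<open>- dif i (- h) \<phi>0\<close>. Paired with \<open>cmp i p\<close>
    this gives \<open>- (norm \<phi>0)\<^sup>2\<close>. The two tangential terms are at most
    \<open>K * norm \<phi>\<close> each, and \<open>norm \<phi> \<le> h * norm \<phi>0\<close>,
    whence the factor 2. The averages at scale \<open>k\<close> below serve to make the test field
    admissible.\<close>
  define \<phi> where "\<phi> = shift (- (h *\<^sub>R ax i)) (av i h \<phi>0)"
  have n\<phi>: "norm \<phi> \<le> h * norm \<phi>0" unfolding \<phi>_def using norm_av[OF h] by simp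
  have bound: "\<bar>inner \<phi>0 (avg i (hs n) (avg j (hs n) (avg m (hs n) \<phi>0)))\<bar> \<le> 2 * K * h * norm \<phi>0" for n
  proof -
    define k where "k = hs n"
    have k: "k > 0" "k \<ge> 0" using hs(1)[of n] by (auto simp: k_def)
    define \<gamma> where "\<gamma> = emb i ((1/k) *\<^sub>R dif i k (avg j k (avg m k \<phi>))) + emb j ((1/k) *\<^sub>R dif j k (avg i k (avg m k \<phi>)))
     + emb m ((1/k) *\<^sub>R dif m k (avg i k (avg j k \<phi>)))"
    have "\<gamma> \<in> GG" unfolding \<gamma>_def GG_def using avg_gradient[OF d all k(1)] closure_subset by blast
    then have 0: "inner p \<gamma> = 0" by (rule orth)
    have e: "inner p (emb l X) = inner (cmp l p) X" for l X
      using inner_emb[of l X p] by (simp add: inner_commute)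
    define \<Psi> where "\<Psi> = avg j k (avg m k \<phi>0)"
    define Z where "Z = avg i k \<Psi>"
    have shift_avg: "shift z (avg l k X) = avg l k (shift z X)" for z l and X :: "(real^'m) l2"
      by (simp add: avg_def shift_scaleR shift_av)
    have av_avg: "avg l k (av q h X) = av q h (avg l k X)" for l q and X :: "(real^'m) l2"
      using k h by (simp add: avg_def linear_cmul[OF bounded_linear.linear[OF bounded_linear_av]] av_av[of k l])
    have "avg j k (avg m k \<phi>) = shift (- (h *\<^sub>R ax i)) (av i h \<Psi>)"
      unfolding \<phi>_def \<Psi>_def by (simp add: shift_avg[symmetric] av_avg)
    then have "(1/k) *\<^sub>R dif i k (avg j k (avg m k \<phi>)) = shift (- (h *\<^sub>R ax i)) (av i h ((1/k) *\<^sub>R dif i k \<Psi>))"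
      using h by (simp add: shift_dif[symmetric] shift_scaleR dif_av linear_cmul[OF bounded_linear.linear[OF bounded_linear_av]])
    also have "av i h ((1/k) *\<^sub>R dif i k \<Psi>) = dif i h Z"
      unfolding Z_def by (rule dif_avg[OF k(1) h, symmetric])
    also have "shift (- (h *\<^sub>R ax i)) (dif i h Z) = - dif i (- h) Z"
      by (simp add: dif_def shift_diff shift_shift)
    finally have i: "inner (cmp i p) ((1/k) *\<^sub>R dif i k (avg j k (avg m k \<phi>))) = - inner \<phi>0 Z"
      using inner_dif_left[of i h "cmp i p" Z] by (simp add: \<phi>0_def)
    have t: "\<bar>inner (cmp l p) ((1/k) *\<^sub>R dif l k \<Theta>)\<bar> \<le> K * h * norm \<phi>0"
      if l: "l \<noteq> i" and \<Theta>: "norm \<Theta> \<le> norm \<phi>" for l \<Theta>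
    proof -
      have "norm (dif l (- k) (cmp l p)) = norm (dif l k (cmp l p))" by (rule norm_dif_uminus)
      also have "\<dots> = norm (cmp l (dif l k p))" by (simp only: dif_cmp)
      also have "\<dots> \<le> K * k" by (rule order_trans[OF norm_cmp tang[OF l k(2)]])
      finally have "norm (dif l (- k) (cmp l p)) \<le> K * k" .
      then have "\<bar>inner (dif l (- k) (cmp l p)) \<Theta>\<bar> \<le> (K * k) * (h * norm \<phi>0)"
        using order_trans[OF \<Theta> n\<phi>] K k h
        by (intro order_trans[OF Cauchy_Schwarz_ineq2] mult_mono) auto
      moreover have "inner (cmp l p) ((1/k) *\<^sub>R dif l k \<Theta>) = (1/k) * inner (dif l (- k) (cmp l p)) \<Theta>"
        using inner_dif_left[of l "- k" "cmp l p" \<Theta>] by simp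
      ultimately show ?thesis
        using k by (simp add: abs_mult divide_le_eq mult.commute mult.left_commute)
    qed
    have n2: "norm (avg a k (avg b k \<phi>)) \<le> norm \<phi>" for a b
      using norm_avg[OF k(1), of a "avg b k \<phi>"] norm_avg[OF k(1), of b \<phi>] by linarith
    have "inner \<phi>0 Z = inner (cmp j p) ((1/k) *\<^sub>R dif j k (avg i k (avg m k \<phi>)))
       + inner (cmp m p) ((1/k) *\<^sub>R dif m k (avg i k (avg j k \<phi>)))"
      using 0 unfolding \<gamma>_def inner_add_right e i by linarith
    then have "\<bar>inner \<phi>0 Z\<bar> \<le> K * h * norm \<phi>0 + K * h * norm \<phi>0"
      using t[OF d(1)[symmetric] n2[of i m]] t[OF d(2)[symmetric] n2[of i j]] by linarith
    then show ?thesis by (simp add: Z_def \<Psi>_def k_def)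
  qed
  have "(\<lambda>n. avg i (hs n) (avg j (hs n) (avg m (hs n) \<phi>0))) \<longlonglongrightarrow> \<phi>0"
    by (intro avg_seq_tendsto avg_tendsto)
  then have "(\<lambda>n. \<bar>inner \<phi>0 (avg i (hs n) (avg j (hs n) (avg m (hs n) \<phi>0)))\<bar>) \<longlonglongrightarrow> \<bar>inner \<phi>0 \<phi>0\<bar>"
    by (intro tendsto_intros)
  then have "\<bar>inner \<phi>0 \<phi>0\<bar> \<le> 2 * K * h * norm \<phi>0"
    by (rule LIMSEQ_le_const2) (use bound in blast)
  then have "norm \<phi>0 * norm \<phi>0 \<le> (2 * K * h) * norm \<phi>0"
    by (simp add: power2_norm_eq_inner[symmetric] power2_eq_square)
  then have "norm \<phi>0 \<le> 2 * K * h"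
    using K h by (cases "norm \<phi>0 = 0") (auto simp: mult_le_cancel_right)
  then show ?thesis by (simp add: \<phi>0_def)
qed

text \<open>The properties of a coefficient that the regularity argument uses. Multiplication by a
  Lipschitz matrix has them by \<open>shift_pw_diff\<close> and \<open>Q_pw\<close>, and so does the
  identity, with \<open>L = 0\<close>.\<close>

definition admissible :: "((real^('m::finite \<times> 3)) l2 \<Rightarrow> (real^('m \<times> 3)) l2) \<Rightarrow> real \<Rightarrow> real \<Rightarrow> bool" where
  "admissible M b L \<longleftrightarrow> bounded_linear M \<and> b \<ge> 0 \<and> L \<ge> 0 \<and> (\<forall>u. norm (M u) \<le> b * norm u) \<and>
     (\<forall>l h u. h \<ge> 0 \<longrightarrow> norm (shift (h *\<^sub>R ax l) (M u) - M (shift (h *\<^sub>R ax l) u)) \<le> L * h * norm u) \<and>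
     (\<forall>l h u. Q l h (M u) = M (Q l h u))"

text \<open>A bound on the difference quotients of \<open>\<gamma>\<close>, except for those in direction \<open>i\<close> that straddle
  a face orthogonal to \<open>i\<close>: there \<open>\<gamma>\<close> may jump.\<close>

definition Reg :: "3 \<Rightarrow> real \<Rightarrow> (real^('m::finite \<times> 3)) l2 \<Rightarrow> bool" where
  "Reg i K \<gamma> \<longleftrightarrow> norm \<gamma> \<le> K \<and> (\<forall>j h. j \<noteq> i \<longrightarrow> h \<ge> 0 \<longrightarrow> norm (dif j h \<gamma>) \<le> K * h) \<and>
     (\<forall>h. 0 < h \<longrightarrow> h < 1 \<longrightarrow> norm (Q i h (dif i h \<gamma>)) \<le> K * h)"

text \<open>Discrete product rule: the commutator plays the part of the derivative of the
  coefficient.\<close>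

lemma dif_admissible:
  assumes "admissible M b L"
  shows "dif l h (M u) = (shift (h *\<^sub>R ax l) (M u) - M (shift (h *\<^sub>R ax l) u)) + M (dif l h u)"
  using assms linear_diff[OF bounded_linear.linear, of M] by (simp add: admissible_def dif_def)

lemma Reg_admissible:
  assumes M: "admissible M b L" and R: "Reg i K \<gamma>"
  shows "Reg i ((b + L) * K) (M \<gamma>)"
proof -
  have bl: "b \<ge> 0" "L \<ge> 0" and nM: "\<And>u. norm (M u) \<le> b * norm u"
    and comm: "\<And>l h u. h \<ge> 0 \<Longrightarrow> norm (shift (h *\<^sub>R ax l) (M u) - M (shift (h *\<^sub>R ax l) u)) \<le> L * h * norm u"
    and QM: "\<And>l h u. Q l h (M u) = M (Q l h u)"
    using M by (auto simp: admissible_def)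
  have K: "norm \<gamma> \<le> K" "K \<ge> 0" using R norm_ge_zero[of \<gamma>] unfolding Reg_def by linarith+
  have c: "norm (shift (h *\<^sub>R ax l) (M \<gamma>) - M (shift (h *\<^sub>R ax l) \<gamma>)) \<le> L * K * h" if "h \<ge> 0" for l h
    using comm[OF that, of l \<gamma>] mult_left_mono[OF K(1), of "L * h"] bl that
    by (simp add: mult.commute mult.left_commute)
  show ?thesis unfolding Reg_def
  proof (intro conjI allI impI)
    have "norm (M \<gamma>) \<le> b * K" using nM[of \<gamma>] mult_left_mono[OF K(1) bl(1)] by linarith
    also have "\<dots> \<le> (b + L) * K" using bl K by (intro mult_right_mono) auto
    finally show "norm (M \<gamma>) \<le> (b + L) * K" .
  next
    fix j and h :: real assume j: "j \<noteq> i" and h: "0 \<le> h"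
    have "norm (M (dif j h \<gamma>)) \<le> b * (K * h)"
      using nM[of "dif j h \<gamma>"] R j h bl unfolding Reg_def
      by (intro order_trans[OF nM] mult_left_mono) auto
    then have "norm (dif j h (M \<gamma>)) \<le> L * K * h + b * (K * h)"
      unfolding dif_admissible[OF M] using c[OF h, of j] by (intro order_trans[OF norm_triangle_ineq] add_mono)
    then show "norm (dif j h (M \<gamma>)) \<le> (b + L) * K * h" by (simp add: algebra_simps)
  next
    fix h :: real assume h: "0 < h" "h < 1"
    have "norm (M (Q i h (dif i h \<gamma>))) \<le> b * (K * h)"
      using R h bl unfolding Reg_def by (intro order_trans[OF nM] mult_left_mono) auto
    then have "norm (Q i h (dif i h (M \<gamma>))) \<le> L * K * h + b * (K * h)"
      unfolding dif_admissible[OF M] linear_add[OF Q_linear] QM using c[of h i] h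
      by (intro order_trans[OF norm_triangle_ineq] add_mono order_trans[OF norm_Q]) auto
    then show "norm (Q i h (dif i h (M \<gamma>))) \<le> (b + L) * K * h" by (simp add: algebra_simps)
  qed
qed

lemma cancel_norm_square:
  assumes "\<alpha> * (norm (x :: 'a::real_inner))\<^sup>2 \<le> c * norm x" "c \<ge> 0"
  shows "\<alpha> * norm x \<le> c"
  using assms by (cases "norm x = 0") (auto simp: power2_eq_square mult_le_cancel_right mult.assoc[symmetric])

text \<open>Difference quotient method: the translated equation minus the original one is an
  equation for \<open>dif j h \<eta>\<close>, with the commutator as additional right-hand side. As
  \<open>GG\<close> is invariant under translations, \<open>dif j h \<eta>\<close> is itself a valid
  test element.\<close>

lemma solution_bounds:
  fixes M :: "(real^('m::finite \<times> 3)) l2 \<Rightarrow> (real^('m \<times> 3)) l2"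
  assumes M: "admissible M b L" and coer: "\<And>u. \<alpha> * (norm u)\<^sup>2 \<le> inner (M u) u"
    and \<eta>: "\<eta> \<in> GG" and eq: "\<And>\<zeta>. \<zeta> \<in> GG \<Longrightarrow> inner (M \<eta>) \<zeta> = inner f \<zeta>"
  shows "\<alpha> * norm \<eta> \<le> norm f"
    and "h \<ge> 0 \<Longrightarrow> \<alpha> * norm (dif j h \<eta>) \<le> norm (dif j h f) + L * h * norm \<eta>"
proof -
  have bl: "b \<ge> 0" "L \<ge> 0" and lin: "linear M"
    and comm: "\<And>l h u. h \<ge> 0 \<Longrightarrow> norm (shift (h *\<^sub>R ax l) (M u) - M (shift (h *\<^sub>R ax l) u)) \<le> L * h * norm u"
    using M by (auto simp: admissible_def bounded_linear.linear)
  have "\<alpha> * (norm \<eta>)\<^sup>2 \<le> norm f * norm \<eta>"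
    using coer[of \<eta>] eq[OF \<eta>] norm_cauchy_schwarz[of f \<eta>] by linarith
  then show "\<alpha> * norm \<eta> \<le> norm f" by (rule cancel_norm_square) simp
  assume h: "h \<ge> 0"
  define D where "D = dif j h \<eta>"
  define z where "z = h *\<^sub>R ax j"
  have D: "D \<in> GG" unfolding D_def by (rule dif_GG[OF \<eta>])
  have "inner (shift z (M \<eta>)) D = inner (shift z f) D"
    unfolding inner_shift_left using eq[OF shift_GG[OF D]] by simp
  then have "inner (M D) D = inner (dif j h f - (shift z (M \<eta>) - M (shift z \<eta>))) D"
    using eq[OF D] by (simp add: D_def dif_def z_def linear_diff[OF lin] inner_diff_left)
  also have "\<dots> \<le> norm (dif j h f - (shift z (M \<eta>) - M (shift z \<eta>))) * norm D"
    by (rule norm_cauchy_schwarz)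
  also have "\<dots> \<le> (norm (dif j h f) + L * h * norm \<eta>) * norm D"
    using comm[OF h, of j \<eta>] norm_triangle_ineq4[of "dif j h f" "shift z (M \<eta>) - M (shift z \<eta>)"]
    unfolding z_def by (intro mult_right_mono) (linarith, simp)
  finally have "\<alpha> * (norm D)\<^sup>2 \<le> (norm (dif j h f) + L * h * norm \<eta>) * norm D"
    using coer[of D] by linarith
  then show "\<alpha> * norm (dif j h \<eta>) \<le> norm (dif j h f) + L * h * norm \<eta>"
    unfolding D_def[symmetric] by (rule cancel_norm_square) (use bl h in simp)
qed

text \<open>The right-hand side \<open>f\<close> is not assumed to be a gradient. Tangential
  differences of \<open>\<eta>\<close> come from testing; \<open>curl_bound\<close> turns those of
  component \<open>i\<close> into normal differences of the tangential components. The normal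
  difference of component \<open>i\<close> itself is solved for in the equation, using the flux of
  \<open>p = M \<eta> - f\<close>.\<close>

lemma elliptic_regularity:
  fixes M :: "(real^('m::finite \<times> 3)) l2 \<Rightarrow> (real^('m \<times> 3)) l2"
  assumes M: "admissible M b L" and coer: "\<And>u. \<alpha> * (norm u)\<^sup>2 \<le> inner (M u) u" and \<alpha>: "\<alpha> > 0"
  shows "\<exists>C\<ge>0. \<forall>i K f. \<forall>\<eta>\<in>GG. (\<forall>\<zeta>\<in>GG. inner (M \<eta>) \<zeta> = inner f \<zeta>) \<longrightarrow> Reg i K f \<longrightarrow> Reg i (C * K) \<eta>"
proof -
  have bl: "b \<ge> 0" "L \<ge> 0" and nM: "\<And>u. norm (M u) \<le> b * norm u" and lin: "linear M"
    and comm: "\<And>l h u. h \<ge> 0 \<Longrightarrow> norm (shift (h *\<^sub>R ax l) (M u) - M (shift (h *\<^sub>R ax l) u)) \<le> L * h * norm u"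
    and QM: "\<And>l h u. Q l h (M u) = M (Q l h u)"
    using M by (auto simp: admissible_def bounded_linear.linear)
  \<comment> \<open>\<open>C0\<close> controls \<open>\<eta>\<close>, \<open>C1\<close> its
    tangential differences and \<open>C2\<close> those of the residual \<open>p\<close>. In
    \<open>C3\<close> the term \<open>2 * C2\<close> is the bound of \<open>flux_bound\<close>,
    \<open>1\<close> belongs to \<open>f\<close>, \<open>L * C0\<close> to the commutator, and
    \<open>2 * b * C1\<close> to the two tangential components moved to the right-hand side.\<close>
  define C0 where "C0 = 1 / \<alpha>"
  define C1 where "C1 = (1 + L * C0) / \<alpha>"
  define C2 where "C2 = 1 + L * C0 + b * C1"
  define C3 where "C3 = (2 * C2 + 1 + L * C0 + 2 * b * C1) / \<alpha>"
  have C: "C0 \<ge> 0" "C1 \<ge> 0" "C2 \<ge> 0" "C3 \<ge> 0"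
    unfolding C0_def C1_def C2_def C3_def using bl \<alpha> by (auto intro!: divide_nonneg_pos add_nonneg_nonneg)
  show ?thesis
  proof (intro exI[of _ "C0 + C1 + C3 + 2 * C1"] conjI allI ballI impI)
    show "0 \<le> C0 + C1 + C3 + 2 * C1" using C by simp
    fix i K f \<eta>
    assume \<eta>: "\<eta> \<in> GG" and "\<forall>\<zeta>\<in>GG. inner (M \<eta>) \<zeta> = inner f \<zeta>" and f: "Reg i K f"
    then have eq: "\<And>\<zeta>. \<zeta> \<in> GG \<Longrightarrow> inner (M \<eta>) \<zeta> = inner f \<zeta>" by blast
    have K: "norm f \<le> K" "K \<ge> 0" using f norm_ge_zero[of f] unfolding Reg_def by linarith+
    have 0: "norm \<eta> \<le> C0 * K"
      using solution_bounds(1)[OF M coer \<eta> eq] K \<alpha> by (simp add: C0_def pos_le_divide_eq mult.commute)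
    have 1: "norm (dif j h \<eta>) \<le> C1 * K * h" if j: "j \<noteq> i" and h: "h \<ge> 0" for j h
    proof -
      have "\<alpha> * norm (dif j h \<eta>) \<le> K * h + L * h * (C0 * K)"
      proof -
        have "norm (dif j h f) \<le> K * h" using f j h by (simp add: Reg_def)
        moreover have "L * h * norm \<eta> \<le> L * h * (C0 * K)"
          using bl h by (intro mult_left_mono[OF 0]) simp
        ultimately show ?thesis using solution_bounds(2)[OF M coer \<eta> eq h, of j] by linarith
      qed
      then have "norm (dif j h \<eta>) \<le> (K * h + L * h * (C0 * K)) / \<alpha>"
        using \<alpha> by (simp add: pos_le_divide_eq mult.commute)
      also have "\<dots> = C1 * K * h" by (simp add: C1_def algebra_simps add_divide_distrib)
      finally show ?thesis .
    qed
    have cM: "norm (shift (h *\<^sub>R ax l) (M \<eta>) - M (shift (h *\<^sub>R ax l) \<eta>)) \<le> L * C0 * K * h" if "h \<ge> 0" for l h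
      using comm[OF that, of l \<eta>] mult_left_mono[OF 0, of "L * h"] bl that
      by (simp add: mult.commute mult.left_commute)
    \<comment> \<open>The equation says that \<open>p\<close> annihilates all gradients, so it is
      solenoidal in the sense of \<open>flux_bound\<close>.\<close>
    define p where "p = M \<eta> - f"
    have p0: "inner p \<gamma> = 0" if "\<gamma> \<in> GG" for \<gamma> using eq[OF that] by (simp add: p_def inner_diff_left)
    have p1: "norm (dif j h p) \<le> C2 * K * h" if j: "j \<noteq> i" and h: "h \<ge> 0" for j h
    proof -
      have "norm (M (dif j h \<eta>)) \<le> b * (C1 * K * h)"
        using 1[OF j h] bl by (intro order_trans[OF nM] mult_left_mono)
      moreover have "norm (dif j h f) \<le> K * h" using f j h by (simp add: Reg_def)
      moreover have eqp: "dif j h p = (shift (h *\<^sub>R ax j) (M \<eta>) - M (shift (h *\<^sub>R ax j) \<eta>)) + M (dif j h \<eta>) - dif j h f"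
        unfolding p_def linear_diff[OF dif_linear] dif_admissible[OF M] ..
      ultimately have "norm (dif j h p) \<le> L * C0 * K * h + b * (C1 * K * h) + K * h"
        using cM[OF h, of j] norm_triangle_ineq4[of "(shift (h *\<^sub>R ax j) (M \<eta>) - M (shift (h *\<^sub>R ax j) \<eta>)) + M (dif j h \<eta>)" "dif j h f"]
          norm_triangle_ineq[of "shift (h *\<^sub>R ax j) (M \<eta>) - M (shift (h *\<^sub>R ax j) \<eta>)" "M (dif j h \<eta>)"]
        unfolding eqp by linarith
      then show ?thesis by (simp add: C2_def algebra_simps)
    qed
    have p2: "norm (dif i h (cmp i p)) \<le> 2 * (C2 * K) * h" if "h \<ge> 0" for h
      by (rule flux_bound[OF p0 _ p1 that]) (use C K in auto)
    have curl: "norm (dif i h (cmp j \<eta>)) \<le> C1 * K * h" if "j \<noteq> i" "h \<ge> 0" for j h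
    proof (rule curl_bound[OF \<eta> _ that(2)])
      show "norm (dif j k (cmp i \<eta>)) \<le> C1 * K * k" if "0 \<le> k" for k
        using 1[OF \<open>j \<noteq> i\<close> that] norm_cmp[of i "dif j k \<eta>"] by (simp add: dif_cmp)
    qed
    have 3: "norm (Q i h (dif i h \<eta>)) \<le> (C3 + 2 * C1) * K * h" if h: "0 < h" "h < 1" for h
    proof -
      define \<zeta> where "\<zeta> = Q i h (dif i h \<eta>)"
      \<comment> \<open>Coercivity is used for a field in direction \<open>i\<close> only. Testing
        with \<open>q\<close> sees just \<open>cmp i (M \<zeta>)\<close>, which is known from the
        flux, and the contribution of the tangential components of \<open>\<zeta>\<close>, which are
        bounded already.\<close>
      define q where "q = emb i (cmp i \<zeta>)"
      have h0: "h \<ge> 0" using h by simp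
      have t: "norm (cmp j \<zeta>) \<le> C1 * K * h" if "j \<noteq> i" for j
        using order_trans[OF norm_Q curl[OF that h0], of i h] by (simp add: \<zeta>_def Q_cmp[symmetric] dif_cmp)
      obtain j m where d: "i \<noteq> j" "i \<noteq> m" "j \<noteq> m" and all: "\<And>l. l = i \<or> l = j \<or> l = m"
        using other_axes by blast
      have U: "UNIV = {i, j, m}" using all by auto
      have q\<zeta>: "\<zeta> = q + (emb j (cmp j \<zeta>) + emb m (cmp m \<zeta>))"
        using sum_emb_cmp[of \<zeta>] d unfolding U by (simp add: q_def)
      have Me: "norm (M (emb l (cmp l \<zeta>))) \<le> b * (C1 * K * h)" if "l \<noteq> i" for l
        using order_trans[OF norm_emb t[OF that]] bl by (intro order_trans[OF nM] mult_left_mono)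
      \<comment> \<open>Of the three terms only the difference of \<open>f\<close> is confined to
        points away from the faces; the flux and the commutator are bounded across them.\<close>
      have "M \<zeta> = Q i h (dif i h p + dif i h f - (shift (h *\<^sub>R ax i) (M \<eta>) - M (shift (h *\<^sub>R ax i) \<eta>)))"
        unfolding \<zeta>_def QM[symmetric] p_def linear_diff[OF dif_linear] dif_admissible[OF M] by simp
      then have "cmp i (M \<zeta>) = Q i h (dif i h (cmp i p)) + cmp i (Q i h (dif i h f))
           - cmp i (Q i h (shift (h *\<^sub>R ax i) (M \<eta>) - M (shift (h *\<^sub>R ax i) \<eta>)))"
        by (simp only: linear_add[OF Q_linear] linear_diff[OF Q_linear] Q_cmp dif_cmp
            linear_add[OF bounded_linear.linear[OF bounded_linear_cmp]]
            linear_diff[OF bounded_linear.linear[OF bounded_linear_cmp]])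
      then have "norm (cmp i (M \<zeta>)) \<le> norm (Q i h (dif i h (cmp i p))) + norm (cmp i (Q i h (dif i h f)))
           + norm (cmp i (Q i h (shift (h *\<^sub>R ax i) (M \<eta>) - M (shift (h *\<^sub>R ax i) \<eta>))))"
        by (simp only:) (intro order_trans[OF norm_triangle_ineq4] add_right_mono norm_triangle_ineq)
      also have "\<dots> \<le> 2 * (C2 * K) * h + K * h + L * C0 * K * h"
      proof (intro add_mono)
        show "norm (Q i h (dif i h (cmp i p))) \<le> 2 * (C2 * K) * h" by (rule order_trans[OF norm_Q p2[OF h0]])
        show "norm (cmp i (Q i h (dif i h f))) \<le> K * h"
          using f h by (intro order_trans[OF norm_cmp]) (simp add: Reg_def)
        show "norm (cmp i (Q i h (shift (h *\<^sub>R ax i) (M \<eta>) - M (shift (h *\<^sub>R ax i) \<eta>)))) \<le> L * C0 * K * h"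
          by (intro order_trans[OF norm_cmp] order_trans[OF norm_Q] cM h0)
      qed
      finally have c: "norm (cmp i (M \<zeta>)) \<le> 2 * (C2 * K) * h + K * h + L * C0 * K * h" .
      have "inner (M q) q = inner (M \<zeta>) q - inner (M (emb j (cmp j \<zeta>))) q - inner (M (emb m (cmp m \<zeta>))) q"
        using arg_cong[OF q\<zeta>, of M] by (simp add: linear_add[OF lin] inner_add_left)
      also have "inner (M \<zeta>) q = inner (cmp i (M \<zeta>)) (cmp i \<zeta>)"
        unfolding q_def using inner_emb[of i "cmp i \<zeta>" "M \<zeta>"] by (simp add: inner_commute)
      also have "\<dots> \<le> norm (cmp i (M \<zeta>)) * norm q"
      proof -
        have "cmp i q = cmp i \<zeta>" by (simp add: q_def cmp_emb)
        then show ?thesis using norm_cmp[of i q]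
          by (intro order_trans[OF norm_cauchy_schwarz] mult_left_mono) auto
      qed
      also have "\<dots> \<le> (2 * (C2 * K) * h + K * h + L * C0 * K * h) * norm q"
        using c by (intro mult_right_mono) auto
      finally have "inner (M q) q \<le> (2 * (C2 * K) * h + K * h + L * C0 * K * h) * norm q
          - inner (M (emb j (cmp j \<zeta>))) q - inner (M (emb m (cmp m \<zeta>))) q" by simp
      moreover have "- inner (M (emb l (cmp l \<zeta>))) q \<le> (b * (C1 * K * h)) * norm q" if "l \<noteq> i" for l
      proof -
        have "- inner (M (emb l (cmp l \<zeta>))) q \<le> norm (M (emb l (cmp l \<zeta>))) * norm q"
          using Cauchy_Schwarz_ineq2[of "M (emb l (cmp l \<zeta>))" q] by linarith
        also have "\<dots> \<le> (b * (C1 * K * h)) * norm q" using Me[OF that] by (intro mult_right_mono) auto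
        finally show ?thesis .
      qed
      from this[of j] this[of m] d
      have "- inner (M (emb j (cmp j \<zeta>))) q \<le> (b * (C1 * K * h)) * norm q"
        "- inner (M (emb m (cmp m \<zeta>))) q \<le> (b * (C1 * K * h)) * norm q" by auto
      ultimately have "\<alpha> * (norm q)\<^sup>2 \<le> (2 * (C2 * K) * h + K * h + L * C0 * K * h) * norm q
         + (b * (C1 * K * h)) * norm q + (b * (C1 * K * h)) * norm q"
        using coer[of q] by linarith
      also have "\<dots> = (\<alpha> * C3 * K * h) * norm q"
      proof -
        have "\<alpha> * C3 = 2 * C2 + 1 + L * C0 + 2 * b * C1" using \<alpha> by (simp add: C3_def)
        then show ?thesis by (simp add: algebra_simps)
      qed
      finally have "\<alpha> * norm q \<le> \<alpha> * C3 * K * h"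
        by (rule cancel_norm_square) (use C K \<alpha> h in auto)
      then have nq: "norm q \<le> C3 * K * h" using \<alpha> by simp
      have "norm \<zeta> \<le> norm q + (norm (emb j (cmp j \<zeta>)) + norm (emb m (cmp m \<zeta>)))"
        by (subst q\<zeta>) (intro order_trans[OF norm_triangle_ineq] add_left_mono norm_triangle_ineq)
      also have "\<dots> \<le> C3 * K * h + (C1 * K * h + C1 * K * h)"
        using d by (intro add_mono nq order_trans[OF norm_emb t]) auto
      finally show ?thesis by (simp add: \<zeta>_def algebra_simps)
    qed
    have up: "norm x \<le> (C0 + C1 + C3 + 2 * C1) * K * h"
      if "norm x \<le> c * K * h" "c \<le> C0 + C1 + C3 + 2 * C1" "h \<ge> 0" for x :: "(real^('m \<times> 3)) l2" and c h
      using that K by (meson mult_right_mono order_trans mult_nonneg_nonneg)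
    show "Reg i ((C0 + C1 + C3 + 2 * C1) * K) \<eta>"
      unfolding Reg_def
    proof (intro conjI allI impI)
      show "norm \<eta> \<le> (C0 + C1 + C3 + 2 * C1) * K" using up[of \<eta> C0 1] 0 C by simp
      show "norm (dif j h \<eta>) \<le> (C0 + C1 + C3 + 2 * C1) * K * h" if "j \<noteq> i" "0 \<le> h" for j h
        using up[OF 1[OF that]] C that by simp
      show "norm (Q i h (dif i h \<eta>)) \<le> (C0 + C1 + C3 + 2 * C1) * K * h" if "0 < h" "h < 1" for h
        using up[OF 3[OF that]] C that by simp
    qed
  qed
qed

section \<open>Evolution of regular initial data\<close>

lemma Reg_add: "Reg i K x \<Longrightarrow> Reg i K' y \<Longrightarrow> Reg i (K + K') (x + y)"
  unfolding Reg_def linear_add[OF dif_linear] linear_add[OF Q_linear]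
  by (auto simp: distrib_right intro!: order_trans[OF norm_triangle_ineq] add_mono)

lemma Reg_scaleR: assumes "Reg i K x" shows "Reg i (\<bar>c\<bar> * K) (c *\<^sub>R x)"
  using assms unfolding Reg_def linear_cmul[OF dif_linear] linear_cmul[OF Q_linear]
  by (auto simp: mult.assoc intro!: mult_left_mono)

lemma Reg_0: "Reg i 0 0"
  by (simp add: Reg_def linear_0[OF dif_linear] linear_0[OF Q_linear])

lemma Reg_sum: "(\<And>k. k \<in> S \<Longrightarrow> Reg i (K k) (x k)) \<Longrightarrow> Reg i (\<Sum>k\<in>S. K k) (\<Sum>k\<in>S. x k)"
  by (induction S rule: infinite_finite_induct) (auto simp: Reg_0 Reg_add)

lemma Reg_nonneg: "Reg i K x \<Longrightarrow> K \<ge> 0"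
  unfolding Reg_def using norm_ge_zero[of x] by linarith

definition solve :: "((real^('m::finite \<times> 3)) l2 \<Rightarrow> (real^('m \<times> 3)) l2) \<Rightarrow> (real^('m \<times> 3)) l2 \<Rightarrow> (real^('m \<times> 3)) l2" where
  "solve M f = (SOME \<eta>. \<eta> \<in> GG \<and> (\<forall>\<zeta>\<in>GG. inner (M \<eta>) \<zeta> = inner f \<zeta>))"

lemma solve_props:
  fixes M :: "(real^('m::finite \<times> 3)) l2 \<Rightarrow> (real^('m \<times> 3)) l2"
  assumes "bounded_linear M" "\<And>u v. inner (M u) v = inner u (M v)"
    and "\<And>u. \<alpha> * (norm u)\<^sup>2 \<le> inner (M u) u" "\<alpha> > 0"
  shows "solve M f \<in> GG" "\<And>\<zeta>. \<zeta> \<in> GG \<Longrightarrow> inner (M (solve M f)) \<zeta> = inner f \<zeta>"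
proof -
  have "\<exists>\<eta>. \<eta> \<in> GG \<and> (\<forall>\<zeta>\<in>GG. inner (M \<eta>) \<zeta> = inner f \<zeta>)"
    using riesz_coercive[OF subspace_GG closed_GG assms] by blast
  from someI_ex[OF this]
  show "solve M f \<in> GG" "\<And>\<zeta>. \<zeta> \<in> GG \<Longrightarrow> inner (M (solve M f)) \<zeta> = inner f \<zeta>"
    unfolding solve_def by auto
qed

lemma GG_solution_unique:
  fixes M :: "(real^('m::finite \<times> 3)) l2 \<Rightarrow> (real^('m \<times> 3)) l2"
  assumes M: "bounded_linear M" and coer: "\<And>u. \<alpha> * (norm u)\<^sup>2 \<le> inner (M u) u" and \<alpha>: "\<alpha> > 0"
    and "x \<in> GG" "y \<in> GG" "\<And>\<zeta>. \<zeta> \<in> GG \<Longrightarrow> inner (M x) \<zeta> = inner (M y) \<zeta>"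
  shows "x = y"
proof -
  have d: "x - y \<in> GG" using assms by (intro subspace_diff[OF subspace_GG])
  have "inner (M (x - y)) (x - y) = 0"
    using assms(6)[OF d] by (simp add: linear_diff[OF bounded_linear.linear[OF M]] inner_diff_left)
  then have "\<alpha> * (norm (x - y))\<^sup>2 \<le> 0" using coer[of "x - y"] by simp
  then show ?thesis using \<alpha> by (simp add: mult_le_0_iff)
qed

text \<open>The constant is fixed before the solution, so it cannot depend on the initial value or
  on time. Each application of \<open>B\<close> costs a factor \<open>Cb\<close> in
  \<open>Reg\<close>, so the series is dominated by that of \<open>exp (Cb * \<tau>)\<close>. The
  three parts may jump across different families of faces; the bound they share is the one with the
  cut-off in every direction, and that is the conclusion.\<close>

lemma evolution_regularity:
  fixes M R :: "(real^('m::finite \<times> 3)) l2 \<Rightarrow> (real^('m \<times> 3)) l2"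
  assumes M: "admissible M b L" and R: "admissible R b' L'"
    and sym: "\<And>u v. inner (M u) v = inner u (M v)"
    and coer: "\<And>u. \<alpha> * (norm u)\<^sup>2 \<le> inner (M u) u" and \<alpha>: "\<alpha> > 0" and \<tau>: "\<tau> \<ge> 0"
  shows "\<exists>C\<ge>0. \<forall>G G' K.
     (\<forall>t\<in>{0..\<tau>}. (G has_vector_derivative G' t) (at t within {0..\<tau>}) \<and> G t \<in> GG \<and> G' t \<in> GG \<and>
        (\<forall>\<zeta>\<in>GG. inner (M (G' t)) \<zeta> + inner (R (G t)) \<zeta> = 0)) \<longrightarrow>
     (\<forall>i. Reg i K (emb i (cmp i (G 0)))) \<longrightarrow>
     (\<forall>t\<in>{0..\<tau>}. norm (G t) \<le> C * K \<and>
        (\<forall>j h. 0 < h \<longrightarrow> h < 1 \<longrightarrow> norm (Q j h (dif j h (G t))) \<le> C * K * h))"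
proof -
  have Mb: "bounded_linear M" and Rb: "bounded_linear R"
    and nR: "\<And>u. norm (R u) \<le> b' * norm u" "b' \<ge> 0" "L' \<ge> 0"
    using M R by (auto simp: admissible_def)
  \<comment> \<open>Solving with the identity is the orthogonal projection onto \<open>GG\<close>,
    so \<open>elliptic_regularity\<close> also covers the projections of the three components of the
    initial gradient.\<close>
  define I where "I = (\<lambda>u :: (real^('m \<times> 3)) l2. u)"
  have I: "admissible I 1 0" by (simp add: admissible_def I_def bounded_linear_ident)
  have Icoer: "1 * (norm u)\<^sup>2 \<le> inner (I u) u" for u by (simp add: I_def power2_norm_eq_inner)
  have Isym: "inner (I u) v = inner u (I v)" for u v by (simp add: I_def)
  obtain C1 where C1a: "C1 \<ge> 0" "\<forall>i K f. \<forall>\<eta>\<in>GG. (\<forall>\<zeta>\<in>GG. inner (I \<eta>) \<zeta> = inner f \<zeta>) \<longrightarrow> Reg i K f \<longrightarrow> Reg i (C1 * K) \<eta>"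
    using elliptic_regularity[OF I Icoer zero_less_one] by blast
  note C1 = C1a(1) C1a(2)[rule_format]
  obtain C2 where C2a: "C2 \<ge> 0" "\<forall>i K f. \<forall>\<eta>\<in>GG. (\<forall>\<zeta>\<in>GG. inner (M \<eta>) \<zeta> = inner f \<zeta>) \<longrightarrow> Reg i K f \<longrightarrow> Reg i (C2 * K) \<eta>"
    using elliptic_regularity[OF M coer \<alpha>] by blast
  note C2 = C2a(1) C2a(2)[rule_format]
  define B where "B u = solve M (R u)" for u
  have Bp1: "B u \<in> GG" for u
    unfolding B_def by (rule solve_props(1)[OF Mb sym coer \<alpha>])
  have Bp2: "inner (M (B u)) \<zeta> = inner (R u) \<zeta>" if "\<zeta> \<in> GG" for u \<zeta>
    unfolding B_def by (rule solve_props(2)[OF Mb sym coer \<alpha> that])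
  note Bp = Bp1 Bp2
  note uniq = GG_solution_unique[OF Mb coer \<alpha>]
  have nB: "norm (B u) \<le> (b' / \<alpha>) * norm u" for u
  proof -
    have "\<alpha> * norm (B u) \<le> norm (R u)" by (rule solution_bounds(1)[OF M coer Bp(1) Bp(2)])
    also have "\<dots> \<le> b' * norm u" by (rule nR)
    finally show ?thesis using \<alpha> by (simp add: pos_le_divide_eq mult.commute)
  qed
  have Bb: "bounded_linear B"
  proof (rule bounded_linear_intro[where K = "b' / \<alpha>"])
    show "B (x + y) = B x + B y" for x y
      by (rule uniq) (auto simp: Bp subspace_add[OF subspace_GG] inner_add_left
          linear_add[OF bounded_linear.linear[OF Mb]] linear_add[OF bounded_linear.linear[OF Rb]])
    show "B (r *\<^sub>R x) = r *\<^sub>R B x" for r x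
      by (rule uniq) (auto simp: Bp subspace_scale[OF subspace_GG]
          linear_cmul[OF bounded_linear.linear[OF Mb]] linear_cmul[OF bounded_linear.linear[OF Rb]])
    show "norm (B x) \<le> norm x * (b' / \<alpha>)" for x using nB[of x] by (simp add: mult.commute)
  qed
  define Cb where "Cb = C2 * (b' + L')"
  have Cb: "Cb \<ge> 0" using C2 nR by (simp add: Cb_def)
  have RegB: "Reg i (Cb * K) (B \<gamma>)" if "Reg i K \<gamma>" for i K \<gamma>
    using C2(2)[OF Bp(1) Bp(2) Reg_admissible[OF R that]] by (simp add: Cb_def mult.assoc)
  have linBk: "linear (B ^^ k)" for k
  proof (induction k)
    case 0 show ?case by (simp add: linear_iff)
  next
    case (Suc k) then show ?case unfolding funpow.simps by (intro linear_compose bounded_linear.linear[OF Bb])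
  qed
  \<comment> \<open>Three directional parts, each with the exponential from the series and the
    constant \<open>C1\<close> of its projection.\<close>
  define C where "C = 3 * (exp (Cb * \<tau>) * C1)"
  show ?thesis
  proof (intro exI[of _ C] conjI allI impI ballI)
    show "C \<ge> 0" using C1 by (simp add: C_def)
  next
    fix G G' K t
    assume sol: "\<forall>t\<in>{0..\<tau>}. (G has_vector_derivative G' t) (at t within {0..\<tau>}) \<and> G t \<in> GG \<and> G' t \<in> GG \<and>
        (\<forall>\<zeta>\<in>GG. inner (M (G' t)) \<zeta> + inner (R (G t)) \<zeta> = 0)"
      and init: "\<forall>i. Reg i K (emb i (cmp i (G 0)))" and t: "t \<in> {0..\<tau>}"
    have K: "K \<ge> 0" using init Reg_nonneg by blast
    have G': "G' t = - B (G t)" if "t \<in> {0..\<tau>}" for t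
    proof (rule uniq)
      show "G' t \<in> GG" using sol that by blast
      show "- B (G t) \<in> GG" using Bp(1) subspace_neg[OF subspace_GG] by blast
      show "inner (M (G' t)) \<zeta> = inner (M (- B (G t))) \<zeta>" if z: "\<zeta> \<in> GG" for \<zeta>
      proof -
        have "inner (M (G' t)) \<zeta> + inner (R (G t)) \<zeta> = 0"
          using sol \<open>t \<in> {0..\<tau>}\<close> z by blast
        moreover have "inner (M (- B (G t))) \<zeta> = - inner (R (G t)) \<zeta>"
          using Bp(2)[OF z, of "G t"] by (simp add: linear_neg[OF bounded_linear.linear[OF Mb]])
        ultimately show ?thesis by linarith
      qed
    qed
    define S where "S x n = (\<Sum>k\<le>n. ((- t) ^ k / fact k) *\<^sub>R (B ^^ k) x)" for x n
    have lim: "S (G 0) \<longlonglongrightarrow> G t"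
      unfolding S_def
    proof (rule exp_taylor_unique[OF Bb nB _ _ t])
      show "0 \<le> b' / \<alpha>" using nR \<alpha> by simp
      show "(G has_vector_derivative - B (G t)) (at t within {0..\<tau>})" if "t \<in> {0..\<tau>}" for t
        using sol G'[OF that] that by force
    qed
    define g where "g i = solve I (emb i (cmp i (G 0)))" for i
    have Ib: "bounded_linear I" using I by (simp add: admissible_def)
    have gp1: "g i \<in> GG" for i
      unfolding g_def by (rule solve_props(1)[OF Ib Isym Icoer zero_less_one])
    have gp2: "inner (I (g i)) \<zeta> = inner (emb i (cmp i (G 0))) \<zeta>" if "\<zeta> \<in> GG" for i \<zeta>
      unfolding g_def by (rule solve_props(2)[OF Ib Isym Icoer zero_less_one that])
    have Regg: "Reg i (C1 * K) (g i)" for i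
      by (rule C1(2)[OF gp1 gp2 init[rule_format, of i]])
    \<comment> \<open>The projections of the components add up to the projection of
      \<open>G 0\<close>, which lies in \<open>GG\<close> already.\<close>
    have sumg: "(\<Sum>i\<in>UNIV. g i) = G 0"
    proof (rule GG_solution_unique[OF Ib Icoer])
      show "(\<Sum>i\<in>UNIV. g i) \<in> GG" using gp1 by (intro subspace_sum[OF subspace_GG]) simp
      show "G 0 \<in> GG" using sol \<tau> by simp
      show "inner (I (\<Sum>i\<in>UNIV. g i)) \<zeta> = inner (I (G 0)) \<zeta>" if z: "\<zeta> \<in> GG" for \<zeta>
      proof -
        have "inner (I (\<Sum>i\<in>UNIV. g i)) \<zeta> = (\<Sum>i\<in>UNIV. inner (I (g i)) \<zeta>)" by (simp add: I_def inner_sum_left)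
        also have "\<dots> = inner (\<Sum>i\<in>UNIV. emb i (cmp i (G 0))) \<zeta>"
          using gp2[OF z] by (simp add: inner_sum_left)
        finally show ?thesis by (simp add: sum_emb_cmp I_def)
      qed
    qed simp
    have RegBk: "Reg i (Cb ^ k * (C1 * K)) ((B ^^ k) (g i))" for i k
    proof (induction k)
      case 0 then show ?case using Regg by simp
    next
      case (Suc k) then show ?case using RegB[OF Suc] by (simp add: mult.assoc)
    qed
    have expb: "(\<Sum>k\<le>n. \<bar>(- t) ^ k / fact k\<bar> * (Cb ^ k * (C1 * K))) \<le> exp (Cb * \<tau>) * (C1 * K)" for n
    proof -
      have "(\<Sum>k\<le>n. \<bar>(- t) ^ k / fact k\<bar> * (Cb ^ k * (C1 * K))) = (\<Sum>k\<le>n. (Cb * t) ^ k /\<^sub>R fact k) * (C1 * K)"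
        unfolding sum_distrib_right using t
        by (intro sum.cong) (auto simp: abs_mult power_abs power_mult_distrib divide_inverse)
      also have "(\<Sum>k\<le>n. (Cb * t) ^ k /\<^sub>R fact k) \<le> exp (Cb * t)"
        unfolding exp_def using t Cb by (intro sum_le_suminf summable_exp_generic) auto
      also have "exp (Cb * t) \<le> exp (Cb * \<tau>)" using t Cb by (simp add: mult_left_mono)
      finally show ?thesis using C1 K by (simp add: mult_right_mono)
    qed
    define K' where "K' = exp (Cb * \<tau>) * (C1 * K)"
    have RegS: "norm (S (g i) n) \<le> K'" "0 < h \<Longrightarrow> h < 1 \<Longrightarrow> norm (Q j h (dif j h (S (g i) n))) \<le> K' * h" for i j n h
    proof -
      have r: "Reg i (\<Sum>k\<le>n. \<bar>(- t) ^ k / fact k\<bar> * (Cb ^ k * (C1 * K))) (S (g i) n)"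
        unfolding S_def by (intro Reg_sum Reg_scaleR RegBk)
      show "norm (S (g i) n) \<le> K'" using r expb[of n] by (simp add: Reg_def K'_def)
      assume h: "0 < h" "h < 1"
      have "norm (Q j h (dif j h (S (g i) n))) \<le> (\<Sum>k\<le>n. \<bar>(- t) ^ k / fact k\<bar> * (Cb ^ k * (C1 * K))) * h"
        using r h order_trans[OF norm_Q[of j h "dif j h (S (g i) n)"]] unfolding Reg_def
        by (cases "j = i") auto
      also have "\<dots> \<le> K' * h" unfolding K'_def using expb[of n] h by (intro mult_right_mono) auto
      finally show "norm (Q j h (dif j h (S (g i) n))) \<le> K' * h" .
    qed
    have sumS: "S (G 0) n = (\<Sum>i\<in>UNIV. S (g i) n)" for n
    proof -
      have "S (G 0) n = (\<Sum>k\<le>n. \<Sum>i\<in>UNIV. ((- t) ^ k / fact k) *\<^sub>R (B ^^ k) (g i))"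
        unfolding S_def sumg[symmetric] by (simp add: linear_sum[OF linBk] scaleR_sum_right)
      also have "\<dots> = (\<Sum>i\<in>UNIV. S (g i) n)" unfolding S_def by (rule sum.swap)
      finally show ?thesis .
    qed
    have CK: "C * K = (\<Sum>i\<in>(UNIV :: 3 set). K')" by (simp add: C_def K'_def)
    show "norm (G t) \<le> C * K"
    proof (rule LIMSEQ_le_const2[OF tendsto_norm[OF lim]])
      have "norm (S (G 0) n) \<le> C * K" for n
        unfolding sumS CK by (rule order_trans[OF norm_sum]) (intro sum_mono RegS)
      then show "\<exists>N. \<forall>n\<ge>N. norm (S (G 0) n) \<le> C * K" by blast
    qed
    fix j and h :: real assume h: "0 < h" "h < 1"
    show "norm (Q j h (dif j h (G t))) \<le> C * K * h"
    proof (rule LIMSEQ_le_const2[OF tendsto_norm])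
      show "(\<lambda>n. Q j h (dif j h (S (G 0) n))) \<longlonglongrightarrow> Q j h (dif j h (G t))"
        by (intro bounded_linear.tendsto[OF bounded_linear_Q] bounded_linear.tendsto[OF bounded_linear_dif] lim)
      have "norm (Q j h (dif j h (S (G 0) n))) \<le> C * K * h" for n
        unfolding sumS CK linear_sum[OF dif_linear] linear_sum[OF Q_linear] sum_distrib_right
        by (rule order_trans[OF norm_sum]) (intro sum_mono RegS h)
      then show "\<exists>N. \<forall>n\<ge>N. norm (Q j h (dif j h (S (G 0) n))) \<le> C * K * h" by blast
    qed
  qed
qed

section \<open>Transfer between the cell and the unit cube\<close>

definition aff :: "real \<Rightarrow> real^3 \<Rightarrow> real^3 \<Rightarrow> real^3" where
  "aff \<delta> x z = x + \<delta> *\<^sub>R z"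

lemma aff_measurable [measurable]: "aff \<delta> x \<in> borel_measurable borel"
  unfolding aff_def[abs_def] by measurable

lemma aff_inverse: "\<delta> \<noteq> 0 \<Longrightarrow> aff \<delta> x (aff (1 / \<delta>) (- ((1 / \<delta>) *\<^sub>R x)) y) = y"
  by (simp add: aff_def algebra_simps)

lemma aff_inverse': "\<delta> \<noteq> 0 \<Longrightarrow> aff (1 / \<delta>) (- ((1 / \<delta>) *\<^sub>R x)) (aff \<delta> x y) = y"
  by (simp add: aff_def algebra_simps)

lemma lborel_aff: "\<delta> > 0 \<Longrightarrow> lborel = density (distr lborel borel (aff \<delta> x)) (\<lambda>_. ennreal (\<delta> ^ 3))"
  using lborel_affine[of \<delta> x] unfolding aff_def[abs_def] by (simp add: DIM_cart)

lemma AE_aff_imp: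
  assumes "\<delta> > 0" "AE y in lborel. P y" shows "AE z in lborel. P (aff \<delta> x z)"
proof -
  obtain N where N: "N \<in> null_sets lborel" "{y\<in>space lborel. \<not> P y} \<subseteq> N"
    using assms(2) unfolding eventually_ae_filter by auto
  then have [measurable]: "N \<in> sets borel" by auto
  have [measurable]: "aff \<delta> x -` N \<in> sets borel"
    using measurable_sets[OF aff_measurable \<open>N \<in> sets borel\<close>] by simp
  have "0 = emeasure lborel N" using N by auto
  also have "\<dots> = ennreal (\<delta> ^ 3) * emeasure lborel (aff \<delta> x -` N)"
    by (subst lborel_aff[OF assms(1), of x])
       (auto simp: emeasure_density emeasure_distr nn_integral_cmult)
  finally have "emeasure lborel (aff \<delta> x -` N) = 0" using assms(1) by auto
  then have "aff \<delta> x -` N \<in> null_sets lborel" by auto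
  then have "AE z in lborel. z \<notin> aff \<delta> x -` N" by (rule AE_not_in)
  then show ?thesis by eventually_elim (use N(2) in auto)
qed

lemma AE_aff_iff:
  assumes "\<delta> > 0" shows "(AE z in lborel. P (aff \<delta> x z)) \<longleftrightarrow> (AE y in lborel. P y)"
proof
  assume *: "AE z in lborel. P (aff \<delta> x z)"
  have "1 / \<delta> > 0" using assms by simp
  from AE_aff_imp[OF this *, of "- ((1 / \<delta>) *\<^sub>R x)"]
  show "AE y in lborel. P y" using assms by (simp only: aff_inverse less_imp_neq[symmetric] simp_thms)
qed (rule AE_aff_imp[OF assms])

lemma integrable_scaleR_iff:
  fixes f :: "'a \<Rightarrow> 'b::{banach, second_countable_topology}"
  assumes "c \<noteq> (0::real)"
  shows "integrable M (\<lambda>x. c *\<^sub>R f x) \<longleftrightarrow> integrable M f"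
proof
  assume "integrable M (\<lambda>x. c *\<^sub>R f x)"
  then have "integrable M (\<lambda>x. (1 / c) *\<^sub>R (c *\<^sub>R f x))" by (rule integrable_scaleR_right)
  then show "integrable M f" using assms by simp
qed simp

text \<open>Change of variables and change of measurability in one step: \<open>F\<close> is only
  Lebesgue measurable, while \<open>F'\<close> is a Borel function that agrees with it almost
  everywhere in cube coordinates. The auxiliary \<open>H\<close> is \<open>F'\<close> carried back,
  hence a Borel version of \<open>F\<close>.\<close>

lemma integral_aff:
  fixes F F' :: "real^3 \<Rightarrow> 'b::euclidean_space"
  assumes \<delta>: "\<delta> > 0" and F: "F \<in> borel_measurable lebesgue" and F' [measurable]: "F' \<in> borel_measurable borel"
    and eq: "AE z in lborel. F' z = F (aff \<delta> x z)"
  shows "integrable lebesgue F \<longleftrightarrow> integrable lborel F'"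
    and "integral\<^sup>L lebesgue F = (\<delta> ^ 3) *\<^sub>R integral\<^sup>L lborel F'"
proof -
  define H where "H y = F' (aff (1 / \<delta>) (- ((1 / \<delta>) *\<^sub>R x)) y)" for y
  have [measurable]: "H \<in> borel_measurable borel" unfolding H_def by measurable
  have HF': "H (aff \<delta> x z) = F' z" for z using \<delta> by (simp add: H_def aff_inverse')
  have "AE z in lborel. F (aff \<delta> x z) = H (aff \<delta> x z)"
    using eq by eventually_elim (simp add: HF')
  then have "AE y in lborel. F y = H y"
    by (rule AE_aff_iff[OF \<delta>, where P = "\<lambda>y. F y = H y", THEN iffD1])
  then have ae: "AE y in lebesgue. F y = H y" by (rule AE_completion)
  have Hl: "H \<in> borel_measurable lebesgue" by (rule measurable_completion) simp
  have "integrable lebesgue F \<longleftrightarrow> integrable lebesgue H" by (rule integrable_cong_AE[OF F Hl ae])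
  also have "\<dots> \<longleftrightarrow> integrable lborel H" by (rule integrable_completion) simp
  also have "\<dots> \<longleftrightarrow> integrable lborel F'"
    using \<delta> by (subst lborel_aff[OF \<delta>, of x])
      (simp add: integrable_density integrable_distr_eq HF' integrable_scaleR_iff)
  finally show "integrable lebesgue F \<longleftrightarrow> integrable lborel F'" .
  have "integral\<^sup>L lebesgue F = integral\<^sup>L lebesgue H" by (rule integral_cong_AE[OF F Hl ae])
  also have "\<dots> = integral\<^sup>L lborel H" by (rule integral_completion) simp
  also have "\<dots> = (\<delta> ^ 3) *\<^sub>R integral\<^sup>L lborel F'"
    using \<delta> by (subst lborel_aff[OF \<delta>, of x])
      (simp add: integral_density integral_distr HF')
  finally show "integral\<^sup>L lebesgue F = (\<delta> ^ 3) *\<^sub>R integral\<^sup>L lborel F'" .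
qed

lemma borel_rep:
  fixes f :: "real^3 \<Rightarrow> 'b::euclidean_space"
  assumes f: "f \<in> borel_measurable lebesgue"
  obtains f' where "f' \<in> borel_measurable borel" "AE y in lborel. f y = f' y"
proof -
  have "\<exists>g\<in>borel_measurable lborel. AE y in lborel. inner (f y) b = g y" for b
    by (rule completion_ex_borel_measurable_real) (use f in measurable)
  then obtain g where g: "\<And>b. g b \<in> borel_measurable lborel" "\<And>b. AE y in lborel. inner (f y) b = g b y"
    by metis
  have "AE y in lborel. \<forall>b\<in>Basis. inner (f y) b = g b y"
    using g(2) by (intro AE_finite_allI) auto
  then have "AE y in lborel. f y = (\<Sum>b\<in>Basis. g b y *\<^sub>R b)"
  proof eventually_elim
    case (elim y)
    have "f y = (\<Sum>b\<in>Basis. inner (f y) b *\<^sub>R b)" by (simp add: euclidean_representation)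
    also have "\<dots> = (\<Sum>b\<in>Basis. g b y *\<^sub>R b)" using elim by (intro sum.cong) auto
    finally show ?case .
  qed
  moreover have "(\<lambda>y. \<Sum>b\<in>Basis. g b y *\<^sub>R b) \<in> borel_measurable borel"
    using g(1) by (intro borel_measurable_sum borel_measurable_scaleR) auto
  ultimately show ?thesis using that by blast
qed

lemma borel_rep_aff:
  fixes f :: "real^3 \<Rightarrow> 'b::euclidean_space"
  assumes f: "f \<in> borel_measurable lebesgue" and \<delta>: "\<delta> > 0"
  obtains f' where "f' \<in> borel_measurable borel" "AE z in lborel. f' z = f (aff \<delta> x z)"
proof -
  obtain g where [measurable]: "g \<in> borel_measurable borel" and g: "AE y in lborel. f y = g y"
    using borel_rep[OF f] .
  have "AE z in lborel. g (aff \<delta> x z) = f (aff \<delta> x z)"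
    using AE_aff_imp[OF \<delta> g, of x] by eventually_elim simp
  then show ?thesis by (intro that[of "\<lambda>z. g (aff \<delta> x z)"]) auto
qed

abbreviation ucell :: "(real^3) set" where
  "ucell \<equiv> box 0 (\<chi> i. 1)"

lemma cell_aff: "\<delta> > 0 \<Longrightarrow> aff \<delta> x z \<in> cell \<delta> x \<longleftrightarrow> z \<in> ucell"
  by (auto simp: cell_def aff_def image_iff mem_box_cart)

lemma cell_box: assumes "\<delta> > 0" shows "cell \<delta> x = box x (x + \<delta> *\<^sub>R (\<chi> i. 1))"
proof -
  have "y \<in> cell \<delta> x \<longleftrightarrow> y \<in> box x (x + \<delta> *\<^sub>R (\<chi> i. 1))" for y
  proof -
    have y: "y = aff \<delta> x ((1 / \<delta>) *\<^sub>R (y - x))" using assms by (simp add: aff_def)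
    show ?thesis
      by (subst y, subst cell_aff[OF assms])
         (use assms in \<open>simp add: mem_box_cart zero_less_divide_iff divide_less_eq algebra_simps\<close>)
  qed
  then show ?thesis by blast
qed

lemma cell_sets: "\<delta> > 0 \<Longrightarrow> cell \<delta> x \<in> sets borel"
  by (simp add: cell_box)

lemma open_cell: "\<delta> > 0 \<Longrightarrow> open (cell \<delta> x)"
  by (simp add: cell_box open_box)

lemma ucell_subset: "ucell \<subseteq> unit_cube"
  by (auto simp: unit_cube_def mem_box_cart less_imp_le)

lemma AE_cubeM_ucell: "(AE z in cubeM. P z) \<longleftrightarrow> (AE z in lborel. z \<in> ucell \<longrightarrow> P z)"
proof
  assume "AE z in cubeM. P z"
  then show "AE z in lborel. z \<in> ucell \<longrightarrow> P z"
    unfolding AE_cubeM by eventually_elim (use ucell_subset in auto)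
next
  assume *: "AE z in lborel. z \<in> ucell \<longrightarrow> P z"
  have "AE z in lborel. z \<in> unit_cube \<longrightarrow> z \<in> ucell" using AE_cube_interior by (simp add: AE_cubeM)
  then show "AE z in cubeM. P z" unfolding AE_cubeM using * by eventually_elim auto
qed

lemma AE_cell:
  assumes "\<delta> > 0"
  shows "(AE y in lebesgue_on (cell \<delta> x). P y) \<longleftrightarrow> (AE z in cubeM. P (aff \<delta> x z))"
proof -
  have "(AE y in lebesgue_on (cell \<delta> x). P y) \<longleftrightarrow> (AE y in lborel. y \<in> cell \<delta> x \<longrightarrow> P y)"
    using cell_sets[OF assms] by (subst AE_restrict_space_iff) (auto simp: AE_completion_iff)
  also have "\<dots> \<longleftrightarrow> (AE z in lborel. aff \<delta> x z \<in> cell \<delta> x \<longrightarrow> P (aff \<delta> x z))"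
    by (rule AE_aff_iff[OF assms, symmetric])
  finally show ?thesis unfolding cell_aff[OF assms] AE_cubeM_ucell .
qed

lemma integral_cell:
  fixes F F' :: "real^3 \<Rightarrow> 'b::euclidean_space"
  assumes \<delta>: "\<delta> > 0" and F: "F \<in> borel_measurable (lebesgue_on (cell \<delta> x))"
    and F' [measurable]: "F' \<in> borel_measurable borel" and eq: "AE z in cubeM. F' z = F (aff \<delta> x z)"
  shows "integrable (lebesgue_on (cell \<delta> x)) F \<longleftrightarrow> integrable cubeM F'"
    and "integral\<^sup>L (lebesgue_on (cell \<delta> x)) F = (\<delta> ^ 3) *\<^sub>R integral\<^sup>L cubeM F'"
proof -
  let ?c = "cell \<delta> x"
  have c: "?c \<in> sets lebesgue" using cell_sets[OF \<delta>] by simp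
  have Fl: "(\<lambda>y. indicator ?c y *\<^sub>R F y) \<in> borel_measurable lebesgue"
    using F c by (subst (asm) borel_measurable_restrict_space_iff) auto
  have ae: "AE z in lborel. indicator unit_cube z *\<^sub>R F' z = indicator ?c (aff \<delta> x z) *\<^sub>R F (aff \<delta> x z)"
  proof -
    have "AE z in lborel. z \<in> unit_cube \<longrightarrow> z \<in> ucell" using AE_cube_interior by (simp add: AE_cubeM)
    then show ?thesis using eq unfolding AE_cubeM
    proof eventually_elim
      case (elim z) then show ?case
        using ucell_subset by (auto simp: indicator_def cell_aff[OF \<delta>])
    qed
  qed
  have m: "(\<lambda>z. indicator unit_cube z *\<^sub>R F' z) \<in> borel_measurable borel" by measurable
  have "integrable (lebesgue_on ?c) F \<longleftrightarrow> integrable lebesgue (\<lambda>y. indicator ?c y *\<^sub>R F y)"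
    using c by (intro integrable_restrict_space) auto
  also have "\<dots> \<longleftrightarrow> integrable cubeM F'"
    unfolding integral_aff(1)[OF \<delta> Fl m ae] integrable_cubeM_iff ..
  finally show "integrable (lebesgue_on ?c) F \<longleftrightarrow> integrable cubeM F'" .
  have "integral\<^sup>L (lebesgue_on ?c) F = integral\<^sup>L lebesgue (\<lambda>y. indicator ?c y *\<^sub>R F y)"
    using c by (intro integral_restrict_space) auto
  then show "integral\<^sup>L (lebesgue_on ?c) F = (\<delta> ^ 3) *\<^sub>R integral\<^sup>L cubeM F'"
    unfolding integral_aff(2)[OF \<delta> Fl m ae] integral_cubeM .
qed

lemma cell_measurable_rep:
  fixes f :: "real^3 \<Rightarrow> 'b::euclidean_space"
  assumes \<delta>: "\<delta> > 0" and f: "f \<in> borel_measurable (lebesgue_on (cell \<delta> x))"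
  obtains f' where "f' \<in> borel_measurable borel" "AE z in cubeM. f' z = f (aff \<delta> x z)"
proof -
  have c: "cell \<delta> x \<in> sets lebesgue" using cell_sets[OF \<delta>] by simp
  have "(\<lambda>y. indicator (cell \<delta> x) y *\<^sub>R f y) \<in> borel_measurable lebesgue"
    using f c by (subst (asm) borel_measurable_restrict_space_iff) auto
  then obtain f' where f': "f' \<in> borel_measurable borel"
    "AE z in lborel. f' z = indicator (cell \<delta> x) (aff \<delta> x z) *\<^sub>R f (aff \<delta> x z)"
    using borel_rep_aff[OF _ \<delta>] by blast
  from f'(2) have "AE z in cubeM. f' z = f (aff \<delta> x z)"
    unfolding AE_cubeM_ucell by eventually_elim (simp add: cell_aff[OF \<delta>])
  with f'(1) show ?thesis using that by blast
qed

text \<open>The class of \<open>f\<close> in the coordinates of the unit cube; arbitrary unless \<open>f\<close> is square integrable.\<close>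

definition lft :: "real \<Rightarrow> real^3 \<Rightarrow> (real^3 \<Rightarrow> 'b::euclidean_space) \<Rightarrow> 'b l2" where
  "lft \<delta> x f = cls (SOME F. F \<in> Sq \<and> (AE z in cubeM. F z = f (aff \<delta> x z)))"

lemma lft_eq:
  assumes "F \<in> Sq" "AE z in cubeM. F z = f (aff \<delta> x z)"
  shows "lft \<delta> x f = cls F"
proof -
  define G where "G = (SOME F. F \<in> Sq \<and> (AE z in cubeM. F z = f (aff \<delta> x z)))"
  have G: "G \<in> Sq \<and> (AE z in cubeM. G z = f (aff \<delta> x z))"
    unfolding G_def by (rule someI[of _ F]) (use assms in simp)
  have "AE z in cubeM. G z = F z"
    using conjunct2[OF G] assms(2) by eventually_elim simp
  then show ?thesis
    unfolding lft_def G_def[symmetric] using cls_eq_iff[of G F] G assms(1) by blast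
qed

lemma L2_rep:
  fixes f :: "real^3 \<Rightarrow> 'b::euclidean_space"
  assumes \<delta>: "\<delta> > 0" and f: "L2 (cell \<delta> x) f"
  obtains F where "F \<in> Sq" "AE z in cubeM. F z = f (aff \<delta> x z)" "lft \<delta> x f = cls F"
proof -
  have fm: "f \<in> borel_measurable (lebesgue_on (cell \<delta> x))"
    and fi: "integrable (lebesgue_on (cell \<delta> x)) (\<lambda>y. (norm (f y))\<^sup>2)"
    using f by (auto simp: L2_def)
  obtain F where F: "F \<in> borel_measurable borel" "AE z in cubeM. F z = f (aff \<delta> x z)"
    using cell_measurable_rep[OF \<delta> fm] .
  have "integrable cubeM (\<lambda>z. (norm (F z))\<^sup>2)"
  proof (subst integral_cell(1)[OF \<delta>, symmetric, where F = "\<lambda>y. (norm (f y))\<^sup>2" and x = x])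
    show "AE z in cubeM. (norm (F z))\<^sup>2 = (norm (f (aff \<delta> x z)))\<^sup>2" using F(2) by eventually_elim simp
  qed (use fm fi F(1) in measurable)
  then have S: "F \<in> Sq" using F(1) by (simp add: Sq_def)
  then show ?thesis using that F(2) lft_eq by blast
qed

lemma rep_lft:
  assumes "\<delta> > 0" "L2 (cell \<delta> x) f" shows "AE z in cubeM. rep (lft \<delta> x f) z = f (aff \<delta> x z)"
proof -
  obtain F where F: "F \<in> Sq" "AE z in cubeM. F z = f (aff \<delta> x z)" "lft \<delta> x f = cls F"
    using L2_rep[OF assms] .
  from rep_cls[OF F(1)] F(2) show ?thesis unfolding F(3) by eventually_elim simp
qed

lemma L2_I:
  fixes f :: "real^3 \<Rightarrow> 'b::euclidean_space"
  assumes \<delta>: "\<delta> > 0" and F: "F \<in> Sq" "AE z in cubeM. F z = f (aff \<delta> x z)"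
    and fm: "f \<in> borel_measurable (lebesgue_on (cell \<delta> x))"
  shows "L2 (cell \<delta> x) f"
  unfolding L2_def
proof (intro conjI fm)
  have "(\<lambda>z. (norm (F z))\<^sup>2) \<in> borel_measurable borel" using Sq_measurable[OF F(1)] by measurable
  moreover have "AE z in cubeM. (norm (F z))\<^sup>2 = (norm (f (aff \<delta> x z)))\<^sup>2" using F(2) by eventually_elim simp
  ultimately show "integrable (lebesgue_on (cell \<delta> x)) (\<lambda>y. (norm (f y))\<^sup>2)"
    using fm F(1) by (subst integral_cell(1)[OF \<delta>]) (auto simp: Sq_def)
qed

lemma L2_norm_lft:
  assumes \<delta>: "\<delta> > 0" and f: "L2 (cell \<delta> x) f"
  shows "(L2_norm (cell \<delta> x) f)\<^sup>2 = \<delta> ^ 3 * (norm (lft \<delta> x f))\<^sup>2"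
proof -
  obtain F where F: "F \<in> Sq" "AE z in cubeM. F z = f (aff \<delta> x z)" "lft \<delta> x f = cls F"
    using L2_rep[OF assms] .
  have "(LINT y|lebesgue_on (cell \<delta> x). (norm (f y))\<^sup>2) = (\<delta> ^ 3) *\<^sub>R (\<integral>z. (norm (F z))\<^sup>2 \<partial>cubeM)"
  proof (rule integral_cell(2)[OF \<delta>])
    show "AE z in cubeM. (norm (F z))\<^sup>2 = (norm (f (aff \<delta> x z)))\<^sup>2" using F(2) by eventually_elim simp
    show "(\<lambda>y. (norm (f y))\<^sup>2) \<in> borel_measurable (lebesgue_on (cell \<delta> x))"
      using conjunct1[OF f[unfolded L2_def]] by measurable
    show "(\<lambda>z. (norm (F z))\<^sup>2) \<in> borel_measurable borel" using Sq_measurable[OF F(1)] by measurable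
  qed
  then show ?thesis using \<delta> by (simp add: L2_norm_def F(3) norm_cls[OF F(1)] integral_nonneg_AE)
qed

lemma L2_comb:
  fixes f g :: "real^3 \<Rightarrow> 'b::euclidean_space"
  assumes \<delta>: "\<delta> > 0" and f: "L2 (cell \<delta> x) f" and g: "L2 (cell \<delta> x) g"
  shows "L2 (cell \<delta> x) (\<lambda>y. a *\<^sub>R f y + b *\<^sub>R g y)"
    and "lft \<delta> x (\<lambda>y. a *\<^sub>R f y + b *\<^sub>R g y) = a *\<^sub>R lft \<delta> x f + b *\<^sub>R lft \<delta> x g"
proof -
  obtain F where F: "F \<in> Sq" "AE z in cubeM. F z = f (aff \<delta> x z)" "lft \<delta> x f = cls F"
    using L2_rep[OF \<delta> f] .
  obtain G where G: "G \<in> Sq" "AE z in cubeM. G z = g (aff \<delta> x z)" "lft \<delta> x g = cls G"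
    using L2_rep[OF \<delta> g] .
  have S: "(\<lambda>z. a *\<^sub>R F z + b *\<^sub>R G z) \<in> Sq" by (intro Sq_add Sq_scaleR F G)
  have ae: "AE z in cubeM. a *\<^sub>R F z + b *\<^sub>R G z = a *\<^sub>R f (aff \<delta> x z) + b *\<^sub>R g (aff \<delta> x z)"
    using F(2) G(2) by eventually_elim simp
  show "L2 (cell \<delta> x) (\<lambda>y. a *\<^sub>R f y + b *\<^sub>R g y)"
    by (rule L2_I[OF \<delta> S ae]) (use f g in \<open>auto simp: L2_def\<close>)
  show "lft \<delta> x (\<lambda>y. a *\<^sub>R f y + b *\<^sub>R g y) = a *\<^sub>R lft \<delta> x f + b *\<^sub>R lft \<delta> x g"
    using lft_eq[OF S ae] F G by (simp add: cls_add cls_scaleR Sq_scaleR)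
qed

section \<open>Weak derivatives in cube coordinates\<close>

text \<open>A weak derivative that is tested with the functions \<open>bump\<close> only, for Borel representatives, so that
  the completion of the Lebesgue measure does not interfere with Fubini's theorem.\<close>

definition wd :: "(real^3) set \<Rightarrow> 3 \<Rightarrow> (real^3 \<Rightarrow> 'b::euclidean_space) \<Rightarrow> (real^3 \<Rightarrow> 'b) \<Rightarrow> bool" where
  "wd U i f g \<longleftrightarrow> f \<in> borel_measurable borel \<and> g \<in> borel_measurable borel \<and>
     (\<forall>p q. cbox p q \<subseteq> U \<longrightarrow> integrable lborel (\<lambda>y. indicator (cbox p q) y *\<^sub>R f y) \<and>
        integrable lborel (\<lambda>y. indicator (cbox p q) y *\<^sub>R g y)) \<and>
     (\<forall>n c d. n > 0 \<longrightarrow> cbox c d \<subseteq> U \<longrightarrow>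
        (LINT y|lborel. pd i (bump n c d) y *\<^sub>R f y) = - (LINT y|lborel. bump n c d y *\<^sub>R g y))"

lemma bump_cut:
  fixes f :: "real^3 \<Rightarrow> 'b::real_vector"
  assumes "n > 0" "cbox c d \<subseteq> K"
  shows "bump n c d y *\<^sub>R (indicator K y *\<^sub>R f y) = bump n c d y *\<^sub>R f y"
    and "pd i (bump n c d) y *\<^sub>R (indicator K y *\<^sub>R f y) = pd i (bump n c d) y *\<^sub>R f y"
proof -
  obtain D B where D: "pd i (bump n c d) = D" "\<And>y. y \<notin> cbox c d \<Longrightarrow> D y = 0"
    using pd_bump[OF assms(1), of i c d] by metis
  have 1: "y \<in> K" if "y \<in> cbox c d" using that assms(2) by blast
  have 2: "bump n c d y = 0" if "y \<notin> cbox c d"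
    using that box_subset_cbox[of c d] bump_eq_0[OF assms(1), of y c d] by blast
  show "bump n c d y *\<^sub>R (indicator K y *\<^sub>R f y) = bump n c d y *\<^sub>R f y"
    using 1 2 by (cases "y \<in> cbox c d") auto
  show "pd i (bump n c d) y *\<^sub>R (indicator K y *\<^sub>R f y) = pd i (bump n c d) y *\<^sub>R f y"
    unfolding D(1) using 1 D(2)[of y] by (cases "y \<in> cbox c d") auto
qed

text \<open>Null sets in single boxes combine to a null set in \<open>U\<close> only if countably
  many boxes suffice, hence Lindelof.\<close>

lemma AE_open_boxes:
  assumes "open U" "\<And>p q. cbox p q \<subseteq> U \<Longrightarrow> AE y in lborel. y \<in> box p q \<longrightarrow> P y"
  shows "AE y in lborel. y \<in> U \<longrightarrow> P (y :: real^3)"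
proof -
  define F where "F = {box p q | p q. cbox p q \<subseteq> U}"
  have op: "\<And>S. S \<in> F \<Longrightarrow> open S" by (auto simp: F_def open_box)
  obtain F' where F': "F' \<subseteq> F" "countable F'" "\<Union>F' = \<Union>F"
    using Lindelof[of F] op by metis
  have "U \<subseteq> \<Union>F"
  proof
    fix y assume "y \<in> U"
    then obtain e where e: "e > 0" "ball y e \<subseteq> U" using assms(1) open_contains_ball by blast
    obtain p q where "y \<in> box p q" "cbox p q \<subseteq> ball y e"
      using rational_boxes[of "e/2" y] e(1)
      by (metis (no_types, lifting) open_ball open_contains_cbox centre_in_ball)
    moreover have "box p q \<in> F" using \<open>cbox p q \<subseteq> ball y e\<close> e(2) unfolding F_def by blast
    ultimately show "y \<in> \<Union>F" by blast
  qed
  then have U: "U \<subseteq> \<Union>F'" using F' by simp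
  have "AE y in lborel. y \<in> S \<longrightarrow> P y" if "S \<in> F'" for S
    using that F'(1) assms(2) by (auto simp: F_def)
  then have "AE y in lborel. \<forall>S\<in>F'. y \<in> S \<longrightarrow> P y"
    by (intro AE_ball_countable[OF F'(2), THEN iffD2] ballI)
  then show ?thesis by eventually_elim (use U in blast)
qed

lemma wd_unique:
  assumes "wd U i f g1" "wd U i f g2" "open U"
  shows "AE y in lborel. y \<in> U \<longrightarrow> g1 y = g2 y"
proof (rule AE_open_boxes[OF assms(3)])
  fix p q assume K: "cbox p q \<subseteq> U"
  let ?c = "\<lambda>g y. indicator (cbox p q) y *\<^sub>R g y"
  have i: "integrable lborel (?c g1)" "integrable lborel (?c g2)" using assms(1,2) K by (auto simp: wd_def)
  have "AE y in lborel. y \<in> box p q \<longrightarrow> ?c g1 y - ?c g2 y = 0"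
  proof (rule fundamental_lemma)
    show "integrable lborel (\<lambda>y. ?c g1 y - ?c g2 y)" using i by simp
    fix n :: real and c d assume n: "n > 0" and cd: "cbox c d \<subseteq> cbox p q"
    have b: "integrable lborel (\<lambda>y. bump n c d y *\<^sub>R ?c g y)" if "integrable lborel (?c g)" for g :: "real^3 \<Rightarrow> 'a"
    proof (rule Bochner_Integration.integrable_bound[OF that])
      show "AE y in lborel. norm (bump n c d y *\<^sub>R ?c g y) \<le> norm (?c g y)"
        by (intro AE_I2, subst norm_scaleR, intro mult_left_le_one_le) (simp_all add: bump_bounds)
      show "(\<lambda>y. bump n c d y *\<^sub>R ?c g y) \<in> borel_measurable lborel"
        using borel_measurable_integrable[OF that] by measurable
    qed
    have "(LINT y|lborel. bump n c d y *\<^sub>R (?c g1 y - ?c g2 y))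
      = (LINT y|lborel. bump n c d y *\<^sub>R ?c g1 y) - (LINT y|lborel. bump n c d y *\<^sub>R ?c g2 y)"
      using b[OF i(1)] b[OF i(2)] by (simp add: scaleR_diff_right)
    also have "\<dots> = (LINT y|lborel. bump n c d y *\<^sub>R g1 y) - (LINT y|lborel. bump n c d y *\<^sub>R g2 y)"
      unfolding bump_cut(1)[OF n cd] ..
    also have "\<dots> = 0"
    proof -
      have "cbox c d \<subseteq> U" using cd K by blast
      then have "- (LINT y|lborel. bump n c d y *\<^sub>R g1 y) = - (LINT y|lborel. bump n c d y *\<^sub>R g2 y)"
        using assms(1,2) n unfolding wd_def by metis
      then show ?thesis by simp
    qed
    finally show "(LINT y|lborel. bump n c d y *\<^sub>R (?c g1 y - ?c g2 y)) = 0" .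
  qed
  then show "AE y in lborel. y \<in> box p q \<longrightarrow> g1 y = g2 y"
    by eventually_elim (use box_subset_cbox in \<open>fastforce simp: indicator_def\<close>)
qed

text \<open>The functions are cut to the closed box swept out by the translation, where they are
  integrable; bumps inside that box do not notice the cut. Only this box has to lie in
  \<open>U\<close>.\<close>

lemma wd_translation:
  assumes w: "wd U i f g" and h: "h \<ge> 0" and U: "cbox p (q + h *\<^sub>R ax i) \<subseteq> U"
  shows "AE y in lborel. y \<in> box p q \<longrightarrow>
     f (y + h *\<^sub>R ax i) - f y = (LINT s|lborel. indicator {0..h} s *\<^sub>R g (y + s *\<^sub>R ax i))"
proof -
  let ?K = "cbox p (q + h *\<^sub>R ax i)"
  let ?c = "\<lambda>g y. indicator ?K y *\<^sub>R g y"
  have i: "integrable lborel (?c f)" "integrable lborel (?c g)" using w U by (auto simp: wd_def)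
  have shift: "y + s *\<^sub>R ax i \<in> ?K" if "y \<in> cbox p q" "s \<in> {0..h}" for y s
  proof -
    have "p $ j \<le> (y + s *\<^sub>R ax i) $ j \<and> (y + s *\<^sub>R ax i) $ j \<le> (q + h *\<^sub>R ax i) $ j" for j
    proof -
      have "p $ j \<le> y $ j" "y $ j \<le> q $ j" using that(1) by (auto simp: mem_box_cart)
      then show ?thesis using that(2) by (auto simp: axis_def)
    qed
    then show ?thesis by (simp only: mem_box_cart) blast
  qed
  have "AE y in lborel. y \<in> box p q \<longrightarrow>
     ?c f (y + h *\<^sub>R ax i) - ?c f y = (LINT s|lborel. indicator {0..h} s *\<^sub>R ?c g (y + s *\<^sub>R ax i))"
  proof (rule weak_deriv_translation[OF i _ h])
    show "(\<lambda>y. y + s *\<^sub>R ax i) ` cbox p q \<subseteq> ?K" if "s \<in> {0..h}" for s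
      using shift that by blast
    fix n :: real and c d assume n: "n > 0" and cd: "cbox c d \<subseteq> ?K"
    then show "(LINT y|lborel. pd i (bump n c d) y *\<^sub>R ?c f y) = - (LINT y|lborel. bump n c d y *\<^sub>R ?c g y)"
      unfolding bump_cut[OF n cd] using w U unfolding wd_def by (meson order_trans)
  qed
  then show ?thesis
  proof eventually_elim
    case (elim y)
    show ?case
    proof
      assume y: "y \<in> box p q"
      then have yK: "y \<in> cbox p q" using box_subset_cbox by blast
      have 1: "?c f (y + h *\<^sub>R ax i) = f (y + h *\<^sub>R ax i)" "?c f y = f y"
        using shift[OF yK, of h] shift[OF yK, of 0] h by auto
      have 2: "indicator {0..h} s *\<^sub>R ?c g (y + s *\<^sub>R ax i) = indicator {0..h} s *\<^sub>R g (y + s *\<^sub>R ax i)" for s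
        using shift[OF yK, of s] by (auto simp: indicator_def)
      show "f (y + h *\<^sub>R ax i) - f y = (LINT s|lborel. indicator {0..h} s *\<^sub>R g (y + s *\<^sub>R ax i))"
        using elim y unfolding 1 2 by blast
    qed
  qed
qed

text \<open>Local integrability yields measurability on compact sets only, so \<open>U\<close> is
  exhausted by finite unions of closed boxes.\<close>

lemma loc_integrable_measurable:
  fixes f :: "real^3 \<Rightarrow> 'b::euclidean_space"
  assumes f: "loc_integrable U f" and U: "open U"
  shows "(\<lambda>y. indicator U y *\<^sub>R f y) \<in> borel_measurable lebesgue"
proof (cases "U = {}")
  case True then show ?thesis by simp
next
  case False
  obtain D where D: "countable D" "D \<subseteq> Pow U" "\<And>X. X \<in> D \<Longrightarrow> \<exists>a b. X = cbox a b" "\<Union>D = U"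
    using open_countable_Union_open_cbox[OF U] by metis
  then have D0: "D \<noteq> {}" using False by auto
  define L where "L n = (\<Union>i\<le>n. from_nat_into D i)" for n :: nat
  have inD: "from_nat_into D i \<in> D" for i using from_nat_into[OF D0] .
  have "compact (L n) \<and> L n \<subseteq> U" for n
  proof
    have "compact (from_nat_into D i)" for i using D(3)[OF inD[of i]] by (auto intro: compact_cbox)
    then show "compact (L n)" unfolding L_def by (intro compact_UN) auto
    have "from_nat_into D i \<subseteq> U" for i using inD[of i] D(2) by blast
    then show "L n \<subseteq> U" unfolding L_def by blast
  qed
  then have "f absolutely_integrable_on L n" for n using f by (simp add: loc_integrable_def)
  then have m: "(\<lambda>y. indicator (L n) y *\<^sub>R f y) \<in> borel_measurable lebesgue" for n
    unfolding set_integrable_def by (rule borel_measurable_integrable)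
  show ?thesis
  proof (rule borel_measurable_LIMSEQ_metric[OF m])
    fix y
    show "(\<lambda>n. indicator (L n) y *\<^sub>R f y) \<longlonglongrightarrow> indicator U y *\<^sub>R f y"
    proof (cases "y \<in> U")
      case True
      then obtain X where "X \<in> D" "y \<in> X" using D(4) by blast
      then obtain m where m: "y \<in> from_nat_into D m" using from_nat_into_surj[OF D(1)] by metis
      have "\<forall>\<^sub>F n in sequentially. indicator (L n) y *\<^sub>R f y = indicator U y *\<^sub>R f y"
        unfolding eventually_sequentially
      proof (intro exI allI impI)
        fix n assume "m \<le> n"
        then have "y \<in> L n" unfolding L_def using m by blast
        then show "indicator (L n) y *\<^sub>R f y = indicator U y *\<^sub>R f y" using True by simp
      qed
      then show ?thesis by (rule tendsto_eventually)
    next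
      case False
      have "y \<notin> L n" for n
      proof
        assume "y \<in> L n"
        then obtain i where "y \<in> from_nat_into D i" by (auto simp: L_def)
        then show False using inD[of i] D(2) False by blast
      qed
      then show ?thesis using False by simp
    qed
  qed
qed

lemma pd_outside_support:
  assumes "y \<notin> closure {y. \<phi> y \<noteq> 0}" shows "pd i \<phi> y = 0"
proof -
  have "(\<phi> has_derivative (\<lambda>_. 0)) (at y)"
  proof (rule has_derivative_transform_within_open[of "\<lambda>_. 0" _ _ _ "- closure {y. \<phi> y \<noteq> 0}"])
    show "\<And>x. x \<in> - closure {y. \<phi> y \<noteq> 0} \<Longrightarrow> 0 = \<phi> x"
    proof -
      fix x assume "x \<in> - closure {y. \<phi> y \<noteq> 0}"
      then have "x \<notin> {y. \<phi> y \<noteq> 0}" using closure_subset[of "{y. \<phi> y \<noteq> 0}"] by blast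
      then show "0 = \<phi> x" by simp
    qed
  qed (use assms in \<open>auto intro: open_Compl\<close>)
  then have "frechet_derivative \<phi> (at y) = (\<lambda>_. 0)" by (rule frechet_derivative_at[symmetric])
  then show ?thesis by (simp add: pd_def)
qed

lemma integral_open:
  assumes "open U"
  shows "(LINT y|lebesgue_on U. F y) = (LINT y|lebesgue. indicator U y *\<^sub>R (F y :: 'b::euclidean_space))"
  using assms by (intro integral_restrict_space) auto

lemma has_weak_deriv_restrict:
  assumes w: "has_weak_deriv UNIV i f g" and U: "open U"
  shows "has_weak_deriv U i f g"
  unfolding has_weak_deriv_def
proof (intro conjI allI impI)
  show "loc_integrable U f" "loc_integrable U g"
    using w by (auto simp: has_weak_deriv_def loc_integrable_def)
  fix \<phi> assume \<phi>: "test_fun U \<phi>"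
  then have z: "\<phi> y = 0 \<and> pd i \<phi> y = 0" if "y \<notin> U" for y
  proof -
    have y: "y \<notin> closure {y. \<phi> y \<noteq> 0}" using \<phi> that by (auto simp: test_fun_def)
    then show ?thesis using pd_outside_support[OF y] closure_subset[of "{y. \<phi> y \<noteq> 0}"] by blast
  qed
  have e: "indicator U y *\<^sub>R pd i \<phi> y *\<^sub>R f y = indicator UNIV y *\<^sub>R pd i \<phi> y *\<^sub>R f y"
    "indicator U y *\<^sub>R \<phi> y *\<^sub>R g y = indicator UNIV y *\<^sub>R \<phi> y *\<^sub>R g y" for y
    using z[of y] by (cases "y \<in> U"; simp)+
  have "test_fun UNIV \<phi>" using \<phi> by (simp add: test_fun_def)
  then have "(LINT y|lebesgue_on UNIV. pd i \<phi> y *\<^sub>R f y) = - (LINT y|lebesgue_on UNIV. \<phi> y *\<^sub>R g y)"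
    using w unfolding has_weak_deriv_def by blast
  then show "(LINT y|lebesgue_on U. pd i \<phi> y *\<^sub>R f y) = - (LINT y|lebesgue_on U. \<phi> y *\<^sub>R g y)"
    unfolding integral_open[OF U] integral_open[OF open_UNIV] e .
qed

text \<open>The dilation carries a bump of steepness \<open>n\<close> in cube coordinates to a bump
  of steepness \<open>n / \<delta>\<close> in the original ones, so both sides are tested with the
  same family. The factor \<delta> on \<open>g\<close> is the chain rule. Values of
  \<open>f'\<close> and \<open>g'\<close> outside the preimage of \<open>U\<close> are free.\<close>

lemma has_weak_deriv_wd:
  fixes f g f' g' :: "real^3 \<Rightarrow> 'b::euclidean_space"
  assumes w: "has_weak_deriv U i f g" and U: "open U" and \<delta>: "\<delta> > 0"
    and f' [measurable]: "f' \<in> borel_measurable borel" and g' [measurable]: "g' \<in> borel_measurable borel"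
    and eq: "AE z in lborel. aff \<delta> x z \<in> U \<longrightarrow> f' z = f (aff \<delta> x z) \<and> g' z = \<delta> *\<^sub>R g (aff \<delta> x z)"
  shows "wd (aff \<delta> x -` U) i f' g'"
  unfolding wd_def
proof (intro conjI allI impI f' g')
  have lf: "loc_integrable U f" and lg: "loc_integrable U g" using w by (auto simp: has_weak_deriv_def)
  have mf: "(\<lambda>y. indicator U y *\<^sub>R f y) \<in> borel_measurable lebesgue"
    and mg: "(\<lambda>y. indicator U y *\<^sub>R g y) \<in> borel_measurable lebesgue"
    using loc_integrable_measurable[OF lf U] loc_integrable_measurable[OF lg U] .
  {
    fix p q assume K: "cbox p q \<subseteq> aff \<delta> x -` U"
    let ?K = "aff \<delta> x ` cbox p q"
    have Kc: "compact ?K" unfolding aff_def by (intro compact_continuous_image continuous_intros compact_cbox)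
    have KU: "?K \<subseteq> U" using K by blast
    have mem: "aff \<delta> x z \<in> ?K \<longleftrightarrow> z \<in> cbox p q" for z using \<delta> by (auto simp: aff_def)
    have 1: "integrable lborel (\<lambda>y. indicator (cbox p q) y *\<^sub>R F' y)"
      if F: "loc_integrable U F" and F' [measurable]: "F' \<in> borel_measurable borel"
        and ae: "AE z in lborel. aff \<delta> x z \<in> U \<longrightarrow> F' z = F (aff \<delta> x z)" for F F' :: "real^3 \<Rightarrow> 'b"
    proof -
      have "F absolutely_integrable_on ?K" using F Kc KU by (simp add: loc_integrable_def)
      then have i: "integrable lebesgue (\<lambda>y. indicator ?K y *\<^sub>R F y)" by (simp add: set_integrable_def)
      show ?thesis
      proof (subst integral_aff(1)[OF \<delta> borel_measurable_integrable[OF i], symmetric])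
        show "AE z in lborel. indicator (cbox p q) z *\<^sub>R F' z = indicator ?K (aff \<delta> x z) *\<^sub>R F (aff \<delta> x z)"
          using ae
        proof eventually_elim
          case (elim z) then show ?case using mem[of z] K by (cases "z \<in> cbox p q") auto
        qed
        show "integrable lebesgue (\<lambda>y. indicator ?K y *\<^sub>R F y)" by (rule i)
      qed measurable
    qed
    show "integrable lborel (\<lambda>y. indicator (cbox p q) y *\<^sub>R f' y)"
      by (rule 1[OF lf f']) (use eq in \<open>eventually_elim, simp\<close>)
    have "loc_integrable U (\<lambda>y. \<delta> *\<^sub>R g y)"
      using lg by (auto simp: loc_integrable_def intro: absolutely_integrable_scaleR_left)
    then show "integrable lborel (\<lambda>y. indicator (cbox p q) y *\<^sub>R g' y)"
      by (rule 1[OF _ g']) (use eq in \<open>eventually_elim, simp\<close>)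
  }
  fix n :: real and c d assume n: "n > 0" and cd: "cbox c d \<subseteq> aff \<delta> x -` U"
  define c' d' where "c' = aff \<delta> x c" and "d' = aff \<delta> x d"
  have n': "n / \<delta> > 0" using n \<delta> by simp
  have bb: "bump (n / \<delta>) c' d' (aff \<delta> x z) = bump n c d z" for z
  proof -
    have "(n / \<delta>) * (aff \<delta> x a $ j - aff \<delta> x b $ j) = n * (a $ j - b $ j)" for a b j
      using \<delta> by (simp add: aff_def field_simps)
    then show ?thesis unfolding bump_def bump1_def c'_def d'_def by simp
  qed
  have sub: "cbox c' d' \<subseteq> U"
  proof
    fix y assume y: "y \<in> cbox c' d'"
    define z where "z = (1 / \<delta>) *\<^sub>R (y - x)"
    have yz: "y = aff \<delta> x z" using \<delta> by (simp add: z_def aff_def)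
    have "z \<in> cbox c d" using y \<delta> unfolding yz c'_def d'_def by (auto simp: aff_def mem_box_cart)
    then show "y \<in> U" using cd yz by auto
  qed
  obtain D B where D: "pd i (bump n c d) = D"
      "\<And>y t. ((\<lambda>t. bump n c d (y + t *\<^sub>R ax i)) has_real_derivative D (y + t *\<^sub>R ax i)) (at t)"
      "\<And>y. y \<notin> cbox c d \<Longrightarrow> D y = 0"
    using pd_bump[OF n, of i c d] by metis
  obtain D' B' where D': "pd i (bump (n / \<delta>) c' d') = D'" "continuous_on UNIV D'"
      "\<And>y t. ((\<lambda>t. bump (n / \<delta>) c' d' (y + t *\<^sub>R ax i)) has_real_derivative D' (y + t *\<^sub>R ax i)) (at t)"
    using pd_bump[OF n', of i c' d'] by metis
  have DD: "D' (aff \<delta> x z) = (1 / \<delta>) * D z" for z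
  proof -
    have "((\<lambda>t. bump (n / \<delta>) c' d' (aff \<delta> x z + (\<delta> * t) *\<^sub>R ax i)) has_real_derivative D' (aff \<delta> x z) * \<delta>) (at 0)"
      using DERIV_chain2[OF D'(3)[of "aff \<delta> x z" "\<delta> * 0"] DERIV_cmult_Id[of \<delta> 0]] by simp
    moreover have "bump (n / \<delta>) c' d' (aff \<delta> x z + (\<delta> * t) *\<^sub>R ax i) = bump n c d (z + t *\<^sub>R ax i)" for t
      using bb[of "z + t *\<^sub>R ax i"] by (simp add: aff_def scaleR_add_right add.assoc)
    ultimately have "((\<lambda>t. bump n c d (z + t *\<^sub>R ax i)) has_real_derivative D' (aff \<delta> x z) * \<delta>) (at 0)" by simp
    from DERIV_unique[OF this] D(2)[of z 0] have "D' (aff \<delta> x z) * \<delta> = D z" by simp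
    then show ?thesis using \<delta> by (simp add: field_simps)
  qed
  have out: "bump n c d z = 0 \<and> D z = 0" if "aff \<delta> x z \<notin> U" for z
  proof -
    have "z \<notin> cbox c d" using that cd by blast
    then show ?thesis using D(3) box_subset_cbox[of c d] bump_eq_0[OF n, of z c d] by blast
  qed
  have [measurable]: "D' \<in> borel_measurable borel" by (rule borel_measurable_continuous_onI[OF D'(2)])
  have Dm [measurable]: "D \<in> borel_measurable borel"
  proof -
    have "D = (\<lambda>z. \<delta> * D' (aff \<delta> x z))" using DD \<delta> by auto
    then show ?thesis by simp
  qed
  have ml: "h \<in> borel_measurable borel \<Longrightarrow> h \<in> borel_measurable lebesgue" for h :: "real^3 \<Rightarrow> real"
    by (rule measurable_completion) simp
  have "test_fun U (bump (n / \<delta>) c' d')" by (rule test_fun_bump[OF n' sub])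
  then have "(LINT y|lebesgue_on U. D' y *\<^sub>R f y) = - (LINT y|lebesgue_on U. bump (n / \<delta>) c' d' y *\<^sub>R g y)"
    using w unfolding has_weak_deriv_def D'(1)[symmetric] by blast
  then have 1: "(LINT y|lebesgue. D' y *\<^sub>R (indicator U y *\<^sub>R f y)) = - (LINT y|lebesgue. bump (n / \<delta>) c' d' y *\<^sub>R (indicator U y *\<^sub>R g y))"
    unfolding integral_open[OF U] by (simp add: mult.commute)
  have 2: "(LINT y|lebesgue. D' y *\<^sub>R (indicator U y *\<^sub>R f y)) = (\<delta> ^ 3) *\<^sub>R (LINT z|lborel. (1 / \<delta>) *\<^sub>R (D z *\<^sub>R f' z))"
  proof (rule integral_aff(2)[OF \<delta>])
    show "(\<lambda>y. D' y *\<^sub>R indicator U y *\<^sub>R f y) \<in> borel_measurable lebesgue"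
      by (intro borel_measurable_scaleR mf ml) measurable
    show "AE z in lborel. (1 / \<delta>) *\<^sub>R D z *\<^sub>R f' z = D' (aff \<delta> x z) *\<^sub>R indicator U (aff \<delta> x z) *\<^sub>R f (aff \<delta> x z)"
      using eq
    proof eventually_elim
      case (elim z) then show ?case using out[of z] by (cases "aff \<delta> x z \<in> U") (auto simp: DD)
    qed
  qed measurable
  have 3: "(LINT y|lebesgue. bump (n / \<delta>) c' d' y *\<^sub>R (indicator U y *\<^sub>R g y)) = (\<delta> ^ 3) *\<^sub>R (LINT z|lborel. (1 / \<delta>) *\<^sub>R (bump n c d z *\<^sub>R g' z))"
  proof (rule integral_aff(2)[OF \<delta>])
    show "(\<lambda>y. bump (n / \<delta>) c' d' y *\<^sub>R indicator U y *\<^sub>R g y) \<in> borel_measurable lebesgue"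
      by (intro borel_measurable_scaleR mg ml) measurable
    show "AE z in lborel. (1 / \<delta>) *\<^sub>R bump n c d z *\<^sub>R g' z = bump (n / \<delta>) c' d' (aff \<delta> x z) *\<^sub>R indicator U (aff \<delta> x z) *\<^sub>R g (aff \<delta> x z)"
      using eq
    proof eventually_elim
      case (elim z) then show ?case using out[of z] \<delta> by (cases "aff \<delta> x z \<in> U") (auto simp: bb)
    qed
  qed measurable
  show "(LINT y|lborel. pd i (bump n c d) y *\<^sub>R f' y) = - (LINT y|lborel. bump n c d y *\<^sub>R g' y)"
    using 1 \<delta> unfolding 2 3 D(1) integral_scaleR_right' by (simp flip: scaleR_minus_right)
qed

lemma open_aff_vimage: "open U \<Longrightarrow> open (aff \<delta> x -` U)"
  unfolding aff_def by (intro open_vimage continuous_intros)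

text \<open>With the trivial coordinates \<open>aff 1 0\<close> the lemma
  \<open>has_weak_deriv_wd\<close> merely replaces the functions by Borel representatives, for which
  \<open>wd_unique\<close> holds.\<close>

lemma weak_deriv_unique:
  fixes f g1 g2 :: "real^3 \<Rightarrow> 'b::euclidean_space"
  assumes w: "has_weak_deriv U i f g1" "has_weak_deriv U i f g2" and U: "open U"
  shows "AE y in lborel. y \<in> U \<longrightarrow> g1 y = g2 y"
proof -
  have ex: "\<exists>f'. f' \<in> borel_measurable borel \<and> (AE z in lborel. aff 1 0 z \<in> U \<longrightarrow> f' z = F (aff 1 0 z))"
    if F: "loc_integrable U F" for F :: "real^3 \<Rightarrow> 'b"
  proof -
    obtain F' where F': "F' \<in> borel_measurable borel" "AE z in lborel. F' z = indicator U (aff 1 0 z) *\<^sub>R F (aff 1 0 z)"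
      using borel_rep_aff[OF loc_integrable_measurable[OF F U], of 1 0] by auto
    from F'(2) have "AE z in lborel. aff 1 0 z \<in> U \<longrightarrow> F' z = F (aff 1 0 z)" by eventually_elim simp
    with F'(1) show ?thesis by blast
  qed
  have l: "loc_integrable U f" "loc_integrable U g1" "loc_integrable U g2"
    using w by (auto simp: has_weak_deriv_def)
  obtain f' g1' g2' where m: "f' \<in> borel_measurable borel" "g1' \<in> borel_measurable borel" "g2' \<in> borel_measurable borel"
    and ae: "AE z in lborel. aff 1 0 z \<in> U \<longrightarrow> f' z = f (aff 1 0 z)"
      "AE z in lborel. aff 1 0 z \<in> U \<longrightarrow> g1' z = g1 (aff 1 0 z)"
      "AE z in lborel. aff 1 0 z \<in> U \<longrightarrow> g2' z = g2 (aff 1 0 z)"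
    using ex[OF l(1)] ex[OF l(2)] ex[OF l(3)] by blast
  have "wd (aff 1 0 -` U) i f' g1'"
    by (rule has_weak_deriv_wd[OF w(1) U _ m(1,2)]) (simp, use ae(1,2) in \<open>eventually_elim, simp\<close>)
  moreover have "wd (aff 1 0 -` U) i f' g2'"
    by (rule has_weak_deriv_wd[OF w(2) U _ m(1,3)]) (simp, use ae(1,3) in \<open>eventually_elim, simp\<close>)
  ultimately have "AE z in lborel. z \<in> aff 1 0 -` U \<longrightarrow> g1' z = g2' z"
    by (rule wd_unique) (rule open_aff_vimage[OF U])
  with ae show ?thesis
    by eventually_elim (simp add: aff_def)
qed

lemma has_weak_deriv_weak_deriv: "has_weak_deriv U i f g \<Longrightarrow> has_weak_deriv U i f (weak_deriv U i f)"
  unfolding weak_deriv_def by (rule someI[of "has_weak_deriv U i f"])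

lemma ucell_vimage: "\<delta> > 0 \<Longrightarrow> aff \<delta> x -` cell \<delta> x = ucell"
  using cell_aff by blast

text \<open>The derivative exists inside the open cell only, so the formula holds for points whose
  segment of length \<open>h\<close> does not leave the cell, and both sides are cut off
  accordingly. On such segments \<open>fr\<close> is the identity and the difference on the torus is
  an ordinary one.\<close>

lemma local_difference:
  fixes u g :: "real^3 \<Rightarrow> 'b::euclidean_space"
  assumes \<delta>: "\<delta> > 0" and u: "L2 (cell \<delta> x) u" and g: "L2 (cell \<delta> x) g"
    and w: "has_weak_deriv (cell \<delta> x) j u g" and h: "0 < h" "h < 1"
  shows "Q j h (dif j h (lft \<delta> x u)) = Q j h (av j h (\<delta> *\<^sub>R lft \<delta> x g))"
proof -
  define f where "f = rep (lft \<delta> x u)"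
  define \<psi> where "\<psi> = rep (\<delta> *\<^sub>R lft \<delta> x g)"
  have S: "f \<in> Sq" "\<psi> \<in> Sq" by (auto simp: f_def \<psi>_def)
  have g2: "L2 (cell \<delta> x) (\<lambda>y. \<delta> *\<^sub>R g y + 0 *\<^sub>R g y)" and gl: "lft \<delta> x (\<lambda>y. \<delta> *\<^sub>R g y + 0 *\<^sub>R g y) = \<delta> *\<^sub>R lft \<delta> x g"
    using L2_comb[OF \<delta> g g, of \<delta> 0] by auto
  have a: "AE z in cubeM. f z = u (aff \<delta> x z)" "AE z in cubeM. \<psi> z = \<delta> *\<^sub>R g (aff \<delta> x z)"
    using rep_lft[OF \<delta> u] rep_lft[OF \<delta> g2] unfolding gl by (simp_all add: f_def \<psi>_def)
  have "wd (aff \<delta> x -` cell \<delta> x) j f \<psi>"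
  proof (rule has_weak_deriv_wd[OF w open_cell[OF \<delta>] \<delta> Sq_measurable[OF S(1)] Sq_measurable[OF S(2)]])
    show "AE z in lborel. aff \<delta> x z \<in> cell \<delta> x \<longrightarrow> f z = u (aff \<delta> x z) \<and> \<psi> z = \<delta> *\<^sub>R g (aff \<delta> x z)"
      using a unfolding AE_cubeM_ucell cell_aff[OF \<delta>] by eventually_elim simp
  qed
  then have W: "wd ucell j f \<psi>" by (simp add: ucell_vimage[OF \<delta>])
  \<comment> \<open>The points of the open cube whose segment in direction \<open>j\<close> stays in
    it; \<open>V\<close> is covered by boxes to which \<open>wd_translation\<close> applies.\<close>
  define V where "V = box 0 ((\<chi> i. 1) - h *\<^sub>R ax j)"
  have V: "y \<in> V \<longleftrightarrow> y \<in> ucell \<and> y $ j < 1 - h" for y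
  proof -
    have "y \<in> V \<longleftrightarrow> (\<forall>i. 0 < y $ i \<and> y $ i < 1 - h * ax j $ i)" unfolding V_def by (simp add: mem_box_cart)
    also have "\<dots> \<longleftrightarrow> (\<forall>i. 0 < y $ i \<and> y $ i < 1) \<and> y $ j < 1 - h"
    proof safe
      fix i assume a: "\<forall>i. 0 < y $ i \<and> y $ i < 1 - h * ax j $ i"
      show "0 < y $ i" using a by blast
      show "y $ i < 1" using spec[OF a, of i] h by (cases "i = j") (auto simp: axis_def)
      show "y $ j < 1 - h" using spec[OF a, of j] by simp
    next
      fix i assume "\<forall>i. 0 < y $ i \<and> y $ i < 1" "y $ j < 1 - h"
      then show "0 < y $ i" "y $ i < 1 - h * ax j $ i" by (cases "i = j"; simp add: axis_def)+
    qed
    finally show ?thesis by (simp add: mem_box_cart)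
  qed
  have "AE y in lborel. y \<in> V \<longrightarrow> f (y + h *\<^sub>R ax j) - f y = (LINT s|lborel. indicator {0..h} s *\<^sub>R \<psi> (y + s *\<^sub>R ax j))"
  proof (rule AE_open_boxes)
    show "open V" unfolding V_def by (rule open_box)
    fix p q assume pq: "cbox p q \<subseteq> V"
    show "AE y in lborel. y \<in> box p q \<longrightarrow> f (y + h *\<^sub>R ax j) - f y = (LINT s|lborel. indicator {0..h} s *\<^sub>R \<psi> (y + s *\<^sub>R ax j))"
    proof (cases "box p q = {}")
      case False
      then obtain y where "y \<in> box p q" by blast
      then have "p $ i \<le> q $ i" for i by (meson less_imp_le less_trans mem_box_cart)
      then have "p \<in> cbox p q" "q \<in> cbox p q" by (simp_all add: mem_box_cart)
      then have "p \<in> V" "q \<in> V" using pq by blast+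
      then have "cbox p (q + h *\<^sub>R ax j) \<subseteq> ucell"
      proof (intro subsetI)
        fix z assume z: "z \<in> cbox p (q + h *\<^sub>R ax j)"
        have "0 < z $ i \<and> z $ i < 1" for i
        proof -
          have "0 < p $ i" "q $ i < 1 - h * ax j $ i" using \<open>p \<in> V\<close> \<open>q \<in> V\<close> by (simp_all add: V_def mem_box_cart)
          moreover have "p $ i \<le> z $ i" "z $ i \<le> q $ i + h * ax j $ i"
            using z by (simp_all add: mem_box_cart)
          ultimately show ?thesis by linarith
        qed
        then show "z \<in> ucell" by (simp add: mem_box_cart)
      qed
      then show ?thesis using h by (intro wd_translation[OF W]) auto
    qed simp
  qed
  then have ae: "AE y in cubeM. y \<in> slab j h \<longrightarrow>
     f (fr (y + h *\<^sub>R ax j)) - f y = (LINT s|lborel. indicator {0..h} s *\<^sub>R \<psi> (fr (y + s *\<^sub>R ax j)))"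
    unfolding AE_cubeM_ucell
  proof eventually_elim
    case (elim y)
    show ?case
    proof (intro impI)
      assume y: "y \<in> ucell" "y \<in> slab j h"
      then have yV: "y \<in> V" using V by (simp add: slab_def)
      have c: "fr (y + s *\<^sub>R ax j) = y + s *\<^sub>R ax j" if "s \<in> {0..h}" for s
      proof (rule fr_cube)
        show "y + s *\<^sub>R ax j \<in> unit_cube"
          unfolding unit_cube_def
        proof (intro CollectI allI conjI)
          fix i
          have "0 < y $ i" "y $ i < 1" using y by (simp_all add: mem_box_cart)
          moreover have "y $ j < 1 - h" using y by (simp add: slab_def)
          ultimately show "0 \<le> (y + s *\<^sub>R ax j) $ i" "(y + s *\<^sub>R ax j) $ i < 1"
            using that by (cases "i = j"; simp add: axis_def)+
        qed
      qed
      have e: "indicator {0..h} s *\<^sub>R \<psi> (fr (y + s *\<^sub>R ax j)) = indicator {0..h} s *\<^sub>R \<psi> (y + s *\<^sub>R ax j)" for s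
        using c[of s] by (auto simp: indicator_def)
      then show "f (fr (y + h *\<^sub>R ax j)) - f y = (LINT s|lborel. indicator {0..h} s *\<^sub>R \<psi> (fr (y + s *\<^sub>R ax j)))"
        unfolding e using elim yV c[of h] h by simp
    qed
  qed
  have "Q j h (cls (\<lambda>y. f (fr (y + h *\<^sub>R ax j)) - f y)) = Q j h (av j h (cls \<psi>))"
    unfolding Q_def by (rule cls_eq_av[OF Sq_diff[OF Sq_shift[OF S(1)] S(1)] S(2) slab_sets ae])
  moreover have "cls (\<lambda>y. f (fr (y + h *\<^sub>R ax j)) - f y) = dif j h (lft \<delta> x u)"
    unfolding dif_def shift_def f_def using cls_diff[OF Sq_shift[OF S(1)] S(1)] by (simp add: f_def)
  ultimately show ?thesis by (simp add: \<psi>_def)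
qed

section \<open>Periodic functions\<close>

definition lattice :: "(real^3) set" where
  "lattice = range (\<lambda>k :: int^3. \<chi> i. of_int (k $ i))"

lemma countable_lattice: "countable lattice"
  unfolding lattice_def by simp

lemma lattice_iff: "k \<in> lattice \<longleftrightarrow> (\<forall>i. k $ i \<in> \<int>)"
proof
  assume "\<forall>i. k $ i \<in> \<int>"
  then have "k = (\<chi> i. of_int ((\<chi> i. \<lfloor>k $ i\<rfloor>) $ i))" by (simp add: vec_eq_iff)
  then show "k \<in> lattice" unfolding lattice_def by blast
qed (auto simp: lattice_def)

lemma lattice_fr: "fr z - z \<in> lattice" "z - fr z \<in> lattice"
  by (auto simp: lattice_iff fr_def frac_def)

lemma fr_lattice: "k \<in> lattice \<Longrightarrow> fr (z + k) = fr z"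
  by (auto simp: lattice_def fr_def vec_eq_iff frac_add_of_int)

lemma periodic_lattice:
  assumes p: "periodic L f" and k: "k \<in> lattice"
  shows "f (y + L *\<^sub>R k) = f y"
proof -
  have n: "f (y + (L * real n) *\<^sub>R ax i) = f y" for n y i
  proof (induction n)
    case (Suc n)
    have "y + (L * real (Suc n)) *\<^sub>R ax i = (y + (L * real n) *\<^sub>R ax i) + L *\<^sub>R ax i"
      by (simp add: algebra_simps)
    also have "f \<dots> = f y" using p Suc by (simp only: periodic_def)
    finally show ?case .
  qed simp
  have z: "f (y + (L * a) *\<^sub>R ax i) = f y" if a: "a \<in> \<int>" for a y i
  proof -
    obtain b where b: "a = of_int b" using a by (auto elim: Ints_cases)
    show ?thesis
    proof (cases "b \<ge> 0")
      case True then show ?thesis using n[of y "nat b" i] by (simp add: b)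
    next
      case False then show ?thesis using n[of "y + (L * a) *\<^sub>R ax i" "nat (- b)" i] by (simp add: b)
    qed
  qed
  have e: "L *\<^sub>R k = (L * k $ 1) *\<^sub>R ax 1 + (L * k $ 2) *\<^sub>R ax 2 + (L * k $ 3) *\<^sub>R ax 3"
    by (simp add: vec_eq_iff forall_3 axis_def)
  have "\<forall>i. k $ i \<in> \<int>" using k by (simp add: lattice_iff)
  then show ?thesis unfolding e add.assoc[symmetric] by (simp add: z)
qed

lemma aff_add: "aff \<delta> x (z + k) = aff \<delta> x z + \<delta> *\<^sub>R k" "aff \<delta> (x + \<delta> *\<^sub>R k) z = aff \<delta> x (z + k)"
  by (simp_all add: aff_def algebra_simps)

lemma periodic_fr:
  assumes "periodic \<delta> f" shows "f (aff \<delta> x (fr z)) = f (aff \<delta> x z)"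
  using periodic_lattice[OF assms lattice_fr(1), of "aff \<delta> x z" z] by (simp flip: aff_add(1))

lemma AE_translate: assumes "AE y in lborel. P y" shows "AE z in lborel. P (z + k :: real^3)"
  using AE_aff_imp[OF zero_less_one assms, of k] by (simp add: aff_def add.commute)

text \<open>Countably many lattice translates of the cube cover the space, so the translated null
  sets still form a null set.\<close>

lemma AE_periodic: assumes "AE z in cubeM. P z" shows "AE z in lborel. P (fr z)"
proof -
  have "AE z in lborel. \<forall>k\<in>lattice. z + k \<in> unit_cube \<longrightarrow> P (z + k)"
    by (intro AE_ball_countable[OF countable_lattice, THEN iffD2] ballI
        AE_translate[where P = "\<lambda>z. z \<in> unit_cube \<longrightarrow> P z"]) (use assms in \<open>simp add: AE_cubeM\<close>)
  then show ?thesis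
  proof eventually_elim
    case (elim z)
    then show ?case using bspec[OF elim lattice_fr(1)[of z]] by simp
  qed
qed

lemma AE_lborel_cubeM: "AE z in lborel. P z \<Longrightarrow> AE z in cubeM. P z"
  unfolding AE_cubeM by (erule eventually_mono) simp

text \<open>The weak derivative \<open>g\<close> is not assumed to be periodic. Its lattice
  translates are weak derivatives of the same periodic function, so by uniqueness they all agree
  almost everywhere, and the values of \<open>g\<close> on one cell determine it on the whole
  space.\<close>

lemma per_wd:
  fixes f g :: "real^3 \<Rightarrow> 'b::euclidean_space"
  assumes \<delta>: "\<delta> > 0" and p: "periodic \<delta> f" and w: "has_weak_deriv UNIV i f g"
    and F: "F \<in> borel_measurable borel" "AE z in cubeM. F z = f (aff \<delta> x z)"
    and G: "G \<in> borel_measurable borel" "AE z in cubeM. G z = \<delta> *\<^sub>R g (aff \<delta> x z)"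
  shows "wd UNIV i (\<lambda>z. F (fr z)) (\<lambda>z. G (fr z))"
proof -
  have [measurable]: "F \<in> borel_measurable borel" "G \<in> borel_measurable borel" using F G by auto
  have Ff: "AE z in lborel. F (fr z) = f (aff \<delta> x z)"
    using AE_periodic[OF F(2)] by eventually_elim (simp add: periodic_fr[OF p])
  have lg: "loc_integrable UNIV g" using w by (simp add: has_weak_deriv_def)
  have "g \<in> borel_measurable lebesgue" using loc_integrable_measurable[OF lg] by simp
  then obtain g1 where g1m [measurable]: "g1 \<in> borel_measurable borel" and g1: "AE z in lborel. g1 z = g (aff \<delta> x z)"
    using borel_rep_aff[OF _ \<delta>] by blast
  have W: "wd UNIV i (\<lambda>z. F (fr z)) (\<lambda>z. \<delta> *\<^sub>R g1 (z + k))" if k: "k \<in> lattice" for k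
  proof -
    have "wd (aff \<delta> (x + \<delta> *\<^sub>R k) -` UNIV) i (\<lambda>z. F (fr z)) (\<lambda>z. \<delta> *\<^sub>R g1 (z + k))"
    proof (rule has_weak_deriv_wd[OF w open_UNIV \<delta>])
      show "AE z in lborel. aff \<delta> (x + \<delta> *\<^sub>R k) z \<in> UNIV \<longrightarrow>
        F (fr z) = f (aff \<delta> (x + \<delta> *\<^sub>R k) z) \<and> \<delta> *\<^sub>R g1 (z + k) = \<delta> *\<^sub>R g (aff \<delta> (x + \<delta> *\<^sub>R k) z)"
        using Ff AE_translate[OF g1, of k]
      proof eventually_elim
        case (elim z)
        have "f (aff \<delta> (x + \<delta> *\<^sub>R k) z) = f (aff \<delta> x z)"
          unfolding aff_add by (rule periodic_lattice[OF p k])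
        then show ?case using elim by (simp add: aff_add(2))
      qed
    qed measurable
    then show ?thesis by simp
  qed
  have "AE z in lborel. \<forall>k\<in>lattice. \<delta> *\<^sub>R g1 (z + 0) = \<delta> *\<^sub>R g1 (z + k)"
  proof (intro AE_ball_countable[OF countable_lattice, THEN iffD2] ballI)
    fix k assume k: "k \<in> lattice"
    have "0 \<in> lattice" by (simp add: lattice_iff)
    from wd_unique[OF W[OF this] W[OF k] open_UNIV]
    show "AE z in lborel. \<delta> *\<^sub>R g1 (z + 0) = \<delta> *\<^sub>R g1 (z + k)" by simp
  qed
  with AE_periodic[OF G(2)] AE_periodic[OF AE_lborel_cubeM[OF g1]] g1
  have GG: "AE z in lborel. G (fr z) = \<delta> *\<^sub>R g (aff \<delta> x z)"
  proof eventually_elim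
    case (elim z)
    have "\<delta> *\<^sub>R g1 z = \<delta> *\<^sub>R g1 (fr z)"
      using bspec[OF elim(4) lattice_fr(1)[of z]] by simp
    then show ?case using elim(1-3) \<delta> by (simp only:)
  qed
  have "wd (aff \<delta> x -` UNIV) i (\<lambda>z. F (fr z)) (\<lambda>z. G (fr z))"
  proof (rule has_weak_deriv_wd[OF w open_UNIV \<delta>])
    show "AE z in lborel. aff \<delta> x z \<in> UNIV \<longrightarrow> F (fr z) = f (aff \<delta> x z) \<and> G (fr z) = \<delta> *\<^sub>R g (aff \<delta> x z)"
      using Ff GG by eventually_elim simp
  qed measurable
  then show ?thesis by simp
qed

text \<open>Counterpart of \<open>local_difference\<close> without cut-off: the derivative exists
  across the faces, so segments may wrap around the torus.\<close>

lemma per_difference: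
  fixes f g :: "real^3 \<Rightarrow> 'b::euclidean_space"
  assumes \<delta>: "\<delta> > 0" and p: "periodic \<delta> f" and f: "L2 (cell \<delta> x) f"
    and w: "has_weak_deriv UNIV i f g" and g: "L2 (cell \<delta> x) g" and h: "h \<ge> 0"
  shows "dif i h (lft \<delta> x f) = av i h (\<delta> *\<^sub>R lft \<delta> x g)"
proof -
  define F where "F = rep (lft \<delta> x f)"
  define G where "G = rep (\<delta> *\<^sub>R lft \<delta> x g)"
  have S: "F \<in> Sq" "G \<in> Sq" by (auto simp: F_def G_def)
  have g2: "L2 (cell \<delta> x) (\<lambda>y. \<delta> *\<^sub>R g y + 0 *\<^sub>R g y)" and gl: "lft \<delta> x (\<lambda>y. \<delta> *\<^sub>R g y + 0 *\<^sub>R g y) = \<delta> *\<^sub>R lft \<delta> x g"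
    using L2_comb[OF \<delta> g g, of \<delta> 0] by auto
  have a: "AE z in cubeM. F z = f (aff \<delta> x z)" "AE z in cubeM. G z = \<delta> *\<^sub>R g (aff \<delta> x z)"
    using rep_lft[OF \<delta> f] rep_lft[OF \<delta> g2] unfolding gl by (simp_all add: F_def G_def)
  have W: "wd UNIV i (\<lambda>z. F (fr z)) (\<lambda>z. G (fr z))"
    by (rule per_wd[OF \<delta> p w Sq_measurable[OF S(1)] a(1) Sq_measurable[OF S(2)] a(2)])
  have t: "AE y in lborel. y \<in> ucell \<longrightarrow>
     F (fr (y + h *\<^sub>R ax i)) - F (fr y) = (LINT s|lborel. indicator {0..h} s *\<^sub>R G (fr (y + s *\<^sub>R ax i)))"
    by (rule wd_translation[OF W h]) simp
  have ae: "AE y in cubeM. y \<in> UNIV \<longrightarrow>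
     F (fr (y + h *\<^sub>R ax i)) - F y = (LINT s|lborel. indicator {0..h} s *\<^sub>R G (fr (y + s *\<^sub>R ax i)))"
    using t unfolding AE_cubeM_ucell
  proof eventually_elim
    case (elim y)
    then show ?case using fr_cube[of y] ucell_subset by auto
  qed
  have pw: "pw (\<lambda>y v. indicator UNIV y *\<^sub>R v) H = H" for H :: "'b l2"
  proof -
    obtain u where u: "H = cls u" "u \<in> Sq" using l2_obtain .
    have "(UNIV :: (real^3) set) \<in> sets borel" by simp
    from pw_cls[OF lin_field_indicator[OF this] u(2)] show ?thesis by (simp add: u(1))
  qed
  have "cls (\<lambda>y. F (fr (y + h *\<^sub>R ax i)) - F y) = av i h (cls G)"
    using cls_eq_av[OF Sq_diff[OF Sq_shift[OF S(1)] S(1)] S(2) _ ae] unfolding pw by simp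
  moreover have "cls (\<lambda>y. F (fr (y + h *\<^sub>R ax i)) - F y) = dif i h (lft \<delta> x f)"
    unfolding dif_def shift_def F_def using cls_diff[OF Sq_shift[OF S(1)] S(1)] by (simp add: F_def)
  ultimately show ?thesis by (simp add: G_def)
qed

lemma lft_cong:
  assumes "\<delta> > 0" "AE y in lebesgue_on (cell \<delta> x). f y = g y" "L2 (cell \<delta> x) f"
  shows "lft \<delta> x g = lft \<delta> x f"
proof -
  obtain F where F: "F \<in> Sq" "AE z in cubeM. F z = f (aff \<delta> x z)" "lft \<delta> x f = cls F"
    using L2_rep[OF assms(1,3)] .
  have "AE z in cubeM. F z = g (aff \<delta> x z)"
    using F(2) assms(2)[unfolded AE_cell[OF assms(1)]] by eventually_elim simp
  from lft_eq[OF F(1) this] F(3) show ?thesis by simp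
qed

lemma L2_cong:
  fixes f g :: "real^3 \<Rightarrow> 'b::euclidean_space"
  assumes "\<delta> > 0" "AE y in lebesgue_on (cell \<delta> x). f y = g y" "L2 (cell \<delta> x) f"
    and "g \<in> borel_measurable (lebesgue_on (cell \<delta> x))"
  shows "L2 (cell \<delta> x) g"
proof -
  obtain F where F: "F \<in> Sq" "AE z in cubeM. F z = f (aff \<delta> x z)" "lft \<delta> x f = cls F"
    using L2_rep[OF assms(1,3)] .
  have "AE z in cubeM. F z = g (aff \<delta> x z)"
    using F(2) assms(2)[unfolded AE_cell[OF assms(1)]] by eventually_elim simp
  from L2_I[OF assms(1) F(1) this assms(4)] show ?thesis .
qed

lemma AE_cell_lborel:
  assumes "\<delta> > 0"
  shows "(AE y in lebesgue_on (cell \<delta> x). P y) \<longleftrightarrow> (AE y in lborel. y \<in> cell \<delta> x \<longrightarrow> P y)"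
  using cell_sets[OF assms] by (subst AE_restrict_space_iff) (auto simp: AE_completion_iff)

lemma loc_integrable_cell_measurable:
  fixes f :: "real^3 \<Rightarrow> 'b::euclidean_space"
  assumes "\<delta> > 0" "loc_integrable (cell \<delta> x) f"
  shows "f \<in> borel_measurable (lebesgue_on (cell \<delta> x))"
  using loc_integrable_measurable[OF assms(2) open_cell[OF assms(1)]] cell_sets[OF assms(1)]
  by (subst borel_measurable_restrict_space_iff) auto

text \<open>\<open>weak_deriv\<close> is an arbitrary choice. Comparison with one square integrable
  candidate shows that the choice matters on a null set only, and that it leaves the class
  unchanged.\<close>

lemma weak_deriv_L2:
  fixes f g :: "real^3 \<Rightarrow> 'b::euclidean_space"
  assumes \<delta>: "\<delta> > 0" and w: "has_weak_deriv (cell \<delta> x) i f g" and g: "L2 (cell \<delta> x) g"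
  shows "L2 (cell \<delta> x) (weak_deriv (cell \<delta> x) i f)"
    and "lft \<delta> x (weak_deriv (cell \<delta> x) i f) = lft \<delta> x g"
    and "AE y in lebesgue_on (cell \<delta> x). g y = weak_deriv (cell \<delta> x) i f y"
proof -
  have w': "has_weak_deriv (cell \<delta> x) i f (weak_deriv (cell \<delta> x) i f)"
    by (rule has_weak_deriv_weak_deriv[OF w])
  show ae: "AE y in lebesgue_on (cell \<delta> x). g y = weak_deriv (cell \<delta> x) i f y"
    unfolding AE_cell_lborel[OF \<delta>] by (rule weak_deriv_unique[OF w w' open_cell[OF \<delta>]])
  have "weak_deriv (cell \<delta> x) i f \<in> borel_measurable (lebesgue_on (cell \<delta> x))"
    using w' by (intro loc_integrable_cell_measurable[OF \<delta>]) (simp add: has_weak_deriv_def)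
  from L2_cong[OF \<delta> ae g this] lft_cong[OF \<delta> ae g]
  show "L2 (cell \<delta> x) (weak_deriv (cell \<delta> x) i f)" "lft \<delta> x (weak_deriv (cell \<delta> x) i f) = lft \<delta> x g" .
qed

text \<open>The weak derivative on the whole space restricts to one on the cell, where uniqueness
  identifies it with the \<open>weak_deriv\<close> used in the norms and in the equation. The
  matching of opposite faces thereby becomes a difference formula on the torus for derivatives taken
  in the cell.\<close>

lemma H1_per_weak_deriv:
  fixes w :: "real^3 \<Rightarrow> 'b::euclidean_space"
  assumes \<delta>: "\<delta> > 0" and w: "H1_per \<delta> x w"
  shows "has_weak_deriv (cell \<delta> x) i w (weak_deriv (cell \<delta> x) i w)"
    and "L2 (cell \<delta> x) (weak_deriv (cell \<delta> x) i w)"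
    and "h \<ge> 0 \<Longrightarrow> dif i h (lft \<delta> x w) = av i h (\<delta> *\<^sub>R lft \<delta> x (weak_deriv (cell \<delta> x) i w))"
proof -
  obtain g where g: "has_weak_deriv UNIV i w g" "L2 (cell \<delta> x) g"
    and p: "periodic \<delta> w" "L2 (cell \<delta> x) w" using w unfolding H1_per_def by blast
  have gc: "has_weak_deriv (cell \<delta> x) i w g" by (rule has_weak_deriv_restrict[OF g(1) open_cell[OF \<delta>]])
  show "has_weak_deriv (cell \<delta> x) i w (weak_deriv (cell \<delta> x) i w)" by (rule has_weak_deriv_weak_deriv[OF gc])
  show "L2 (cell \<delta> x) (weak_deriv (cell \<delta> x) i w)" by (rule weak_deriv_L2(1)[OF \<delta> gc g(2)])
  show "dif i h (lft \<delta> x w) = av i h (\<delta> *\<^sub>R lft \<delta> x (weak_deriv (cell \<delta> x) i w))" if "h \<ge> 0"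
    unfolding weak_deriv_L2(2)[OF \<delta> gc g(2)] by (rule per_difference[OF \<delta> p g that])
qed

section \<open>Periodisation of test functions\<close>

lemma bounded_lattice_cover:
  assumes "bounded B"
  obtains S where "finite S" "S \<subseteq> lattice" "\<And>z. z \<in> B \<Longrightarrow> z - fr z \<in> S"
proof -
  obtain r where r: "\<And>z. z \<in> B \<Longrightarrow> norm z \<le> r" using assms by (auto simp: bounded_iff)
  define n where "n = \<lceil>r\<rceil> + 1"
  define v :: "int \<times> int \<times> int \<Rightarrow> real^3" where
    "v = (\<lambda>(a, b, c). \<chi> i. of_int (if i = 1 then a else if i = 2 then b else c))"
  define S where "S = v ` ({-n..n} \<times> {-n..n} \<times> {-n..n})"
  have "finite S" by (simp add: S_def)
  moreover have "S \<subseteq> lattice" by (auto simp: S_def v_def lattice_iff)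
  moreover have "z - fr z \<in> S" if "z \<in> B" for z
  proof -
    have "\<lfloor>z $ i\<rfloor> \<in> {-n..n}" for i
    proof -
      have "\<bar>z $ i\<bar> \<le> r" using component_le_norm_cart[of z i] r[OF that] by linarith
      then have "- of_int \<lceil>r\<rceil> \<le> z $ i" "z $ i \<le> of_int \<lceil>r\<rceil>" by linarith+
      then show ?thesis unfolding n_def by (simp add: le_floor_iff floor_le_iff)
    qed
    moreover have "z - fr z = v (\<lfloor>z $ 1\<rfloor>, \<lfloor>z $ 2\<rfloor>, \<lfloor>z $ 3\<rfloor>)"
      by (simp add: vec_eq_iff forall_3 v_def fr_def frac_def)
    ultimately show ?thesis unfolding S_def by blast
  qed
  ultimately show ?thesis using that by blast
qed

lemma sum_shift_bound:
  fixes \<phi> :: "'a::plus \<Rightarrow> real"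
  assumes "\<And>z. \<bar>\<phi> z\<bar> \<le> B" shows "\<bar>\<Sum>k\<in>S. \<phi> (z + k)\<bar> \<le> real (card S) * B"
  using order_trans[OF sum_abs sum_bounded_above[of S "\<lambda>k. \<bar>\<phi> (z + k)\<bar>" B]] assms by simp

text \<open>Unfolding: a compactly supported function meets only finitely many lattice cells, and
  summing its lattice translates turns an integral over the whole space into one over the
  cube.\<close>

lemma per_integral:
  fixes H :: "real^3 \<Rightarrow> 'b::euclidean_space" and \<phi> :: "real^3 \<Rightarrow> real"
  assumes S: "finite S" "S \<subseteq> lattice" and supp: "\<And>z. z - fr z \<notin> S \<Longrightarrow> \<phi> z = 0"
    and \<phi> [measurable]: "\<phi> \<in> borel_measurable borel" and B: "\<And>z. \<bar>\<phi> z\<bar> \<le> B"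
    and H [measurable]: "H \<in> borel_measurable borel" and Hi: "integrable cubeM H"
  shows "integrable lborel (\<lambda>z. \<phi> z *\<^sub>R H (fr z))"
    and "(LINT z|lborel. \<phi> z *\<^sub>R H (fr z)) = (\<integral>z. (\<Sum>k\<in>S. \<phi> (z + k)) *\<^sub>R H z \<partial>cubeM)"
proof -
  define q where "q k z = indicator unit_cube z *\<^sub>R (\<phi> (z + k) *\<^sub>R H z)" for k z
  have qm [measurable]: "q k \<in> borel_measurable borel" for k unfolding q_def by measurable
  have ci: "integrable cubeM (\<lambda>z. \<phi> (z + k) *\<^sub>R H z)" for k
  proof (rule Bochner_Integration.integrable_bound)
    show "integrable cubeM (\<lambda>z. B *\<^sub>R H z)" using Hi by simp
    have "\<bar>\<phi> (z + k)\<bar> \<le> \<bar>B\<bar>" for z using B[of "z + k"] by linarith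
    then show "AE z in cubeM. norm (\<phi> (z + k) *\<^sub>R H z) \<le> norm (B *\<^sub>R H z)"
      by (auto intro!: mult_right_mono)
  qed measurable
  have qi: "integrable lborel (q k)" for k
    using ci[of k] unfolding integrable_cubeM_iff q_def .
  have dec: "\<phi> z *\<^sub>R H (fr z) = (\<Sum>k\<in>S. q k (z + (- k)))" for z
  proof -
    have q: "q k (z + (- k)) = (if k = z - fr z then \<phi> z *\<^sub>R H (fr z) else 0)" if "k \<in> S" for k
    proof (cases "k = z - fr z")
      case False
      have "z - k \<notin> unit_cube"
      proof
        assume "z - k \<in> unit_cube"
        then have "z - k = fr (z - k)" by (simp add: fr_cube)
        also have "\<dots> = fr ((z - k) + k)" using fr_lattice[of k "z - k"] that S by auto
        finally show False using False by (simp add: algebra_simps)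
      qed
      then show ?thesis using False by (simp add: q_def)
    qed (simp add: q_def)
    have "(\<Sum>k\<in>S. q k (z + (- k))) = (\<Sum>k\<in>S. if k = z - fr z then \<phi> z *\<^sub>R H (fr z) else 0)"
      by (rule sum.cong[OF refl q])
    also have "\<dots> = \<phi> z *\<^sub>R H (fr z)" using S supp[of z] by simp
    finally show ?thesis ..
  qed
  show "integrable lborel (\<lambda>z. \<phi> z *\<^sub>R H (fr z))"
    unfolding dec by (intro Bochner_Integration.integrable_sum integrable_lborel_shift qi)
  have "(LINT z|lborel. \<phi> z *\<^sub>R H (fr z)) = (\<Sum>k\<in>S. LINT z|lborel. q k (z + (- k)))"
    unfolding dec by (intro Bochner_Integration.integral_sum integrable_lborel_shift qi)
  also have "\<dots> = (\<Sum>k\<in>S. \<integral>z. \<phi> (z + k) *\<^sub>R H z \<partial>cubeM)"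
  proof (intro sum.cong refl)
    fix k
    have "(LINT z|lborel. q k (z + (- k))) = (LINT z|lborel. q k z)" by (rule integral_lborel_shift[OF qm])
    then show "(LINT z|lborel. q k (z + (- k))) = (\<integral>z. \<phi> (z + k) *\<^sub>R H z \<partial>cubeM)"
      by (simp add: q_def integral_cubeM)
  qed
  also have "\<dots> = (\<integral>z. (\<Sum>k\<in>S. \<phi> (z + k)) *\<^sub>R H z \<partial>cubeM)"
    by (simp add: scaleR_sum_left ci)
  finally show "(LINT z|lborel. \<phi> z *\<^sub>R H (fr z)) = (\<integral>z. (\<Sum>k\<in>S. \<phi> (z + k)) *\<^sub>R H z \<partial>cubeM)" .
qed

text \<open>Converse of \<open>per_difference\<close>. The difference quotient is moved from
  \<open>F\<close> to \<open>\<psi>\<close>, where it converges to \<open>- D\<close> by dominated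
  convergence. On the side of \<open>F\<close> it is the normalised average of \<open>G\<close>,
  which tends to \<open>G\<close>. The periodisation \<open>\<Phi>\<close> expresses pairings with
  \<open>\<psi>\<close> as inner products of classes.\<close>

lemma per_weak:
  fixes F G :: "real^3 \<Rightarrow> 'b::euclidean_space" and \<psi> D :: "real^3 \<Rightarrow> real"
  assumes F: "F \<in> Sq" and G: "G \<in> Sq" and dif: "\<And>h. h \<ge> 0 \<Longrightarrow> dif l h (cls F) = av l h (cls G)"
    and \<psi>: "continuous_on UNIV \<psi>" and D: "continuous_on UNIV D"
    and K: "compact K" "\<And>z. z \<notin> K \<Longrightarrow> \<psi> z = 0" "\<And>z. z \<notin> K \<Longrightarrow> D z = 0"
    and der: "\<And>z t. ((\<lambda>t. \<psi> (z + t *\<^sub>R ax l)) has_real_derivative D (z + t *\<^sub>R ax l)) (at t)"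
  shows "(LINT z|lborel. D z *\<^sub>R F (fr z)) = - (LINT z|lborel. \<psi> z *\<^sub>R G (fr z))"
proof -
  have [measurable]: "\<psi> \<in> borel_measurable borel" "D \<in> borel_measurable borel"
    "F \<in> borel_measurable borel" "G \<in> borel_measurable borel"
    using borel_measurable_continuous_onI[OF \<psi>] borel_measurable_continuous_onI[OF D] Sq_measurable F G by auto
  have bd: "\<exists>B\<ge>0. \<forall>z. \<bar>f z\<bar> \<le> B" if "continuous_on UNIV f" "\<And>z. z \<notin> K \<Longrightarrow> f z = 0" for f :: "real^3 \<Rightarrow> real"
  proof -
    have "compact (f ` K)" using that(1) K(1) by (intro compact_continuous_image continuous_on_subset[OF that(1)]) auto
    then obtain B where "\<And>z. z \<in> K \<Longrightarrow> \<bar>f z\<bar> \<le> B" using compact_imp_bounded by (fastforce simp: bounded_iff)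
    then have "\<bar>f z\<bar> \<le> max B 0" for z using that(2)[of z] by (cases "z \<in> K") (auto simp: le_max_iff_disj)
    then show ?thesis by (intro exI[of _ "max B 0"]) auto
  qed
  obtain P where P: "P \<ge> 0" "\<And>z. \<bar>\<psi> z\<bar> \<le> P" using bd[OF \<psi> K(2)] by blast
  obtain B where B: "B \<ge> 0" "\<And>z. \<bar>D z\<bar> \<le> B" using bd[OF D K(3)] by blast
  obtain r where r0: "K \<subseteq> ball 0 r" using bounded_subset_ballD[OF compact_imp_bounded[OF K(1)], of 0] by blast
  then have r: "K \<subseteq> cball 0 r" using ball_subset_cball by blast
  \<comment> \<open>One unit larger than a ball containing \<open>K\<close>: the steps
    \<open>h n\<close> are at most one, and the shifted \<open>\<psi>\<close> must still be
    supported in it.\<close>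
  let ?K = "cball 0 (r + 1) :: (real^3) set"
  obtain S where S: "finite S" "S \<subseteq> lattice" "\<And>z. z \<in> ?K \<Longrightarrow> z - fr z \<in> S"
    using bounded_lattice_cover[OF bounded_cball] by metis
  have KK: "K \<subseteq> ?K" using r by (force simp: subset_iff)
  have supp: "\<psi> z = 0" "D z = 0" "indicat_real ?K z = 0" if z: "z - fr z \<notin> S" for z
  proof -
    have "z \<notin> ?K" using z S(3)[of z] by blast
    moreover from this have "z \<notin> K" using KK by blast
    ultimately show "\<psi> z = 0" "D z = 0" "indicat_real ?K z = 0" using K(2,3)[of z] by simp_all
  qed
  have FL1: "integrable cubeM F" "integrable cubeM G" using Sq_integrable F G by auto
  have FL1n: "integrable cubeM (\<lambda>z. norm (F z))" using FL1 by simp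
  define \<Phi> where "\<Phi> z = (\<Sum>k\<in>S. \<psi> (z + k))" for z
  have [measurable]: "\<Phi> \<in> borel_measurable borel" unfolding \<Phi>_def by measurable
  have \<Phi>b: "\<bar>\<Phi> z\<bar> \<le> real (card S) * P" for z
    unfolding \<Phi>_def by (rule sum_shift_bound[OF P(2)])
  have \<Phi>S: "(\<lambda>z. \<Phi> z *\<^sub>R b) \<in> Sq" for b :: 'b
  proof (rule Sq_bounded[where c = "real (card S) * P * norm b"])
    show "AE z in cubeM. norm (\<Phi> z *\<^sub>R b) \<le> real (card S) * P * norm b"
      using \<Phi>b by (auto intro!: mult_right_mono)
  qed measurable
  have pair: "inner (LINT z|lborel. \<psi> z *\<^sub>R H (fr z)) b = inner (cls H) (cls (\<lambda>z. \<Phi> z *\<^sub>R b))"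
    if H: "H \<in> Sq" for H :: "real^3 \<Rightarrow> 'b" and b
  proof -
    have [measurable]: "H \<in> borel_measurable borel" by (rule Sq_measurable[OF H])
    have Hi: "integrable cubeM H" by (rule Sq_integrable[OF H])
    have i: "integrable cubeM (\<lambda>z. \<Phi> z *\<^sub>R H z)"
    proof (rule Bochner_Integration.integrable_bound)
      show "integrable cubeM (\<lambda>z. (real (card S) * P) *\<^sub>R H z)" using Hi by simp
      show "AE z in cubeM. norm (\<Phi> z *\<^sub>R H z) \<le> norm ((real (card S) * P) *\<^sub>R H z)"
        using \<Phi>b P(1) by (auto simp: abs_mult intro!: mult_right_mono)
    qed measurable
    have "(LINT z|lborel. \<psi> z *\<^sub>R H (fr z)) = (\<integral>z. \<Phi> z *\<^sub>R H z \<partial>cubeM)"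
      unfolding \<Phi>_def by (rule per_integral(2)[OF S(1,2) supp(1) _ P(2) _ Hi]) measurable
    then show ?thesis
      unfolding inner_cls[OF H \<Phi>S] using integral_inner_left[OF i, of b] by (simp add: mult.commute)
  qed
  define h where "h n = 1 / real (Suc n)" for n
  have h: "h n > 0" "h n \<le> 1" for n by (simp_all add: h_def)
  have h0: "h \<longlonglongrightarrow> 0" unfolding h_def by (rule lim_1_over_n[THEN LIMSEQ_Suc])
  have h0r: "filterlim h (at_right 0) sequentially"
    by (rule tendsto_imp_filterlim_at_right[OF h0]) (simp add: h)
  let ?q = "\<lambda>n z. (1 / h n) * (\<psi> (z + (- h n) *\<^sub>R ax l) - \<psi> z)"
  have lip: "\<bar>\<psi> (z + (- h n) *\<^sub>R ax l) - \<psi> z\<bar> \<le> B * h n" for n z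
  proof -
    have "norm (\<psi> (z + (- h n) *\<^sub>R ax l) - \<psi> (z + 0 *\<^sub>R ax l)) \<le> B * norm (- h n - 0)"
    proof (rule field_differentiable_bound[of UNIV])
      show "((\<lambda>t. \<psi> (z + t *\<^sub>R ax l)) has_field_derivative D (z + t *\<^sub>R ax l)) (at t within UNIV)" for t
        using der[of z t] by simp
    qed (use B in auto)
    then show ?thesis using h[of n] by simp
  qed
  have q1: "(LINT z|lborel. ?q n z *\<^sub>R F (fr z)) = (LINT z|lborel. \<psi> z *\<^sub>R ((1 / h n) *\<^sub>R (F (fr (fr z + h n *\<^sub>R ax l)) - F (fr z))))" for n
  proof -
    have i1: "integrable lborel (\<lambda>z. \<psi> z *\<^sub>R F (fr z))"
      by (rule per_integral(1)[OF S(1,2) supp(1) _ P(2) _ FL1(1)]) measurable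
    have FSs: "(\<lambda>z. F (fr (z + h n *\<^sub>R ax l))) \<in> Sq" by (rule Sq_shift[OF F])
    have i2: "integrable lborel (\<lambda>z. \<psi> z *\<^sub>R (\<lambda>z. F (fr (z + h n *\<^sub>R ax l))) (fr z))"
      by (rule per_integral(1)[OF S(1,2) supp(1) _ P(2) _ Sq_integrable[OF FSs]]) measurable
    have i2': "integrable lborel (\<lambda>z. \<psi> z *\<^sub>R F (fr (z + h n *\<^sub>R ax l)))" using i2 by simp
    from integrable_lborel_shift[OF this, of "(- h n) *\<^sub>R ax l"]
    have i3: "integrable lborel (\<lambda>z. \<psi> (z + (- h n) *\<^sub>R ax l) *\<^sub>R F (fr z))" by simp
    have "(LINT z|lborel. \<psi> (z + (- h n) *\<^sub>R ax l) *\<^sub>R F (fr z)) = (LINT z|lborel. \<psi> z *\<^sub>R F (fr (z + h n *\<^sub>R ax l)))"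
      using integral_lborel_shift[of "\<lambda>z. \<psi> z *\<^sub>R F (fr (z + h n *\<^sub>R ax l))" "(- h n) *\<^sub>R ax l"] by simp
    moreover have "(LINT z|lborel. ?q n z *\<^sub>R F (fr z)) = (1 / h n) *\<^sub>R (LINT z|lborel. \<psi> (z + (- h n) *\<^sub>R ax l) *\<^sub>R F (fr z) - \<psi> z *\<^sub>R F (fr z))"
      by (subst integral_scaleR_right'[symmetric]) (simp add: algebra_simps)
    moreover have "(LINT z|lborel. \<psi> z *\<^sub>R ((1 / h n) *\<^sub>R (F (fr (fr z + h n *\<^sub>R ax l)) - F (fr z)))) =
      (1 / h n) *\<^sub>R (LINT z|lborel. \<psi> z *\<^sub>R F (fr (z + h n *\<^sub>R ax l)) - \<psi> z *\<^sub>R F (fr z))"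
      by (subst integral_scaleR_right'[symmetric]) (simp add: algebra_simps)
    ultimately show ?thesis using i1 i2' i3 by simp
  qed
  have "(\<lambda>n. LINT z|lborel. ?q n z *\<^sub>R F (fr z)) \<longlonglongrightarrow> (LINT z|lborel. (- D z) *\<^sub>R F (fr z))"
  proof (rule integral_dominated_convergence[where w = "\<lambda>z. B *\<^sub>R (indicat_real ?K z *\<^sub>R norm (F (fr z)))"])
    have "integrable lborel (\<lambda>z. indicat_real ?K z *\<^sub>R norm (F (fr z)))"
      by (rule per_integral(1)[OF S(1,2) supp(3), where B = 1 and H = "\<lambda>z. norm (F z)"]) (use FL1n in \<open>auto simp: indicator_def\<close>)
    then show "integrable lborel (\<lambda>z. B *\<^sub>R (indicat_real ?K z *\<^sub>R norm (F (fr z))))" by (rule integrable_scaleR_right)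
    show "AE z in lborel. (\<lambda>n. ?q n z *\<^sub>R F (fr z)) \<longlonglongrightarrow> (- D z) *\<^sub>R F (fr z)"
    proof (rule AE_I2)
      fix z
      have "((\<lambda>t. (\<psi> (z + t *\<^sub>R ax l) - \<psi> z) / t) \<longlongrightarrow> D z) (at 0)"
        using der[of z 0] by (simp add: has_field_derivative_iff)
      moreover have "filterlim (\<lambda>n. - h n) (at 0) sequentially"
      proof (rule filterlim_atI)
        show "(\<lambda>n. - h n) \<longlonglongrightarrow> 0" using tendsto_minus[OF h0] by simp
        have "- h n \<noteq> 0" for n using h(1)[of n] by simp
        then show "\<forall>\<^sub>F n in sequentially. - h n \<noteq> 0" by simp
      qed
      ultimately have "(\<lambda>n. (\<psi> (z + (- h n) *\<^sub>R ax l) - \<psi> z) / (- h n)) \<longlonglongrightarrow> D z"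
        by (rule filterlim_compose)
      from tendsto_minus[OF this] have "(\<lambda>n. ?q n z) \<longlonglongrightarrow> - D z" by simp
      then show "(\<lambda>n. ?q n z *\<^sub>R F (fr z)) \<longlonglongrightarrow> (- D z) *\<^sub>R F (fr z)" by (intro tendsto_intros)
    qed
    show "AE z in lborel. norm (?q n z *\<^sub>R F (fr z)) \<le> B *\<^sub>R (indicat_real ?K z *\<^sub>R norm (F (fr z)))" for n
    proof (rule AE_I2)
      fix z
      have "\<bar>?q n z\<bar> \<le> B * indicat_real ?K z"
      proof (cases "z \<in> ?K")
        case True then show ?thesis using lip[of z n] h(1)[of n] by (simp add: abs_mult field_simps)
      next
        case False
        have "z \<notin> K" using False KK by blast
        moreover have "z + (- h n) *\<^sub>R ax l \<notin> K"
        proof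
          assume "z + (- h n) *\<^sub>R ax l \<in> K"
          then have "norm (z + (- h n) *\<^sub>R ax l) \<le> r" using r by auto
          moreover have "norm z \<le> norm (z + (- h n) *\<^sub>R ax l) + norm (h n *\<^sub>R ax l)"
            using norm_triangle_ineq[of "z + (- h n) *\<^sub>R ax l" "h n *\<^sub>R ax l"] by simp
          ultimately have "norm z \<le> r + 1" using h[of n] by simp
          then show False using False by simp
        qed
        ultimately show ?thesis using K(2) B(1) by simp
      qed
      then show "norm (?q n z *\<^sub>R F (fr z)) \<le> B *\<^sub>R (indicat_real ?K z *\<^sub>R norm (F (fr z)))"
        using mult_right_mono[of "\<bar>?q n z\<bar>" "B * indicat_real ?K z" "norm (F (fr z))"] by (simp add: mult.assoc)
    qed
  qed measurable
  then have L: "(\<lambda>n. inner (LINT z|lborel. ?q n z *\<^sub>R F (fr z)) b) \<longlonglongrightarrow> inner (LINT z|lborel. (- D z) *\<^sub>R F (fr z)) b" for b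
    by (intro tendsto_intros)
  have "inner (LINT z|lborel. (- D z) *\<^sub>R F (fr z)) b = inner (LINT z|lborel. \<psi> z *\<^sub>R G (fr z)) b" for b
  proof -
    have e: "inner (LINT z|lborel. ?q n z *\<^sub>R F (fr z)) b = inner ((1 / h n) *\<^sub>R av l (h n) (cls G)) (cls (\<lambda>z. \<Phi> z *\<^sub>R b))" for n
    proof -
      let ?H = "\<lambda>z. (1 / h n) *\<^sub>R (F (fr (z + h n *\<^sub>R ax l)) - F z)"
      have HS: "?H \<in> Sq" by (intro Sq_scaleR Sq_diff Sq_shift F)
      have "cls ?H = (1 / h n) *\<^sub>R dif l (h n) (cls F)"
        using F by (simp add: dif_def shift_cls cls_scaleR cls_diff Sq_shift Sq_diff)
      also have "\<dots> = (1 / h n) *\<^sub>R av l (h n) (cls G)" using dif[of "h n"] h(1)[of n] by simp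
      finally show ?thesis unfolding q1 using pair[OF HS, of b] by simp
    qed
    have "(\<lambda>n. inner ((1 / h n) *\<^sub>R av l (h n) (cls G)) (cls (\<lambda>z. \<Phi> z *\<^sub>R b))) \<longlonglongrightarrow> inner (cls G) (cls (\<lambda>z. \<Phi> z *\<^sub>R b))"
      by (intro tendsto_inner tendsto_const filterlim_compose[OF av_limit h0r])
    from LIMSEQ_unique[OF L[of b, unfolded e] this] show ?thesis unfolding pair[OF G] .
  qed
  then have "(LINT z|lborel. (- D z) *\<^sub>R F (fr z)) = (LINT z|lborel. \<psi> z *\<^sub>R G (fr z))"
    by (rule vector_eq_rdot[THEN iffD1, OF allI])
  from arg_cong[OF this, of uminus] show ?thesis by simp
qed

section \<open>Realisation of gradients and of the coefficients\<close>

lemma loc_integrable_per: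
  fixes H :: "real^3 \<Rightarrow> 'b::euclidean_space"
  assumes \<delta>: "\<delta> > 0" and H: "H \<in> Sq"
  shows "loc_integrable UNIV (\<lambda>y. H (fr ((1 / \<delta>) *\<^sub>R (y - x))))"
  unfolding loc_integrable_def set_integrable_def
proof (intro allI impI)
  fix K :: "(real^3) set" assume K: "compact K \<and> K \<subseteq> UNIV"
  let ?p = "\<lambda>y. (1 / \<delta>) *\<^sub>R (y - x)"
  have pa: "?p (aff \<delta> x z) = z" "aff \<delta> x (?p y) = y" for z y using \<delta> by (simp_all add: aff_def)
  have [measurable]: "H \<in> borel_measurable borel" by (rule Sq_measurable[OF H])
  have Kb [measurable]: "K \<in> sets borel" using K by (simp add: borel_compact)
  have "bounded (?p ` K)"
    using K by (intro compact_imp_bounded compact_continuous_image continuous_intros) auto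
  then obtain S where S: "finite S" "S \<subseteq> lattice" "\<And>z. z \<in> ?p ` K \<Longrightarrow> z - fr z \<in> S"
    using bounded_lattice_cover by metis
  have supp: "indicat_real K (aff \<delta> x z) = 0" if z: "z - fr z \<notin> S" for z
  proof -
    have "aff \<delta> x z \<notin> K"
    proof
      assume "aff \<delta> x z \<in> K"
      then have "?p (aff \<delta> x z) \<in> ?p ` K" by (rule imageI)
      then show False using S(3)[of z] z unfolding pa(1) by blast
    qed
    then show ?thesis by simp
  qed
  have im [measurable]: "(\<lambda>z. indicat_real K (aff \<delta> x z)) \<in> borel_measurable borel"
    using measurable_compose[OF aff_measurable borel_measurable_indicator[OF Kb]] by simp
  have i: "integrable lborel (\<lambda>z. indicat_real K (aff \<delta> x z) *\<^sub>R H (fr z))"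
    by (rule per_integral(1)[OF S(1,2) supp im _ _ Sq_integrable[OF H], where B = 1]) (auto simp: indicator_def)
  have m: "(\<lambda>y. indicat_real K y *\<^sub>R H (fr (?p y))) \<in> borel_measurable borel" by measurable
  have ml: "(\<lambda>y. indicat_real K y *\<^sub>R H (fr (?p y))) \<in> borel_measurable lebesgue"
    by (rule measurable_completion) (use m in simp)
  show "integrable lebesgue (\<lambda>y. indicat_real K y *\<^sub>R H (fr (?p y)))"
    by (subst integral_aff(1)[OF \<delta> ml _ AE_I2, where F' = "\<lambda>z. indicat_real K (aff \<delta> x z) *\<^sub>R H (fr z)" and x = x])
       (measurable, simp add: pa, rule i)
qed

lemma test_fun_continuous:
  assumes "test_fun U \<phi>" shows "continuous_on UNIV \<phi>" "continuous_on UNIV (pd i \<phi>)" "\<phi> differentiable at y"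
proof -
  have c: "Ck 0 \<phi>" "Ck (Suc 0) \<phi>" using assms unfolding test_fun_def by blast+
  show "continuous_on UNIV \<phi>" using c(1) by simp
  show "continuous_on UNIV (pd i \<phi>)" using c(2) by simp
  show "\<phi> differentiable at y" using c(2) by (simp add: differentiable_on_def)
qed

lemma test_fun_line_derivative:
  assumes \<phi>: "test_fun U \<phi>"
  shows "((\<lambda>t. \<phi> (aff \<delta> x (z + t *\<^sub>R ax l))) has_real_derivative \<delta> * pd l \<phi> (aff \<delta> x (z + t *\<^sub>R ax l))) (at t)"
proof -
  let ?f = "frechet_derivative \<phi> (at (aff \<delta> x (z + t *\<^sub>R ax l)))"
  have d: "(\<phi> has_derivative ?f) (at (aff \<delta> x (z + t *\<^sub>R ax l)))"
    using test_fun_continuous(3)[OF \<phi>] by (simp add: frechet_derivative_works)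
  have a: "((\<lambda>t. aff \<delta> x (z + t *\<^sub>R ax l)) has_derivative (\<lambda>s. s *\<^sub>R (\<delta> *\<^sub>R ax l))) (at t)"
    unfolding aff_def by (auto intro!: derivative_eq_intros simp: algebra_simps)
  have lin: "linear ?f" using has_derivative_linear[OF d] .
  have "((\<lambda>t. \<phi> (aff \<delta> x (z + t *\<^sub>R ax l))) has_derivative (\<lambda>s. ?f (s *\<^sub>R (\<delta> *\<^sub>R ax l)))) (at t)"
    by (rule has_derivative_compose[OF a d])
  moreover have "?f (s *\<^sub>R (\<delta> *\<^sub>R ax l)) = \<delta> * pd l \<phi> (aff \<delta> x (z + t *\<^sub>R ax l)) * s" for s
    unfolding pd_def linear_cmul[OF lin] by simp
  ultimately show ?thesis by (simp add: has_field_derivative_def)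
qed

text \<open>The equation is assumed for test functions in \<open>V_mic\<close> only. Here each
  element of \<open>GG0\<close> receives such a test function, so that the equation can be read on
  \<open>GG0\<close> and then on its closure. The factor \<open>1 / \<delta>\<close> is the chain
  rule.\<close>

lemma realise_gradient:
  fixes \<gamma> :: "(real^('m::finite \<times> 3)) l2"
  assumes \<delta>: "\<delta> > 0" and \<gamma>: "\<gamma> \<in> GG0"
  obtains v where "v \<in> V_mic \<delta> x" "\<And>l. lft \<delta> x (weak_deriv (cell \<delta> x) l v) = (1 / \<delta>) *\<^sub>R cmp l \<gamma>"
proof -
  let ?p = "\<lambda>y. (1 / \<delta>) *\<^sub>R (y - x)"
  have pa: "?p (aff \<delta> x z) = z" "aff \<delta> x (?p y) = y" for z y using \<delta> by (simp_all add: aff_def)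
  obtain W where W: "\<And>l h. h \<ge> 0 \<Longrightarrow> dif l h W = av l h (cmp l \<gamma>)" using \<gamma> unfolding GG0_def by blast
  \<comment> \<open>Constants have zero differences, so subtracting the mean of the potential gives
    the zero mean demanded by \<open>V_mic\<close> and leaves the gradient unchanged.\<close>
  define m where "m = (\<integral>y. rep W y \<partial>cubeM)"
  define F where "F z = rep W z - m" for z
  define G where "G l = rep (cmp l \<gamma>)" for l
  have FS: "F \<in> Sq" unfolding F_def by (intro Sq_diff Sq_const rep_Sq)
  have GS: "G l \<in> Sq" for l by (simp add: G_def)
  have [measurable]: "F \<in> borel_measurable borel" by (rule Sq_measurable[OF FS])
  have [measurable]: "G l \<in> borel_measurable borel" for l by (rule Sq_measurable[OF GS])
  have "cls F = W - cls (\<lambda>_. m)" unfolding F_def using cls_diff[OF rep_Sq[of W] Sq_const[of m]] by simp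
  moreover have "dif l h (cls (\<lambda>_. m)) = 0" for l h by (simp add: dif_def shift_cls[OF Sq_const])
  ultimately have dF: "dif l h (cls F) = av l h (cls (G l))" if "h \<ge> 0" for l h
    using W[OF that, of l] by (simp add: linear_diff[OF dif_linear] G_def)
  define v where "v y = F (fr (?p y))" for y
  define g where "g l y = (1 / \<delta>) *\<^sub>R G l (fr (?p y))" for l y
  have [measurable]: "v \<in> borel_measurable borel" "g l \<in> borel_measurable borel" for l
    unfolding v_def g_def by measurable
  have ml: "f \<in> borel_measurable borel \<Longrightarrow> f \<in> borel_measurable lebesgue" for f :: "real^3 \<Rightarrow> 'c::euclidean_space"
    by (rule measurable_completion) simp
  have mc: "f \<in> borel_measurable borel \<Longrightarrow> f \<in> borel_measurable (lebesgue_on (cell \<delta> x))" for f :: "real^3 \<Rightarrow> 'c::euclidean_space"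
    by (rule measurable_restrict_space1[OF ml])
  have lv: "loc_integrable UNIV v" unfolding v_def by (rule loc_integrable_per[OF \<delta> FS])
  have lg: "loc_integrable UNIV (g l)" for l
    unfolding g_def using loc_integrable_per[OF \<delta> Sq_scaleR[OF GS[of l], of "1 / \<delta>"], where x = x] by simp
  have w: "has_weak_deriv UNIV l v (g l)" for l
    unfolding has_weak_deriv_def
  proof (intro conjI lv lg allI impI)
    fix \<phi> assume \<phi>: "test_fun UNIV \<phi>"
    let ?\<psi> = "\<lambda>z. \<phi> (aff \<delta> x z)" and ?D = "\<lambda>z. \<delta> * pd l \<phi> (aff \<delta> x z)"
    let ?K = "?p ` closure {y. \<phi> y \<noteq> 0}"
    have cs: "continuous_on UNIV (aff \<delta> x)" unfolding aff_def by (intro continuous_intros)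
    note c = test_fun_continuous[OF \<phi>]
    have [measurable]: "\<phi> \<in> borel_measurable borel" "pd l \<phi> \<in> borel_measurable borel"
      by (rule borel_measurable_continuous_onI[OF c(1)], rule borel_measurable_continuous_onI[OF c(2)])
    have out: "aff \<delta> x z \<notin> closure {y. \<phi> y \<noteq> 0}" if z: "z \<notin> ?K" for z
    proof
      assume "aff \<delta> x z \<in> closure {y. \<phi> y \<noteq> 0}"
      then have "?p (aff \<delta> x z) \<in> ?K" by (rule imageI)
      then show False using z unfolding pa(1) by blast
    qed
    have "(LINT z|lborel. ?D z *\<^sub>R F (fr z)) = - (LINT z|lborel. ?\<psi> z *\<^sub>R G l (fr z))"
    proof (rule per_weak[OF FS GS dF, where K = ?K])
      show "continuous_on UNIV ?\<psi>" using continuous_on_compose2[OF c(1) cs] by simp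
      have "continuous_on UNIV (\<lambda>z. pd l \<phi> (aff \<delta> x z))" using continuous_on_compose2[OF c(2) cs] by simp
      then show "continuous_on UNIV ?D" by (intro continuous_on_mult continuous_on_const)
      show "compact ?K" using \<phi> unfolding test_fun_def by (intro compact_continuous_image continuous_intros) auto
      show "?\<psi> z = 0" if "z \<notin> ?K" for z
        using out[OF that] closure_subset[of "{y. \<phi> y \<noteq> 0}"] by blast
      show "?D z = 0" if "z \<notin> ?K" for z using pd_outside_support[OF out[OF that]] by simp
    qed (assumption, rule test_fun_line_derivative[OF \<phi>])
    then have e: "\<delta> *\<^sub>R (LINT z|lborel. pd l \<phi> (aff \<delta> x z) *\<^sub>R F (fr z)) = - (LINT z|lborel. ?\<psi> z *\<^sub>R G l (fr z))"
      by (subst integral_scaleR_right'[symmetric]) simp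
    have 1: "(LINT y|lebesgue. pd l \<phi> y *\<^sub>R v y) = (\<delta> ^ 3) *\<^sub>R (LINT z|lborel. pd l \<phi> (aff \<delta> x z) *\<^sub>R F (fr z))"
      by (rule integral_aff(2)[OF \<delta> ml _ AE_I2, where x = x]) (measurable, simp add: v_def pa)
    have 2: "(LINT y|lebesgue. \<phi> y *\<^sub>R g l y) = (\<delta> ^ 3) *\<^sub>R (LINT z|lborel. (1 / \<delta>) *\<^sub>R (?\<psi> z *\<^sub>R G l (fr z)))"
      by (rule integral_aff(2)[OF \<delta> ml _ AE_I2, where x = x]) (measurable, simp add: g_def pa)
    have "(LINT z|lborel. pd l \<phi> (aff \<delta> x z) *\<^sub>R F (fr z)) = - ((1 / \<delta>) *\<^sub>R (LINT z|lborel. ?\<psi> z *\<^sub>R G l (fr z)))"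
      using arg_cong[OF e, of "(*\<^sub>R) (1 / \<delta>)"] \<delta> by simp
    then show "(LINT y|lebesgue_on UNIV. pd l \<phi> y *\<^sub>R v y) = - (LINT y|lebesgue_on UNIV. \<phi> y *\<^sub>R g l y)"
      unfolding lebesgue_on_UNIV_eq 1 2 integral_scaleR_right' by simp
  qed
  have cube: "AE z in cubeM. fr z = z" unfolding AE_cubeM by (simp add: fr_cube)
  have vae: "AE z in cubeM. F z = v (aff \<delta> x z)"
    using cube by eventually_elim (simp add: v_def pa del: fr_cube)
  have gae: "AE z in cubeM. (1 / \<delta>) *\<^sub>R G l z = g l (aff \<delta> x z)" for l
    using cube by eventually_elim (simp add: g_def pa)
  have L2v: "L2 (cell \<delta> x) v" by (rule L2_I[OF \<delta> FS vae mc]) measurable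
  have L2g: "L2 (cell \<delta> x) (g l)" for l by (rule L2_I[OF \<delta> Sq_scaleR[OF GS] gae mc]) measurable
  have per: "periodic \<delta> v"
    unfolding periodic_def
  proof (intro allI)
    fix y i
    have "?p (y + \<delta> *\<^sub>R ax i) = ?p y + ax i" using \<delta> by (simp add: algebra_simps)
    moreover have "ax i \<in> lattice" by (simp add: lattice_iff axis_def)
    ultimately show "v (y + \<delta> *\<^sub>R ax i) = v y" unfolding v_def by (simp only: fr_lattice)
  qed
  have "(LINT y|lebesgue_on (cell \<delta> x). v y) = (\<delta> ^ 3) *\<^sub>R (\<integral>z. F z \<partial>cubeM)"
    by (rule integral_cell(2)[OF \<delta> mc _ vae]) measurable
  also have "(\<integral>z. F z \<partial>cubeM) = 0"
    unfolding F_def m_def using Sq_integrable[OF rep_Sq[of W]] by (simp add: measure_def emeasure_cubeM)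
  finally have mean: "(LINT y|lebesgue_on (cell \<delta> x). v y) = 0" by simp
  have "H1_per \<delta> x v" unfolding H1_per_def using per L2v w L2g by blast
  with mean have "v \<in> V_mic \<delta> x" by (simp add: V_mic_def)
  moreover have "lft \<delta> x (weak_deriv (cell \<delta> x) l v) = (1 / \<delta>) *\<^sub>R cmp l \<gamma>" for l
  proof -
    have "lft \<delta> x (weak_deriv (cell \<delta> x) l v) = lft \<delta> x (g l)"
      by (rule weak_deriv_L2(2)[OF \<delta> has_weak_deriv_restrict[OF w open_cell[OF \<delta>]] L2g])
    also have "\<dots> = cls (\<lambda>z. (1 / \<delta>) *\<^sub>R G l z)" by (rule lft_eq[OF Sq_scaleR[OF GS] gae])
    also have "\<dots> = (1 / \<delta>) *\<^sub>R cmp l \<gamma>" by (subst cls_scaleR[OF GS, symmetric]) (simp add: G_def)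
    finally show ?thesis .
  qed
  ultimately show ?thesis using that by blast
qed

section \<open>Coefficients as multiplication operators\<close>

lemma Linf_rep:
  fixes f :: "real^3 \<Rightarrow> 'b::euclidean_space"
  assumes \<delta>: "\<delta> > 0" and f: "Linf (cell \<delta> x) f"
  obtains B F where "B \<ge> 0" "F \<in> Sq" "\<And>z. norm (F z) \<le> B" "AE z in cubeM. F z = f (aff \<delta> x z)"
    "L2 (cell \<delta> x) f" "lft \<delta> x f = cls F"
proof -
  obtain B0 where fm: "f \<in> borel_measurable (lebesgue_on (cell \<delta> x))"
    and B0: "AE y in lebesgue_on (cell \<delta> x). norm (f y) \<le> B0" using f by (auto simp: Linf_def)
  obtain F0 where F0 [measurable]: "F0 \<in> borel_measurable borel" and F0f: "AE z in cubeM. F0 z = f (aff \<delta> x z)"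
    using cell_measurable_rep[OF \<delta> fm] .
  define B where "B = max B0 0"
  define F where "F z = (if norm (F0 z) \<le> B then F0 z else 0)" for z
  have [measurable]: "F \<in> borel_measurable borel" unfolding F_def by measurable
  have B: "norm (F z) \<le> B" for z by (simp add: F_def B_def)
  have S: "F \<in> Sq" by (rule Sq_bounded[where c = B]) (use B in auto)
  have ae: "AE z in cubeM. F z = f (aff \<delta> x z)"
    using F0f B0[unfolded AE_cell[OF \<delta>]] by eventually_elim (simp add: F_def B_def le_max_iff_disj)
  show ?thesis
    by (rule that[of B F]) (use B S ae L2_I[OF \<delta> S ae fm] lft_eq[OF S ae] in \<open>auto simp: B_def\<close>)
qed

lemma norm_matrix_vector_bound:
  obtains \<kappa> where "\<kappa> > 0" "\<And>(A :: real^'n::finite^'m::finite) v. norm (A *v v) \<le> \<kappa> * norm A * norm v"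
proof -
  have "bilinear (\<lambda>(A :: real^'n^'m) v. A *v v)"
    unfolding bilinear_def
    by (auto intro!: linearI simp: matrix_vector_mult_add_rdistrib matrix_vector_right_distrib
        scaleR_matrix_vector_assoc matrix_vector_mult_scaleR)
  from bilinear_bounded_pos[OF this] show ?thesis using that by (metis mult.assoc)
qed

lemma matrix_vector_measurable:
  fixes A :: "'a \<Rightarrow> real^'n::finite^'m::finite"
  assumes [measurable]: "A \<in> borel_measurable M" "v \<in> borel_measurable M"
  shows "(\<lambda>y. A y *v v y) \<in> borel_measurable M"
proof (rule borel_measurable_vecI)
  fix i
  have A: "(\<lambda>y. A y $ i $ j) \<in> borel_measurable M" for j
    using borel_measurable_continuous_on[of "\<lambda>X :: real^'n^'m. X $ i $ j", OF _ assms(1)] by (simp add: continuous_on_component)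
  have v: "(\<lambda>y. v y $ j) \<in> borel_measurable M" for j
    using borel_measurable_continuous_on[of "\<lambda>X :: real^'n. X $ j", OF _ assms(2)] by (simp add: continuous_on_component)
  show "(\<lambda>y. (A y *v v y) $ i) \<in> borel_measurable M"
    unfolding matrix_vector_mult_def using A v by simp
qed

text \<open>By \<open>rep_av\<close> the difference is a line integral of the density, so a bounded
  density gives a pointwise Lipschitz bound. The exceptional null set may depend on
  \<open>h\<close>, which is harmless because each commutator estimate concerns one step
  only.\<close>

lemma av_bounded_density:
  fixes f G :: "real^3 \<Rightarrow> 'b::euclidean_space"
  assumes f: "f \<in> Sq" and G: "G \<in> Sq" and B: "\<And>z. norm (G z) \<le> B" and h: "h \<ge> 0"
    and eq: "dif i h (cls f) = av i h (cls G)"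
  shows "AE y in cubeM. norm (f (fr (y + h *\<^sub>R ax i)) - f y) \<le> B * h"
proof -
  have "cls (\<lambda>y. f (fr (y + h *\<^sub>R ax i)) - f y) = cls (rep (av i h (cls G)))"
    using eq f by (simp add: dif_def shift_cls cls_diff Sq_shift)
  then have "AE y in cubeM. f (fr (y + h *\<^sub>R ax i)) - f y = rep (av i h (cls G)) y"
    using cls_eq_iff[OF Sq_diff[OF Sq_shift[OF f] f] rep_Sq] by blast
  with rep_av[OF G, of i h] show ?thesis
  proof eventually_elim
    case (elim y)
    have "norm (LINT s|lborel. indicator {0..h} s *\<^sub>R G (fr (y + s *\<^sub>R ax i)))
      \<le> (LINT s|lborel. norm (indicat_real {0..h} s *\<^sub>R G (fr (y + s *\<^sub>R ax i))))" by (rule integral_norm_bound)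
    also have "\<dots> \<le> (LINT s|lborel. indicat_real {0..h} s * B)"
    proof (rule integral_mono')
      show "integrable lborel (\<lambda>s. indicat_real {0..h} s * B)"
        by (intro integrable_mult_left integrable_real_indicator) (auto simp: emeasure_lborel_Icc_eq)
      show "norm (indicat_real {0..h} s *\<^sub>R G (fr (y + s *\<^sub>R ax i))) \<le> indicat_real {0..h} s * B" for s
        using B by (simp add: mult_left_mono)
    qed (use order_trans[OF norm_ge_zero B] in simp)
    also have "\<dots> = B * h" using h by simp
    finally show ?case using elim by simp
  qed
qed

lemma coefficient_field:
  fixes \<MM> :: "real^3 \<Rightarrow> real^('m::finite \<times> 3)^('m \<times> 3)"
  assumes \<delta>: "\<delta> > 0" and W: "W1inf_per \<delta> x \<MM>"
  obtains A b L where "lin_field A b" "admissible (pw A) b L" "AE z in cubeM. \<forall>v. A z v = \<MM> (aff \<delta> x z) *v v"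
    "\<MM> \<in> borel_measurable (lebesgue_on (cell \<delta> x))"
proof -
  obtain \<kappa> where \<kappa>: "\<kappa> > 0" "\<And>(A :: real^('m \<times> 3)^('m \<times> 3)) v. norm (A *v v) \<le> \<kappa> * norm A * norm v"
    using norm_matrix_vector_bound by blast
  have p: "periodic \<delta> \<MM>" and Li: "Linf (cell \<delta> x) \<MM>"
    and "\<forall>i. \<exists>g. has_weak_deriv UNIV i \<MM> g \<and> Linf (cell \<delta> x) g" using W unfolding W1inf_per_def by blast+
  then obtain g where g: "\<And>i. has_weak_deriv UNIV i \<MM> (g i)" "\<And>i. Linf (cell \<delta> x) (g i)" by metis
  obtain B F where F: "B \<ge> 0" "F \<in> Sq" "\<And>z. norm (F z) \<le> B" "AE z in cubeM. F z = \<MM> (aff \<delta> x z)"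
    "L2 (cell \<delta> x) \<MM>" "lft \<delta> x \<MM> = cls F" using Linf_rep[OF \<delta> Li] by blast
  have "\<exists>G C. C \<ge> 0 \<and> G \<in> Sq \<and> (\<forall>z. norm (G z) \<le> C) \<and> L2 (cell \<delta> x) (g i) \<and> lft \<delta> x (g i) = cls G" for i
    using Linf_rep[OF \<delta> g(2)[of i]] by metis
  then obtain G C where G: "\<And>i. C i \<ge> (0::real)" "\<And>i. G i \<in> Sq" "\<And>i z. norm (G i z) \<le> C i" "\<And>i. L2 (cell \<delta> x) (g i)" "\<And>i. lft \<delta> x (g i) = cls (G i)"
    by metis
  define A where "A z v = F z *v v" for z v
  have [measurable]: "F \<in> borel_measurable borel" by (rule Sq_measurable[OF F(2)])
  have lin: "linear (A z)" for z unfolding A_def by simp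
  have Ab: "norm (A z v) \<le> (\<kappa> * B) * norm v" for z v
  proof -
    have "norm (A z v) \<le> \<kappa> * norm (F z) * norm v" unfolding A_def by (rule \<kappa>(2))
    also have "\<dots> \<le> (\<kappa> * B) * norm v" using F(3)[of z] \<kappa>(1) by (intro mult_right_mono mult_left_mono) auto
    finally show ?thesis .
  qed
  have Af: "lin_field A (\<kappa> * B)"
    unfolding lin_field_def using lin Ab by (auto simp: A_def intro!: matrix_vector_measurable)
  \<comment> \<open>\<kappa> compares the norm of a matrix with its action on vectors, \<delta>
    comes from rescaling derivatives to the unit cube, and the sum over \<open>i\<close> makes one
    constant serve all directions.\<close>
  define L where "L = \<kappa> * (\<delta> * (\<Sum>i\<in>UNIV. C i))"
  have Lip: "AE y in cubeM. \<forall>v. norm (A (fr (y + h *\<^sub>R ax i)) v - A y v) \<le> (L * h) * norm v" if h: "h \<ge> 0" for i h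
  proof -
    have "dif i h (cls F) = av i h (cls (\<lambda>z. \<delta> *\<^sub>R G i z))"
      using per_difference[OF \<delta> p F(5) g(1)[of i] G(4)[of i] h] unfolding F(6) G(5) cls_scaleR[OF G(2)] .
    moreover have "norm (\<delta> *\<^sub>R G i z) \<le> \<delta> * (\<Sum>i\<in>UNIV. C i)" for z
      using G(3)[of i z] member_le_sum[of i UNIV C] G(1) \<delta> by (auto intro!: mult_left_mono)
    ultimately have "AE y in cubeM. norm (F (fr (y + h *\<^sub>R ax i)) - F y) \<le> (\<delta> * (\<Sum>i\<in>UNIV. C i)) * h"
      by (intro av_bounded_density[OF F(2) Sq_scaleR[OF G(2)] _ h])
    then show ?thesis
    proof eventually_elim
      case (elim y)
      show ?case
      proof
        fix v
        have "norm (A (fr (y + h *\<^sub>R ax i)) v - A y v) = norm ((F (fr (y + h *\<^sub>R ax i)) - F y) *v v)"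
          by (simp add: A_def matrix_vector_mult_diff_rdistrib)
        also have "\<dots> \<le> \<kappa> * norm (F (fr (y + h *\<^sub>R ax i)) - F y) * norm v" by (rule \<kappa>(2))
        also have "\<dots> \<le> (L * h) * norm v"
          unfolding L_def mult.assoc[of \<kappa>] using elim \<kappa>(1) by (intro mult_right_mono mult_left_mono) auto
        finally show "norm (A (fr (y + h *\<^sub>R ax i)) v - A y v) \<le> (L * h) * norm v" .
      qed
    qed
  qed
  have L0: "L \<ge> 0" unfolding L_def using \<kappa>(1) \<delta> G(1) by (intro mult_nonneg_nonneg sum_nonneg) auto
  have b0: "\<kappa> * B \<ge> 0" using \<kappa>(1) F(1) by simp
  have "admissible (pw A) (\<kappa> * B) L"
    unfolding admissible_def
  proof (intro conjI allI impI)
    show "norm (shift (h *\<^sub>R ax l) (pw A u) - pw A (shift (h *\<^sub>R ax l) u)) \<le> L * h * norm u" if "h \<ge> 0" for l h u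
      using shift_pw_diff[OF Af Lip[OF that]] L0 that by simp
  qed (use bounded_linear_pw[OF Af] norm_pw[OF Af b0] b0 L0 Q_pw[OF Af] in auto)
  moreover have "AE z in cubeM. \<forall>v. A z v = \<MM> (aff \<delta> x z) *v v"
    using F(4) by eventually_elim (simp add: A_def)
  moreover have "\<MM> \<in> borel_measurable (lebesgue_on (cell \<delta> x))" using Li by (simp add: Linf_def)
  ultimately show ?thesis using that Af by blast
qed

lemma pw_symmetric:
  fixes A :: "real^3 \<Rightarrow> 'b::euclidean_space \<Rightarrow> 'b"
  assumes A: "lin_field A c" and s: "AE y in cubeM. \<forall>v w. inner (A y v) w = inner v (A y w)"
  shows "inner (pw A u) v = inner u (pw A v)"
proof -
  have [measurable]: "(\<lambda>y. A y (rep u y)) \<in> borel_measurable borel" "(\<lambda>y. A y (rep v y)) \<in> borel_measurable borel"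
    by (rule lin_field_measurable[OF A], measurable)+
  have "inner (pw A u) v = (\<integral>y. inner (A y (rep u y)) (rep v y) \<partial>cubeM)" by (rule inner_pw[OF A])
  also have "\<dots> = (\<integral>y. inner (A y (rep v y)) (rep u y) \<partial>cubeM)"
  proof (rule integral_cong_AE)
    show "AE y in cubeM. inner (A y (rep u y)) (rep v y) = inner (A y (rep v y)) (rep u y)"
      using s by eventually_elim (metis inner_commute)
  qed measurable
  also have "\<dots> = inner (pw A v) u" by (rule inner_pw[OF A, symmetric])
  also have "\<dots> = inner u (pw A v)" by (rule inner_commute)
  finally show ?thesis .
qed

lemma pw_coercive:
  fixes A :: "real^3 \<Rightarrow> 'b::euclidean_space \<Rightarrow> 'b"
  assumes A: "lin_field A c" and s: "AE y in cubeM. \<forall>v. \<alpha> * (norm v)\<^sup>2 \<le> inner (A y v) v"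
  shows "\<alpha> * (norm u)\<^sup>2 \<le> inner (pw A u) u"
proof -
  have "\<alpha> * (norm u)\<^sup>2 = (\<integral>y. \<alpha> * (norm (rep u y))\<^sup>2 \<partial>cubeM)" by (simp add: norm_rep)
  also have "\<dots> \<le> (\<integral>y. inner (A y (rep u y)) (rep u y) \<partial>cubeM)"
  proof (rule integral_mono_AE)
    show "integrable cubeM (\<lambda>y. \<alpha> * (norm (rep u y))\<^sup>2)" using rep_Sq[of u] by (simp add: Sq_def)
    show "integrable cubeM (\<lambda>y. inner (A y (rep u y)) (rep u y))"
      by (rule Sq_integrable_inner[OF lin_field_Sq[OF A rep_Sq] rep_Sq])
    show "AE y in cubeM. \<alpha> * (norm (rep u y))\<^sup>2 \<le> inner (A y (rep u y)) (rep u y)"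
      using s by eventually_elim simp
  qed
  also have "\<dots> = inner (pw A u) u" by (rule inner_pw[OF A, symmetric])
  finally show ?thesis .
qed

section \<open>Gradients of solutions\<close>

lemma test_product_integrable:
  fixes f :: "real^3 \<Rightarrow> 'b::euclidean_space"
  assumes f: "loc_integrable U f" and U: "open U" and \<phi>: "test_fun U \<phi>"
  shows "integrable (lebesgue_on U) (\<lambda>y. \<phi> y *\<^sub>R f y)" "integrable (lebesgue_on U) (\<lambda>y. pd i \<phi> y *\<^sub>R f y)"
proof -
  let ?K = "closure {y. \<phi> y \<noteq> 0}"
  have K: "compact ?K" "?K \<subseteq> U" using \<phi> by (auto simp: test_fun_def)
  have fK: "integrable lebesgue (\<lambda>y. indicator ?K y *\<^sub>R f y)"
    using f K by (auto simp: loc_integrable_def set_integrable_def)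
  have main: "integrable (lebesgue_on U) (\<lambda>y. \<psi> y *\<^sub>R f y)"
    if \<psi>: "continuous_on UNIV \<psi>" and out: "\<And>y. y \<notin> ?K \<Longrightarrow> \<psi> y = 0" for \<psi> :: "real^3 \<Rightarrow> real"
  proof -
    have "compact (\<psi> ` ?K)" using K(1) by (intro compact_continuous_image continuous_on_subset[OF \<psi>]) auto
    then obtain B where B: "\<And>y. y \<in> ?K \<Longrightarrow> \<bar>\<psi> y\<bar> \<le> B"
      using compact_imp_bounded[of "\<psi> ` ?K"] by (auto simp: bounded_iff)
    have \<psi>m: "\<psi> \<in> borel_measurable lebesgue"
      by (rule measurable_completion) (simp add: borel_measurable_continuous_onI[OF \<psi>])
    have e: "indicator U y *\<^sub>R (\<psi> y *\<^sub>R f y) = \<psi> y *\<^sub>R (indicator ?K y *\<^sub>R f y)" for y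
      using out[of y] K(2) by (cases "y \<in> ?K") auto
    have "integrable lebesgue (\<lambda>y. \<psi> y *\<^sub>R (indicator ?K y *\<^sub>R f y))"
    proof (rule Bochner_Integration.integrable_bound)
      show "integrable lebesgue (\<lambda>y. B *\<^sub>R (indicator ?K y *\<^sub>R f y))" using fK by (rule integrable_scaleR_right)
      show "(\<lambda>y. \<psi> y *\<^sub>R (indicator ?K y *\<^sub>R f y)) \<in> borel_measurable lebesgue"
        by (intro borel_measurable_scaleR \<psi>m borel_measurable_integrable[OF fK])
      show "AE y in lebesgue. norm (\<psi> y *\<^sub>R (indicator ?K y *\<^sub>R f y)) \<le> norm (B *\<^sub>R (indicator ?K y *\<^sub>R f y))"
      proof (rule AE_I2)
        fix y
        show "norm (\<psi> y *\<^sub>R (indicator ?K y *\<^sub>R f y)) \<le> norm (B *\<^sub>R (indicator ?K y *\<^sub>R f y))"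
          using B[of y] by (cases "y \<in> ?K") (auto intro!: mult_right_mono)
      qed
    qed
    then show ?thesis unfolding e[symmetric] using U by (intro integrable_restrict_space[THEN iffD2]) auto
  qed
  show "integrable (lebesgue_on U) (\<lambda>y. \<phi> y *\<^sub>R f y)"
    by (rule main[OF test_fun_continuous(1)[OF \<phi>]]) (use closure_subset[of "{y. \<phi> y \<noteq> 0}"] in blast)
  show "integrable (lebesgue_on U) (\<lambda>y. pd i \<phi> y *\<^sub>R f y)"
    by (rule main[OF test_fun_continuous(2)[OF \<phi>] pd_outside_support])
qed

lemma has_weak_deriv_comb:
  fixes f1 f2 g1 g2 :: "real^3 \<Rightarrow> 'b::euclidean_space"
  assumes w: "has_weak_deriv U i f1 g1" "has_weak_deriv U i f2 g2" and U: "open U"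
  shows "has_weak_deriv U i (\<lambda>y. a *\<^sub>R f1 y + b *\<^sub>R f2 y) (\<lambda>y. a *\<^sub>R g1 y + b *\<^sub>R g2 y)"
proof -
  have l: "loc_integrable U f1" "loc_integrable U f2" "loc_integrable U g1" "loc_integrable U g2"
    using w by (auto simp: has_weak_deriv_def)
  have lc: "loc_integrable U (\<lambda>y. a *\<^sub>R F y + b *\<^sub>R G y)" if "loc_integrable U F" "loc_integrable U G"
    for F G :: "real^3 \<Rightarrow> 'b"
    using that by (auto simp: loc_integrable_def intro!: set_integral_add absolutely_integrable_scaleR_left)
  have "(LINT y|lebesgue_on U. pd i \<phi> y *\<^sub>R (a *\<^sub>R f1 y + b *\<^sub>R f2 y)) = - (LINT y|lebesgue_on U. \<phi> y *\<^sub>R (a *\<^sub>R g1 y + b *\<^sub>R g2 y))"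
    if \<phi>: "test_fun U \<phi>" for \<phi>
  proof -
    note t = test_product_integrable[OF _ U \<phi>]
    have "(LINT y|lebesgue_on U. pd i \<phi> y *\<^sub>R (a *\<^sub>R f1 y + b *\<^sub>R f2 y))
      = (LINT y|lebesgue_on U. a *\<^sub>R (pd i \<phi> y *\<^sub>R f1 y) + b *\<^sub>R (pd i \<phi> y *\<^sub>R f2 y))"
      by (simp add: algebra_simps)
    also have "\<dots> = a *\<^sub>R (LINT y|lebesgue_on U. pd i \<phi> y *\<^sub>R f1 y) + b *\<^sub>R (LINT y|lebesgue_on U. pd i \<phi> y *\<^sub>R f2 y)"
      using t(2)[OF l(1)] t(2)[OF l(2)] by (simp del: scaleR_scaleR)
    also have "\<dots> = - (a *\<^sub>R (LINT y|lebesgue_on U. \<phi> y *\<^sub>R g1 y) + b *\<^sub>R (LINT y|lebesgue_on U. \<phi> y *\<^sub>R g2 y))"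
      using w \<phi> unfolding has_weak_deriv_def by simp
    also have "a *\<^sub>R (LINT y|lebesgue_on U. \<phi> y *\<^sub>R g1 y) + b *\<^sub>R (LINT y|lebesgue_on U. \<phi> y *\<^sub>R g2 y)
      = (LINT y|lebesgue_on U. a *\<^sub>R (\<phi> y *\<^sub>R g1 y) + b *\<^sub>R (\<phi> y *\<^sub>R g2 y))"
      using t(1)[OF l(3)] t(1)[OF l(4)] by (simp del: scaleR_scaleR)
    also have "\<dots> = (LINT y|lebesgue_on U. \<phi> y *\<^sub>R (a *\<^sub>R g1 y + b *\<^sub>R g2 y))"
      by (simp add: algebra_simps)
    finally show ?thesis .
  qed
  then show ?thesis unfolding has_weak_deriv_def using lc l by blast
qed

lemma has_weak_deriv_cong:
  fixes f f' :: "real^3 \<Rightarrow> 'b::euclidean_space"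
  assumes \<delta>: "\<delta> > 0" and ae: "AE y in lebesgue_on (cell \<delta> x). f y = f' y"
    and w: "has_weak_deriv (cell \<delta> x) i f g" and l: "loc_integrable (cell \<delta> x) f'"
  shows "has_weak_deriv (cell \<delta> x) i f' g"
proof -
  have lf: "loc_integrable (cell \<delta> x) f" using w by (simp add: has_weak_deriv_def)
  have "(LINT y|lebesgue_on (cell \<delta> x). pd i \<phi> y *\<^sub>R f' y) = (LINT y|lebesgue_on (cell \<delta> x). pd i \<phi> y *\<^sub>R f y)"
    if \<phi>: "test_fun (cell \<delta> x) \<phi>" for \<phi>
  proof (rule integral_cong_AE)
    note t = test_product_integrable(2)[OF _ open_cell[OF \<delta>] \<phi>]
    show "(\<lambda>y. pd i \<phi> y *\<^sub>R f' y) \<in> borel_measurable (lebesgue_on (cell \<delta> x))"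
      "(\<lambda>y. pd i \<phi> y *\<^sub>R f y) \<in> borel_measurable (lebesgue_on (cell \<delta> x))"
      using t[OF l] t[OF lf] by (auto intro: borel_measurable_integrable)
    show "AE y in lebesgue_on (cell \<delta> x). pd i \<phi> y *\<^sub>R f' y = pd i \<phi> y *\<^sub>R f y"
      using ae by eventually_elim simp
  qed
  with w l show ?thesis unfolding has_weak_deriv_def by simp
qed

text \<open>Functions that agree almost everywhere have the same weak derivatives, so the choice in
  \<open>weak_deriv\<close> returns literally the same function for both, and only the term of order
  zero is left to compare. This matters because a solution attains its initial value almost
  everywhere only.\<close>

lemma H2_norm_cong:
  fixes f f' :: "real^3 \<Rightarrow> 'b::euclidean_space"
  assumes \<delta>: "\<delta> > 0" and ae: "AE y in lebesgue_on (cell \<delta> x). f y = f' y"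
    and f: "H1_per \<delta> x f" and f': "H1_per \<delta> x f'"
  shows "H2_norm (cell \<delta> x) f = H2_norm (cell \<delta> x) f'"
proof -
  have l: "loc_integrable (cell \<delta> x) f" "loc_integrable (cell \<delta> x) f'"
    using H1_per_weak_deriv(1)[OF \<delta> f] H1_per_weak_deriv(1)[OF \<delta> f'] by (auto simp: has_weak_deriv_def)
  have ae': "AE y in lebesgue_on (cell \<delta> x). f' y = f y" using ae by eventually_elim simp
  have "has_weak_deriv (cell \<delta> x) i f = has_weak_deriv (cell \<delta> x) i f'" for i
    using has_weak_deriv_cong[OF \<delta> ae _ l(2)] has_weak_deriv_cong[OF \<delta> ae' _ l(1)] by (intro ext) blast
  then have wd: "weak_deriv (cell \<delta> x) i f = weak_deriv (cell \<delta> x) i f'" for i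
    unfolding weak_deriv_def by simp
  have L2: "L2 (cell \<delta> x) f" "L2 (cell \<delta> x) f'" using f f' by (auto simp: H1_per_def)
  have "(L2_norm (cell \<delta> x) f)\<^sup>2 = (L2_norm (cell \<delta> x) f')\<^sup>2"
    unfolding L2_norm_lft[OF \<delta> L2(1)] L2_norm_lft[OF \<delta> L2(2)] lft_cong[OF \<delta> ae L2(1)] ..
  then show ?thesis unfolding H2_norm_def wd by simp
qed

lemma grad_eq: "grad U f y = (\<Sum>i\<in>UNIV. emb0 i (weak_deriv U i f y))"
proof (rule vec_eq_iff[THEN iffD2], rule allI)
  fix p :: "'a \<times> 3"
  have "(\<Sum>i\<in>UNIV. emb0 i (weak_deriv U i f y)) $ p = (\<Sum>i\<in>UNIV. if i = snd p then weak_deriv U i f y $ fst p else 0)"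
    by (auto simp: emb0_def intro!: sum.cong)
  then show "grad U f y $ p = (\<Sum>i\<in>UNIV. emb0 i (weak_deriv U i f y)) $ p" by (simp add: grad_def)
qed

lemma emb0_linear: "linear (emb0 l :: real^'m::finite \<Rightarrow> _)"
  using lin_field_emb0[of l] unfolding lin_field_def by blast

lemma grad_rep:
  fixes w :: "real^3 \<Rightarrow> real^'m::finite"
  assumes \<delta>: "\<delta> > 0" and w: "\<And>i. L2 (cell \<delta> x) (weak_deriv (cell \<delta> x) i w)"
  shows "cmp l (lft \<delta> x (grad (cell \<delta> x) w)) = lft \<delta> x (weak_deriv (cell \<delta> x) l w)"
    and "AE z in cubeM. rep (lft \<delta> x (grad (cell \<delta> x) w)) z = grad (cell \<delta> x) w (aff \<delta> x z)"
    and "grad (cell \<delta> x) w \<in> borel_measurable (lebesgue_on (cell \<delta> x))"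
proof -
  let ?d = "\<lambda>i. weak_deriv (cell \<delta> x) i w"
  have emb_m: "(emb0 i :: real^'m \<Rightarrow> _) \<in> borel_measurable borel" for i
    using linear_continuous_on[OF linear_conv_bounded_linear[THEN iffD1, OF emb0_linear]]
    by (rule borel_measurable_continuous_onI)
  show "grad (cell \<delta> x) w \<in> borel_measurable (lebesgue_on (cell \<delta> x))"
    unfolding grad_eq[abs_def] using w unfolding L2_def
    by (intro borel_measurable_sum measurable_compose[OF _ emb_m]) blast
  define F where "F i = rep (lft \<delta> x (?d i))" for i
  have FS: "F i \<in> Sq" for i by (simp add: F_def)
  have Fe: "AE z in cubeM. F i z = ?d i (aff \<delta> x z)" for i unfolding F_def by (rule rep_lft[OF \<delta> w])
  define \<Gamma> where "\<Gamma> z = (\<Sum>i\<in>UNIV. emb0 i (F i z))" for z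
  have ES: "(\<lambda>z. emb0 i (F i z)) \<in> Sq" for i by (rule lin_field_Sq[OF lin_field_emb0 FS])
  have \<Gamma>S: "\<Gamma> \<in> Sq" unfolding \<Gamma>_def sum_3 by (intro Sq_add ES)
  have "AE z in cubeM. \<forall>i\<in>UNIV. F i z = ?d i (aff \<delta> x z)" using Fe by (intro AE_finite_allI) auto
  then have \<Gamma>e: "AE z in cubeM. \<Gamma> z = grad (cell \<delta> x) w (aff \<delta> x z)"
    by eventually_elim (simp add: \<Gamma>_def grad_eq)
  have L: "lft \<delta> x (grad (cell \<delta> x) w) = cls \<Gamma>" by (rule lft_eq[OF \<Gamma>S \<Gamma>e])
  show "AE z in cubeM. rep (lft \<delta> x (grad (cell \<delta> x) w)) z = grad (cell \<delta> x) w (aff \<delta> x z)"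
    unfolding L using rep_cls[OF \<Gamma>S] \<Gamma>e by eventually_elim simp
  have c: "cmp0 l (\<Gamma> z) = F l z" for z
    by (simp add: \<Gamma>_def sum_3 cmp0_def emb0_def vec_eq_iff exhaust_3[of l] del: sum_3)
  show "cmp l (lft \<delta> x (grad (cell \<delta> x) w)) = lft \<delta> x (?d l)"
    unfolding L cmp_cls[OF \<Gamma>S] c by (simp add: F_def)
qed

lemma H1_per_GG0:
  fixes w :: "real^3 \<Rightarrow> real^'m::finite"
  assumes \<delta>: "\<delta> > 0" and w: "H1_per \<delta> x w"
  shows "lft \<delta> x (grad (cell \<delta> x) w) \<in> GG0"
proof -
  have "\<delta> *\<^sub>R lft \<delta> x (grad (cell \<delta> x) w) \<in> GG0"
    unfolding GG0_def
    using H1_per_weak_deriv(3)[OF \<delta> w]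
    by (auto simp: linear_cmul[OF bounded_linear.linear[OF bounded_linear_cmp]] grad_rep(1)[OF \<delta> H1_per_weak_deriv(2)[OF \<delta> w]])
  from subspace_scale[OF subspace_GG0 this, of "1 / \<delta>"] show ?thesis using \<delta> by simp
qed

lemma integral_pw_grad:
  fixes w v :: "real^3 \<Rightarrow> real^'m::finite" and \<MM> :: "real^3 \<Rightarrow> real^('m \<times> 3)^('m \<times> 3)"
  assumes \<delta>: "\<delta> > 0" and A: "lin_field A b" and AM: "AE z in cubeM. \<forall>v. A z v = \<MM> (aff \<delta> x z) *v v"
    and \<MM>: "\<MM> \<in> borel_measurable (lebesgue_on (cell \<delta> x))"
    and w: "\<And>i. L2 (cell \<delta> x) (weak_deriv (cell \<delta> x) i w)" and v: "\<And>i. L2 (cell \<delta> x) (weak_deriv (cell \<delta> x) i v)"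
  shows "(LINT y|lebesgue_on (cell \<delta> x). inner (\<MM> y *v grad (cell \<delta> x) w y) (grad (cell \<delta> x) v y))
    = \<delta> ^ 3 * inner (pw A (lft \<delta> x (grad (cell \<delta> x) w))) (lft \<delta> x (grad (cell \<delta> x) v))"
proof -
  let ?W = "rep (lft \<delta> x (grad (cell \<delta> x) w))" and ?V = "rep (lft \<delta> x (grad (cell \<delta> x) v))"
  have "(LINT y|lebesgue_on (cell \<delta> x). inner (\<MM> y *v grad (cell \<delta> x) w y) (grad (cell \<delta> x) v y))
    = (\<delta> ^ 3) *\<^sub>R (\<integral>z. inner (A z (?W z)) (?V z) \<partial>cubeM)"
  proof (rule integral_cell(2)[OF \<delta>])
    show "(\<lambda>y. inner (\<MM> y *v grad (cell \<delta> x) w y) (grad (cell \<delta> x) v y)) \<in> borel_measurable (lebesgue_on (cell \<delta> x))"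
      by (intro borel_measurable_inner matrix_vector_measurable \<MM> grad_rep(3)[OF \<delta>] w v)
    show "(\<lambda>z. inner (A z (?W z)) (?V z)) \<in> borel_measurable borel"
      by (intro borel_measurable_inner lin_field_measurable[OF A] rep_measurable)
    show "AE z in cubeM. inner (A z (?W z)) (?V z) = inner (\<MM> (aff \<delta> x z) *v grad (cell \<delta> x) w (aff \<delta> x z)) (grad (cell \<delta> x) v (aff \<delta> x z))"
      using AM grad_rep(2)[OF \<delta> w] grad_rep(2)[OF \<delta> v] by eventually_elim simp
  qed
  then show ?thesis by (simp add: inner_pw[OF A])
qed

lemma H1_norm_ge: "L2_norm U (weak_deriv U i f) \<le> H1_norm U f"
  unfolding H1_norm_def
proof (rule real_le_rsqrt)
  have "(L2_norm U (weak_deriv U i f))\<^sup>2 \<le> (\<Sum>i\<in>UNIV. (L2_norm U (weak_deriv U i f))\<^sup>2)"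
    by (rule member_le_sum) auto
  then show "(L2_norm U (weak_deriv U i f))\<^sup>2 \<le> (L2_norm U f)\<^sup>2 + (\<Sum>i\<in>UNIV. (L2_norm U (weak_deriv U i f))\<^sup>2)"
    by (simp add: add_increasing)
qed

lemma norm_lft_L2_norm:
  assumes "\<delta> > 0" "L2 (cell \<delta> x) f"
  shows "L2_norm (cell \<delta> x) f = sqrt (\<delta> ^ 3) * norm (lft \<delta> x f)"
proof -
  have "0 \<le> L2_norm (cell \<delta> x) f" by (simp add: L2_norm_def integral_nonneg_AE)
  then have "L2_norm (cell \<delta> x) f = sqrt ((L2_norm (cell \<delta> x) f)\<^sup>2)" by simp
  then show ?thesis unfolding L2_norm_lft[OF assms] by (simp add: real_sqrt_mult)
qed

lemma diff_quotient_comb: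
  fixes p q r :: "'a::real_vector"
  shows "a *\<^sub>R (p - q) - r = a *\<^sub>R p + 1 *\<^sub>R ((- a) *\<^sub>R q + (-1) *\<^sub>R r)"
  by (simp add: algebra_simps)

text \<open>Convergence in \<open>H1_norm\<close> dominates the convergence of each gradient
  component in \<open>L2\<close>. As a choice, \<open>weak_deriv\<close> need not be linear, but its
  class under \<open>lft\<close> is, by \<open>has_weak_deriv_comb\<close> and
  \<open>weak_deriv_L2\<close>.\<close>

lemma time_derivative:
  fixes w dw :: "real \<Rightarrow> real^3 \<Rightarrow> real^'m::finite"
  assumes \<delta>: "\<delta> > 0" and d: "has_time_deriv \<tau> \<delta> x w dw" and t: "t \<in> {0..\<tau>}"
  shows "((\<lambda>t. lft \<delta> x (grad (cell \<delta> x) (w t))) has_vector_derivative lft \<delta> x (grad (cell \<delta> x) (dw t))) (at t within {0..\<tau>})"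
proof -
  let ?c = "cell \<delta> x"
  let ?G = "\<lambda>u. lft \<delta> x (grad ?c u)"
  define q where "q s y = (1 / (s - t)) *\<^sub>R (w s y - w t y) - dw t y" for s y
  have per: "H1_per \<delta> x (w s)" if "s \<in> {0..\<tau>}" for s using d that by (simp add: has_time_deriv_def V_mic_def)
  have perd: "H1_per \<delta> x (dw t)" using d t by (simp add: has_time_deriv_def V_mic_def)
  have lim: "((\<lambda>s. H1_norm ?c (q s)) \<longlongrightarrow> 0) (at t within {0..\<tau>})"
    using d t unfolding has_time_deriv_def q_def by blast
  \<comment> \<open>Three gradient components, each at most the \<open>H1_norm\<close> up to the
    volume factor \<open>sqrt (\<delta> ^ 3)\<close> of the change of variables.\<close>
  have bound: "norm ((1 / (s - t)) *\<^sub>R (?G (w s) - ?G (w t)) - ?G (dw t)) \<le> 3 / sqrt (\<delta> ^ 3) * H1_norm ?c (q s)"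
    if s: "s \<in> {0..\<tau>}" for s
  proof -
    let ?a = "1 / (s - t)"
    note W = H1_per_weak_deriv(1,2)[OF \<delta> per[OF s]] and Wt = H1_per_weak_deriv(1,2)[OF \<delta> per[OF t]]
      and D = H1_per_weak_deriv(1,2)[OF \<delta> perd]
    have qe: "q s = (\<lambda>y. ?a *\<^sub>R w s y + 1 *\<^sub>R ((- ?a) *\<^sub>R w t y + (-1) *\<^sub>R dw t y))"
      by (rule ext) (simp only: q_def diff_quotient_comb)
    have l: "lft \<delta> x (weak_deriv ?c l (q s)) = ?a *\<^sub>R (lft \<delta> x (weak_deriv ?c l (w s)) - lft \<delta> x (weak_deriv ?c l (w t))) - lft \<delta> x (weak_deriv ?c l (dw t))"
      and L: "L2 ?c (weak_deriv ?c l (q s))" for l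
    proof -
      let ?g = "\<lambda>y. ?a *\<^sub>R weak_deriv ?c l (w s) y + 1 *\<^sub>R ((- ?a) *\<^sub>R weak_deriv ?c l (w t) y + (-1) *\<^sub>R weak_deriv ?c l (dw t) y)"
      have h: "has_weak_deriv ?c l (q s) ?g"
        unfolding qe by (intro has_weak_deriv_comb W Wt D open_cell[OF \<delta>])
      note c1 = L2_comb[OF \<delta> Wt(2)[of l] D(2)[of l], of "- ?a" "-1"]
      note c2 = L2_comb[OF \<delta> W(2)[of l] c1(1), of ?a 1]
      show "L2 ?c (weak_deriv ?c l (q s))" by (rule weak_deriv_L2(1)[OF \<delta> h c2(1)])
      show "lft \<delta> x (weak_deriv ?c l (q s)) = ?a *\<^sub>R (lft \<delta> x (weak_deriv ?c l (w s)) - lft \<delta> x (weak_deriv ?c l (w t))) - lft \<delta> x (weak_deriv ?c l (dw t))"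
        unfolding weak_deriv_L2(2)[OF \<delta> h c2(1)] c2(2) c1(2)
        by (rule diff_quotient_comb[symmetric])
    qed
    have "norm (?a *\<^sub>R (?G (w s) - ?G (w t)) - ?G (dw t)) \<le> (\<Sum>l\<in>UNIV. norm (cmp l (?a *\<^sub>R (?G (w s) - ?G (w t)) - ?G (dw t))))"
      by (rule norm_le_sum_cmp)
    also have "\<dots> = (\<Sum>l\<in>UNIV. norm (lft \<delta> x (weak_deriv ?c l (q s))))"
    proof (intro sum.cong refl arg_cong[where f = norm])
      fix l
      note lc = bounded_linear.linear[OF bounded_linear_cmp[of l]]
      show "cmp l (?a *\<^sub>R (?G (w s) - ?G (w t)) - ?G (dw t)) = lft \<delta> x (weak_deriv ?c l (q s))"
        unfolding linear_diff[OF lc] linear_cmul[OF lc] l grad_rep(1)[OF \<delta> W(2)] grad_rep(1)[OF \<delta> Wt(2)] grad_rep(1)[OF \<delta> D(2)] ..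
    qed
    also have "\<dots> \<le> (\<Sum>l\<in>(UNIV :: 3 set). H1_norm ?c (q s) / sqrt (\<delta> ^ 3))"
    proof (rule sum_mono)
      fix l
      show "norm (lft \<delta> x (weak_deriv ?c l (q s))) \<le> H1_norm ?c (q s) / sqrt (\<delta> ^ 3)"
        using H1_norm_ge[of ?c l "q s"] \<delta> unfolding norm_lft_L2_norm[OF \<delta> L] by (simp add: pos_le_divide_eq mult.commute)
    qed
    finally show ?thesis by simp
  qed
  have "((\<lambda>s. (1 / (s - t)) *\<^sub>R (?G (w s) - ?G (w t)) - ?G (dw t)) \<longlongrightarrow> 0) (at t within {0..\<tau>})"
  proof (rule Lim_null_comparison)
    show "\<forall>\<^sub>F s in at t within {0..\<tau>}. norm ((1 / (s - t)) *\<^sub>R (?G (w s) - ?G (w t)) - ?G (dw t)) \<le> 3 / sqrt (\<delta> ^ 3) * H1_norm ?c (q s)"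
      unfolding eventually_at_filter by (intro always_eventually allI impI bound)
    show "((\<lambda>s. 3 / sqrt (\<delta> ^ 3) * H1_norm ?c (q s)) \<longlongrightarrow> 0) (at t within {0..\<tau>})"
      by (rule tendsto_mult_right_zero[OF lim])
  qed
  from tendsto_norm_zero[OF this]
  have "((\<lambda>s. norm ((1 / norm (s - t)) *\<^sub>R (?G (w s) - (?G (w t) + (s - t) *\<^sub>R ?G (dw t))))) \<longlongrightarrow> 0) (at t within {0..\<tau>})"
  proof (rule Lim_transform_eventually)
    show "\<forall>\<^sub>F s in at t within {0..\<tau>}. norm ((1 / (s - t)) *\<^sub>R (?G (w s) - ?G (w t)) - ?G (dw t))
      = norm ((1 / norm (s - t)) *\<^sub>R (?G (w s) - (?G (w t) + (s - t) *\<^sub>R ?G (dw t))))"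
      unfolding eventually_at_filter
    proof (intro always_eventually allI impI)
      fix s assume "s \<noteq> t"
      then have "?G (w s) - (?G (w t) + (s - t) *\<^sub>R ?G (dw t)) = (s - t) *\<^sub>R ((1 / (s - t)) *\<^sub>R (?G (w s) - ?G (w t)) - ?G (dw t))"
        by (simp add: scaleR_diff_right)
      then show "norm ((1 / (s - t)) *\<^sub>R (?G (w s) - ?G (w t)) - ?G (dw t))
        = norm ((1 / norm (s - t)) *\<^sub>R (?G (w s) - (?G (w t) + (s - t) *\<^sub>R ?G (dw t))))"
        using \<open>s \<noteq> t\<close> by (simp only:) simp
    qed
  qed
  from tendsto_norm_zero_cancel[OF this] show ?thesis
    unfolding has_vector_derivative_def has_derivative_within by (simp add: bounded_linear_scaleR_left)
qed

section \<open>Second derivatives and difference bounds\<close>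

lemma Q_emb: "Q l h (emb m F) = emb m (Q l h F)"
  unfolding emb_def by (rule Q_pw[OF lin_field_emb0])

lemma H2_weak_deriv:
  assumes "\<delta> > 0" "H2 (cell \<delta> x) w"
  shows "has_weak_deriv (cell \<delta> x) j (weak_deriv (cell \<delta> x) i w) (weak_deriv (cell \<delta> x) j (weak_deriv (cell \<delta> x) i w))"
    and "L2 (cell \<delta> x) (weak_deriv (cell \<delta> x) j (weak_deriv (cell \<delta> x) i w))"
proof -
  obtain g where g: "has_weak_deriv (cell \<delta> x) j (weak_deriv (cell \<delta> x) i w) g" "L2 (cell \<delta> x) g"
    using assms(2) unfolding H2_def H1_def by blast
  show "has_weak_deriv (cell \<delta> x) j (weak_deriv (cell \<delta> x) i w) (weak_deriv (cell \<delta> x) j (weak_deriv (cell \<delta> x) i w))"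
    by (rule has_weak_deriv_weak_deriv[OF g(1)])
  show "L2 (cell \<delta> x) (weak_deriv (cell \<delta> x) j (weak_deriv (cell \<delta> x) i w))"
    by (rule weak_deriv_L2(1)[OF assms(1) g])
qed

lemma H2_norm_sq: 
  "(H2_norm U f)\<^sup>2 = (L2_norm U f)\<^sup>2 + (\<Sum>i\<in>UNIV. (L2_norm U (weak_deriv U i f))\<^sup>2)
     + (\<Sum>i\<in>UNIV. \<Sum>j\<in>UNIV. (L2_norm U (weak_deriv U j (weak_deriv U i f)))\<^sup>2)"
  unfolding H2_norm_def by (rule real_sqrt_pow2) (intro add_nonneg_nonneg sum_nonneg zero_le_power2)

lemma H2_norm_nonneg: "H2_norm U f \<ge> 0"
  unfolding H2_norm_def by (rule real_sqrt_ge_zero) (intro add_nonneg_nonneg sum_nonneg zero_le_power2)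

lemma L2_norm_le_H2_norm:
  "L2_norm U (weak_deriv U i f) \<le> H2_norm U f"
  "L2_norm U (weak_deriv U j (weak_deriv U i f)) \<le> H2_norm U f"
proof -
  let ?a = "\<lambda>i. (L2_norm U (weak_deriv U i f))\<^sup>2"
  let ?b = "\<lambda>i j. (L2_norm U (weak_deriv U j (weak_deriv U i f)))\<^sup>2"
  have "?a i \<le> (\<Sum>i\<in>UNIV. ?a i)" by (rule member_le_sum) auto
  moreover have "?b i j \<le> (\<Sum>j\<in>UNIV. ?b i j)" by (rule member_le_sum) auto
  moreover have "(\<Sum>j\<in>UNIV. ?b i j) \<le> (\<Sum>i\<in>UNIV. \<Sum>j\<in>UNIV. ?b i j)"
    by (rule member_le_sum[of i UNIV "\<lambda>i. \<Sum>j\<in>UNIV. ?b i j"]) (auto intro: sum_nonneg)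
  moreover have "0 \<le> (\<Sum>i\<in>UNIV. ?a i)" "0 \<le> (\<Sum>i\<in>UNIV. \<Sum>j\<in>UNIV. ?b i j)" "0 \<le> (L2_norm U f)\<^sup>2"
    by (intro sum_nonneg zero_le_power2)+
  ultimately have "?a i \<le> (H2_norm U f)\<^sup>2" "?b i j \<le> (H2_norm U f)\<^sup>2"
    unfolding H2_norm_sq by linarith+
  then show "L2_norm U (weak_deriv U i f) \<le> H2_norm U f"
    "L2_norm U (weak_deriv U j (weak_deriv U i f)) \<le> H2_norm U f"
    using H2_norm_nonneg by (auto intro: power2_le_imp_le)
qed

text \<open>Component \<open>i\<close> of the gradient has its own weak derivatives inside the cell
  only. Its normal differences are therefore bounded with the cut-off, by
  \<open>local_difference\<close>; the tangential ones are bounded across all faces, by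
  \<open>mixed_difference\<close>, which exploits that \<open>w\<close> itself is periodic without
  jumps.\<close>

lemma initial_regularity:
  fixes w :: "real^3 \<Rightarrow> real^'m::finite"
  assumes \<delta>: "\<delta> > 0" and w: "H1_per \<delta> x w" and H2: "H2 (cell \<delta> x) w"
  shows "Reg i ((1 + \<delta>) / sqrt (\<delta> ^ 3) * H2_norm (cell \<delta> x) w) (emb i (cmp i (lft \<delta> x (grad (cell \<delta> x) w))))"
proof -
  let ?c = "cell \<delta> x"
  define g where "g i = lft \<delta> x (weak_deriv ?c i w)" for i
  define g2 where "g2 j i = lft \<delta> x (weak_deriv ?c j (weak_deriv ?c i w))" for j i
  define N where "N = H2_norm ?c w / sqrt (\<delta> ^ 3)"
  note W = H1_per_weak_deriv[OF \<delta> w] and W2 = H2_weak_deriv[OF \<delta> H2]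
  have s: "sqrt (\<delta> ^ 3) > 0" using \<delta> by simp
  have Ng: "norm (g i) \<le> N" for i
    using L2_norm_le_H2_norm(1)[of ?c i w] s unfolding norm_lft_L2_norm[OF \<delta> W(2)] N_def g_def
    by (simp add: pos_le_divide_eq mult.commute)
  have Ng2: "norm (g2 j i) \<le> N" for i j
    using L2_norm_le_H2_norm(2)[of ?c j i w] s unfolding norm_lft_L2_norm[OF \<delta> W2(2)] N_def g2_def
    by (simp add: pos_le_divide_eq mult.commute)
  have N0: "N \<ge> 0" using order_trans[OF norm_ge_zero Ng] .
  \<comment> \<open>\<open>N\<close> bounds the component and \<open>\<delta> * N\<close> its
    derivatives in cube coordinates; \<open>K\<close> exceeds both.\<close>
  define K where "K = (1 + \<delta>) * N"
  have K: "N \<le> K" "\<delta> * N \<le> K" using N0 \<delta> by (simp_all add: K_def algebra_simps)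
  have eK: "(1 + \<delta>) / sqrt (\<delta> ^ 3) * H2_norm ?c w = K" by (simp add: K_def N_def)
  have loc: "Q j h (dif j h (g i)) = Q j h (av j h (\<delta> *\<^sub>R g2 j i))" if "0 < h" "h < 1" for j i h
    unfolding g_def g2_def by (rule local_difference[OF \<delta> W(2) W2(2) W2(1) that])
  have av_le: "norm (av j h (\<delta> *\<^sub>R g2 k i)) \<le> K * h" if "h \<ge> 0" for j k h i
  proof -
    have "norm (av j h (\<delta> *\<^sub>R g2 k i)) \<le> h * norm (\<delta> *\<^sub>R g2 k i)" by (rule norm_av[OF that])
    also have "\<dots> \<le> h * (\<delta> * N)" using Ng2[of k i] \<delta> that by (intro mult_left_mono) (auto intro: mult_left_mono)
    also have "\<dots> \<le> h * K" using K(2) that by (rule mult_left_mono)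
    finally show ?thesis by (simp add: mult.commute)
  qed
  have "norm (dif j h (g i)) \<le> K * h" if ji: "j \<noteq> i" and h: "h \<ge> 0" for j h
  proof -
    have "dif j h (\<delta> *\<^sub>R g i) = av j h (\<delta> *\<^sub>R (\<delta> *\<^sub>R g2 i j))"
    proof (rule mixed_difference[where w = "lft \<delta> x w" and g = "\<lambda>i. \<delta> *\<^sub>R g i"])
      show "dif l k (lft \<delta> x w) = av l k (\<delta> *\<^sub>R g l)" if "k \<ge> 0" for l k unfolding g_def by (rule W(3)[OF that])
      show "Q i k (dif i k (\<delta> *\<^sub>R g j)) = Q i k (av i k (\<delta> *\<^sub>R (\<delta> *\<^sub>R g2 i j)))" if "0 < k" "k < 1" for k
      proof -
        have k: "k \<ge> 0" using that by simp
        have "Q i k (dif i k (\<delta> *\<^sub>R g j)) = \<delta> *\<^sub>R Q i k (dif i k (g j))"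
          by (simp add: linear_cmul[OF dif_linear] linear_cmul[OF Q_linear])
        also have "\<dots> = \<delta> *\<^sub>R Q i k (av i k (\<delta> *\<^sub>R g2 i j))" by (simp only: loc[OF that])
        also have "\<dots> = Q i k (av i k (\<delta> *\<^sub>R (\<delta> *\<^sub>R g2 i j)))"
          by (simp only: linear_cmul[OF bounded_linear.linear[OF bounded_linear_av[OF k]]] linear_cmul[OF Q_linear])
        finally show ?thesis .
      qed
    qed (use ji h in auto)
    also have "\<dots> = \<delta> *\<^sub>R av j h (\<delta> *\<^sub>R g2 i j)"
      by (rule linear_cmul[OF bounded_linear.linear[OF bounded_linear_av[OF h]]])
    finally have "\<delta> *\<^sub>R dif j h (g i) = \<delta> *\<^sub>R av j h (\<delta> *\<^sub>R g2 i j)" by (simp only: linear_cmul[OF dif_linear])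
    then have "dif j h (g i) = av j h (\<delta> *\<^sub>R g2 i j)" using \<delta> by (simp only: scaleR_cancel_left) simp
    then show ?thesis using av_le[OF h] by simp
  qed
  moreover have "norm (Q i h (dif i h (g i))) \<le> K * h" if h: "0 < h" "h < 1" for h
    unfolding loc[OF h] using order_trans[OF norm_Q av_le] h by simp
  moreover have "cmp i (lft \<delta> x (grad ?c w)) = g i" unfolding g_def by (rule grad_rep(1)[OF \<delta> W(2)])
  ultimately show ?thesis
    unfolding Reg_def eK dif_emb Q_emb using order_trans[OF Ng K(1)] by (auto intro: order_trans[OF norm_emb])
qed

text \<open>In the constant, \<open>\<delta> ^ 3\<close> is the volume factor,
  \<open>9 * \<delta>\<^sup>2\<close> the square of the Poincare constant
  \<open>3 * \<delta>\<close>, \<open>3\<close> counts the first derivatives, and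
  \<open>9 / \<delta>\<^sup>2\<close> the nine second ones, each bounded by
  \<open>B / \<delta>\<close>. The cut-off in \<open>D\<close> loses nothing, as second derivatives
  are only taken inside the cell and \<open>norm_le_of_Q_av\<close> removes it.\<close>

lemma H2_norm_bound:
  fixes w :: "real^3 \<Rightarrow> real^'m::finite"
  assumes \<delta>: "\<delta> > 0" and w: "w \<in> V_mic \<delta> x" and H2: "H2 (cell \<delta> x) w"
    and B: "norm (lft \<delta> x (grad (cell \<delta> x) w)) \<le> B"
    and D: "\<And>j h. 0 < h \<Longrightarrow> h < 1 \<Longrightarrow> norm (Q j h (dif j h (lft \<delta> x (grad (cell \<delta> x) w)))) \<le> B * h"
  shows "H2_norm (cell \<delta> x) w \<le> sqrt (\<delta> ^ 3 * (9 * \<delta>\<^sup>2 + 3 + 9 / \<delta>\<^sup>2)) * B"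
proof -
  let ?c = "cell \<delta> x"
  define g where "g i = lft \<delta> x (weak_deriv ?c i w)" for i
  define g2 where "g2 j i = lft \<delta> x (weak_deriv ?c j (weak_deriv ?c i w))" for j i
  have per: "H1_per \<delta> x w" using w by (simp add: V_mic_def)
  have L2w: "L2 ?c w" using per by (simp add: H1_per_def)
  note W = H1_per_weak_deriv[OF \<delta> per] and W2 = H2_weak_deriv[OF \<delta> H2]
  have cg: "cmp i (lft \<delta> x (grad ?c w)) = g i" for i unfolding g_def by (rule grad_rep(1)[OF \<delta> W(2)])
  have g: "norm (g i) \<le> B" for i unfolding cg[symmetric] using norm_cmp B by (rule order_trans)
  have B0: "B \<ge> 0" using B norm_ge_zero by (rule order_trans[rotated])
  have g2: "norm (g2 j i) \<le> B / \<delta>" for j i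
  proof -
    have "norm (\<delta> *\<^sub>R g2 j i) \<le> B"
    proof (rule norm_le_of_Q_av)
      fix h :: real assume h: "0 < h" "h < 1"
      have "Q j h (av j h (\<delta> *\<^sub>R g2 j i)) = Q j h (dif j h (g i))"
        unfolding g_def g2_def by (rule local_difference[OF \<delta> W(2) W2(2) W2(1) h, symmetric])
      also have "\<dots> = cmp i (Q j h (dif j h (lft \<delta> x (grad ?c w))))"
        unfolding cg[symmetric] dif_cmp Q_cmp ..
      finally show "norm (Q j h (av j h (\<delta> *\<^sub>R g2 j i))) \<le> B * h"
        using order_trans[OF norm_cmp D[OF h]] by simp
    qed
    then show ?thesis using \<delta> by (simp add: pos_le_divide_eq mult.commute)
  qed
  have w0: "norm (lft \<delta> x w) \<le> 3 * (\<delta> * B)"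
  proof -
    have "norm (lft \<delta> x w) \<le> (\<Sum>l\<in>(UNIV :: 3 set). \<delta> * B)"
    proof (rule poincare)
      fix l h assume h: "h \<ge> (0::real)"
      have "norm (dif l h (lft \<delta> x w)) \<le> h * norm (\<delta> *\<^sub>R g l)"
        unfolding W(3)[OF h] g_def by (rule norm_av[OF h])
      also have "\<dots> \<le> h * (\<delta> * B)" using g[of l] \<delta> h by (intro mult_left_mono) (auto intro: mult_left_mono)
      finally show "norm (shift (h *\<^sub>R ax l) (lft \<delta> x w) - lft \<delta> x w) \<le> h * (\<delta> * B)" by (simp add: dif_def)
    next
      have "(LINT y|lebesgue_on ?c. w y) = (\<delta> ^ 3) *\<^sub>R (\<integral>y. rep (lft \<delta> x w) y \<partial>cubeM)"
        by (rule integral_cell(2)[OF \<delta> _ rep_measurable rep_lft[OF \<delta> L2w]]) (use L2w in \<open>simp add: L2_def\<close>)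
      then show "(\<integral>y. rep (lft \<delta> x w) y \<partial>cubeM) = 0" using w \<delta> by (simp add: V_mic_def)
    qed
    then show ?thesis by simp
  qed
  have "(norm (lft \<delta> x w))\<^sup>2 \<le> (3 * (\<delta> * B))\<^sup>2" using w0 by (rule power_mono) simp
  moreover have "(\<Sum>i\<in>UNIV. (norm (g i))\<^sup>2) \<le> (\<Sum>i\<in>(UNIV :: 3 set). B\<^sup>2)"
    by (intro sum_mono power_mono g norm_ge_zero)
  moreover have "(\<Sum>i\<in>UNIV. \<Sum>j\<in>UNIV. (norm (g2 j i))\<^sup>2) \<le> (\<Sum>i\<in>(UNIV :: 3 set). \<Sum>j\<in>(UNIV :: 3 set). (B / \<delta>)\<^sup>2)"
    by (intro sum_mono power_mono g2 norm_ge_zero)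
  ultimately have "(norm (lft \<delta> x w))\<^sup>2 + (\<Sum>i\<in>UNIV. (norm (g i))\<^sup>2) + (\<Sum>i\<in>UNIV. \<Sum>j\<in>UNIV. (norm (g2 j i))\<^sup>2)
    \<le> (9 * \<delta>\<^sup>2 + 3 + 9 / \<delta>\<^sup>2) * B\<^sup>2"
    by (simp add: power_mult_distrib power_divide algebra_simps)
  then have "\<delta> ^ 3 * ((norm (lft \<delta> x w))\<^sup>2 + (\<Sum>i\<in>UNIV. (norm (g i))\<^sup>2) + (\<Sum>i\<in>UNIV. \<Sum>j\<in>UNIV. (norm (g2 j i))\<^sup>2))
    \<le> \<delta> ^ 3 * ((9 * \<delta>\<^sup>2 + 3 + 9 / \<delta>\<^sup>2) * B\<^sup>2)" using \<delta> by (intro mult_left_mono) auto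
  then have "(H2_norm ?c w)\<^sup>2 \<le> \<delta> ^ 3 * ((9 * \<delta>\<^sup>2 + 3 + 9 / \<delta>\<^sup>2) * B\<^sup>2)"
    unfolding H2_norm_sq L2_norm_lft[OF \<delta> L2w] L2_norm_lft[OF \<delta> W(2)] L2_norm_lft[OF \<delta> W2(2)] g_def g2_def
    by (simp only: distrib_left sum_distrib_left)
  then have "H2_norm ?c w \<le> sqrt (\<delta> ^ 3 * ((9 * \<delta>\<^sup>2 + 3 + 9 / \<delta>\<^sup>2) * B\<^sup>2))" by (rule real_le_rsqrt)
  also have "\<dots> = sqrt (\<delta> ^ 3 * (9 * \<delta>\<^sup>2 + 3 + 9 / \<delta>\<^sup>2)) * B"
    unfolding mult.assoc[symmetric] by (subst real_sqrt_mult) (use B0 in simp)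
  finally show ?thesis .
qed

section \<open>The bound for solutions, uniform in time and in the initial value\<close>

lemma AE_rescaled:
  assumes \<delta>: "\<delta> > 0" and P: "AE y in lebesgue. P (y :: real^3)"
  shows "AE z in cubeM. P ((1 / \<delta>) *\<^sub>R aff \<delta> x z)"
proof -
  have e: "(1 / \<delta>) *\<^sub>R aff \<delta> x z = z + (1 / \<delta>) *\<^sub>R x" for z using \<delta> by (simp add: aff_def algebra_simps)
  have "AE y in lborel. P y" using P by (simp add: AE_completion_iff)
  from AE_lborel_cubeM[OF AE_translate[OF this]] show ?thesis unfolding e .
qed

theorem theorem4p3:
  fixes T \<delta> \<alpha> C_M :: real
    and N_E :: nat
    and \<Omega> :: "(real^3) set"
    and x :: "real^3"
    and M R :: "real^3 \<Rightarrow> real^('m::finite \<times> 3)^('m \<times> 3)"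
  assumes "T > 0" and "\<delta> > 0"
    and "open \<Omega>" and "bounded \<Omega>" and "simply_connected \<Omega>" and "x \<in> \<Omega>"
    and "CARD('m) = 2 + N_E"
    and "periodic 1 M" and "periodic 1 R"
    and "W1inf_per \<delta> x (\<lambda>y. M ((1 / \<delta>) *\<^sub>R y))"
    and "W1inf_per \<delta> x (\<lambda>y. R ((1 / \<delta>) *\<^sub>R y))"
    and "AE y in lebesgue. transpose (M y) = M y"
    and "\<alpha> > 0" and "C_M > 0"
    and "AE y in lebesgue. \<forall>\<Phi>. \<alpha> * (norm \<Phi>)\<^sup>2 \<le> (M y *v \<Phi>) \<bullet> \<Phi> \<and> (M y *v \<Phi>) \<bullet> \<Phi> \<le> C_M * (norm \<Phi>)\<^sup>2"
    and "AE y in lebesgue. \<forall>\<Phi>. (R y *v \<Phi>) \<bullet> \<Phi> \<ge> 0"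
  shows "\<exists>C>0. \<forall>w0 w.
           w0 \<in> V_mic \<delta> x \<and> H2 (cell \<delta> x) w0 \<and>
           sobolev_solution T \<delta> x M R w0 w \<and> (\<forall>t\<in>{0..T}. H2 (cell \<delta> x) (w t)) \<longrightarrow>
           (\<forall>t\<in>{0..T}. H2_norm (cell \<delta> x) (w t) \<le> C * H2_norm (cell \<delta> x) w0)"
proof -
  note \<delta> = assms(2) and \<alpha> = assms(13)
  let ?c = "cell \<delta> x"
  let ?M = "\<lambda>y. M ((1 / \<delta>) *\<^sub>R y)" and ?R = "\<lambda>y. R ((1 / \<delta>) *\<^sub>R y)"
  obtain A b L where A: "lin_field A b" "admissible (pw A) b L" "AE z in cubeM. \<forall>v. A z v = ?M (aff \<delta> x z) *v v"
    "?M \<in> borel_measurable (lebesgue_on ?c)" using coefficient_field[OF \<delta> assms(10)] by blast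
  obtain S b' L' where S: "lin_field S b'" "admissible (pw S) b' L'" "AE z in cubeM. \<forall>v. S z v = ?R (aff \<delta> x z) *v v"
    "?R \<in> borel_measurable (lebesgue_on ?c)" using coefficient_field[OF \<delta> assms(11)] by blast
  have sym: "inner (pw A u) v = inner u (pw A v)" for u v
  proof (rule pw_symmetric[OF A(1)])
    show "AE y in cubeM. \<forall>v w. inner (A y v) w = inner v (A y w)"
      using A(3) AE_rescaled[OF \<delta> assms(12), of x]
    proof eventually_elim
      case (elim z)
      let ?X = "?M (aff \<delta> x z)"
      have "(?X *v v) \<bullet> w = v \<bullet> (?X *v w)" for v w
      proof -
        have "(?X *v v) \<bullet> w = (transpose ?X *v v) \<bullet> w" using elim(2) by simp
        also have "\<dots> = v \<bullet> (?X *v w)" unfolding transpose_matrix_vector by (rule dot_lmul_matrix)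
        finally show ?thesis .
      qed
      then show ?case using elim(1) by simp
    qed
  qed
  have coer: "\<alpha> * (norm u)\<^sup>2 \<le> inner (pw A u) u" for u
  proof (rule pw_coercive[OF A(1)])
    show "AE y in cubeM. \<forall>v. \<alpha> * (norm v)\<^sup>2 \<le> inner (A y v) v"
      using A(3) AE_rescaled[OF \<delta> assms(15), of x] by eventually_elim simp
  qed
  have T0: "T \<ge> 0" using assms(1) by simp
  obtain C where C0: "C \<ge> 0" and C: "\<forall>G G' K.
     (\<forall>t\<in>{0..T}. (G has_vector_derivative G' t) (at t within {0..T}) \<and> G t \<in> GG \<and> G' t \<in> GG \<and>
        (\<forall>\<zeta>\<in>GG. inner (pw A (G' t)) \<zeta> + inner (pw S (G t)) \<zeta> = 0)) \<longrightarrow>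
     (\<forall>i. Reg i K (emb i (cmp i (G 0)))) \<longrightarrow>
     (\<forall>t\<in>{0..T}. norm (G t) \<le> C * K \<and>
        (\<forall>j h. 0 < h \<longrightarrow> h < 1 \<longrightarrow> norm (Q j h (dif j h (G t))) \<le> C * K * h))"
    using evolution_regularity[OF A(2) S(2) sym coer \<alpha> T0] by blast
  define c1 where "c1 = (1 + \<delta>) / sqrt (\<delta> ^ 3)"
  define c2 where "c2 = sqrt (\<delta> ^ 3 * (9 * \<delta>\<^sup>2 + 3 + 9 / \<delta>\<^sup>2))"
  have c: "c1 \<ge> 0" "c2 \<ge> 0" using \<delta> by (simp_all add: c1_def c2_def)
  show ?thesis
  \<comment> \<open>\<open>c1\<close> converts the initial \<open>H2_norm\<close> into difference
    bounds and \<open>c2\<close> converts back. The summand 1 makes the constant positive also when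
    \<open>C\<close> is zero.\<close>
  proof (intro exI[of _ "c2 * (C * c1) + 1"] conjI allI impI ballI)
    show "c2 * (C * c1) + 1 > 0" using c C0 by (simp add: add_nonneg_pos)
  next
    fix w0 w t
    assume H: "w0 \<in> V_mic \<delta> x \<and> H2 ?c w0 \<and> sobolev_solution T \<delta> x M R w0 w \<and> (\<forall>t\<in>{0..T}. H2 ?c (w t))"
      and t: "t \<in> {0..T}"
    then obtain dw where td: "has_time_deriv T \<delta> x w dw"
      and eq: "\<And>v t. v \<in> V_mic \<delta> x \<Longrightarrow> t \<in> {0..T} \<Longrightarrow>
          (LINT y|lebesgue_on ?c. (?M y *v grad ?c (dw t) y) \<bullet> grad ?c v y)
        + (LINT y|lebesgue_on ?c. (?R y *v grad ?c (w t) y) \<bullet> grad ?c v y) = 0"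
      and init: "AE y in lebesgue_on ?c. w 0 y = w0 y" unfolding sobolev_solution_def by blast
    have V: "w s \<in> V_mic \<delta> x" "dw s \<in> V_mic \<delta> x" if "s \<in> {0..T}" for s
      using td that by (auto simp: has_time_deriv_def)
    then have P: "H1_per \<delta> x (w s)" "H1_per \<delta> x (dw s)" if "s \<in> {0..T}" for s
      using that by (auto simp: V_mic_def)
    let ?G = "\<lambda>s. lft \<delta> x (grad ?c (w s))" and ?G' = "\<lambda>s. lft \<delta> x (grad ?c (dw s))"
    define K where "K = c1 * H2_norm ?c w0"
    \<comment> \<open>Elements of \<open>GG0\<close> are realised, up to scaling, by test functions
      in \<open>V_mic\<close>. The solutions \<zeta> of the equation form a closed hyperplane or the
      whole space, so with \<open>GG0\<close> they include its closure.\<close>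
    have weak: "inner (pw A (?G' s)) \<zeta> + inner (pw S (?G s)) \<zeta> = 0" if s: "s \<in> {0..T}" and \<zeta>: "\<zeta> \<in> GG" for s \<zeta>
    proof -
      have "GG0 \<subseteq> {\<zeta>. inner (pw A (?G' s) + pw S (?G s)) \<zeta> = 0}"
      proof
        fix \<xi> :: "(real^('m \<times> 3)) l2" assume \<xi>: "\<xi> \<in> GG0"
        obtain v where v: "v \<in> V_mic \<delta> x" "\<And>l. lft \<delta> x (weak_deriv ?c l v) = (1 / \<delta>) *\<^sub>R cmp l \<xi>"
          using realise_gradient[OF \<delta> \<xi>, where x = x] by blast
        have vP: "H1_per \<delta> x v" using v(1) by (simp add: V_mic_def)
        note L = H1_per_weak_deriv(2)[OF \<delta>]
        have gv: "lft \<delta> x (grad ?c v) = (1 / \<delta>) *\<^sub>R \<xi>"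
        proof (rule l2_eq_cmpI)
          fix l
          show "cmp l (lft \<delta> x (grad ?c v)) = cmp l ((1 / \<delta>) *\<^sub>R \<xi>)"
            unfolding grad_rep(1)[OF \<delta> L[OF vP]] v(2) linear_cmul[OF bounded_linear.linear[OF bounded_linear_cmp]] ..
        qed
        have "\<delta> ^ 3 * inner (pw A (?G' s)) (lft \<delta> x (grad ?c v)) + \<delta> ^ 3 * inner (pw S (?G s)) (lft \<delta> x (grad ?c v)) = 0"
          using eq[OF v(1) s]
          unfolding integral_pw_grad[OF \<delta> A(1,3,4) L[OF P(2)[OF s]] L[OF vP]]
            integral_pw_grad[OF \<delta> S(1,3,4) L[OF P(1)[OF s]] L[OF vP]] .
        then have "\<delta> ^ 3 * (1 / \<delta>) * inner (pw A (?G' s) + pw S (?G s)) \<xi> = 0"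
          unfolding gv inner_scaleR_right by (simp add: inner_add_left algebra_simps)
        then show "\<xi> \<in> {\<zeta>. inner (pw A (?G' s) + pw S (?G s)) \<zeta> = 0}" using \<delta> by simp
      qed
      then have "GG \<subseteq> {\<zeta>. inner (pw A (?G' s) + pw S (?G s)) \<zeta> = 0}"
        unfolding GG_def by (rule closure_minimal) (rule closed_hyperplane)
      then show ?thesis using \<zeta> by (auto simp: inner_add_left)
    qed
    have GGI: "lft \<delta> x (grad ?c u) \<in> GG" if "H1_per \<delta> x u" for u :: "real^3 \<Rightarrow> real^'m"
      unfolding GG_def using H1_per_GG0[OF \<delta> that] closure_subset by blast
    have "0 \<in> {0..T}" using T0 by simp
    note P0 = P(1)[OF this] and H20 = H[THEN conjunct2, THEN conjunct2, THEN conjunct2, THEN bspec, OF this]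
    have w0P: "H1_per \<delta> x w0" using H by (simp add: V_mic_def)
    \<comment> \<open>\<open>w 0\<close> and \<open>w0\<close> agree only almost everywhere.
      Regularity is read off from \<open>w 0\<close>, which has it as a value of the solution, and
      the norm is then replaced by that of \<open>w0\<close>.\<close>
    have Reg: "Reg i K (emb i (cmp i (?G 0)))" for i
      using initial_regularity[OF \<delta> P0 H20, of i] unfolding K_def c1_def H2_norm_cong[OF \<delta> init P0 w0P] .
    have all: "\<forall>s\<in>{0..T}. (?G has_vector_derivative ?G' s) (at s within {0..T}) \<and> ?G s \<in> GG \<and> ?G' s \<in> GG \<and>
        (\<forall>\<zeta>\<in>GG. inner (pw A (?G' s)) \<zeta> + inner (pw S (?G s)) \<zeta> = 0)"
      using time_derivative[OF \<delta> td] GGI[OF P(1)] GGI[OF P(2)] weak by blast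
    note bd = C[rule_format, OF all[rule_format] Reg t]
    have "H2_norm ?c (w t) \<le> c2 * (C * K)"
      unfolding c2_def
      by (rule H2_norm_bound[OF \<delta> V(1)[OF t]]) (use H t bd in blast)+
    also have "\<dots> \<le> (c2 * (C * c1) + 1) * H2_norm ?c w0"
      using H2_norm_nonneg[of ?c w0] by (simp add: K_def algebra_simps)
    finally show "H2_norm ?c (w t) \<le> (c2 * (C * c1) + 1) * H2_norm ?c w0" .
  qed
qed

end
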